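(* Let $S$ be a finitely generated, perfect, torsion free group which is virtually solvable but not solvable, and which is not virtually nilpotent, and let $H=S/\widetilde{S}$. If $H\cong A_5$ then $h(S)\geq 9$; if $H\cong PSL(2,7)$ then $h(S)\geq 13$; and if $H\cong SL(2,8)$ then $h(S)\geq 14$.
   Context: For a virtually solvable group $G$, $\widetilde{G}$ denotes its maximal solvable normal subgroup (which has finite index), and $h(G)\in\{0,1,2,\dots\}\cup\{\infty\}$ denotes its Hirsch length: the Hirsch length of any solvable subgroup $G_0$ of finite index, i.e. the sum over the factors $A_i$ of a finite subnormal series of $G_0$ with abelian factors of $\dim_{\mathbb{Q}}(\mathbb{Q}\otimes A_i)$. *)

theory Defs
  imports
    "HOL-Algebra.Algebra"
    "HOL-Library.Cardinality"
    "HOL-Library.Extended_Nat"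
    "Jordan_Normal_Form.VS_Connect"
begin

hide_const (open) Modules.module

section \<open>Group-theoretic hypotheses\<close>

definition finitely_generated :: "('a, 'b) monoid_scheme \<Rightarrow> bool" where
  "finitely_generated G \<longleftrightarrow> (\<exists>A \<subseteq> carrier G. finite A \<and> generate G A = carrier G)"

definition perfect :: "('a, 'b) monoid_scheme \<Rightarrow> bool" where
  "perfect G \<longleftrightarrow> derived G (carrier G) = carrier G"

definition torsion_free :: "('a, 'b) monoid_scheme \<Rightarrow> bool" where
  "torsion_free G \<longleftrightarrow>
     (\<forall>x \<in> carrier G. \<forall>n::nat. 0 < n \<longrightarrow> x [^]\<^bsub>G\<^esub> n = \<one>\<^bsub>G\<^esub> \<longrightarrow> x = \<one>\<^bsub>G\<^esub>)"

primrec lower_central :: "('a, 'b) monoid_scheme \<Rightarrow> nat \<Rightarrow> 'a set" where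
  "lower_central G 0 = carrier G"
| "lower_central G (Suc n) = generate G
     {x \<otimes>\<^bsub>G\<^esub> y \<otimes>\<^bsub>G\<^esub> inv\<^bsub>G\<^esub> x \<otimes>\<^bsub>G\<^esub> inv\<^bsub>G\<^esub> y | x y. x \<in> lower_central G n \<and> y \<in> carrier G}"

definition nilpotent :: "('a, 'b) monoid_scheme \<Rightarrow> bool" where
  "nilpotent G \<longleftrightarrow> (\<exists>n. lower_central G n = {\<one>\<^bsub>G\<^esub>})"

definition finite_index_subgroup :: "'a set \<Rightarrow> ('a, 'b) monoid_scheme \<Rightarrow> bool" where
  "finite_index_subgroup H G \<longleftrightarrow> subgroup H G \<and> finite (rcosets\<^bsub>G\<^esub> H)"

definition virtually :: "(('a, 'b) monoid_scheme \<Rightarrow> bool) \<Rightarrow> ('a, 'b) monoid_scheme \<Rightarrow> bool" where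
  "virtually P G \<longleftrightarrow> (\<exists>H. finite_index_subgroup H G \<and> P (G\<lparr>carrier := H\<rparr>))"

text \<open>The order on sets is inclusion, so this is the largest solvable normal subgroup. It
  exists when \<open>G\<close> is virtually solvable; otherwise the value may be unspecified.\<close>

definition solvable_radical :: "('a, 'b) monoid_scheme \<Rightarrow> 'a set" where
  "solvable_radical G = (GREATEST N. N \<lhd> G \<and> solvable (G\<lparr>carrier := N\<rparr>))"


section \<open>Rationalization of an abelian group\<close>

text \<open>\<open>\<rat> \<otimes>\<^sub>\<int> A\<close> for a multiplicatively written abelian group \<open>A\<close>: the free abelian group on the
  symbols \<open>(q, a)\<close>, with \<open>q\<close> rational, modulo the relations making \<open>(q, a)\<close> biadditive.\<close>

definition tensor_free :: "('a, 'b) monoid_scheme \<Rightarrow> (rat \<times> 'a \<Rightarrow>\<^sub>0 int) monoid" where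
  "tensor_free A = free_Abelian_group (UNIV \<times> carrier A)"

definition tensor_rels :: "('a, 'b) monoid_scheme \<Rightarrow> (rat \<times> 'a \<Rightarrow>\<^sub>0 int) set" where
  "tensor_rels A = generate (tensor_free A)
     ({frag_of (p + q, a) - frag_of (p, a) - frag_of (q, a) | p q a. a \<in> carrier A} \<union>
      {frag_of (q, a \<otimes>\<^bsub>A\<^esub> b) - frag_of (q, a) - frag_of (q, b) | q a b.
         a \<in> carrier A \<and> b \<in> carrier A})"

text \<open>Rational scalars act on the first tensor factor. The ring multiplication and unit of the
  underlying record play no role in a module.\<close>

definition rat_tensor ::
    "('a, 'b) monoid_scheme \<Rightarrow> (rat, (rat \<times> 'a \<Rightarrow>\<^sub>0 int) set) module" where
  "rat_tensor A =
     \<lparr>carrier = carrier (tensor_free A Mod tensor_rels A),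
      monoid.mult = undefined,
      monoid.one = undefined,
      ring.zero = monoid.one (tensor_free A Mod tensor_rels A),
      ring.add = monoid.mult (tensor_free A Mod tensor_rels A),
      module.smult = (\<lambda>q C. tensor_rels A <#>\<^bsub>tensor_free A\<^esub>
                       frag_extend (\<lambda>(p, a). frag_of (q * p, a)) ` C)\<rparr>"

definition rat_dim :: "(rat, 'v, 'c) module_scheme \<Rightarrow> enat" where
  "rat_dim V =
     (if vectorspace.fin_dim class_ring V then enat (vectorspace.dim class_ring V) else \<infinity>)"


section \<open>Hirsch length\<close>

definition abelian_series :: "('a, 'b) monoid_scheme \<Rightarrow> nat \<Rightarrow> (nat \<Rightarrow> 'a set) \<Rightarrow> bool" where
  "abelian_series G n N \<longleftrightarrow>
     N 0 = carrier G \<and> N n = {\<one>\<^bsub>G\<^esub>} \<and>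
     (\<forall>i<n. N (Suc i) \<lhd> G\<lparr>carrier := N i\<rparr> \<and>
            comm_group (G\<lparr>carrier := N i\<rparr> Mod N (Suc i)))"

text \<open>A finite-index subgroup having a finite subnormal series with abelian factors is precisely
  a solvable one. The sum does not depend on the subgroup or on the series, so the choice is
  immaterial when \<open>G\<close> is virtually solvable.\<close>

definition hirsch_length :: "('a, 'b) monoid_scheme \<Rightarrow> enat" where
  "hirsch_length G = (SOME h. \<exists>H n N.
     finite_index_subgroup H G \<and> abelian_series (G\<lparr>carrier := H\<rparr>) n N \<and>
     h = (\<Sum>i<n. rat_dim (rat_tensor (G\<lparr>carrier := N i\<rparr> Mod N (Suc i)))))"


section \<open>Linear groups\<close>

definition group_center :: "('a, 'b) monoid_scheme \<Rightarrow> 'a set" where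
  "group_center G = {z \<in> carrier G. \<forall>x \<in> carrier G. z \<otimes>\<^bsub>G\<^esub> x = x \<otimes>\<^bsub>G\<^esub> z}"

definition special_linear_group :: "nat \<Rightarrow> 'f::field itself \<Rightarrow> 'f mat monoid" where
  "special_linear_group n F =
     \<lparr>carrier = {A \<in> carrier_mat n n. det A = 1}, monoid.mult = (*), one = 1\<^sub>m n\<rparr>"

definition projective_special_linear_group ::
    "nat \<Rightarrow> 'f::field itself \<Rightarrow> 'f mat set monoid" where
  "projective_special_linear_group n F =
     special_linear_group n F Mod group_center (special_linear_group n F)"

end

theory Submission
  imports Defs "Jordan_Normal_Form.Spectral_Radius" "Berlekamp_Zassenhaus.Factor_Bound"
begin

text \<open>Let \<open>N\<close> be the solvable radical of \<open>S\<close> and \<open>H = S/N\<close>, and put \<open>q = 5, 7, 9\<close> in the three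
  cases. Write \<open>q = p r\<close> with \<open>p = 5, 7, 3\<close> prime, so that \<open>r (p - 1) = 4, 6, 6\<close> is the degree of
  the cyclotomic polynomial of \<open>q\<close>. The claim follows from \<open>h(S) \<ge> q + r (p - 1)\<close>, that is from
  the bounds 9, 13 and 15 (\<open>hirsch_length_bound\<close>); the last one is stronger than required.

  The number \<open>q\<close> is the order of an element of \<open>H\<close> whose \<open>r\<close>-th power normally generates \<open>H\<close>. Let
  \<open>g \<in> S\<close> be a lift of this element. If a normal subgroup \<open>M\<close> of \<open>S\<close> contains \<open>g\<^sup>j\<close> with \<open>q\<close> not
  dividing \<open>j\<close>, then \<open>M N = S\<close>, so \<open>S/M\<close> is a quotient of \<open>N\<close>, hence solvable and perfect, hence
  trivial. Every use of the structure of \<open>H\<close> goes through this property, the hypothesis \<open>full\<close> of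
  \<open>perfect_extension\<close>. Assume now that \<open>h(S) < q + r (p - 1)\<close>. The aim is that \<open>S\<close> is virtually
  nilpotent, which it is not. Let \<open>N = E\<^sub>0 \<supseteq> E\<^sub>1 \<supseteq> \<dots>\<close> be the derived series of \<open>N\<close>, let \<open>V\<^sub>i\<close> be
  the rational vector space obtained from \<open>E\<^sub>i / E\<^sub>i\<^sub>+\<^sub>1\<close>, and let \<open>S\<close> act on \<open>V\<^sub>i\<close> by
  conjugation.

  The terms of infinite index have small Hirsch length. Let \<open>j\<close> be the least number for which
  \<open>E\<^sub>j\<^sub>+\<^sub>1\<close> has infinite index. Then \<open>E\<^sub>j\<close> is finitely generated, so \<open>V\<^sub>j \<noteq> 0\<close>. If \<open>S\<close> acted
  trivially on \<open>V\<^sub>j\<close>, the transfer would extend a coordinate on \<open>V\<^sub>j\<close> to a nonzero homomorphism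
  from the perfect group \<open>S\<close> to the rationals. So the action is nontrivial, some power of \<open>g\<close> acts
  on \<open>V\<^sub>j\<close> with order \<open>q\<close>, and since the cyclotomic polynomial is irreducible,
  \<open>dim V\<^sub>j \<ge> r (p - 1)\<close> (\<open>rank_of_section\<close>). The Hirsch length of \<open>E\<^sub>i\<close> is therefore less than \<open>q\<close>
  for all \<open>i > j\<close>.

  Complex representations \<open>\<rho>\<close> of \<open>S\<close> of dimension less than \<open>q\<close> are unipotent on a subgroup of
  finite index of \<open>N\<close> (\<open>virtually_unipotent\<close>). If \<open>\<rho>\<close> is irreducible, \<open>\<rho>(N)\<close> is even finite: the
  element \<open>g\<close> permutes the weights of a normal subgroup \<open>T\<close> with abelian image in orbits shorter
  than \<open>q\<close>, so a power \<open>g\<^sup>k\<close> with \<open>q\<close> not dividing \<open>k\<close> fixes them all, and then \<open>S\<close> does, by the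
  property of \<open>g\<close>. So \<open>\<rho>(T)\<close> is scalar, and it is finite because \<open>S\<close> is perfect and its image has
  determinant 1. Finiteness climbs up the derived series of \<open>N\<close>, because a linear group of class
  two whose centre consists of finitely many scalar matrices is finite: elements outside the
  centre have trace 0, so representatives of the cosets of the centre are linearly independent.
  The reducible case is a block triangular induction.

  Hence a normal subgroup \<open>D\<close> of finite index acts unipotently on all \<open>V\<^sub>i\<close>: iterated commutators
  with elements of \<open>D\<close> have, up to powers, their values one step down in the series. Powers can be
  removed because \<open>S\<close> is torsion free and roots are unique in torsion-free nilpotent groups
  (\<open>isolator_in_center\<close>), so \<open>D\<close> is nilpotent (\<open>virtually_nilpotent_of_small_hirsch\<close>).

  The Hirsch length is handled through the lower bounds \<open>hirsch_ge\<close>, which are independent of a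
  series. \<open>hirsch_ge_series\<close> transports such a bound to any series, and \<open>int_indep_le_rat_dim\<close> to
  the dimensions in the definition of the Hirsch length.\<close>

section \<open>Integral independence and rational coordinates\<close>

text \<open>Recursion fixes an order of the factors, so that the product makes sense before the group
  is known to be commutative.\<close>

primrec int_comb :: "('a, 'b) monoid_scheme \<Rightarrow> nat \<Rightarrow> (nat \<Rightarrow> 'a) \<Rightarrow> (nat \<Rightarrow> int) \<Rightarrow> 'a" where
  "int_comb Q 0 x e = \<one>\<^bsub>Q\<^esub>"
| "int_comb Q (Suc n) x e = int_comb Q n x e \<otimes>\<^bsub>Q\<^esub> x n [^]\<^bsub>Q\<^esub> e n"

definition int_indep :: "('a, 'b) monoid_scheme \<Rightarrow> nat \<Rightarrow> (nat \<Rightarrow> 'a) \<Rightarrow> bool" where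
  "int_indep Q n x \<longleftrightarrow> x ` {..<n} \<subseteq> carrier Q \<and> (\<forall>e. int_comb Q n x e = \<one>\<^bsub>Q\<^esub> \<longrightarrow> (\<forall>i<n. e i = 0))"

context comm_group begin

lemma int_comb_closed: "x ` {..<n} \<subseteq> carrier G \<Longrightarrow> int_comb G n x e \<in> carrier G"
  by (induction n) (auto simp: lessThan_Suc)

lemma int_comb_in_subgroup:
  assumes "subgroup B G" shows "x ` {..<n} \<subseteq> B \<Longrightarrow> int_comb G n x e \<in> B"
  by (induction n)
     (auto simp: lessThan_Suc subgroup.one_closed[OF assms] intro!: subgroup.m_closed[OF assms]
        subgroup_int_pow_closed[OF assms])

lemma int_comb_cong:
  "(\<And>i. i < n \<Longrightarrow> x i = y i) \<Longrightarrow> (\<And>i. i < n \<Longrightarrow> e i = f i) \<Longrightarrow> int_comb G n x e = int_comb G n y f"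
  by (induction n) auto

lemma int_comb_add:
  "x ` {..<n} \<subseteq> carrier G \<Longrightarrow> int_comb G n x (\<lambda>i. e i + f i) = int_comb G n x e \<otimes> int_comb G n x f"
proof (induction n)
  case (Suc n)
  then have x: "x ` {..<n} \<subseteq> carrier G" "x n \<in> carrier G" by auto
  then show ?case
    using Suc.IH int_comb_closed[OF x(1), of e] int_comb_closed[OF x(1), of f]
    by (simp add: int_pow_mult[symmetric] m_ac)
qed auto

lemma int_comb_scale:
  "x ` {..<n} \<subseteq> carrier G \<Longrightarrow> int_comb G n x (\<lambda>i. k * e i) = int_comb G n x e [^] (k::int)"
proof (induction n)
  case (Suc n)
  then have x: "x ` {..<n} \<subseteq> carrier G" "x n \<in> carrier G" by auto
  then show ?case
    using Suc.IH int_comb_closed[OF x(1), of e]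
    by (simp add: int_pow_distrib int_pow_pow mult.commute)
qed auto

lemma int_comb_zero:
  "x ` {..<n} \<subseteq> carrier G \<Longrightarrow> (\<And>i. i < n \<Longrightarrow> e i = 0) \<Longrightarrow> int_comb G n x e = \<one>"
  by (induction n) (auto simp: lessThan_Suc)

lemma int_comb_single:
  "x ` {..<n} \<subseteq> carrier G \<Longrightarrow> j < n \<Longrightarrow> int_comb G n x (\<lambda>i. of_bool (i = j)) = x j"
proof (induction n)
  case (Suc n)
  then have x: "x ` {..<n} \<subseteq> carrier G" "x n \<in> carrier G" by auto
  show ?case
  proof (cases "j = n")
    case True
    then show ?thesis using x int_comb_zero[OF x(1), of "\<lambda>i. of_bool (i = j)"] by simp
  next
    case False
    with Suc x show ?thesis by auto
  qed
qed simp

text \<open>In a relation between the \<open>x i\<close> and \<open>y\<close> the exponent of \<open>y\<close> vanishes, since otherwise a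
  positive power of \<open>y\<close> would lie in \<open>B\<close>. A chain of subgroups provides such a \<open>B\<close> that may be
  larger than the subgroup generated by the \<open>x i\<close>.\<close>

lemma int_indep_extend:
  assumes x: "int_indep G n x" "x ` {..<n} \<subseteq> B" and B: "subgroup B G"
    and y: "y \<in> carrier G" "\<And>k::nat. 0 < k \<Longrightarrow> y [^] k \<notin> B"
  shows "int_indep G (Suc n) (x(n := y))"
proof -
  have carr: "x ` {..<n} \<subseteq> carrier G" using x by (simp add: int_indep_def)
  have "e i = 0" if e: "int_comb G (Suc n) (x(n := y)) e = \<one>" and i: "i < Suc n" for e i
  proof -
    have eq: "int_comb G n x e \<otimes> y [^] e n = \<one>"
      using e int_comb_cong[of n "x(n := y)" x e e] by simp
    have "y [^] e n = inv (int_comb G n x e)"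
      using eq y int_comb_closed[OF carr] by (metis inv_equality inv_inv int_pow_closed m_comm)
    then have mem: "y [^] e n \<in> B"
      using int_comb_in_subgroup[OF B x(2)] subgroup.m_inv_closed[OF B] by simp
    have en: "e n = 0"
    proof (rule ccontr)
      assume "e n \<noteq> 0"
      then have pos: "0 < nat \<bar>e n\<bar>" by simp
      have "y [^] (nat \<bar>e n\<bar>) \<in> B"
      proof (cases "0 \<le> e n")
        case True
        then have "y [^] nat \<bar>e n\<bar> = y [^] int (nat \<bar>e n\<bar>)" by (simp only: int_pow_int)
        with True show ?thesis using mem by simp
      next
        case False
        have "y [^] nat \<bar>e n\<bar> = y [^] int (nat \<bar>e n\<bar>)" by (simp only: int_pow_int)
        also have "\<dots> = inv (y [^] e n)" using False y by (simp add: int_pow_neg)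
        finally show ?thesis using mem subgroup.m_inv_closed[OF B] by simp
      qed
      with y(2)[OF pos] show False ..
    qed
    with eq int_comb_closed[OF carr] have "int_comb G n x e = \<one>" by simp
    with x(1) i en show ?thesis by (auto simp: int_indep_def less_Suc_eq)
  qed
  then show ?thesis using carr y by (auto simp: int_indep_def lessThan_Suc)
qed

lemma range_int_comb_subgroup:
  assumes carr: "x ` {..<n} \<subseteq> carrier G"
  shows "subgroup (range (int_comb G n x)) G" (is "subgroup ?B G")
proof (rule subgroupI)
  show "?B \<subseteq> carrier G" using int_comb_closed[OF carr] by auto
  show "inv a \<in> ?B" if a: "a \<in> ?B" for a
  proof -
    obtain e where "a = int_comb G n x e" using a by auto
    then have "inv a = int_comb G n x (\<lambda>i. (-1) * e i)"
      using int_comb_scale[OF carr, of "-1" e] int_comb_closed[OF carr] by (simp add: int_pow_neg)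
    then show ?thesis by blast
  qed
  show "a \<otimes> b \<in> ?B" if "a \<in> ?B" "b \<in> ?B" for a b
    using that int_comb_add[OF carr, symmetric] by auto
qed auto

text \<open>A maximal independent system \<open>x\<close> has the property that each element \<open>a\<close> has a positive
  power \<open>a [^] k\<close> which is an integral combination of the \<open>x i\<close>. Its exponents divided by \<open>k\<close> are
  the coordinates of \<open>a\<close> in the rational vector space of the group, with \<open>x\<close> as basis; the kernel
  is the torsion. The bound \<open>r\<close> is what makes a maximal system exist.\<close>

lemma ex_rational_coordinates:
  assumes bound: "\<And>n x. int_indep G n x \<Longrightarrow> n \<le> r"
  obtains n x c where "int_indep G n x"
    "\<And>a b i. a \<in> carrier G \<Longrightarrow> b \<in> carrier G \<Longrightarrow> i < n \<Longrightarrow> c (a \<otimes> b) i = (c a i + c b i :: rat)"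
    "\<And>i j. i < n \<Longrightarrow> j < n \<Longrightarrow> c (x i) j = of_bool (i = j)"
    "\<And>a. a \<in> carrier G \<Longrightarrow> (\<forall>i<n. c a i = 0) \<longleftrightarrow> (\<exists>k::nat. 0 < k \<and> a [^] k = \<one>)"
proof -
  have "int_indep G 0 (\<lambda>_. \<one>)" by (simp add: int_indep_def)
  then have ex0: "\<exists>x. int_indep G 0 x" by blast
  have bd: "\<And>n. (\<exists>x. int_indep G n x) \<Longrightarrow> n \<le> r" using bound by blast
  define n where "n = (GREATEST n. \<exists>x. int_indep G n x)"
  obtain x where x: "int_indep G n x"
    using GreatestI_nat[of "\<lambda>n. \<exists>x. int_indep G n x", OF ex0 bd] n_def by auto
  have carr: "x ` {..<n} \<subseteq> carrier G" using x by (simp add: int_indep_def)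
  have max: "\<not> int_indep G (Suc n) z" for z
    using Greatest_le_nat[of "\<lambda>n. \<exists>x. int_indep G n x" "Suc n" r] bd n_def by fastforce
  let ?B = "range (int_comb G n x)"
  have B: "subgroup ?B G" by (rule range_int_comb_subgroup[OF carr])
  have ex: "\<exists>k e. 0 < k \<and> y [^] (k::nat) = int_comb G n x e" if y: "y \<in> carrier G" for y
  proof (rule ccontr)
    assume "\<not> ?thesis"
    then have "\<And>k::nat. 0 < k \<Longrightarrow> y [^] k \<notin> ?B" by blast
    moreover have "x ` {..<n} \<subseteq> ?B"
      using int_comb_single[OF carr, symmetric] by auto
    ultimately show False using int_indep_extend[OF x _ B y] max by blast
  qed
  \<comment> \<open>The coordinates are read off from one chosen power of \<open>y\<close>; the fact \<open>key\<close> says that any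
    other power gives the same result.\<close>
  define P where "P y p \<longleftrightarrow> 0 < fst p \<and> y [^] (fst p :: nat) = int_comb G n x (snd p)" for y p
  define c where "c y i = (let p = (SOME p. P y p) in of_int (snd p i) / of_nat (fst p) :: rat)" for y i
  have key: "c y i = of_int (e i) / of_nat k"
    if y: "y \<in> carrier G" and k: "0 < k" "y [^] (k::nat) = int_comb G n x e" and i: "i < n" for y k e i
  proof -
    obtain l f where lf: "(SOME p. P y p) = (l, f)" by (cases "SOME p. P y p")
    have "P y (SOME p. P y p)" by (rule someI_ex) (use ex[OF y] P_def in auto)
    then have l: "0 < l" "y [^] l = int_comb G n x f" using lf P_def by auto
    have "int_comb G n x (\<lambda>i. int k * f i + (- int l) * e i)
        = (y [^] l) [^] int k \<otimes> (y [^] k) [^] (- int l)"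
      using int_comb_add[OF carr, of "\<lambda>i. int k * f i" "\<lambda>i. (- int l) * e i"]
        int_comb_scale[OF carr, of _ f] int_comb_scale[OF carr, of "- int l" e] l(2) k(2)
      by (simp del: mult_minus_left)
    also have "\<dots> = y [^] (int l * int k) \<otimes> y [^] (int k * (- int l))"
      using y by (metis int_pow_int int_pow_pow)
    also have "\<dots> = \<one>" using y by (simp add: int_pow_mult[symmetric] mult.commute)
    finally have "int k * f i + (- int l) * e i = 0" using x i unfolding int_indep_def by blast
    then have "int k * f i = int l * e i" by simp
    then have "(of_nat k * of_int (f i) :: rat) = of_nat l * of_int (e i)"
      by (metis of_int_mult of_int_of_nat_eq)
    then show ?thesis using l(1) k(1) lf unfolding c_def by (simp add: field_simps)
  qed
  show thesis
  proof (rule that[OF x])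
    fix a b i assume a: "a \<in> carrier G" and b: "b \<in> carrier G" and i: "i < n"
    obtain k e where k: "0 < k" "a [^] (k::nat) = int_comb G n x e" using ex[OF a] by auto
    obtain l f where l: "0 < l" "b [^] (l::nat) = int_comb G n x f" using ex[OF b] by auto
    have "(a \<otimes> b) [^] (k * l) = (a [^] k) [^] int l \<otimes> (b [^] l) [^] int k"
      using a b by (simp add: nat_pow_distrib int_pow_int nat_pow_pow mult.commute)
    also have "\<dots> = int_comb G n x (\<lambda>i. int l * e i + int k * f i)"
      using int_comb_add[OF carr, of "\<lambda>i. int l * e i" "\<lambda>i. int k * f i"]
        int_comb_scale[OF carr] l(2) k(2) by simp
    finally have "c (a \<otimes> b) i = of_int (int l * e i + int k * f i) / of_nat (k * l)"
      using key[of "a \<otimes> b" "k * l"] a b k l i by simp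
    also have "\<dots> = c a i + c b i" using key[OF a k i] key[OF b l i] k l by (simp add: field_simps)
    finally show "c (a \<otimes> b) i = c a i + c b i" .
  next
    fix i j assume ij: "i < n" "j < n"
    have "x i [^] (1::nat) = int_comb G n x (\<lambda>j. of_bool (j = i))"
      using int_comb_single[OF carr ij(1)] carr ij by (auto simp: image_subset_iff)
    from key[OF _ _ this ij(2)] show "c (x i) j = of_bool (i = j)" using carr ij by auto
  next
    fix a assume a: "a \<in> carrier G"
    obtain k e where k: "0 < k" "a [^] (k::nat) = int_comb G n x e" using ex[OF a] by auto
    show "(\<forall>i<n. c a i = 0) \<longleftrightarrow> (\<exists>k::nat. 0 < k \<and> a [^] k = \<one>)"
    proof
      assume "\<forall>i<n. c a i = 0"
      then have "\<And>i. i < n \<Longrightarrow> e i = 0" using key[OF a k] k(1) by auto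
      then have "a [^] k = \<one>" using int_comb_zero[OF carr] k(2) by simp
      with k(1) show "\<exists>k::nat. 0 < k \<and> a [^] k = \<one>" by blast
    next
      assume "\<exists>k::nat. 0 < k \<and> a [^] k = \<one>"
      then obtain l where l: "0 < (l::nat)" "a [^] l = int_comb G n x (\<lambda>_. 0)"
        using int_comb_zero[OF carr, of "\<lambda>_. 0"] by auto
      show "\<forall>i<n. c a i = 0" using key[OF a l] by simp
    qed
  qed
qed

end

section \<open>Lower bounds for the Hirsch length\<close>

text \<open>Normality of \<open>K\<close> in \<open>L\<close> expressed by the operations of the ambient group, so that chains
  of subgroups need not change the group.\<close>

definition normal_within :: "('a, 'b) monoid_scheme \<Rightarrow> 'a set \<Rightarrow> 'a set \<Rightarrow> bool" where
  "normal_within G K L \<longleftrightarrow> subgroup K G \<and> subgroup L G \<and> K \<subseteq> L \<and>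
     (\<forall>l\<in>L. \<forall>k\<in>K. l \<otimes>\<^bsub>G\<^esub> k \<otimes>\<^bsub>G\<^esub> inv\<^bsub>G\<^esub> l \<in> K)"

text \<open>The subgroup has Hirsch length at least \<open>v\<close>: it contains a chain of subgroups, each normal
  in the next, with \<open>v\<close> steps in whose factor groups some element has infinite order. Chains of
  this kind can be lengthened freely, so lower bounds for a subgroup and for a factor add up.\<close>

inductive hirsch_ge :: "('a, 'b) monoid_scheme \<Rightarrow> 'a set \<Rightarrow> nat \<Rightarrow> bool" for G where
  zero: "subgroup K G \<Longrightarrow> hirsch_ge G K 0"
| step: "hirsch_ge G K v \<Longrightarrow> normal_within G K L \<Longrightarrow> x \<in> L \<Longrightarrow>
    (\<And>n::nat. 0 < n \<Longrightarrow> x [^]\<^bsub>G\<^esub> n \<notin> K) \<Longrightarrow> hirsch_ge G L (Suc v)"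
| mono: "hirsch_ge G K v \<Longrightarrow> K \<subseteq> L \<Longrightarrow> subgroup L G \<Longrightarrow> hirsch_ge G L v"

context group begin

lemma normal_within_iff:
  assumes "subgroup L G"
  shows "normal_within G K L \<longleftrightarrow> K \<lhd> G\<lparr>carrier := L\<rparr>"
proof -
  interpret L: group "G\<lparr>carrier := L\<rparr>" using assms by (rule subgroup_imp_group)
  show ?thesis
  proof
    assume K: "normal_within G K L"
    then have "subgroup K (G\<lparr>carrier := L\<rparr>)"
      unfolding normal_within_def using subgroup_incl by blast
    moreover have "\<forall>x\<in>L. \<forall>h\<in>K. x \<otimes> h \<otimes> inv\<^bsub>G\<lparr>carrier := L\<rparr>\<^esub> x \<in> K"
      using K assms by (auto simp: normal_within_def m_inv_consistent)
    ultimately show "K \<lhd> G\<lparr>carrier := L\<rparr>" unfolding L.normal_inv_iff by simp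
  next
    assume K: "K \<lhd> G\<lparr>carrier := L\<rparr>"
    then have "subgroup K (G\<lparr>carrier := L\<rparr>)" by (rule normal_imp_subgroup)
    then have "subgroup K G" "K \<subseteq> L"
      using incl_subgroup[OF assms] subgroup.subset by fastforce+
    moreover have "\<forall>l\<in>L. \<forall>k\<in>K. l \<otimes> k \<otimes> inv l \<in> K"
      using K assms unfolding L.normal_inv_iff by (simp add: m_inv_consistent)
    ultimately show "normal_within G K L" using assms by (simp add: normal_within_def)
  qed
qed

lemma ex_pow_in_finite_index:
  assumes "finite_index_subgroup H G" "x \<in> carrier G"
  obtains n :: nat where "0 < n" "x [^] n \<in> H"
proof -
  have H: "subgroup H G" and fin: "finite (rcosets H)"
    using assms(1) by (auto simp: finite_index_subgroup_def)
  have "range (\<lambda>n::nat. H #> x [^] n) \<subseteq> rcosets H"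
    using assms(2) subgroup.subset[OF H] by (auto intro: rcosetsI)
  then have "\<not> inj (\<lambda>n::nat. H #> x [^] n)"
    using fin finite_subset finite_imageD infinite_UNIV_nat by metis
  then obtain i j :: nat where ij: "i < j" "H #> x [^] i = H #> x [^] j"
    unfolding inj_on_def by (metis linorder_neqE_nat)
  have "x [^] j \<in> H #> x [^] i" using ij(2) rcos_self[OF _ H, of "x [^] j"] assms(2) by simp
  then have "x [^] j \<otimes> inv (x [^] i) \<in> H"
    using subgroup.rcos_module_imp[OF H is_group] assms(2) by simp
  moreover have "x [^] j = x [^] (j - i) \<otimes> x [^] i" using ij(1) assms(2) by (simp add: nat_pow_mult)
  ultimately have "x [^] (j - i) \<in> H" using assms(2) by (simp add: m_assoc)
  with ij(1) show thesis using that[of "j - i"] by simp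
qed

text \<open>Modulo \<open>K\<close> the factor \<open>z\<close> disappears, so the two powers agree up to an element of \<open>K\<close>.\<close>

lemma pow_mult_normal_within:
  assumes K: "normal_within G K L" and u: "u \<in> L" and z: "z \<in> K"
  shows "\<exists>k\<in>K. (u \<otimes> z) [^] (n::nat) = u [^] n \<otimes> k"
proof (induction n)
  case 0
  have "\<one> \<in> K" using K by (simp add: normal_within_def subgroup.one_closed)
  then show ?case by (intro bexI[of _ "\<one>"]) auto
next
  case (Suc n)
  then obtain k where k: "k \<in> K" "(u \<otimes> z) [^] n = u [^] n \<otimes> k" by auto
  have sub: "subgroup K G" "subgroup L G" "K \<subseteq> L" using K by (auto simp: normal_within_def)
  have carr: "u \<in> carrier G" "z \<in> carrier G" "k \<in> carrier G"
    using sub u z k(1) subgroup.mem_carrier by fast+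
  have "inv u \<otimes> k \<otimes> inv (inv u) \<in> K"
    using K u k(1) subgroup.m_inv_closed[OF sub(2)] unfolding normal_within_def by blast
  then have mem: "inv u \<otimes> k \<otimes> u \<otimes> z \<in> K" using carr z subgroup.m_closed[OF sub(1)] by simp
  have "(u \<otimes> z) [^] Suc n = u [^] n \<otimes> k \<otimes> (u \<otimes> z)" using k(2) by simp
  also have "\<dots> = u [^] n \<otimes> (u \<otimes> inv u) \<otimes> k \<otimes> (u \<otimes> z)" using carr by simp
  also have "\<dots> = (u [^] n \<otimes> u) \<otimes> (inv u \<otimes> k \<otimes> u \<otimes> z)" using carr by (simp only: m_assoc m_closed inv_closed nat_pow_closed)
  finally show ?case using mem by (auto simp: carr)
qed

lemma abelian_series_subgroup:
  assumes "subgroup H G" "abelian_series (G\<lparr>carrier := H\<rparr>) m M"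
  shows "i \<le> m \<Longrightarrow> subgroup (M i) G"
proof (induction i)
  case 0
  then show ?case using assms by (simp add: abelian_series_def)
next
  case (Suc i)
  then have "M (Suc i) \<lhd> G\<lparr>carrier := M i\<rparr>" using assms by (auto simp: abelian_series_def)
  then show ?case using Suc incl_subgroup normal_imp_subgroup by fastforce
qed

text \<open>Half of the fact that the Hirsch length does not depend on the series. Each step of the
  chain contributes to exactly one factor of the series: take the last \<open>M j\<close> for which some
  element of \<open>L \<inter> M j\<close> has no positive power in \<open>K\<close>. There the image of that element is
  independent of the image of \<open>K \<inter> M j\<close>. The clause about the images of \<open>x\<close> keeps the induction
  going.\<close>

lemma hirsch_ge_series:
  assumes "hirsch_ge G K v" and H: "finite_index_subgroup H G"
    and M: "abelian_series (G\<lparr>carrier := H\<rparr>) m M"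
  shows "\<exists>\<nu>. v \<le> (\<Sum>j<m. \<nu> j) \<and> (\<forall>j<m. \<exists>x. int_indep (G\<lparr>carrier := M j\<rparr> Mod M (Suc j)) (\<nu> j) x \<and>
    x ` {..<\<nu> j} \<subseteq> (#>) (M (Suc j)) ` (K \<inter> M j))"
  using assms(1)
proof induction
  case (zero K)
  have "int_indep (G\<lparr>carrier := M j\<rparr> Mod M (Suc j)) 0 (\<lambda>_. undefined)" for j
    by (simp add: int_indep_def)
  then show ?case by (intro exI[of _ "\<lambda>_. 0"]) auto
next
  case (mono K v L)
  then obtain \<nu> where \<nu>: "v \<le> (\<Sum>j<m. \<nu> j)"
    "\<And>j. j < m \<Longrightarrow> \<exists>x. int_indep (G\<lparr>carrier := M j\<rparr> Mod M (Suc j)) (\<nu> j) x \<and>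
      x ` {..<\<nu> j} \<subseteq> (#>) (M (Suc j)) ` (K \<inter> M j)" by auto
  have "(#>) (M (Suc j)) ` (K \<inter> M j) \<subseteq> (#>) (M (Suc j)) ` (L \<inter> M j)" for j using mono(2) by blast
  with \<nu> show ?case by (meson order_trans)
next
  case (step K v L x)
  have K: "subgroup K G" and L: "subgroup L G" and KL: "K \<subseteq> L"
    using step(2) by (auto simp: normal_within_def)
  obtain \<nu> where \<nu>: "v \<le> (\<Sum>j<m. \<nu> j)"
    "\<And>j. j < m \<Longrightarrow> \<exists>x. int_indep (G\<lparr>carrier := M j\<rparr> Mod M (Suc j)) (\<nu> j) x \<and>
      x ` {..<\<nu> j} \<subseteq> (#>) (M (Suc j)) ` (K \<inter> M j)" using step.IH by auto
  have Hs: "subgroup H G" using H by (simp add: finite_index_subgroup_def)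
  have Msub: "subgroup (M i) G" if "i \<le> m" for i using abelian_series_subgroup[OF Hs M that] .
  define T where "T j \<longleftrightarrow> j \<le> m \<and> (\<exists>y\<in>L \<inter> M j. \<forall>n::nat. 0 < n \<longrightarrow> y [^] n \<notin> K)" for j
  \<comment> \<open>The finite index of \<open>H\<close> enters only here: a power of \<open>x\<close> lies in the top term of the
    series.\<close>
  have "T 0"
  proof -
    have xc: "x \<in> carrier G" using step(3) L subgroup.mem_carrier by fast
    obtain n :: nat where n: "0 < n" "x [^] n \<in> H" using ex_pow_in_finite_index[OF H xc] .
    have "x [^] n \<in> L" using nat_pow_closed[OF ] step(3) L
      by (metis subgroup_int_pow_closed int_pow_int)
    moreover have "(x [^] n) [^] k \<notin> K" if "0 < k" for k :: nat
      using step(4)[of "n * k"] n(1) that xc by (simp add: nat_pow_pow)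
    ultimately show ?thesis using n(2) M by (auto simp: T_def abelian_series_def)
  qed
  moreover have bd: "\<And>j. T j \<Longrightarrow> j \<le> m" by (simp add: T_def)
  ultimately obtain j where j: "T j" and jmax: "\<And>i. T i \<Longrightarrow> i \<le> j"
    using GreatestI_nat[of T 0 m] Greatest_le_nat[of T _ m] by blast
  have "\<not> T m"
    using M subgroup.one_closed[OF K] by (auto simp: T_def abelian_series_def intro!: exI[of _ "1::nat"])
  with j have jm: "j < m" by (metis T_def le_neq_implies_less)
  obtain y where y: "y \<in> L" "y \<in> M j" "\<And>n::nat. 0 < n \<Longrightarrow> y [^] n \<notin> K" using j by (auto simp: T_def)
  have tors: "\<exists>n::nat. 0 < n \<and> u [^] n \<in> K" if u: "u \<in> L" "u \<in> M (Suc j)" for u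
  proof (rule ccontr)
    assume "\<not> ?thesis"
    then have "\<forall>n::nat. 0 < n \<longrightarrow> u [^] n \<notin> K" by blast
    with u have "T (Suc j)" using jm unfolding T_def by (intro conjI bexI[of _ u]) auto
    then show False using jmax by fastforce
  qed
  let ?Q = "G\<lparr>carrier := M j\<rparr> Mod M (Suc j)"
  let ?\<pi> = "(#>) (M (Suc j))"
  have Mj: "subgroup (M j) G" and Mj': "subgroup (M (Suc j)) G" using Msub jm by simp_all
  interpret N: normal "M (Suc j)" "G\<lparr>carrier := M j\<rparr>" using M jm by (simp add: abelian_series_def)
  interpret Q: comm_group ?Q using M jm by (simp add: abelian_series_def)
  have \<pi>: "?\<pi> \<in> hom (G\<lparr>carrier := M j\<rparr>) ?Q"
  proof -
    have "(\<lambda>a. M (Suc j) #>\<^bsub>G\<lparr>carrier := M j\<rparr>\<^esub> a) = ?\<pi>" by (simp add: r_coset_def fun_eq_iff)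
    then show ?thesis using N.r_coset_hom_Mod by simp
  qed
  interpret \<pi>: group_hom "G\<lparr>carrier := M j\<rparr>" ?Q ?\<pi>
    using \<pi> by unfold_locales
  have KM: "subgroup (K \<inter> M j) (G\<lparr>carrier := M j\<rparr>)"
    using subgroups_Inter_pair[OF K Mj] subgroup_incl Mj by blast
  then have B: "subgroup (?\<pi> ` (K \<inter> M j)) ?Q" by (rule \<pi>.subgroup_img_is_subgroup)
  obtain z where z: "int_indep ?Q (\<nu> j) z" "z ` {..<\<nu> j} \<subseteq> ?\<pi> ` (K \<inter> M j)" using \<nu>(2)[OF jm] by auto
  have yc: "y \<in> carrier G" using y(2) Mj subgroup.mem_carrier by fast
  have "int_indep ?Q (Suc (\<nu> j)) (z(\<nu> j := ?\<pi> y))"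
  proof (rule Q.int_indep_extend[OF z B])
    show "?\<pi> y \<in> carrier ?Q" using y(2) \<pi>.hom_closed by simp
    fix k :: nat assume k: "0 < k"
    show "?\<pi> y [^]\<^bsub>?Q\<^esub> k \<notin> ?\<pi> ` (K \<inter> M j)"
    proof
      assume "?\<pi> y [^]\<^bsub>?Q\<^esub> k \<in> ?\<pi> ` (K \<inter> M j)"
      then obtain w where w: "w \<in> K" "w \<in> M j" "?\<pi> y [^]\<^bsub>?Q\<^esub> k = ?\<pi> w" by auto
      have yk: "y [^]\<^bsub>G\<lparr>carrier := M j\<rparr>\<^esub> k = y [^] k" by (simp add: nat_pow_def)
      have "?\<pi> (y [^] k) = ?\<pi> w" using \<pi>.hom_nat_pow[of y k] y(2) w(3) yk by simp
      moreover have wc: "w \<in> carrier G" using w(1) K subgroup.mem_carrier by fast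
      ultimately have "y [^] k \<in> ?\<pi> w" using rcos_self[OF _ Mj', of "y [^] k"] yc by auto
      then have u: "y [^] k \<otimes> inv w \<in> M (Suc j)"
        using subgroup.rcos_module_imp[OF Mj' is_group wc] by simp
      \<comment> \<open>This element lies one step lower in the series, where powers fall into \<open>K\<close> by the
        choice of \<open>j\<close>. So a power of \<open>y\<close> lies in \<open>K\<close>.\<close>
      let ?u = "y [^] k \<otimes> inv w"
      have uL: "?u \<in> L" using y(1) w(1) K L KL
        by (metis int_pow_int subgroup_int_pow_closed subgroup.m_closed subgroup.m_inv_closed subset_iff)
      obtain n :: nat where n: "0 < n" "?u [^] n \<in> K" using tors[OF uL u] by auto
      have eq: "y [^] k = ?u \<otimes> w" using yc wc by (simp add: m_assoc)
      obtain k' where k': "k' \<in> K" "(?u \<otimes> w) [^] n = ?u [^] n \<otimes> k'"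
        using pow_mult_normal_within[OF step(2) uL w(1)] by blast
      have "y [^] (k * n) \<in> K"
        using k' n(2) subgroup.m_closed[OF K] eq yc by (metis nat_pow_pow)
      then show False using y(3) k n(1) by simp
    qed
  qed
  moreover have mono: "?\<pi> ` (K \<inter> M j) \<subseteq> ?\<pi> ` (L \<inter> M j)" using KL by blast
  then have "(z(\<nu> j := ?\<pi> y)) ` {..<Suc (\<nu> j)} \<subseteq> ?\<pi> ` (L \<inter> M j)"
    using subset_trans[OF z(2) mono] y by (auto simp: lessThan_Suc image_subset_iff)
  ultimately have new: "\<exists>x. int_indep ?Q (Suc (\<nu> j)) x \<and> x ` {..<Suc (\<nu> j)} \<subseteq> ?\<pi> ` (L \<inter> M j)"
    by blast
  have count: "Suc v \<le> (\<Sum>i<m. (\<nu>(j := Suc (\<nu> j))) i)"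
  proof -
    have "(\<Sum>i<m. (\<nu>(j := Suc (\<nu> j))) i) = (\<Sum>i<m. \<nu> i + of_bool (i = j))"
      by (rule sum.cong) auto
    also have "\<dots> = (\<Sum>i<m. \<nu> i) + 1" using jm by (simp add: sum.distrib)
    finally show ?thesis using \<nu>(1) by simp
  qed
  have old: "\<exists>x. int_indep (G\<lparr>carrier := M i\<rparr> Mod M (Suc i)) (\<nu> i) x \<and>
      x ` {..<\<nu> i} \<subseteq> (#>) (M (Suc i)) ` (L \<inter> M i)" if im: "i < m" for i
  proof -
    have "(#>) (M (Suc i)) ` (K \<inter> M i) \<subseteq> (#>) (M (Suc i)) ` (L \<inter> M i)" using KL by blast
    with \<nu>(2)[OF im] show ?thesis by (meson order_trans)
  qed
  show ?case
  proof (intro exI[of _ "\<nu>(j := Suc (\<nu> j))"] conjI allI impI)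
    fix i assume "i < m"
    with old new show "\<exists>x. int_indep (G\<lparr>carrier := M i\<rparr> Mod M (Suc i)) ((\<nu>(j := Suc (\<nu> j))) i) x \<and>
      x ` {..<(\<nu>(j := Suc (\<nu> j))) i} \<subseteq> (#>) (M (Suc i)) ` (L \<inter> M i)"
      by (cases "i = j") simp_all
  qed (rule count)
qed

lemma normal_within_quotient_hom:
  assumes "normal_within G K L"
  shows "group_hom (G\<lparr>carrier := L\<rparr>) (G\<lparr>carrier := L\<rparr> Mod K) ((#>) K)"
proof -
  have L: "subgroup L G" using assms by (simp add: normal_within_def)
  interpret N: normal K "G\<lparr>carrier := L\<rparr>" using assms normal_within_iff[OF L] by simp
  have eq: "(\<lambda>a. K #>\<^bsub>G\<lparr>carrier := L\<rparr>\<^esub> a) = (#>) K" by (simp add: r_coset_def fun_eq_iff)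
  show ?thesis
    using N.r_coset_hom_Mod N.factorgroup_is_group N.is_group unfolding eq group_hom_def group_hom_axioms_def
    by blast
qed

lemma rcoset_eq_iff:
  assumes "subgroup K G" "a \<in> carrier G" "b \<in> carrier G"
  shows "K #> a = K #> b \<longleftrightarrow> a \<otimes> inv b \<in> K"
proof
  assume "K #> a = K #> b"
  then have "a \<in> K #> b" using rcos_self[OF assms(2,1)] by simp
  then show "a \<otimes> inv b \<in> K" using subgroup.rcos_module_imp[OF assms(1) is_group assms(3)] by simp
next
  assume "a \<otimes> inv b \<in> K"
  then have "a \<in> K #> b" using subgroup.rcos_module_rev[OF assms(1) is_group assms(3,2)] by simp
  then show "K #> a = K #> b" using repr_independence[OF _ assms(3,1)] by simp
qed

lemma carrier_upd_nat_pow: "x [^]\<^bsub>G\<lparr>carrier := L\<rparr>\<^esub> (k::nat) = x [^] k"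
  by (simp add: nat_pow_def)

lemma carrier_upd_r_coset: "K #>\<^bsub>G\<lparr>carrier := L\<rparr>\<^esub> a = K #> a"
  by (simp add: r_coset_def)

lemma normal_within_between:
  assumes KL: "normal_within G K L" and comm: "comm_group (G\<lparr>carrier := L\<rparr> Mod K)"
    and M: "subgroup M G" "K \<subseteq> M" "M \<subseteq> L"
  shows "normal_within G M L"
proof -
  have K: "subgroup K G" and L: "subgroup L G" using KL by (simp_all add: normal_within_def)
  interpret \<pi>: group_hom "G\<lparr>carrier := L\<rparr>" "G\<lparr>carrier := L\<rparr> Mod K" "(#>) K"
    by (rule normal_within_quotient_hom[OF KL])
  interpret Q: comm_group "G\<lparr>carrier := L\<rparr> Mod K" by (rule comm)
  have "l \<otimes> m \<otimes> inv l \<in> M" if l: "l \<in> L" and m: "m \<in> M" for l m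
  proof -
    have mL: "m \<in> L" using m M by blast
    have c: "l \<in> carrier G" "m \<in> carrier G" using l mL L subgroup.mem_carrier by fast+
    have "K #> (l \<otimes> m) = K #> (m \<otimes> l)"
      using \<pi>.hom_mult[of l m] \<pi>.hom_mult[of m l] l mL Q.m_comm[of "K #> l" "K #> m"]
        \<pi>.hom_closed by simp
    then have "(l \<otimes> m) \<otimes> inv (m \<otimes> l) \<in> K" using rcoset_eq_iff[OF K] c by simp
    then have "(l \<otimes> m) \<otimes> inv (m \<otimes> l) \<otimes> m \<in> M" using M m subgroup.m_closed[OF M(1)] by blast
    moreover have "(l \<otimes> m) \<otimes> inv (m \<otimes> l) \<otimes> m = l \<otimes> m \<otimes> inv l"
      using c by (simp add: inv_mult_group m_assoc)
    ultimately show ?thesis by simp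
  qed
  then show ?thesis using M L by (simp add: normal_within_def)
qed

text \<open>The preimages of the subgroups generated by the first \<open>m\<close> elements of \<open>x\<close> form the chain.\<close>

lemma hirsch_ge_int_indep:
  assumes KL: "normal_within G K L" and comm: "comm_group (G\<lparr>carrier := L\<rparr> Mod K)"
    and w: "hirsch_ge G K w" and x: "int_indep (G\<lparr>carrier := L\<rparr> Mod K) n x"
  shows "hirsch_ge G L (w + n)"
proof -
  let ?Q = "G\<lparr>carrier := L\<rparr> Mod K"
  have K: "subgroup K G" and L: "subgroup L G" and sub: "K \<subseteq> L"
    using KL by (simp_all add: normal_within_def)
  interpret \<pi>: group_hom "G\<lparr>carrier := L\<rparr>" ?Q "(#>) K" by (rule normal_within_quotient_hom[OF KL])
  interpret Q: comm_group ?Q by (rule comm)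
  have xc: "x ` {..<m} \<subseteq> carrier ?Q" if "m \<le> n" for m using x that by (auto simp: int_indep_def)
  \<comment> \<open>The elements of \<open>L\<close> that are, modulo \<open>K\<close>, integral combinations of the first \<open>m\<close> elements
    of \<open>x\<close>.\<close>
  define M where "M m = {y \<in> L. K #> y \<in> range (int_comb ?Q m x)}" for m
  have MI: "a \<in> M m" if "a \<in> L" "K #> a = int_comb ?Q m x e" for a m e
    unfolding M_def mem_Collect_eq using that(1) by (intro conjI) (assumption, subst that(2), rule rangeI)
  have Msub: "subgroup (M m) G" if "m \<le> n" for m
  proof -
    have B: "subgroup (range (int_comb ?Q m x)) ?Q" by (rule Q.range_int_comb_subgroup[OF xc[OF that]])
    have "subgroup (M m) (G\<lparr>carrier := L\<rparr>)"
    proof (rule \<pi>.G.subgroupI)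
      show "M m \<noteq> {}"
        using subgroup.one_closed[OF B] \<pi>.hom_one subgroup.one_closed[OF L] unfolding M_def by fastforce
      show "inv\<^bsub>G\<lparr>carrier := L\<rparr>\<^esub> a \<in> M m" if "a \<in> M m" for a
        using that subgroup.m_inv_closed[OF B] \<pi>.hom_inv[of a] \<pi>.G.inv_closed[of a] by (auto simp: M_def)
      show "a \<otimes>\<^bsub>G\<lparr>carrier := L\<rparr>\<^esub> b \<in> M m" if "a \<in> M m" "b \<in> M m" for a b
        using that subgroup.m_closed[OF B] \<pi>.hom_mult[of a b] subgroup.m_closed[OF L]
        unfolding M_def by simp
    qed (auto simp: M_def)
    then show ?thesis using incl_subgroup[OF L] by blast
  qed
  have MleL: "M m \<subseteq> L" for m unfolding M_def by (rule Collect_restrict)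
  have KM: "K \<subseteq> M m" if "m \<le> n" for m
  proof
    fix k assume k: "k \<in> K"
    have kc: "k \<in> carrier G" using subgroup.mem_carrier[OF K k] .
    have "K #> k = \<one>\<^bsub>?Q\<^esub>" using coset_join2[OF kc K k] by simp
    moreover have "int_comb ?Q m x (\<lambda>_. 0) = \<one>\<^bsub>?Q\<^esub>"
      by (rule Q.int_comb_zero[OF xc[OF that]]) (rule refl)
    ultimately have Kk: "K #> k = int_comb ?Q m x (\<lambda>_. 0)" by (simp only:)
    have kL: "k \<in> L" using k sub by (rule rev_subsetD)
    show "k \<in> M m" by (rule MI[OF kL Kk])
  qed
  have "hirsch_ge G (M m) (w + m)" if "m \<le> n" for m
    using that
  proof (induction m)
    case 0
    show ?case using hirsch_ge.mono[OF w KM[of 0] Msub[of 0]] by simp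
  next
    case (Suc m)
    have mn: "m < n" using Suc by simp
    have "x m \<in> carrier ?Q" using xc[of n] mn by auto
    then obtain y where y: "y \<in> L" "x m = K #> y"
      unfolding carrier_FactGroup carrier_upd_r_coset by auto
    have "normal_within G (M m) L"
      using normal_within_between[OF KL comm Msub[of m] KM[of m] MleL] mn by simp
    moreover have "M m \<subseteq> M (Suc m)"
    proof
      fix a assume a: "a \<in> M m"
      then obtain e where e: "a \<in> L" "K #> a = int_comb ?Q m x e" unfolding M_def by blast
      have "int_comb ?Q m x e = int_comb ?Q m x (e(m := 0))" by (rule Q.int_comb_cong) auto
      then have "int_comb ?Q (Suc m) x (e(m := 0)) = int_comb ?Q m x e"
        using Q.int_comb_closed[OF xc, of m e] mn by (simp del: one_FactGroup mult_FactGroup)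
      then show "a \<in> M (Suc m)" using e by (intro MI[OF e(1), of "Suc m" "e(m := 0)"]) (simp only:)
    qed
    ultimately have nw: "normal_within G (M m) (M (Suc m))"
      using Msub[of "Suc m"] Suc.prems MleL[of "Suc m"] unfolding normal_within_def by blast
    have "x m = int_comb ?Q (Suc m) x (\<lambda>i. of_bool (i = m))"
      using Q.int_comb_single[OF xc, of "Suc m" m] mn by simp
    then have yM: "y \<in> M (Suc m)" using y(2) by (intro MI[OF y(1), of "Suc m" "\<lambda>i. of_bool (i = m)"]) (simp only:)
    have "y [^] k \<notin> M m" if k: "0 < k" for k :: nat
    proof
      assume "y [^] k \<in> M m"
      then obtain e where e: "K #> (y [^] k) = int_comb ?Q m x e" unfolding M_def by blast
      then have xk: "x m [^]\<^bsub>?Q\<^esub> k = int_comb ?Q m x e"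
        using \<pi>.hom_nat_pow[of y k] y by (simp add: carrier_upd_nat_pow)
      define f where "f i = (if i < m then e i else if i = m then - int k else 0)" for i
      have cl: "int_comb ?Q m x e \<in> carrier ?Q" using Q.int_comb_closed[OF xc] mn by simp
      have xm: "x m \<in> carrier ?Q" by fact
      have "int_comb ?Q (Suc m) x f = int_comb ?Q m x e \<otimes>\<^bsub>?Q\<^esub> x m [^]\<^bsub>?Q\<^esub> (- int k)"
        using Q.int_comb_cong[of m x x f e] by (simp add: f_def del: one_FactGroup mult_FactGroup)
      also have "\<dots> = \<one>\<^bsub>?Q\<^esub>"
        using xk cl xm by (simp add: \<pi>.H.int_pow_neg int_pow_int del: one_FactGroup mult_FactGroup)
      finally have 1: "int_comb ?Q (Suc m) x f = \<one>\<^bsub>?Q\<^esub>" .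
      have "int_comb ?Q (Suc m + d) x f = \<one>\<^bsub>?Q\<^esub>" if "Suc m + d \<le> n" for d
        using that
      proof (induction d)
        case 0
        then show ?case using 1 by simp
      next
        case (Suc d)
        have "x (Suc m + d) \<in> carrier ?Q" using xc[of n] Suc.prems by auto
        with Suc show ?case by (simp add: f_def del: one_FactGroup mult_FactGroup)
      qed
      from this[of "n - Suc m"] have "int_comb ?Q n x f = \<one>\<^bsub>?Q\<^esub>" using mn by simp
      then have "f m = 0" using x mn unfolding int_indep_def by blast
      with k show False by (simp add: f_def)
    qed
    then have "hirsch_ge G (M (Suc m)) (Suc (w + m))"
      using hirsch_ge.step[OF _ nw yM] Suc by simp
    then show ?case by simp
  qed
  then have "hirsch_ge G (M n) (w + n)" by blast
  then show ?thesis
  proof (rule hirsch_ge.mono)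
    show "M n \<subseteq> L" by (rule MleL)
  qed (rule L)
qed

text \<open>Coordinates on the rational space of \<open>L / K\<close>, as functions on \<open>L\<close>. The last conclusion
  says that the dimension \<open>n\<close> adds to every lower bound for \<open>K\<close>.\<close>

lemma ex_rational_coordinates_mod:
  assumes KL: "normal_within G K L" and comm: "comm_group (G\<lparr>carrier := L\<rparr> Mod K)"
    and w: "hirsch_ge G K w" and bound: "\<And>v. hirsch_ge G L v \<Longrightarrow> v \<le> r"
  obtains n x c where
    "\<And>i. i < n \<Longrightarrow> x i \<in> L"
    "\<And>a b i. a \<in> L \<Longrightarrow> b \<in> L \<Longrightarrow> i < n \<Longrightarrow> c (a \<otimes> b) i = (c a i + c b i :: rat)"
    "\<And>i j. i < n \<Longrightarrow> j < n \<Longrightarrow> c (x i) j = of_bool (i = j)"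
    "\<And>a. a \<in> L \<Longrightarrow> (\<forall>i<n. c a i = 0) \<longleftrightarrow> (\<exists>k::nat. 0 < k \<and> a [^] k \<in> K)"
    "hirsch_ge G L (w + n)"
proof -
  let ?Q = "G\<lparr>carrier := L\<rparr> Mod K"
  have K: "subgroup K G" and L: "subgroup L G" and sub: "K \<subseteq> L"
    using KL by (simp_all add: normal_within_def)
  interpret \<pi>: group_hom "G\<lparr>carrier := L\<rparr>" ?Q "(#>) K" by (rule normal_within_quotient_hom[OF KL])
  interpret Q: comm_group ?Q by (rule comm)
  have bd: "n \<le> r" if "int_indep ?Q n x" for n x
    using bound[OF hirsch_ge_int_indep[OF KL comm w that]] by simp
  show thesis
  proof (rule Q.ex_rational_coordinates[of r, OF bd])
    fix n :: nat and x :: "nat \<Rightarrow> 'a set" and c :: "'a set \<Rightarrow> nat \<Rightarrow> rat"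
    assume
    x: "int_indep ?Q n x" and
    add: "\<And>a b i. a \<in> carrier ?Q \<Longrightarrow> b \<in> carrier ?Q \<Longrightarrow> i < n \<Longrightarrow> c (a \<otimes>\<^bsub>?Q\<^esub> b) i = (c a i + c b i :: rat)" and
    cx: "\<And>i j. i < n \<Longrightarrow> j < n \<Longrightarrow> c (x i) j = of_bool (i = j)" and
    c0: "\<And>a. a \<in> carrier ?Q \<Longrightarrow> (\<forall>i<n. c a i = 0) \<longleftrightarrow> (\<exists>k::nat. 0 < k \<and> a [^]\<^bsub>?Q\<^esub> k = \<one>\<^bsub>?Q\<^esub>)"
    have "\<exists>y. y \<in> L \<and> x i = K #> y" if "i < n" for i
    proof -
      have "x i \<in> carrier ?Q" using x that unfolding int_indep_def by blast
      then show ?thesis unfolding carrier_FactGroup carrier_upd_r_coset by auto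
    qed
    then have "\<exists>y. \<forall>i. i < n \<longrightarrow> y i \<in> L \<and> x i = K #> y i" by (intro choice) blast
    then obtain y where y: "\<And>i. i < n \<Longrightarrow> y i \<in> L \<and> x i = K #> y i" by blast
    show thesis
    proof (rule that[of n y "\<lambda>a. c (K #> a)"])
      fix a b i assume "a \<in> L" "b \<in> L" "i < n"
      then show "c (K #> (a \<otimes> b)) i = c (K #> a) i + c (K #> b) i"
        using add[of "K #> a" "K #> b" i] \<pi>.hom_closed \<pi>.hom_mult[of a b] by simp
    next
      fix a assume a: "a \<in> L"
      have "K #> a [^] k = \<one>\<^bsub>?Q\<^esub> \<longleftrightarrow> a [^] k \<in> K" for k :: nat
      proof -
        have ac: "a [^] k \<in> carrier G" using a L subgroup.mem_carrier by fast
        show ?thesis using rcoset_eq_iff[OF K ac one_closed] coset_mult_one[of K] subgroup.subset[OF K] ac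
          by simp
      qed
      then show "(\<forall>i<n. c (K #> a) i = 0) \<longleftrightarrow> (\<exists>k::nat. 0 < k \<and> a [^] k \<in> K)"
        using c0[of "K #> a"] \<pi>.hom_closed[of a] a \<pi>.hom_nat_pow[of a] by (simp add: carrier_upd_nat_pow)
    next
      fix i assume "i < n"
      then show "y i \<in> L" using y by blast
    next
      fix i j assume "i < n" "j < n"
      then show "c (K #> y i) j = of_bool (i = j)" using y[of i] cx[of i j] by simp
    next
      show "hirsch_ge G L (w + n)" by (rule hirsch_ge_int_indep[OF KL comm w x])
    qed
  qed
qed

end

section \<open>The dimension of the rationalization\<close>

lemma ex_common_denominator: "\<exists>D::nat. 0 < D \<and> (\<forall>d. D dvd d \<longrightarrow> (\<exists>k::int. of_nat d * (q::rat) = of_int k))"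
proof -
  obtain a b where q: "q = Rat.Fract a b" "0 < b" by (rule Rat_cases[of q])
  have qd: "of_int b * q = of_int a" using q by (simp add: Fract_of_int_quotient)
  have "\<exists>k::int. of_nat d * q = of_int k" if dv: "nat b dvd d" for d
  proof -
    from dv obtain c where c: "d = nat b * c" by (rule dvdE)
    have "of_nat d * q = of_nat c * (of_int b * q)" using q(2) by (simp add: c of_nat_nat)
    also have "\<dots> = of_int (int c * a)" by (simp add: qd)
    finally show ?thesis by (rule exI)
  qed
  moreover have "0 < nat b" using q(2) by simp
  ultimately show ?thesis by blast
qed

context comm_group begin

lemma tensor_free_comm: "comm_group (tensor_free G)"
  by (simp add: tensor_free_def abelian_free_Abelian_group)

lemma carrier_tensor_free: "x \<in> carrier (tensor_free G) \<longleftrightarrow> Poly_Mapping.keys x \<subseteq> UNIV \<times> carrier G"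
  by (simp add: tensor_free_def)

lemma mult_tensor_free [simp]: "x \<otimes>\<^bsub>tensor_free G\<^esub> y = x + y"
  by (simp add: tensor_free_def)

lemma one_tensor_free [simp]: "\<one>\<^bsub>tensor_free G\<^esub> = 0"
  by (simp add: tensor_free_def)

lemma tensor_gen_subset:
  "{frag_of (p + q, a) - frag_of (p, a) - frag_of (q, a) | (p::rat) q a. a \<in> carrier G} \<union>
      {frag_of (q, a \<otimes> b) - frag_of (q, a) - frag_of (q, b) | (q::rat) a b.
         a \<in> carrier G \<and> b \<in> carrier G} \<subseteq> carrier (tensor_free G)" (is "?A \<subseteq> _")
proof -
  have of: "frag_of (q, a) \<in> carrier (tensor_free G)" if "a \<in> carrier G" for q a
    using that by (simp add: carrier_tensor_free)
  have diff: "x - y \<in> carrier (tensor_free G)" if "x \<in> carrier (tensor_free G)" "y \<in> carrier (tensor_free G)" for x y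
    using that keys_diff[of x y] unfolding carrier_tensor_free by blast
  show ?thesis by (auto intro!: diff of)
qed

lemma tensor_rels_subgroup: "subgroup (tensor_rels G) (tensor_free G)"
  unfolding tensor_rels_def
  by (rule group.generate_is_subgroup[OF comm_group.axioms(2)[OF tensor_free_comm] tensor_gen_subset])

text \<open>The action of a rational scalar on the free group of symbols, before passing to the
  quotient.\<close>

definition scale :: "rat \<Rightarrow> (rat \<times> 'a \<Rightarrow>\<^sub>0 int) \<Rightarrow> (rat \<times> 'a \<Rightarrow>\<^sub>0 int)" where
  "scale q = frag_extend (\<lambda>(p, a). frag_of (q * p, a))"

lemma scale_hom: "scale q (x + y) = scale q x + scale q y" "scale q (- x) = - scale q x" "scale q 0 = 0"
  "scale q (x - y) = scale q x - scale q y"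
  by (simp_all add: scale_def frag_extend_add frag_extend_minus frag_extend_diff)

lemma scale_of [simp]: "scale q (frag_of (p, a)) = frag_of (q * p, a)"
  by (simp add: scale_def)

lemma tensor_free_diff_closed:
  "x \<in> carrier (tensor_free G) \<Longrightarrow> y \<in> carrier (tensor_free G) \<Longrightarrow> x - y \<in> carrier (tensor_free G)"
  unfolding carrier_tensor_free using keys_diff[of x y] by blast

lemma tensor_free_induct [consumes 1, case_names zero one diff]:
  assumes "x \<in> carrier (tensor_free G)" "P 0" "\<And>q a. a \<in> carrier G \<Longrightarrow> P (frag_of (q, a))"
    "\<And>x y. P x \<Longrightarrow> P y \<Longrightarrow> P (x - y)"
  shows "P x"
  using assms(1) unfolding carrier_tensor_free
  by (induction rule: frag_induction) (use assms(2-) in auto)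

lemma frag_of_in_tensor_free: "a \<in> carrier G \<Longrightarrow> frag_of (q, a) \<in> carrier (tensor_free G)"
  by (simp add: carrier_tensor_free)

lemma zero_in_tensor_free: "0 \<in> carrier (tensor_free G)"
  by (simp add: carrier_tensor_free)

lemma scale_closed: "x \<in> carrier (tensor_free G) \<Longrightarrow> scale q x \<in> carrier (tensor_free G)"
proof (induction rule: tensor_free_induct)
  case (diff x y)
  then show ?case by (simp add: scale_hom tensor_free_diff_closed)
qed (simp_all add: scale_hom frag_of_in_tensor_free zero_in_tensor_free)

lemma inv_tensor_free: "x \<in> carrier (tensor_free G) \<Longrightarrow> inv\<^bsub>tensor_free G\<^esub> x = - x"
  by (simp add: tensor_free_def)

lemma tensor_rels_closed:
  "0 \<in> tensor_rels G"
  "x \<in> tensor_rels G \<Longrightarrow> y \<in> tensor_rels G \<Longrightarrow> x + y \<in> tensor_rels G"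
  "x \<in> tensor_rels G \<Longrightarrow> - x \<in> tensor_rels G"
  "x \<in> tensor_rels G \<Longrightarrow> y \<in> tensor_rels G \<Longrightarrow> x - y \<in> tensor_rels G"
  "x \<in> tensor_rels G \<Longrightarrow> x \<in> carrier (tensor_free G)"
proof -
  note R = tensor_rels_subgroup
  show 0: "0 \<in> tensor_rels G" using subgroup.one_closed[OF R] by simp
  show c: "x \<in> carrier (tensor_free G)" if "x \<in> tensor_rels G" for x using subgroup.mem_carrier[OF R that] .
  show add: "x + y \<in> tensor_rels G" if "x \<in> tensor_rels G" "y \<in> tensor_rels G" for x y
    using subgroup.m_closed[OF R that] by simp
  show neg: "- x \<in> tensor_rels G" if "x \<in> tensor_rels G" for x
    using subgroup.m_inv_closed[OF R that] inv_tensor_free[OF c[OF that]] by simp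
  show "x - y \<in> tensor_rels G" if "x \<in> tensor_rels G" "y \<in> tensor_rels G" for x y
    using add[OF that(1) neg[OF that(2)]] by simp
qed

lemma tensor_rels_gen:
  "a \<in> carrier G \<Longrightarrow> frag_of (p + q, a) - frag_of (p, a) - frag_of (q, a) \<in> tensor_rels G"
  "a \<in> carrier G \<Longrightarrow> b \<in> carrier G \<Longrightarrow> frag_of (q, a \<otimes> b) - frag_of (q, a) - frag_of (q, b) \<in> tensor_rels G"
  unfolding tensor_rels_def by (rule generate.incl; blast)+

lemma tensor_rels_induct [consumes 1, case_names zero gen1 gen2 neg add]:
  assumes "x \<in> tensor_rels G" "P 0"
    "\<And>p q a. a \<in> carrier G \<Longrightarrow> P (frag_of (p + q, a) - frag_of (p, a) - frag_of (q, a))"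
    "\<And>q a b. a \<in> carrier G \<Longrightarrow> b \<in> carrier G \<Longrightarrow> P (frag_of (q, a \<otimes> b) - frag_of (q, a) - frag_of (q, b))"
    "\<And>x. x \<in> tensor_rels G \<Longrightarrow> P x \<Longrightarrow> P (- x)"
    "\<And>x y. x \<in> tensor_rels G \<Longrightarrow> y \<in> tensor_rels G \<Longrightarrow> P x \<Longrightarrow> P y \<Longrightarrow> P (x + y)"
  shows "P x"
  using assms(1) unfolding tensor_rels_def
proof (induction rule: generate.induct)
  case one
  then show ?case using assms(2) by simp
next
  case (incl h)
  then show ?case using assms(3,4) by auto
next
  case (inv h)
  then have h: "h \<in> tensor_rels G" unfolding tensor_rels_def by (rule generate.incl)
  have "P h" using inv assms(3,4) by auto
  then have "P (- h)" using assms(5)[OF h] by blast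
  then show ?case using inv_tensor_free tensor_rels_closed(5)[OF h] by simp
next
  case (eng h1 h2)
  then show ?case using assms(6)[of h1 h2] unfolding tensor_rels_def by simp
qed

lemma scale_tensor_rels: "x \<in> tensor_rels G \<Longrightarrow> scale q x \<in> tensor_rels G"
proof (induction rule: tensor_rels_induct)
  case (gen1 p r a)
  then show ?case using tensor_rels_gen(1)[of a "q * p" "q * r"] by (simp add: scale_hom distrib_left)
next
  case (gen2 r a b)
  then show ?case using tensor_rels_gen(2)[of a b "q * r"] by (simp add: scale_hom)
qed (simp_all add: scale_hom tensor_rels_closed)

lemma scale_add_rat:
  "x \<in> carrier (tensor_free G) \<Longrightarrow> scale (p + q) x - (scale p x + scale q x) \<in> tensor_rels G"
proof (induction rule: tensor_free_induct)
  case (one r a)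
  then show ?case using tensor_rels_gen(1)[of a "p * r" "q * r"]
    by (simp add: distrib_right algebra_simps)
next
  case (diff x y)
  from tensor_rels_closed(4)[OF diff] show ?case by (simp add: scale_hom algebra_simps)
qed (simp_all add: scale_hom tensor_rels_closed)

lemma scale_assoc: "x \<in> carrier (tensor_free G) \<Longrightarrow> scale (p * q) x = scale p (scale q x)"
  by (induction rule: tensor_free_induct) (simp_all add: scale_hom mult.assoc)

lemma scale_one: "x \<in> carrier (tensor_free G) \<Longrightarrow> scale 1 x = x"
  by (induction rule: tensor_free_induct) (simp_all add: scale_hom)

definition tensor_class :: "(rat \<times> 'a \<Rightarrow>\<^sub>0 int) \<Rightarrow> (rat \<times> 'a \<Rightarrow>\<^sub>0 int) set" where
  "tensor_class x = tensor_rels G #>\<^bsub>tensor_free G\<^esub> x"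

lemma tensor_class_eq: "tensor_class x = {r + x | r. r \<in> tensor_rels G}"
  by (auto simp: tensor_class_def r_coset_def)

lemma tensor_class_eq_iff:
  "tensor_class x = tensor_class y \<longleftrightarrow> x - y \<in> tensor_rels G"
proof
  assume "tensor_class x = tensor_class y"
  moreover have "x \<in> tensor_class x" unfolding tensor_class_eq using tensor_rels_closed(1) by force
  ultimately obtain r where "r \<in> tensor_rels G" "x = r + y" unfolding tensor_class_eq by blast
  then show "x - y \<in> tensor_rels G" by simp
next
  assume *: "x - y \<in> tensor_rels G"
  have 1: "r + x = (r + (x - y)) + y" "r + y = (r - (x - y)) + x" for r by simp_all
  show "tensor_class x = tensor_class y"
    unfolding tensor_class_eq
    using * tensor_rels_closed(2,4) 1 by (intro equalityI subsetI; (elim CollectE exE conjE)) (metis (mono_tags, lifting) mem_Collect_eq)+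
qed

lemma carrier_rat_tensor: "carrier (rat_tensor G) = tensor_class ` carrier (tensor_free G)"
  by (auto simp: rat_tensor_def carrier_FactGroup tensor_class_def)

lemma zero_rat_tensor: "\<zero>\<^bsub>rat_tensor G\<^esub> = tensor_class 0"
  by (auto simp: rat_tensor_def tensor_class_eq)

lemma add_rat_tensor: "tensor_class x \<oplus>\<^bsub>rat_tensor G\<^esub> tensor_class y = tensor_class (x + y)"
proof -
  have "tensor_class x \<oplus>\<^bsub>rat_tensor G\<^esub> tensor_class y = {(r + x) + (s + y) | r s. r \<in> tensor_rels G \<and> s \<in> tensor_rels G}"
    unfolding rat_tensor_def tensor_class_eq by (auto simp: set_mult_def)
  also have "\<dots> = tensor_class (x + y)"
  proof (intro equalityI subsetI)
    fix z assume "z \<in> {(r + x) + (s + y) | r s. r \<in> tensor_rels G \<and> s \<in> tensor_rels G}"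
    then obtain r s where "r \<in> tensor_rels G" "s \<in> tensor_rels G" "z = (r + s) + (x + y)"
      by (auto simp: algebra_simps)
    then show "z \<in> tensor_class (x + y)" unfolding tensor_class_eq using tensor_rels_closed(2) by blast
  next
    fix z assume "z \<in> tensor_class (x + y)"
    then obtain r where "r \<in> tensor_rels G" "z = (r + x) + (0 + y)"
      unfolding tensor_class_eq by (auto simp: algebra_simps)
    then show "z \<in> {(r + x) + (s + y) | r s. r \<in> tensor_rels G \<and> s \<in> tensor_rels G}"
      using tensor_rels_closed(1) by blast
  qed
  finally show ?thesis .
qed

lemma smult_rat_tensor: "q \<odot>\<^bsub>rat_tensor G\<^esub> tensor_class x = tensor_class (scale q x)"
proof -
  have "q \<odot>\<^bsub>rat_tensor G\<^esub> tensor_class x = {s + scale q (r + x) | r s. r \<in> tensor_rels G \<and> s \<in> tensor_rels G}"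
    unfolding rat_tensor_def tensor_class_eq scale_def[symmetric]
    by (auto simp: set_mult_def scale_def)
  also have "\<dots> = tensor_class (scale q x)"
  proof (intro equalityI subsetI)
    fix z assume "z \<in> {s + scale q (r + x) | r s. r \<in> tensor_rels G \<and> s \<in> tensor_rels G}"
    then obtain r s where "r \<in> tensor_rels G" "s \<in> tensor_rels G" "z = (s + scale q r) + scale q x"
      by (auto simp: scale_hom algebra_simps)
    then show "z \<in> tensor_class (scale q x)"
      unfolding tensor_class_eq using tensor_rels_closed(2) scale_tensor_rels by blast
  next
    fix z assume "z \<in> tensor_class (scale q x)"
    then obtain r where "r \<in> tensor_rels G" "z = r + scale q (0 + x)" unfolding tensor_class_eq by auto
    then show "z \<in> {s + scale q (r + x) | r s. r \<in> tensor_rels G \<and> s \<in> tensor_rels G}"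
      using tensor_rels_closed(1) by blast
  qed
  finally show ?thesis .
qed

lemma rat_tensor_abelian_group: "abelian_group (rat_tensor G)"
proof (rule abelian_groupI)
  fix x assume "x \<in> carrier (rat_tensor G)"
  then obtain a where a: "a \<in> carrier (tensor_free G)" "x = tensor_class a" unfolding carrier_rat_tensor by blast
  have "- a \<in> carrier (tensor_free G)" using tensor_free_diff_closed[OF zero_in_tensor_free a(1)] by simp
  then have "tensor_class (- a) \<in> carrier (rat_tensor G)" by (auto simp: carrier_rat_tensor)
  moreover have "tensor_class (- a) \<oplus>\<^bsub>rat_tensor G\<^esub> x = \<zero>\<^bsub>rat_tensor G\<^esub>"
    by (simp add: a add_rat_tensor zero_rat_tensor)
  ultimately show "\<exists>y\<in>carrier (rat_tensor G). y \<oplus>\<^bsub>rat_tensor G\<^esub> x = \<zero>\<^bsub>rat_tensor G\<^esub>" by blast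
next
  fix x y assume "x \<in> carrier (rat_tensor G)" "y \<in> carrier (rat_tensor G)"
  then obtain a b where a: "a \<in> carrier (tensor_free G)" "x = tensor_class a" "b \<in> carrier (tensor_free G)" "y = tensor_class b"
    unfolding carrier_rat_tensor by blast
  have "a + b \<in> carrier (tensor_free G)" using a keys_add[of a b] unfolding carrier_tensor_free by blast
  then show "x \<oplus>\<^bsub>rat_tensor G\<^esub> y \<in> carrier (rat_tensor G)" by (simp add: a add_rat_tensor carrier_rat_tensor)
  show "x \<oplus>\<^bsub>rat_tensor G\<^esub> y = y \<oplus>\<^bsub>rat_tensor G\<^esub> x" by (simp add: a add_rat_tensor add.commute)
qed (auto simp: carrier_rat_tensor add_rat_tensor zero_rat_tensor zero_in_tensor_free add.assoc)

lemma rat_tensor_vectorspace: "vectorspace class_ring (rat_tensor G)"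
proof -
  have f: "field (class_ring :: rat ring)" by (rule class_field)
  have ax: "module_axioms (class_ring :: rat ring) (rat_tensor G)"
  proof
    fix p q :: rat and x assume "x \<in> carrier (rat_tensor G)"
    then obtain a where a: "a \<in> carrier (tensor_free G)" "x = tensor_class a" unfolding carrier_rat_tensor by blast
    show "p \<odot>\<^bsub>rat_tensor G\<^esub> x \<in> carrier (rat_tensor G)"
      using scale_closed[OF a(1)] by (simp add: a smult_rat_tensor carrier_rat_tensor)
    show "(p \<oplus>\<^bsub>class_ring\<^esub> q) \<odot>\<^bsub>rat_tensor G\<^esub> x = p \<odot>\<^bsub>rat_tensor G\<^esub> x \<oplus>\<^bsub>rat_tensor G\<^esub> q \<odot>\<^bsub>rat_tensor G\<^esub> x"
      using scale_add_rat[OF a(1)] by (simp add: a smult_rat_tensor add_rat_tensor tensor_class_eq_iff)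
    show "(p \<otimes>\<^bsub>class_ring\<^esub> q) \<odot>\<^bsub>rat_tensor G\<^esub> x = p \<odot>\<^bsub>rat_tensor G\<^esub> (q \<odot>\<^bsub>rat_tensor G\<^esub> x)"
      using scale_assoc[OF a(1)] by (simp add: a smult_rat_tensor)
    show "\<one>\<^bsub>class_ring\<^esub> \<odot>\<^bsub>rat_tensor G\<^esub> x = x"
      using scale_one[OF a(1)] by (simp add: a smult_rat_tensor)
    fix y assume "y \<in> carrier (rat_tensor G)"
    then obtain b where b: "b \<in> carrier (tensor_free G)" "y = tensor_class b" unfolding carrier_rat_tensor by blast
    show "p \<odot>\<^bsub>rat_tensor G\<^esub> (x \<oplus>\<^bsub>rat_tensor G\<^esub> y) = p \<odot>\<^bsub>rat_tensor G\<^esub> x \<oplus>\<^bsub>rat_tensor G\<^esub> p \<odot>\<^bsub>rat_tensor G\<^esub> y"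
      by (simp add: a b smult_rat_tensor add_rat_tensor scale_hom)
  qed
  have "Module.module (class_ring :: rat ring) (rat_tensor G)"
    unfolding Module.module_def using class_cring.cring_axioms rat_tensor_abelian_group ax by blast
  then show ?thesis using f by (simp add: vectorspace_def)
qed

text \<open>The map that sends \<open>(q, a)\<close> to the power of \<open>a\<close> with exponent \<open>d q\<close> is only meaningful
  when \<open>d q\<close> is an integer; rounding makes it a total homomorphism on the free group. It detects
  relations: it does not respect all defining relations of the tensor product, but each single
  relation is respected as soon as \<open>d\<close> is divisible enough (\<open>tensor_rels_cleared\<close>).\<close>

lemma ex_clear_denominators_hom:
  "\<exists>\<Phi>. \<Phi> \<in> hom (tensor_free G) G \<and> (\<forall>q. \<forall>a\<in>carrier G. \<Phi> (frag_of (q, a)) = a [^] \<lfloor>of_nat d * (q::rat)\<rfloor>)"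
proof -
  have "(\<lambda>(q, a). a [^] \<lfloor>of_nat d * (q::rat)\<rfloor>) ` (UNIV \<times> carrier G) \<subseteq> carrier G" by auto
  then obtain h where "h \<in> hom (free_Abelian_group (UNIV \<times> carrier G)) G"
    "\<And>x. x \<in> UNIV \<times> carrier G \<Longrightarrow> h (frag_of x) = (\<lambda>(q, a). a [^] \<lfloor>of_nat d * (q::rat)\<rfloor>) x"
    using free_Abelian_group_universal[of "\<lambda>(q, a). a [^] \<lfloor>of_nat d * (q::rat)\<rfloor>" "UNIV \<times> carrier G"] by metis
  then show ?thesis unfolding tensor_free_def by (intro exI[of _ h]) auto
qed

lemma mult_cancel_both: "a \<in> carrier G \<Longrightarrow> b \<in> carrier G \<Longrightarrow> a \<otimes> b \<otimes> inv a \<otimes> inv b = \<one>"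
  by (simp add: m_comm[of a b] m_assoc)

lemma mult_cancel_both': "a \<in> carrier G \<Longrightarrow> b \<in> carrier G \<Longrightarrow> inv b \<otimes> (inv a \<otimes> (a \<otimes> b)) = \<one>"
  by (simp add: m_assoc[symmetric])

lemma tensor_rels_cleared:
  assumes \<Phi>: "\<And>d. \<Phi> d \<in> hom (tensor_free G) G"
    "\<And>d q a. a \<in> carrier G \<Longrightarrow> \<Phi> d (frag_of (q, a)) = a [^] \<lfloor>of_nat d * (q::rat)\<rfloor>"
  shows "x \<in> tensor_rels G \<Longrightarrow> \<exists>D::nat. 0 < D \<and> (\<forall>d. D dvd d \<longrightarrow> \<Phi> d x = \<one>)"
proof (induction rule: tensor_rels_induct)
  have F: "group (tensor_free G)" using tensor_free_comm comm_group.axioms(2) by blast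
  interpret H: group_hom "tensor_free G" G "\<Phi> d" for d
    using F \<Phi>(1) is_group by (simp add: group_hom_def group_hom_axioms_def)
  have add_hom: "\<Phi> d (x + y) = \<Phi> d x \<otimes> \<Phi> d y" if "x \<in> carrier (tensor_free G)" "y \<in> carrier (tensor_free G)" for x y d
    using H.hom_mult[OF that] by simp
  have inv_hom: "\<Phi> d (- x) = inv (\<Phi> d x)" if "x \<in> carrier (tensor_free G)" for x d
    using H.hom_inv[OF that] inv_tensor_free[OF that] by simp
  have closed: "\<Phi> d x \<in> carrier G" if "x \<in> carrier (tensor_free G)" for x d using H.hom_closed[OF that] .
  have negc: "- x \<in> carrier (tensor_free G)" if "x \<in> carrier (tensor_free G)" for x
    using tensor_free_diff_closed[OF zero_in_tensor_free that] by simp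
  have diff: "\<Phi> d (x - y) = \<Phi> d x \<otimes> inv (\<Phi> d y)" if "x \<in> carrier (tensor_free G)" "y \<in> carrier (tensor_free G)" for x y d
    using add_hom[OF that(1) negc[OF that(2)], of d] inv_hom[OF that(2), of d] by simp
  {
    case zero
    have "\<Phi> d 0 = \<one>" for d using H.hom_one[of d] by simp
    then show ?case by (intro exI[of _ 1]) auto
  next
    case (gen1 p q a)
    obtain D where D: "0 < D" "\<And>d. D dvd d \<Longrightarrow> \<exists>k::int. of_nat d * p = of_int k" using ex_common_denominator by blast
    obtain E where E: "0 < E" "\<And>d. E dvd d \<Longrightarrow> \<exists>k::int. of_nat d * q = of_int k" using ex_common_denominator by blast
    have "\<Phi> d (frag_of (p + q, a) - frag_of (p, a) - frag_of (q, a)) = \<one>" if dv: "D * E dvd d" for d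
    proof -
      obtain k l :: int where kl: "of_nat d * p = of_int k" "of_nat d * q = of_int l"
        using D(2)[OF dvd_mult_left[OF dv]] E(2)[OF dvd_mult_right[OF dv]] by blast
      then have "of_nat d * (p + q) = of_int (k + l)" by (simp add: distrib_left)
      then have "\<lfloor>of_nat d * (p + q)\<rfloor> = k + l" "\<lfloor>of_nat d * p\<rfloor> = k" "\<lfloor>of_nat d * q\<rfloor> = l"
        using kl by (simp_all only: floor_of_int)
      then show ?thesis using gen1 mult_cancel_both'[of "a [^] k" "a [^] l"]
        by (simp add: diff tensor_free_diff_closed frag_of_in_tensor_free \<Phi>(2) int_pow_mult int_pow_closed m_assoc
            inv_mult_group[symmetric] m_comm)
    qed
    then show ?case using D(1) E(1) by (intro exI[of _ "D * E"]) auto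
  next
    case (gen2 q a b)
    have "\<Phi> d (frag_of (q, a \<otimes> b) - frag_of (q, a) - frag_of (q, b)) = \<one>" for d
      using gen2 by (simp add: diff tensor_free_diff_closed frag_of_in_tensor_free \<Phi>(2) int_pow_distrib mult_cancel_both mult_cancel_both')
    then show ?case by (intro exI[of _ 1]) auto
  next
    case (neg x)
    obtain D where D: "0 < D" "\<forall>d. D dvd d \<longrightarrow> \<Phi> d x = \<one>" using neg(2) by blast
    then show ?case using inv_hom[OF tensor_rels_closed(5)[OF neg(1)]] by (intro exI[of _ D]) simp
  next
    case (add x y)
    then obtain D E where "0 < D" "\<forall>d. D dvd d \<longrightarrow> \<Phi> d x = \<one>" "0 < E" "\<forall>d. E dvd d \<longrightarrow> \<Phi> d y = \<one>" by blast
    moreover have "\<Phi> d (x + y) = \<Phi> d x \<otimes> \<Phi> d y" for d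
      using H.hom_mult[OF tensor_rels_closed(5)[OF add(1)] tensor_rels_closed(5)[OF add(2)], of d] by simp
    ultimately show ?case by (intro exI[of _ "D * E"]) (auto dest: dvd_mult_left dvd_mult_right)
  }
qed

text \<open>A linear relation between the vectors \<open>1 \<otimes> x i\<close> is an element of the relation subgroup.
  Clearing its denominators turns it into a relation between the \<open>x i\<close> in the group, whose
  exponents vanish by independence.\<close>

lemma int_indep_le_rat_dim:
  assumes x: "int_indep G n x"
  shows "enat n \<le> rat_dim (rat_tensor G)"
proof -
  interpret V: vectorspace "class_ring :: rat ring" "rat_tensor G" by (rule rat_tensor_vectorspace)
  have xc: "x ` {..<n} \<subseteq> carrier G" using x by (simp add: int_indep_def)
  have xi: "x i \<in> carrier G" if "i < n" for i using xc that by auto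
  obtain \<Phi> where \<Phi>: "\<And>d. \<Phi> d \<in> hom (tensor_free G) G"
    "\<And>d q a. a \<in> carrier G \<Longrightarrow> \<Phi> d (frag_of (q, a)) = a [^] \<lfloor>of_nat d * (q::rat)\<rfloor>"
    using ex_clear_denominators_hom by metis
  have F: "group (tensor_free G)" using tensor_free_comm comm_group.axioms(2) by blast
  interpret H: group_hom "tensor_free G" G "\<Phi> d" for d
    using F \<Phi>(1) is_group by (simp add: group_hom_def group_hom_axioms_def)
  define v where "v i = tensor_class (frag_of (1, x i))" for i
  have vc: "v i \<in> carrier (rat_tensor G)" if "i < n" for i
    using xi[OF that] by (auto simp: v_def carrier_rat_tensor frag_of_in_tensor_free)
  have sumc: "(\<Sum>i<m. frag_of (q i, x i)) \<in> carrier (tensor_free G)" if "m \<le> n" for m q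
    using that
  proof (induction m)
    case (Suc m)
    then show ?case using H.G.m_closed[OF Suc.IH frag_of_in_tensor_free[OF xi[of m], of "q m"]] by simp
  qed (simp add: zero_in_tensor_free)
  have key: "q i = 0" if q: "(\<Sum>i<n. frag_of (q i, x i)) \<in> tensor_rels G" and i: "i < n" for q i
  proof -
    obtain D where D: "0 < D" "\<And>d. D dvd d \<Longrightarrow> \<Phi> d (\<Sum>i<n. frag_of (q i, x i)) = \<one>"
      using tensor_rels_cleared[OF \<Phi> q] by blast
    have im: "\<Phi> d (\<Sum>i<m. frag_of (q i, x i)) = int_comb G m x (\<lambda>i. \<lfloor>of_nat d * q i\<rfloor>)" if "m \<le> n" for m d
      using that
    proof (induction m)
      case 0
      then show ?case using H.hom_one[of d] by simp
    next
      case (Suc m)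
      then show ?case
        using H.hom_mult[OF sumc[of m q] frag_of_in_tensor_free[OF xi[of m], of "q m"], of d] \<Phi>(2)[OF xi[of m]]
        by simp
    qed
    have fl: "\<lfloor>of_nat d * q i\<rfloor> = 0" if "D dvd d" for d
      using x im[of n d] D(2)[OF that] i unfolding int_indep_def by (metis order_refl)
    obtain E where E: "0 < E" "\<And>d. E dvd d \<Longrightarrow> \<exists>k::int. of_nat d * q i = of_int k"
      using ex_common_denominator by blast
    obtain k :: int where k: "of_nat (D * E) * q i = of_int k" using E(2)[of "D * E"] by auto
    then have "k = 0" using fl[of "D * E"] by simp
    then show "q i = 0" using k D(1) E(1) by simp
  qed
  have inj: "inj_on v {..<n}"
  proof (rule inj_onI, rule ccontr)
    fix i j assume ij: "i \<in> {..<n}" "j \<in> {..<n}" "v i = v j" "i \<noteq> j"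
    then have "frag_of (1, x i) - frag_of (1, x j) \<in> tensor_rels G"
      by (simp add: v_def tensor_class_eq_iff)
    then obtain D where D: "0 < D" "\<And>d. D dvd d \<Longrightarrow> \<Phi> d (frag_of (1, x i) - frag_of (1, x j)) = \<one>"
      using tensor_rels_cleared[OF \<Phi>] by blast
    have fi: "frag_of (1, x i) \<in> carrier (tensor_free G)" "frag_of (1, x j) \<in> carrier (tensor_free G)"
      using ij xi by (auto intro: frag_of_in_tensor_free)
    have "\<Phi> D (frag_of (1, x i) - frag_of (1, x j)) = x i [^] int D \<otimes> inv (x j [^] int D)"
      using H.hom_mult[OF fi(1) H.G.inv_closed[OF fi(2)], of D] H.hom_inv[OF fi(2), of D] inv_tensor_free[OF fi(2)]
        \<Phi>(2)[OF xi[of i], of D 1] \<Phi>(2)[OF xi[of j], of D 1] ij by simp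
    then have "x i [^] int D \<otimes> x j [^] (- int D) = \<one>"
      using D(2)[of D] ij xi by (simp add: int_pow_neg)
    then have "int_comb G n x (\<lambda>k. int D * of_bool (k = i) + (- int D) * of_bool (k = j)) = \<one>"
      using int_comb_add[OF xc, of "\<lambda>k. int D * of_bool (k = i)" "\<lambda>k. (- int D) * of_bool (k = j)"]
        int_comb_scale[OF xc, of "int D" "\<lambda>k. of_bool (k = i)"]
        int_comb_scale[OF xc, of "- int D" "\<lambda>k. of_bool (k = j)"]
        int_comb_single[OF xc, of i] int_comb_single[OF xc, of j] ij by simp
    then have "int D * of_bool (i = i) + (- int D) * of_bool (i = j) = 0"
      using x ij unfolding int_indep_def by blast
    then show False using D(1) ij by simp
  qed
  have fs: "finsum (rat_tensor G) (\<lambda>i. q i \<odot>\<^bsub>rat_tensor G\<^esub> v i) {..<m} = tensor_class (\<Sum>i<m. frag_of (q i, x i))"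
    if "m \<le> n" for m q
    using that
  proof (induction m)
    case 0
    then show ?case by (simp add: zero_rat_tensor)
  next
    case (Suc m)
    have cl: "(\<lambda>i. q i \<odot>\<^bsub>rat_tensor G\<^esub> v i) \<in> {..<m} \<rightarrow> carrier (rat_tensor G)"
      "q m \<odot>\<^bsub>rat_tensor G\<^esub> v m \<in> carrier (rat_tensor G)"
      using vc Suc.prems by (auto intro!: V.smult_closed)
    then show ?case using Suc
      by (simp add: lessThan_Suc V.M.finsum_insert[OF finite_lessThan] v_def smult_rat_tensor add_rat_tensor add.commute)
  qed
  have li: "V.module.lin_indpt (v ` {..<n})"
  proof (rule V.finite_lin_indpt2)
    fix a assume a: "V.module.lincomb a (v ` {..<n}) = \<zero>\<^bsub>rat_tensor G\<^esub>"
    have "V.module.lincomb a (v ` {..<n}) = finsum (rat_tensor G) (\<lambda>i. a (v i) \<odot>\<^bsub>rat_tensor G\<^esub> v i) {..<n}"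
      unfolding V.lincomb_def using vc inj
      by (subst V.M.finsum_reindex) (auto intro!: V.smult_closed)
    then have "tensor_class (\<Sum>i<n. frag_of (a (v i), x i)) = tensor_class 0"
      using a fs[of n "\<lambda>i. a (v i)"] zero_rat_tensor by simp
    then have "(\<Sum>i<n. frag_of (a (v i), x i)) \<in> tensor_rels G" unfolding tensor_class_eq_iff by simp
    from key[OF this] show "\<forall>w\<in>v ` {..<n}. a w = \<zero>\<^bsub>class_ring\<^esub>" by auto
  qed (use vc in auto)
  have "n \<le> vectorspace.dim (class_ring :: rat ring) (rat_tensor G)" if "V.fin_dim"
    using V.li_le_dim(2)[OF that _ li] vc card_image[OF inj] by auto
  then show ?thesis by (simp add: rat_dim_def)
qed

end

section \<open>Block triangular matrices and common eigenvectors\<close>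

text \<open>More unknowns than equations: the system is padded with zero rows to a square matrix,
  which is singular.\<close>

lemma ex_nontrivial_relation:
  fixes a :: "nat \<Rightarrow> nat \<Rightarrow> 'f::field"
  assumes "n < m"
  obtains c where "\<exists>i<m. c i \<noteq> 0" "\<And>r. r < n \<Longrightarrow> (\<Sum>i<m. c i * a r i) = 0"
proof -
  define A where "A = mat m m (\<lambda>(r, i). if r < n then a r i else 0)"
  have A: "A \<in> carrier_mat m m" by (simp add: A_def)
  have "transpose_mat A *\<^sub>v unit_vec m n = 0\<^sub>v m"
  proof (rule eq_vecI)
    fix i assume "i < dim_vec (0\<^sub>v m :: 'f vec)"
    then have i: "i < m" by simp
    have "(transpose_mat A *\<^sub>v unit_vec m n) $ i = col A i \<bullet> unit_vec m n" using i A by simp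
    also have "\<dots> = col A i $ n" using assms A by (intro scalar_prod_right_unit) auto
    finally show "(transpose_mat A *\<^sub>v unit_vec m n) $ i = 0\<^sub>v m $ i" using i assms by (simp add: A_def)
  qed (use A in simp)
  moreover have "unit_vec m n \<noteq> (0\<^sub>v m :: 'f vec)" using assms by (metis index_unit_vec(1) index_zero_vec(1) zero_neq_one)
  ultimately have "det (transpose_mat A) = 0"
    using det_0_iff_vec_prod_zero_field[of "transpose_mat A" m] A by (metis transpose_carrier_mat unit_vec_carrier)
  then have "det A = 0" using det_transpose[OF A] by simp
  then obtain v where v: "v \<in> carrier_vec m" "v \<noteq> 0\<^sub>v m" "A *\<^sub>v v = 0\<^sub>v m"
    using det_0_iff_vec_prod_zero_field[OF A] by auto
  show thesis
  proof (rule that[of "\<lambda>i. v $ i"])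
    show "\<exists>i<m. v $ i \<noteq> 0"
    proof (rule ccontr)
      assume "\<not> ?thesis"
      then have "v = 0\<^sub>v m" using v(1) by (intro eq_vecI) auto
      with v(2) show False ..
    qed
    fix r assume r: "r < n"
    have "0 = (A *\<^sub>v v) $ r" using v(3) r assms by simp
    also have "\<dots> = (\<Sum>i<m. A $$ (r, i) * v $ i)"
      using r assms A v(1) by (simp add: scalar_prod_def lessThan_atLeast0)
    also have "\<dots> = (\<Sum>i<m. v $ i * a r i)" using r assms by (intro sum.cong) (auto simp: A_def)
    finally show "(\<Sum>i<m. v $ i * a r i) = 0" by simp
  qed
qed

definition vec_subspace :: "nat \<Rightarrow> 'f::field vec set \<Rightarrow> bool" where
  "vec_subspace n W \<longleftrightarrow> W \<subseteq> carrier_vec n \<and> 0\<^sub>v n \<in> W \<and> (\<forall>v\<in>W. \<forall>w\<in>W. v + w \<in> W) \<and> (\<forall>c. \<forall>v\<in>W. c \<cdot>\<^sub>v v \<in> W)"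

lemma mat_vec_as_sum:
  assumes "(A :: 'f::field mat) \<in> carrier_mat n m" "v \<in> carrier_vec m" "i < n"
  shows "(A *\<^sub>v v) $ i = (\<Sum>j<m. A $$ (i, j) * v $ j)"
  using assms by (simp add: scalar_prod_def lessThan_atLeast0)

lemma mat_mult_as_sum:
  assumes "(A :: 'f::semiring_0 mat) \<in> carrier_mat n m" "B \<in> carrier_mat m l" "i < n" "j < l"
  shows "(A * B) $$ (i, j) = (\<Sum>k<m. A $$ (i, k) * B $$ (k, j))"
  using assms by (simp add: scalar_prod_def lessThan_atLeast0)

lemma vec_subspace_comb:
  fixes k :: nat
  assumes W: "vec_subspace n W" and v: "\<And>j. j < k \<Longrightarrow> v j \<in> W"
  shows "\<exists>w\<in>W. \<forall>i<n. w $ i = (\<Sum>j<k. v j $ i * c j)"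
  using v
proof (induction k)
  case 0
  then show ?case using W by (intro bexI[of _ "0\<^sub>v n"]) (auto simp: vec_subspace_def)
next
  case (Suc k)
  then obtain w where w: "w \<in> W" "\<forall>i<n. w $ i = (\<Sum>j<k. v j $ i * c j)" by auto
  have vk: "v k \<in> W" using Suc by simp
  have "w + c k \<cdot>\<^sub>v v k \<in> W" using W w vk unfolding vec_subspace_def by blast
  moreover have "w \<in> carrier_vec n" "v k \<in> carrier_vec n" using W w vk by (auto simp: vec_subspace_def)
  ultimately show ?case using w(2)
    by (intro bexI[of _ "w + c k \<cdot>\<^sub>v v k"]) auto
qed

text \<open>The columns of \<open>P\<close> extend a basis of \<open>W\<close>, which makes every matrix preserving \<open>W\<close> block
  triangular. The number \<open>k\<close> is the largest number of columns in \<open>W\<close> that an invertible matrix can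
  begin with; by Cramer's rule a vector of \<open>W\<close> with a nonzero later coordinate could replace a
  further column.\<close>

lemma ex_adapted_basis:
  fixes W :: "'f::field vec set"
  assumes W: "vec_subspace n W" and v0: "v0 \<in> W" "v0 \<noteq> 0\<^sub>v n" and w0: "w0 \<in> carrier_vec n" "w0 \<notin> W"
  obtains P P' k where "P \<in> carrier_mat n n" "P' \<in> carrier_mat n n" "P * P' = 1\<^sub>m n" "P' * P = 1\<^sub>m n"
    "0 < k" "k < n"
    "\<And>B i j. B \<in> carrier_mat n n \<Longrightarrow> (\<And>v. v \<in> W \<Longrightarrow> B *\<^sub>v v \<in> W) \<Longrightarrow> k \<le> i \<Longrightarrow> i < n \<Longrightarrow> j < k \<Longrightarrow>
       (P' * B * P) $$ (i, j) = 0"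
proof -
  have Wc: "v \<in> carrier_vec n" if "v \<in> W" for v using W that by (auto simp: vec_subspace_def)
  define good where "good k \<longleftrightarrow> k \<le> n \<and> (\<exists>P \<in> carrier_mat n n. det P \<noteq> 0 \<and> (\<forall>j<k. col P j \<in> W))" for k
  have "good 0" by (auto simp: good_def intro!: bexI[of _ "1\<^sub>m n"])
  moreover have bd: "\<And>k. good k \<Longrightarrow> k \<le> n" by (simp add: good_def)
  ultimately obtain k where k: "good k" and kmax: "\<And>l. good l \<Longrightarrow> l \<le> k"
    using GreatestI_nat[of good 0 n] Greatest_le_nat[of good _ n] by blast
  obtain P where P: "P \<in> carrier_mat n n" "det P \<noteq> 0" "\<And>j. j < k \<Longrightarrow> col P j \<in> W"
    using k by (auto simp: good_def)
  have kn: "k \<le> n" using k by (simp add: good_def)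
  from det_non_zero_imp_unit[OF P(1,2), of "()"] obtain P' where
    P': "P' \<in> carrier_mat n n" "P * P' = 1\<^sub>m n" "P' * P = 1\<^sub>m n"
    unfolding Units_def by (auto simp: ring_mat_def)
  have PP': "P *\<^sub>v (P' *\<^sub>v v) = v" if "v \<in> carrier_vec n" for v
    using assoc_mult_mat_vec[OF P(1) P'(1) that] P'(2) that by simp
  \<comment> \<open>The vectors of \<open>W\<close> are exactly the combinations of the first \<open>k\<close> columns.\<close>
  have coords: "(P' *\<^sub>v v) $ i = 0" if v: "v \<in> W" and i: "k \<le> i" "i < n" for v i
  proof (rule ccontr)
    assume nz: "(P' *\<^sub>v v) $ i \<noteq> 0"
    let ?u = "P' *\<^sub>v v"
    have vc: "v \<in> carrier_vec n" using Wc[OF v] .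
    have uc: "?u \<in> carrier_vec n" using P'(1) vc by simp
    define R where "R = replace_col P v i"
    have Rc: "R \<in> carrier_mat n n" using P(1) by (simp add: R_def replace_col_def)
    have "det R = ?u $ i * det P"
      using cramer_lemma_mat[OF P(1) uc i(2)] PP'[OF vc] by (simp add: R_def)
    then have detR: "det R \<noteq> 0" using nz P(2) by simp
    have Rcol: "col R j = (if j = i then v else col P j)" if "j < n" for j
      using that P(1) vc i(2) by (intro eq_vecI) (auto simp: R_def replace_col_def)
    define Q where "Q = (if i = k then R else swapcols i k R)"
    have Qc: "Q \<in> carrier_mat n n" using Rc by (simp add: Q_def)
    have "det Q \<noteq> 0" using detR det_swapcols[OF i(2) _ _ Rc, of k] i by (simp add: Q_def)
    moreover have "col Q j \<in> W" if j: "j < Suc k" for j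
    proof (cases "j = k")
      case True
      have "col Q k = v"
      proof (cases "i = k")
        case False
        have "col Q k = col R i"
          using False Rc i by (intro eq_vecI) (auto simp: Q_def)
        then show ?thesis using Rcol[OF i(2)] by simp
      qed (use Rcol i in \<open>simp add: Q_def\<close>)
      then show ?thesis using True v by simp
    next
      case False
      then have jk: "j < k" using j by simp
      have "col Q j = col R j"
        using jk Rc i by (intro eq_vecI) (auto simp: Q_def)
      also have "\<dots> = col P j" using Rcol[of j] jk i by simp
      finally show ?thesis using P(3)[OF jk] by simp
    qed
    moreover have "Suc k \<le> n" using i by simp
    ultimately have "good (Suc k)" using Qc by (auto simp: good_def)
    then show False using kmax by fastforce
  qed
  have "0 < k"
  proof (rule ccontr)
    assume "\<not> 0 < k"
    then have "P' *\<^sub>v v0 = 0\<^sub>v n" using coords[OF v0(1)] P'(1) by (intro eq_vecI) auto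
    then have "v0 = P *\<^sub>v 0\<^sub>v n" using PP'[OF Wc[OF v0(1)]] by simp
    also have "P *\<^sub>v 0\<^sub>v n = 0\<^sub>v n" using P(1) by (intro eq_vecI) auto
    finally show False using v0(2) by simp
  qed
  moreover have "k < n"
  proof (rule ccontr)
    assume "\<not> k < n"
    with kn have [simp]: "k = n" by simp
    let ?u = "P' *\<^sub>v w0"
    have uc: "?u \<in> carrier_vec n" using P'(1) w0(1) by simp
    have cols: "\<And>j. j < n \<Longrightarrow> col P j \<in> W" using P(3) by simp
    from vec_subspace_comb[OF W, of n "col P" "\<lambda>j. ?u $ j"] cols
    obtain w where w: "w \<in> W" "\<And>i. i < n \<Longrightarrow> w $ i = (\<Sum>j<n. col P j $ i * ?u $ j)" by auto
    have "w = P *\<^sub>v ?u"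
    proof (rule eq_vecI)
      fix i assume "i < dim_vec (P *\<^sub>v ?u)"
      then have i: "i < n" using P(1) by simp
      have "(P *\<^sub>v ?u) $ i = (\<Sum>j<n. P $$ (i, j) * ?u $ j)" by (rule mat_vec_as_sum[OF P(1) uc i])
      also have "\<dots> = (\<Sum>j<n. col P j $ i * ?u $ j)" using P(1) i by (intro sum.cong) auto
      finally show "w $ i = (P *\<^sub>v ?u) $ i" using w(2)[OF i] by simp
    qed (use Wc[OF w(1)] P(1) in auto)
    then show False using PP'[OF w0(1)] w(1) w0(2) by simp
  qed
  moreover have "(P' * B * P) $$ (i, j) = 0"
    if B: "B \<in> carrier_mat n n" "\<And>v. v \<in> W \<Longrightarrow> B *\<^sub>v v \<in> W" and ij: "k \<le> i" "i < n" "j < k" for B i j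
  proof -
    have "(P' * B * P) $$ (i, j) = col (P' * B * P) j $ i" using ij kn P(1) P'(1) B(1) by simp
    also have "col (P' * B * P) j = (P' * B) *\<^sub>v col P j"
      using ij kn P(1) P'(1) B(1) by (intro col_mult2[of _ n n _ n]) auto
    also have "\<dots> = P' *\<^sub>v (B *\<^sub>v col P j)"
      using ij kn P(1) P'(1) B(1) by (intro assoc_mult_mat_vec[of _ n n _ n]) auto
    also have "\<dots> $ i = 0" by (rule coords[OF B(2)[OF P(3)[OF ij(3)]] ij(1,2)])
    finally show ?thesis .
  qed
  ultimately show thesis using that[OF P(1) P'] by blast
qed

definition upper_block :: "nat \<Rightarrow> 'f mat \<Rightarrow> 'f mat" where
  "upper_block k A = mat k k (\<lambda>(i, j). A $$ (i, j))"

definition lower_block :: "nat \<Rightarrow> nat \<Rightarrow> 'f mat \<Rightarrow> 'f mat" where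
  "lower_block k n A = mat (n - k) (n - k) (\<lambda>(i, j). A $$ (i + k, j + k))"

definition block_upper :: "nat \<Rightarrow> nat \<Rightarrow> 'f::zero mat \<Rightarrow> bool" where
  "block_upper k n A \<longleftrightarrow> A \<in> carrier_mat n n \<and> (\<forall>i j. k \<le> i \<longrightarrow> i < n \<longrightarrow> j < k \<longrightarrow> A $$ (i, j) = 0)"

lemma blocks_carrier [simp]:
  "upper_block k A \<in> carrier_mat k k" "lower_block k n A \<in> carrier_mat (n - k) (n - k)"
  by (simp_all add: upper_block_def lower_block_def)

lemma upper_block_mult:
  fixes A B :: "'f::field mat"
  assumes A: "block_upper k n A" and B: "block_upper k n B" and k: "k \<le> n"
  shows "upper_block k (A * B) = upper_block k A * upper_block k B"
    "lower_block k n (A * B) = lower_block k n A * lower_block k n B"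
    "block_upper k n (A * B)"
proof -
  have Ac: "A \<in> carrier_mat n n" and Bc: "B \<in> carrier_mat n n" using A B by (auto simp: block_upper_def)
  have "(\<Sum>l<k + m. f l) = (\<Sum>l<k. f l) + (\<Sum>l<m. f (l + k))" for f :: "nat \<Rightarrow> 'f" and m
    by (induction m) (simp_all add: add.commute add.left_commute)
  from this[of _ "n - k"] have split: "(\<Sum>l<n. f l) = (\<Sum>l<k. f l) + (\<Sum>l<n - k. f (l + k))"
    for f :: "nat \<Rightarrow> 'f" using k by simp
  show "upper_block k (A * B) = upper_block k A * upper_block k B"
  proof (rule eq_matI)
    fix i j assume "i < dim_row (upper_block k A * upper_block k B)" "j < dim_col (upper_block k A * upper_block k B)"
    then have ij: "i < k" "j < k" by (auto simp: upper_block_def)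
    have "(A * B) $$ (i, j) = (\<Sum>l<n. A $$ (i, l) * B $$ (l, j))" using mat_mult_as_sum[OF Ac Bc] ij k by simp
    also have "\<dots> = (\<Sum>l<k. A $$ (i, l) * B $$ (l, j))"
      unfolding split using B ij k by (auto simp: block_upper_def)
    also have "\<dots> = (upper_block k A * upper_block k B) $$ (i, j)"
      using mat_mult_as_sum[of "upper_block k A" k k "upper_block k B" k i j] ij by (simp add: upper_block_def)
    finally show "upper_block k (A * B) $$ (i, j) = (upper_block k A * upper_block k B) $$ (i, j)"
      using ij by (simp add: upper_block_def)
  qed (auto simp: upper_block_def)
  show "lower_block k n (A * B) = lower_block k n A * lower_block k n B"
  proof (rule eq_matI)
    fix i j assume "i < dim_row (lower_block k n A * lower_block k n B)" "j < dim_col (lower_block k n A * lower_block k n B)"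
    then have ij: "i < n - k" "j < n - k" by (auto simp: lower_block_def)
    have "(A * B) $$ (i + k, j + k) = (\<Sum>l<n. A $$ (i + k, l) * B $$ (l, j + k))"
      using mat_mult_as_sum[OF Ac Bc, of "i + k" "j + k"] ij by simp
    also have "\<dots> = (\<Sum>l<n - k. A $$ (i + k, l + k) * B $$ (l + k, j + k))"
      unfolding split using A ij k by (auto simp: block_upper_def)
    also have "\<dots> = (lower_block k n A * lower_block k n B) $$ (i, j)"
      using mat_mult_as_sum[of "lower_block k n A" "n - k" "n - k" "lower_block k n B" "n - k" i j] ij
      by (simp add: lower_block_def)
    finally show "lower_block k n (A * B) $$ (i, j) = (lower_block k n A * lower_block k n B) $$ (i, j)"
      using ij by (simp add: lower_block_def)
  qed (auto simp: lower_block_def)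
  have "(A * B) $$ (i, j) = 0" if ij: "k \<le> i" "i < n" "j < k" for i j
  proof -
    have "(A * B) $$ (i, j) = (\<Sum>l<n. A $$ (i, l) * B $$ (l, j))" using mat_mult_as_sum[OF Ac Bc] ij k by simp
    also have "\<dots> = 0" unfolding split using A B ij by (auto simp: block_upper_def)
    finally show ?thesis .
  qed
  then show "block_upper k n (A * B)" using Ac Bc by (auto simp: block_upper_def)
qed

lemma conj_mult:
  fixes P :: "'f::field mat"
  assumes "P \<in> carrier_mat n n" "P' \<in> carrier_mat n n" "P * P' = 1\<^sub>m n" "A \<in> carrier_mat n n" "B \<in> carrier_mat n n"
  shows "P' * (A * B) * P = (P' * A * P) * (P' * B * P)"
proof -
  have "(P' * A * P) * (P' * B * P) = P' * A * (P * P') * B * P"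
    using assms(1,2,4,5) by (simp add: assoc_mult_mat[of _ n n _ n _ n])
  also have "\<dots> = P' * (A * B) * P" using assms by (simp add: assoc_mult_mat[of _ n n _ n _ n])
  finally show ?thesis by simp
qed

text \<open>An eigenspace of a matrix in \<open>F\<close> that is not scalar is a proper nonzero subspace, and the
  commuting matrices preserve it, so the induction on the dimension applies to it.\<close>

lemma ex_common_eigenvector:
  fixes F :: "complex mat set"
  assumes "0 < n" "F \<subseteq> carrier_mat n n" "\<And>B Y. B \<in> F \<Longrightarrow> Y \<in> F \<Longrightarrow> B * Y = Y * B"
  shows "\<exists>v \<in> carrier_vec n. v \<noteq> 0\<^sub>v n \<and> (\<forall>B\<in>F. \<exists>c. B *\<^sub>v v = c \<cdot>\<^sub>v v)"
  using assms
proof (induction n arbitrary: F rule: less_induct)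
  case (less n)
  show ?case
  proof (cases "\<forall>B\<in>F. \<exists>c. \<forall>v\<in>carrier_vec n. B *\<^sub>v v = c \<cdot>\<^sub>v v")
    case True
    have "unit_vec n 0 \<noteq> (0\<^sub>v n :: complex vec)"
      using less.prems(1) by (metis index_unit_vec(1) index_zero_vec(1) zero_neq_one)
    moreover have "\<exists>c. B *\<^sub>v unit_vec n 0 = c \<cdot>\<^sub>v unit_vec n 0" if "B \<in> F" for B
      using True that unit_vec_carrier by blast
    ultimately show ?thesis by (intro bexI[of _ "unit_vec n 0"]) auto
  next
    case False
    then obtain B where B: "B \<in> F" "\<And>c. \<exists>v\<in>carrier_vec n. B *\<^sub>v v \<noteq> c \<cdot>\<^sub>v v" by blast
    have Xc: "B \<in> carrier_mat n n" using B less.prems by auto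
    from spectrum_non_empty[OF Xc less.prems(1)] obtain c v where
      v: "v \<in> carrier_vec n" "v \<noteq> 0\<^sub>v n" "B *\<^sub>v v = c \<cdot>\<^sub>v v"
      using Xc by (auto simp: spectrum_def eigenvalue_def eigenvector_def)
    define W where "W = {v \<in> carrier_vec n. B *\<^sub>v v = c \<cdot>\<^sub>v v}"
    have W: "vec_subspace n W"
      unfolding vec_subspace_def W_def using Xc
      by (auto simp: mult_add_distrib_mat_vec[OF Xc] mult_mat_vec[OF Xc] smult_add_distrib_vec smult_smult_assoc mult.commute)
    obtain w where w: "w \<in> carrier_vec n" "w \<notin> W" using B(2)[of c] by (auto simp: W_def)
    have vW: "v \<in> W" using v by (simp add: W_def)
    from ex_adapted_basis[OF W vW v(2) w] obtain P P' k where
      P: "P \<in> carrier_mat n n" "P' \<in> carrier_mat n n" "P * P' = 1\<^sub>m n" "P' * P = 1\<^sub>m n" and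
      k: "0 < k" "k < n" and
      blk: "\<And>B i j. B \<in> carrier_mat n n \<Longrightarrow> (\<And>v. v \<in> W \<Longrightarrow> B *\<^sub>v v \<in> W) \<Longrightarrow> k \<le> i \<Longrightarrow> i < n \<Longrightarrow> j < k \<Longrightarrow>
       (P' * B * P) $$ (i, j) = 0" by metis
    have stable: "Y *\<^sub>v u \<in> W" if Y: "Y \<in> F" and u: "u \<in> W" for Y u
    proof -
      have Yc: "Y \<in> carrier_mat n n" and uc: "u \<in> carrier_vec n" using Y u less.prems by (auto simp: W_def)
      have "B *\<^sub>v (Y *\<^sub>v u) = (B * Y) *\<^sub>v u" using assoc_mult_mat_vec[OF Xc Yc uc] by simp
      also have "B * Y = Y * B" using less.prems(3) B(1) Y by blast
      also have "(Y * B) *\<^sub>v u = Y *\<^sub>v (B *\<^sub>v u)" using assoc_mult_mat_vec[OF Yc Xc uc] by simp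
      also have "\<dots> = c \<cdot>\<^sub>v (Y *\<^sub>v u)" using u mult_mat_vec[OF Yc uc] by (simp add: W_def)
      finally show ?thesis using Yc uc by (simp add: W_def)
    qed
    have bu: "block_upper k n (P' * Y * P)" if "Y \<in> F" for Y
    proof -
      have Yc: "Y \<in> carrier_mat n n" using that less.prems(2) by blast
      have "(P' * Y * P) $$ (i, j) = 0" if "k \<le> i" "i < n" "j < k" for i j
        by (rule blk[OF Yc stable[OF \<open>Y \<in> F\<close>] that])
      moreover have "P' * Y * P \<in> carrier_mat n n" using Yc P by simp
      ultimately show ?thesis unfolding block_upper_def by blast
    qed
    define F' where "F' = (\<lambda>Y. upper_block k (P' * Y * P)) ` F"
    have comm: "A * B = B * A" if "A \<in> F'" "B \<in> F'" for A B
    proof -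
      obtain Y Z where YZ: "Y \<in> F" "Z \<in> F" "A = upper_block k (P' * Y * P)" "B = upper_block k (P' * Z * P)"
        using \<open>A \<in> F'\<close> \<open>B \<in> F'\<close> by (auto simp: F'_def)
      have c: "Y \<in> carrier_mat n n" "Z \<in> carrier_mat n n" using YZ less.prems by auto
      have "A * B = upper_block k ((P' * Y * P) * (P' * Z * P))"
        using upper_block_mult(1)[OF bu[OF YZ(1)] bu[OF YZ(2)]] k YZ by simp
      also have "\<dots> = upper_block k (P' * (Y * Z) * P)" using conj_mult[OF P(1-3) c] by simp
      also have "Y * Z = Z * Y" using less.prems(3) YZ by blast
      also have "upper_block k (P' * (Z * Y) * P) = upper_block k ((P' * Z * P) * (P' * Y * P))"
        using conj_mult[OF P(1-3) c(2,1)] by simp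
      also have "\<dots> = B * A" using upper_block_mult(1)[OF bu[OF YZ(2)] bu[OF YZ(1)]] k YZ by simp
      finally show ?thesis .
    qed
    obtain u where u: "u \<in> carrier_vec k" "u \<noteq> 0\<^sub>v k" "\<forall>A\<in>F'. \<exists>c. A *\<^sub>v u = c \<cdot>\<^sub>v u"
    proof -
      have "F' \<subseteq> carrier_mat k k" unfolding F'_def by (rule image_subsetI) (rule blocks_carrier)
      note IH = less.IH[OF k(2,1) this]
      have "\<exists>v\<in>carrier_vec k. v \<noteq> 0\<^sub>v k \<and> (\<forall>A\<in>F'. \<exists>c. A *\<^sub>v v = c \<cdot>\<^sub>v v)"
        by (rule IH) (rule comm)
      then show thesis by (elim bexE conjE) (rule that)
    qed
    define u' where "u' = vec n (\<lambda>i. if i < k then u $ i else 0)"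
    have u'c: "u' \<in> carrier_vec n" by (simp add: u'_def)
    have "\<exists>i<k. u $ i \<noteq> 0"
    proof (rule ccontr)
      assume "\<not> ?thesis"
      then have "u = 0\<^sub>v k" using u(1) by (intro eq_vecI) auto
      with u(2) show False ..
    qed
    then obtain i0 where i0: "i0 < k" "u $ i0 \<noteq> 0" by blast
    have u'0: "u' \<noteq> 0\<^sub>v n"
    proof
      assume "u' = 0\<^sub>v n"
      then have "u' $ i0 = 0" using i0 k by simp
      then show False using i0 k by (simp add: u'_def)
    qed
    have eig: "\<exists>c. (P' * Y * P) *\<^sub>v u' = c \<cdot>\<^sub>v u'" if Y: "Y \<in> F" for Y
    proof -
      let ?A = "P' * Y * P"
      have Ac: "?A \<in> carrier_mat n n" using Y less.prems P by auto
      obtain c where c: "upper_block k ?A *\<^sub>v u = c \<cdot>\<^sub>v u" using u(3) Y by (auto simp: F'_def)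
      have "?A *\<^sub>v u' = c \<cdot>\<^sub>v u'"
      proof (rule eq_vecI)
        fix i assume "i < dim_vec (c \<cdot>\<^sub>v u')"
        then have i: "i < n" by (simp add: u'_def)
        have "(?A *\<^sub>v u') $ i = (\<Sum>j<n. ?A $$ (i, j) * u' $ j)" by (rule mat_vec_as_sum[OF Ac u'c i])
        also have "\<dots> = (\<Sum>j<k. ?A $$ (i, j) * u $ j)"
          using k by (intro sum.mono_neutral_cong_right) (auto simp: u'_def)
        also have "\<dots> = (c \<cdot>\<^sub>v u') $ i"
        proof (cases "i < k")
          case True
          have "(upper_block k ?A *\<^sub>v u) $ i = (\<Sum>j<k. ?A $$ (i, j) * u $ j)"
            using mat_vec_as_sum[of "upper_block k ?A" k k u i] u(1) True by (simp add: upper_block_def)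
          then show ?thesis using c True u(1) i by (simp add: u'_def)
        next
          case False
          then show ?thesis using bu[OF Y] i by (simp add: block_upper_def u'_def)
        qed
        finally show "(?A *\<^sub>v u') $ i = (c \<cdot>\<^sub>v u') $ i" .
      next
        show "dim_vec (?A *\<^sub>v u') = dim_vec (c \<cdot>\<^sub>v u')" using Ac u'c unfolding carrier_mat_def carrier_vec_def by simp
      qed
      then show ?thesis by blast
    qed
    have nz: "P *\<^sub>v u' \<noteq> 0\<^sub>v n"
    proof
      assume "P *\<^sub>v u' = 0\<^sub>v n"
      then have "P' *\<^sub>v (P *\<^sub>v u') = 0\<^sub>v n" using P(2) by (intro eq_vecI) auto
      then show False using assoc_mult_mat_vec[OF P(2,1) u'c] P(4) u'c u'0 by simp
    qed
    have "\<exists>c. Y *\<^sub>v (P *\<^sub>v u') = c \<cdot>\<^sub>v (P *\<^sub>v u')" if Y: "Y \<in> F" for Y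
    proof -
      have Yc: "Y \<in> carrier_mat n n" using Y less.prems by auto
      obtain c where c: "(P' * Y * P) *\<^sub>v u' = c \<cdot>\<^sub>v u'" using eig[OF Y] by blast
      have "P * (P' * Y * P) = (P * P') * Y * P" using P(1,2) Yc by (simp add: assoc_mult_mat[of _ n n _ n _ n])
      also have "\<dots> = Y * P" using P Yc by simp
      finally have "Y *\<^sub>v (P *\<^sub>v u') = P *\<^sub>v ((P' * Y * P) *\<^sub>v u')"
        using assoc_mult_mat_vec[OF P(1) _ u'c, of "P' * Y * P"] assoc_mult_mat_vec[OF Yc P(1) u'c] P Yc by simp
      also have "\<dots> = c \<cdot>\<^sub>v (P *\<^sub>v u')" using c mult_mat_vec[OF P(1) u'c] by simp
      finally show ?thesis by blast
    qed
    then show ?thesis using nz P(1) u'c by (intro bexI[of _ "P *\<^sub>v u'"]) auto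
  qed
qed

section \<open>Subgroups of finite index\<close>

context group begin

text \<open>With associativity and the inverse of a product, these rules bring words in group elements
  to freely reduced form, which proves most identities between commutators and conjugates below.\<close>

lemma inv_cancel_left: "x \<in> carrier G \<Longrightarrow> y \<in> carrier G \<Longrightarrow> inv x \<otimes> (x \<otimes> y) = y"
  "x \<in> carrier G \<Longrightarrow> y \<in> carrier G \<Longrightarrow> x \<otimes> (inv x \<otimes> y) = y"
  by (simp_all add: m_assoc[symmetric])

lemmas word_simps = m_assoc inv_mult_group inv_cancel_left

lemma conj_nat_pow:
  "x \<in> carrier G \<Longrightarrow> y \<in> carrier G \<Longrightarrow> (x \<otimes> y \<otimes> inv x) [^] (k::nat) = x \<otimes> y [^] k \<otimes> inv x"
  by (induction k) (simp_all add: word_simps)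

text \<open>Finite index is shown throughout by a map with finite image whose fibres lie in cosets of
  the subgroup.\<close>

lemma finite_index_criterion:
  assumes H: "subgroup H G" and fin: "finite (f ` carrier G)"
    and f: "\<And>x y. x \<in> carrier G \<Longrightarrow> y \<in> carrier G \<Longrightarrow> f x = f y \<Longrightarrow> x \<otimes> inv y \<in> H"
  shows "finite_index_subgroup H G"
proof -
  define r where "r c = (SOME x. x \<in> carrier G \<and> f x = c)" for c
  have r: "r (f x) \<in> carrier G \<and> f (r (f x)) = f x" if "x \<in> carrier G" for x
    unfolding r_def by (rule someI[of _ x]) (use that in simp)
  have "rcosets H \<subseteq> (\<lambda>c. H #> r c) ` (f ` carrier G)"
  proof
    fix C assume "C \<in> rcosets H"
    then obtain x where x: "x \<in> carrier G" "C = H #> x" by (auto simp: RCOSETS_def)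
    have rx: "r (f x) \<in> carrier G" "f (r (f x)) = f x" using r[OF x(1)] by auto
    have "x \<otimes> inv (r (f x)) \<in> H" using f[OF x(1) rx(1)] rx(2) by simp
    then have "x \<in> H #> r (f x)" using subgroup.rcos_module_rev[OF H is_group rx(1) x(1)] by blast
    then have "C = H #> r (f x)" using repr_independence[OF _ rx(1) H] x by simp
    then show "C \<in> (\<lambda>c. H #> r c) ` (f ` carrier G)" using x by blast
  qed
  then show ?thesis using H fin by (auto simp: finite_index_subgroup_def intro: finite_subset)
qed

lemma finite_index_coset_image:
  assumes "finite_index_subgroup H G"
  shows "finite ((#>) H ` carrier G)"
proof -
  have "(#>) H ` carrier G = rcosets H" by (auto simp: RCOSETS_def)
  with assms show ?thesis by (simp add: finite_index_subgroup_def)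
qed

lemmas rcoset_eqD = rcoset_eq_iff[THEN iffD1]

lemma finite_index_trans:
  assumes H: "finite_index_subgroup H G" and K: "subgroup K G" and fin: "finite (f ` H)"
    and f: "\<And>a b. a \<in> H \<Longrightarrow> b \<in> H \<Longrightarrow> f a = f b \<Longrightarrow> a \<otimes> inv b \<in> K"
  shows "finite_index_subgroup K G"
proof -
  have Hs: "subgroup H G" using H by (simp add: finite_index_subgroup_def)
  define r where "r C = (SOME x. x \<in> carrier G \<and> H #> x = C)" for C
  have r: "r (H #> x) \<in> carrier G \<and> H #> r (H #> x) = H #> x" if "x \<in> carrier G" for x
    unfolding r_def by (rule someI[of _ x]) (use that in simp)
  have mem: "x \<otimes> inv (r (H #> x)) \<in> H" if "x \<in> carrier G" for x
    using rcoset_eqD[OF Hs that] r[OF that] by simp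
  show ?thesis
  proof (rule finite_index_criterion[OF K, where f = "\<lambda>x. (H #> x, f (x \<otimes> inv (r (H #> x))))"])
    have "(\<lambda>x. (H #> x, f (x \<otimes> inv (r (H #> x))))) ` carrier G \<subseteq> ((#>) H ` carrier G) \<times> (f ` H)"
      using mem by auto
    then show "finite ((\<lambda>x. (H #> x, f (x \<otimes> inv (r (H #> x))))) ` carrier G)"
      by (rule finite_subset) (intro finite_cartesian_product finite_index_coset_image H fin)
    fix x y assume x: "x \<in> carrier G" and y: "y \<in> carrier G"
      and xy: "(H #> x, f (x \<otimes> inv (r (H #> x)))) = (H #> y, f (y \<otimes> inv (r (H #> y))))"
    have rc: "r (H #> y) \<in> carrier G" using r y by blast
    have "f (x \<otimes> inv (r (H #> x))) = f (y \<otimes> inv (r (H #> y)))" by (rule conjunct2[OF prod.inject[THEN iffD1, OF xy]])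
    then have "(x \<otimes> inv (r (H #> x))) \<otimes> inv (y \<otimes> inv (r (H #> y))) \<in> K"
      by (rule f[OF mem[OF x] mem[OF y]])
    moreover have "(x \<otimes> inv (r (H #> x))) \<otimes> inv (y \<otimes> inv (r (H #> y))) = x \<otimes> inv y"
      using xy x y rc by (simp add: word_simps)
    ultimately show "x \<otimes> inv y \<in> K" by simp
  qed
qed

lemma finite_index_inter:
  assumes "finite_index_subgroup H G" "finite_index_subgroup K G"
  shows "finite_index_subgroup (H \<inter> K) G"
proof (rule finite_index_criterion[where f = "\<lambda>x. (H #> x, K #> x)"])
  have HK: "subgroup H G" "subgroup K G" using assms by (auto simp: finite_index_subgroup_def)
  show "subgroup (H \<inter> K) G" using subgroups_Inter_pair HK by blast
  have "(\<lambda>x. (H #> x, K #> x)) ` carrier G \<subseteq> ((#>) H ` carrier G) \<times> ((#>) K ` carrier G)" by auto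
  then show "finite ((\<lambda>x. (H #> x, K #> x)) ` carrier G)"
    by (rule finite_subset) (intro finite_cartesian_product finite_index_coset_image assms)
  show "x \<otimes> inv y \<in> H \<inter> K" if "x \<in> carrier G" "y \<in> carrier G" "(H #> x, K #> x) = (H #> y, K #> y)" for x y
    using rcoset_eqD[OF HK(1) that(1,2)] rcoset_eqD[OF HK(2) that(1,2)] that(3) by simp
qed

lemma normal_conj:
  assumes "M \<lhd> G" "x \<in> carrier G" "m \<in> M"
  shows "x \<otimes> m \<otimes> inv x \<in> M" "inv x \<otimes> m \<otimes> x \<in> M"
  using assms normal.inv_op_closed1 normal.inv_op_closed2 by metis+

lemma normal_criterion:
  assumes "M \<subseteq> carrier G" "\<one> \<in> M" "\<And>x y. x \<in> M \<Longrightarrow> y \<in> M \<Longrightarrow> x \<otimes> y \<in> M" "\<And>x. x \<in> M \<Longrightarrow> inv x \<in> M"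
    "\<And>x m. x \<in> carrier G \<Longrightarrow> m \<in> M \<Longrightarrow> x \<otimes> m \<otimes> inv x \<in> M"
  shows "M \<lhd> G"
proof -
  have "subgroup M G" using assms by (intro subgroupI) auto
  then show ?thesis using assms(5) normal_inv_iff by blast
qed

end

section \<open>Weights in small dimension\<close>

text \<open>A perfect group with a solvable normal subgroup of finite index and an element \<open>g\<close> whose
  powers \<open>g [^] j\<close> normally generate the group unless \<open>q\<close> divides \<open>j\<close>. The last assumption is a
  condition on the number \<open>q\<close> alone. It holds when \<open>q\<close> is a prime power, because the least common
  multiple of the smaller numbers is then not divisible by \<open>q\<close>. It allows one power of \<open>g\<close> to fix
  all orbits shorter than \<open>q\<close>.\<close>

locale perfect_extension = group G for G (structure) +
  fixes N g and q :: nat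
  assumes perfect: "derived G (carrier G) = carrier G"
    and N: "N \<lhd> G" and N_finite_index: "finite_index_subgroup N G"
    and N_solvable: "\<exists>m. (derived G ^^ m) N = {\<one>}"
    and g: "g \<in> carrier G"
    and full: "\<And>M j. M \<lhd> G \<Longrightarrow> g [^] (j :: nat) \<in> M \<Longrightarrow> \<not> q dvd j \<Longrightarrow> M = carrier G"
    and ex_common_multiple: "\<exists>k::nat. (\<forall>m. 0 < m \<and> m < q \<longrightarrow> m dvd k) \<and> \<not> q dvd k"

definition mat_rep :: "('a, 'b) monoid_scheme \<Rightarrow> nat \<Rightarrow> ('a \<Rightarrow> 'f::field mat) \<Rightarrow> bool" where
  "mat_rep G n \<rho> \<longleftrightarrow> (\<forall>s\<in>carrier G. \<rho> s \<in> carrier_mat n n) \<and> \<rho> \<one>\<^bsub>G\<^esub> = 1\<^sub>m n \<and>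
     (\<forall>s\<in>carrier G. \<forall>t\<in>carrier G. \<rho> (s \<otimes>\<^bsub>G\<^esub> t) = \<rho> s * \<rho> t)"

definition weight :: "nat \<Rightarrow> ('a \<Rightarrow> 'f::field mat) \<Rightarrow> 'a set \<Rightarrow> ('a \<Rightarrow> 'f) \<Rightarrow> 'f vec \<Rightarrow> bool" where
  "weight n \<rho> T \<chi> v \<longleftrightarrow> v \<in> carrier_vec n \<and> v \<noteq> 0\<^sub>v n \<and> (\<forall>t\<in>T. \<rho> t *\<^sub>v v = \<chi> t \<cdot>\<^sub>v v)"

text \<open>Eigenvectors for distinct characters are linearly independent. Applying \<open>\<rho> t - \<chi> m t\<close>,
  where \<open>t\<close> separates two of the characters, to a relation removes its last vector.\<close>

lemma weights_independent:
  fixes \<rho> :: "'a \<Rightarrow> 'f::field mat"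
  assumes \<rho>: "\<And>t. t \<in> T \<Longrightarrow> \<rho> t \<in> carrier_mat n n"
  shows "(\<And>i. i < m \<Longrightarrow> weight n \<rho> T (\<chi> i) (v i)) \<Longrightarrow>
    (\<And>i j. i < j \<Longrightarrow> j < m \<Longrightarrow> \<exists>t\<in>T. \<chi> i t \<noteq> \<chi> j t) \<Longrightarrow>
    (\<And>r. r < n \<Longrightarrow> (\<Sum>i<m. c i * v i $ r) = 0) \<Longrightarrow> i < (m::nat) \<Longrightarrow> c i = 0"
proof (induction m arbitrary: c i)
  case (Suc m)
  have w: "v i \<in> carrier_vec n" "\<And>t. t \<in> T \<Longrightarrow> \<rho> t *\<^sub>v v i = \<chi> i t \<cdot>\<^sub>v v i" if "i < Suc m" for i
    using Suc.prems(1)[OF that] by (auto simp: weight_def)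
  have app: "(\<Sum>r'<n. \<rho> t $$ (r, r') * v i $ r') = \<chi> i t * v i $ r" if "i < Suc m" "t \<in> T" "r < n" for i t r
  proof -
    have "(\<rho> t *\<^sub>v v i) $ r = (\<Sum>r'<n. \<rho> t $$ (r, r') * v i $ r')"
      by (rule mat_vec_as_sum[OF \<rho>[OF that(2)] w(1)[OF that(1)] that(3)])
    moreover have "(\<rho> t *\<^sub>v v i) $ r = \<chi> i t * v i $ r" using w[OF that(1)] that(2,3) by simp
    ultimately show ?thesis by simp
  qed
  have low: "c i = 0" if i: "i < m" for i
  proof -
    obtain t where t: "t \<in> T" "\<chi> i t \<noteq> \<chi> m t" using Suc.prems(2)[of i m] i by auto
    have "(\<Sum>j<m. (c j * (\<chi> j t - \<chi> m t)) * v j $ r) = 0" if r: "r < n" for r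
    proof -
      have "(\<Sum>j<Suc m. c j * (\<chi> j t * v j $ r)) = (\<Sum>j<Suc m. c j * (\<Sum>r'<n. \<rho> t $$ (r, r') * v j $ r'))"
        using app[OF _ t(1) r] by (intro sum.cong) auto
      also have "\<dots> = (\<Sum>r'<n. \<rho> t $$ (r, r') * (\<Sum>j<Suc m. c j * v j $ r'))"
        by (simp only: sum_distrib_left mult.left_commute) (rule sum.swap)
      also have "\<dots> = 0" using Suc.prems(3) by simp
      finally have 1: "(\<Sum>j<Suc m. c j * (\<chi> j t * v j $ r)) = 0" .
      have 2: "\<chi> m t * (\<Sum>j<Suc m. c j * v j $ r) = 0" using Suc.prems(3)[OF r] by simp
      have "(\<Sum>j<Suc m. (c j * (\<chi> j t - \<chi> m t)) * v j $ r) = 0"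
        using 1 2 by (simp add: sum_distrib_left algebra_simps sum.distrib sum_subtractf)
      then show ?thesis by simp
    qed
    from Suc.IH[OF _ _ this i] have "c i * (\<chi> i t - \<chi> m t) = 0"
      using Suc.prems(1,2) by simp
    then show ?thesis using t(2) by simp
  qed
  show ?case
  proof (cases "i < m")
    case True then show ?thesis by (rule low)
  next
    case False
    then have [simp]: "i = m" using Suc.prems(4) by simp
    have "c m * v m $ r = 0" if "r < n" for r using Suc.prems(3)[OF that] low by simp
    moreover obtain r where "r < n" "v m $ r \<noteq> 0"
    proof -
      have "v m \<in> carrier_vec n" "v m \<noteq> 0\<^sub>v n" using Suc.prems(1)[of m] by (auto simp: weight_def)
      then show thesis using that by (metis carrier_vecD eq_vecI index_zero_vec)
    qed
    ultimately show ?thesis by auto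
  qed
qed simp

lemma weights_le_dim:
  fixes \<rho> :: "'a \<Rightarrow> 'f::field mat"
  assumes \<rho>: "\<And>t. t \<in> T \<Longrightarrow> \<rho> t \<in> carrier_mat n n"
    and w: "\<And>i. i < m \<Longrightarrow> weight n \<rho> T (\<chi> i) (v i)"
    and d: "\<And>i j. i < j \<Longrightarrow> j < m \<Longrightarrow> \<exists>t\<in>T. \<chi> i t \<noteq> \<chi> j t"
  shows "m \<le> n"
proof (rule ccontr)
  assume "\<not> m \<le> n"
  then obtain c where c: "\<exists>i<m. c i \<noteq> 0" "\<And>r. r < n \<Longrightarrow> (\<Sum>i<m. c i * v i $ r) = 0"
    using ex_nontrivial_relation[of n m "\<lambda>r i. v i $ r"] by (metis not_le_imp_less)
  then show False using weights_independent[OF \<rho> w d c(2)] by blast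
qed

context group begin

lemma mat_repD:
  assumes "mat_rep G n \<rho>"
  shows "s \<in> carrier G \<Longrightarrow> \<rho> s \<in> carrier_mat n n" "\<rho> \<one> = 1\<^sub>m n"
    "s \<in> carrier G \<Longrightarrow> t \<in> carrier G \<Longrightarrow> \<rho> (s \<otimes> t) = \<rho> s * \<rho> t"
    "s \<in> carrier G \<Longrightarrow> \<rho> s * \<rho> (inv s) = 1\<^sub>m n" "s \<in> carrier G \<Longrightarrow> \<rho> (inv s) * \<rho> s = 1\<^sub>m n"
proof -
  show 1: "\<rho> s \<in> carrier_mat n n" if "s \<in> carrier G" for s using assms that by (simp add: mat_rep_def)
  show 2: "\<rho> \<one> = 1\<^sub>m n" using assms by (simp add: mat_rep_def)
  show 3: "\<rho> (s \<otimes> t) = \<rho> s * \<rho> t" if "s \<in> carrier G" "t \<in> carrier G" for s t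
    using assms that by (simp add: mat_rep_def)
  show "\<rho> s * \<rho> (inv s) = 1\<^sub>m n" if "s \<in> carrier G" using 3[of s "inv s"] that 2 by simp
  show "\<rho> (inv s) * \<rho> s = 1\<^sub>m n" if "s \<in> carrier G" using 3[of "inv s" s] that 2 by simp
qed

lemma weight_translate:
  assumes \<rho>: "mat_rep G n \<rho>" and T: "T \<lhd> G" and w: "weight n \<rho> T \<chi> v" and s: "s \<in> carrier G"
  shows "weight n \<rho> T (\<lambda>t. \<chi> (s \<otimes> t \<otimes> inv s)) (\<rho> (inv s) *\<^sub>v v)"
proof -
  note R = mat_repD[OF \<rho>]
  have v: "v \<in> carrier_vec n" "v \<noteq> 0\<^sub>v n" "\<And>t. t \<in> T \<Longrightarrow> \<rho> t *\<^sub>v v = \<chi> t \<cdot>\<^sub>v v" using w by (auto simp: weight_def)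
  have Tc: "T \<subseteq> carrier G" using normal_imp_subgroup[OF T] subgroup.subset by blast
  have isc: "\<rho> (inv s) \<in> carrier_mat n n" using R(1) s by simp
  have "\<rho> (inv s) *\<^sub>v v \<noteq> 0\<^sub>v n"
  proof
    assume a: "\<rho> (inv s) *\<^sub>v v = 0\<^sub>v n"
    have "v = \<rho> s *\<^sub>v (\<rho> (inv s) *\<^sub>v v)"
      using assoc_mult_mat_vec[OF R(1)[OF s] isc v(1)] R(4)[OF s] v(1) by simp
    also have "\<dots> = 0\<^sub>v n" unfolding a using R(1)[OF s] by (intro eq_vecI) auto
    finally show False using v(2) by simp
  qed
  moreover have "\<rho> t *\<^sub>v (\<rho> (inv s) *\<^sub>v v) = \<chi> (s \<otimes> t \<otimes> inv s) \<cdot>\<^sub>v (\<rho> (inv s) *\<^sub>v v)" if t: "t \<in> T" for t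
  proof -
    have tc: "t \<in> carrier G" using t Tc by blast
    have st: "s \<otimes> t \<otimes> inv s \<in> T" by (rule normal_conj(1)[OF T s t])
    have "t \<otimes> inv s = inv s \<otimes> (s \<otimes> t \<otimes> inv s)" using s tc by (simp add: word_simps)
    then have "\<rho> t * \<rho> (inv s) = \<rho> (inv s) * \<rho> (s \<otimes> t \<otimes> inv s)"
      using R(3)[of t "inv s"] R(3)[of "inv s" "s \<otimes> t \<otimes> inv s"] s tc by simp
    then have "\<rho> t *\<^sub>v (\<rho> (inv s) *\<^sub>v v) = \<rho> (inv s) *\<^sub>v (\<rho> (s \<otimes> t \<otimes> inv s) *\<^sub>v v)"
      using assoc_mult_mat_vec[OF R(1)[OF tc] isc v(1)]
        assoc_mult_mat_vec[OF isc R(1)[of "s \<otimes> t \<otimes> inv s"] v(1)] s tc by simp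
    also have "\<dots> = \<chi> (s \<otimes> t \<otimes> inv s) \<cdot>\<^sub>v (\<rho> (inv s) *\<^sub>v v)"
      using v(3)[OF st] mult_mat_vec[OF isc v(1)] by simp
    finally show ?thesis .
  qed
  ultimately show ?thesis using isc v(1) by (simp add: weight_def)
qed

end

context perfect_extension begin

text \<open>At most \<open>n < q\<close> weights occur, so the \<open>g\<close>-orbit of each has fewer than \<open>q\<close> elements, and
  the power \<open>g [^] k\<close> for a common multiple \<open>k\<close> of the smaller numbers fixes all of them. The
  elements of the group fixing all weights form a normal subgroup, which is everything because \<open>k\<close>
  is not divisible by \<open>q\<close>.\<close>

lemma weight_invariant:
  assumes \<rho>: "mat_rep G n \<rho>" and n: "n < q" and T: "T \<lhd> G" and w: "weight n \<rho> T \<chi> v"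
    and s: "s \<in> carrier G" and t: "t \<in> T"
  shows "\<chi> (s \<otimes> t \<otimes> inv s) = \<chi> t"
proof -
  have Tc: "T \<subseteq> carrier G" using normal_imp_subgroup[OF T] subgroup.subset by blast
  define M where "M = {s \<in> carrier G. \<forall>\<chi> v. weight n \<rho> T \<chi> v \<longrightarrow> (\<forall>t\<in>T. \<chi> (s \<otimes> t \<otimes> inv s) = \<chi> t)}"
  have MD: "\<chi> (s \<otimes> t \<otimes> inv s) = \<chi> t" if "s \<in> M" "weight n \<rho> T \<chi> v" "t \<in> T" for s \<chi> v t
    using that unfolding M_def by blast
  have Mc: "s \<in> carrier G" if "s \<in> M" for s using that by (simp add: M_def)
  have "M \<lhd> G"
  proof (rule normal_criterion)
    show "\<one> \<in> M" using Tc by (auto simp: M_def)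
    show "x \<otimes> y \<in> M" if xy: "x \<in> M" "y \<in> M" for x y
      unfolding M_def
    proof (intro CollectI conjI allI impI ballI)
      fix \<chi> v t assume w: "weight n \<rho> T \<chi> v" and t: "t \<in> T"
      have "x \<otimes> y \<otimes> t \<otimes> inv (x \<otimes> y) = x \<otimes> (y \<otimes> t \<otimes> inv y) \<otimes> inv x"
        using Mc xy t Tc by (simp add: word_simps subset_iff)
      then show "\<chi> (x \<otimes> y \<otimes> t \<otimes> inv (x \<otimes> y)) = \<chi> t"
        using MD[OF xy(1) w normal_conj(1)[OF T Mc[OF xy(2)] t]] MD[OF xy(2) w t] by simp
    qed (use Mc xy in simp)
    show "inv x \<in> M" if x: "x \<in> M" for x
      unfolding M_def
    proof (intro CollectI conjI allI impI ballI)
      fix \<chi> v t assume w: "weight n \<rho> T \<chi> v" and t: "t \<in> T"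
      have "x \<otimes> (inv x \<otimes> t \<otimes> x) \<otimes> inv x = t" using Mc[OF x] t Tc by (simp add: word_simps subset_iff)
      then show "\<chi> (inv x \<otimes> t \<otimes> inv (inv x)) = \<chi> t"
        using MD[OF x w normal_conj(2)[OF T Mc[OF x] t]] Mc[OF x] by simp
    qed (use Mc x in simp)
    show "h \<otimes> x \<otimes> inv h \<in> M" if h: "h \<in> carrier G" and x: "x \<in> M" for h x
      unfolding M_def
    proof (intro CollectI conjI allI impI ballI)
      fix \<chi> v t assume w: "weight n \<rho> T \<chi> v" and t: "t \<in> T"
      let ?t = "inv h \<otimes> t \<otimes> h"
      have tt: "?t \<in> T" by (rule normal_conj(2)[OF T h t])
      have "\<chi> (h \<otimes> (x \<otimes> ?t \<otimes> inv x) \<otimes> inv h) = \<chi> (h \<otimes> ?t \<otimes> inv h)"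
        using MD[OF x weight_translate[OF \<rho> T w h] tt] .
      moreover have "h \<otimes> ?t \<otimes> inv h = t" using h t Tc by (simp add: word_simps subset_iff)
      moreover have "h \<otimes> x \<otimes> inv h \<otimes> t \<otimes> inv (h \<otimes> x \<otimes> inv h) = h \<otimes> (x \<otimes> ?t \<otimes> inv x) \<otimes> inv h"
        using h Mc[OF x] t Tc by (simp add: word_simps subset_iff)
      ultimately show "\<chi> (h \<otimes> x \<otimes> inv h \<otimes> t \<otimes> inv (h \<otimes> x \<otimes> inv h)) = \<chi> t" by simp
    qed (use Mc x h in simp)
  qed (auto simp: M_def)
  moreover obtain k :: nat where k: "\<And>m. 0 < m \<Longrightarrow> m < q \<Longrightarrow> m dvd k" "\<not> q dvd k"
    using ex_common_multiple by blast
  have "g [^] k \<in> M"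
    unfolding M_def
  proof (intro CollectI conjI allI impI ballI)
    show "g [^] k \<in> carrier G" using g by simp
    fix \<chi> v t assume w: "weight n \<rho> T \<chi> v" and t: "t \<in> T"
    \<comment> \<open>The weights translated by the powers of \<open>g\<close>. If the first \<open>q\<close> of them were distinct, they
      would be linearly independent.\<close>
    define \<chi>' where "\<chi>' i t = \<chi> (g [^] (i::nat) \<otimes> t \<otimes> inv (g [^] i))" for i t
    have "\<exists>i j. i < j \<and> j < q \<and> (\<forall>t\<in>T. \<chi>' i t = \<chi>' j t)"
    proof (rule ccontr)
      assume neg: "\<not> ?thesis"
      have "q \<le> n"
      proof (rule weights_le_dim[where \<chi> = \<chi>' and v = "\<lambda>i. \<rho> (inv (g [^] i)) *\<^sub>v v" and T = T and \<rho> = \<rho>])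
        show "\<rho> t \<in> carrier_mat n n" if "t \<in> T" for t using mat_repD(1)[OF \<rho>] that Tc by blast
        show "weight n \<rho> T (\<chi>' i) (\<rho> (inv (g [^] i)) *\<^sub>v v)" for i
          unfolding \<chi>'_def by (rule weight_translate[OF \<rho> T w]) (use g in simp)
      qed (use neg in blast)
      with n show False by simp
    qed
    then obtain i j where ij: "i < j" "j < q" "\<And>t. t \<in> T \<Longrightarrow> \<chi>' i t = \<chi>' j t" by blast
    define m where "m = j - i"
    have m: "0 < m" "m < q" using ij by (auto simp: m_def)
    have step: "\<chi> (g [^] m \<otimes> t \<otimes> inv (g [^] m)) = \<chi> t" if t: "t \<in> T" for t
    proof -
      have tc: "t \<in> carrier G" using t Tc by blast
      have gi: "g [^] i \<in> carrier G" using g by simp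
      let ?t = "inv (g [^] i) \<otimes> t \<otimes> g [^] i"
      have tt: "?t \<in> T" by (rule normal_conj(2)[OF T gi t])
      have gj: "g [^] j = g [^] m \<otimes> g [^] i" using ij g by (simp add: m_def nat_pow_mult)
      have "g [^] j \<otimes> ?t \<otimes> inv (g [^] j) = g [^] m \<otimes> t \<otimes> inv (g [^] m)"
        unfolding gj using g tc by (simp add: word_simps)
      moreover have "g [^] i \<otimes> ?t \<otimes> inv (g [^] i) = t" using g tc by (simp add: word_simps)
      ultimately show ?thesis using ij(3)[OF tt] by (simp add: \<chi>'_def)
    qed
    have iter: "\<chi> (g [^] (m * c) \<otimes> t \<otimes> inv (g [^] (m * c))) = \<chi> t" if t: "t \<in> T" for t and c :: nat
    proof (induction c)
      case 0
      then show ?case using t Tc by auto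
    next
      case (Suc c)
      have tc: "t \<in> carrier G" using t Tc by blast
      have gp: "g [^] (m * c) \<in> carrier G" using g by simp
      let ?t = "g [^] (m * c) \<otimes> t \<otimes> inv (g [^] (m * c))"
      have "g [^] (m * Suc c) = g [^] m \<otimes> g [^] (m * c)" using g by (simp add: nat_pow_mult)
      then have "g [^] (m * Suc c) \<otimes> t \<otimes> inv (g [^] (m * Suc c)) = g [^] m \<otimes> ?t \<otimes> inv (g [^] m)"
        using g tc by (simp add: word_simps)
      then show ?case using step[OF normal_conj(1)[OF T gp t]] Suc by simp
    qed
    obtain c where "k = m * c" using k(1)[OF m] by (rule dvdE)
    then show "\<chi> (g [^] k \<otimes> t \<otimes> inv (g [^] k)) = \<chi> t" using iter[OF t] by simp
  qed
  ultimately have "M = carrier G" using full k(2) by blast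
  then show ?thesis using MD[OF _ w t] s by blast
qed

definition invariant :: "nat \<Rightarrow> ('a \<Rightarrow> 'f::field mat) \<Rightarrow> 'f vec set \<Rightarrow> bool" where
  "invariant n \<rho> W \<longleftrightarrow> vec_subspace n W \<and> (\<forall>s\<in>carrier G. \<forall>v\<in>W. \<rho> s *\<^sub>v v \<in> W)"

definition irreducible_rep :: "nat \<Rightarrow> ('a \<Rightarrow> 'f::field mat) \<Rightarrow> bool" where
  "irreducible_rep n \<rho> \<longleftrightarrow> (\<forall>W. invariant n \<rho> W \<longrightarrow> (\<exists>v\<in>W. v \<noteq> 0\<^sub>v n) \<longrightarrow> W = carrier_vec n)"

text \<open>There is a weight, since the image of \<open>T\<close> is commutative. Its weight space is invariant
  under the whole group because the weight is, so by irreducibility it is the whole space.\<close>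

lemma scalar_of_irreducible:
  fixes \<rho> :: "'a \<Rightarrow> complex mat"
  assumes \<rho>: "mat_rep G n \<rho>" and n: "0 < n" "n < q" and irr: "irreducible_rep n \<rho>"
    and T: "T \<lhd> G" and comm: "\<And>s t. s \<in> T \<Longrightarrow> t \<in> T \<Longrightarrow> \<rho> s * \<rho> t = \<rho> t * \<rho> s"
  obtains \<chi> where "\<And>t. t \<in> T \<Longrightarrow> \<rho> t = \<chi> t \<cdot>\<^sub>m 1\<^sub>m n"
proof -
  note R = mat_repD[OF \<rho>]
  have Tc: "T \<subseteq> carrier G" using normal_imp_subgroup[OF T] subgroup.subset by blast
  have "\<rho> ` T \<subseteq> carrier_mat n n" using R(1) Tc by auto
  from ex_common_eigenvector[OF n(1) this] comm
  obtain v where v: "v \<in> carrier_vec n" "v \<noteq> 0\<^sub>v n" "\<forall>A\<in>\<rho> ` T. \<exists>c. A *\<^sub>v v = c \<cdot>\<^sub>v v" by blast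
  then have "\<forall>t. \<exists>c. t \<in> T \<longrightarrow> \<rho> t *\<^sub>v v = c \<cdot>\<^sub>v v" by blast
  from choice[OF this] obtain \<chi> where \<chi>: "\<And>t. t \<in> T \<Longrightarrow> \<rho> t *\<^sub>v v = \<chi> t \<cdot>\<^sub>v v" by blast
  then have w: "weight n \<rho> T \<chi> v" using v by (simp add: weight_def)
  define W where "W = {v \<in> carrier_vec n. \<forall>t\<in>T. \<rho> t *\<^sub>v v = \<chi> t \<cdot>\<^sub>v v}"
  have tcm: "\<rho> t \<in> carrier_mat n n" if "t \<in> T" for t using R(1) that Tc by blast
  have "vec_subspace n W"
    unfolding vec_subspace_def
  proof (intro conjI ballI allI)
    show "0\<^sub>v n \<in> W"
    proof -
      have "\<rho> t *\<^sub>v 0\<^sub>v n = \<chi> t \<cdot>\<^sub>v 0\<^sub>v n" if "t \<in> T" for t using tcm[OF that] by (intro eq_vecI) auto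
      then show ?thesis by (simp add: W_def)
    qed
    show "x + y \<in> W" if "x \<in> W" "y \<in> W" for x y
      using that tcm by (auto simp: W_def mult_add_distrib_mat_vec[of _ n n] smult_add_distrib_vec[of _ n])
    show "c \<cdot>\<^sub>v x \<in> W" if "x \<in> W" for c x
      using that tcm by (auto simp: W_def mult_mat_vec[of _ n n] smult_smult_assoc mult.commute)
  qed (auto simp: W_def)
  moreover have "\<rho> s *\<^sub>v x \<in> W" if s: "s \<in> carrier G" and x: "x \<in> W" for s x
  proof (cases "x = 0\<^sub>v n")
    case True
    have "\<rho> s *\<^sub>v x = 0\<^sub>v n" unfolding True using R(1)[OF s] by (intro eq_vecI) auto
    then show ?thesis using True x by simp
  next
    case False
    have wx: "weight n \<rho> T \<chi> x" using x False by (simp add: W_def weight_def)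
    have "weight n \<rho> T (\<lambda>t. \<chi> (inv s \<otimes> t \<otimes> inv (inv s))) (\<rho> (inv (inv s)) *\<^sub>v x)"
      by (rule weight_translate[OF \<rho> T wx]) (use s in simp)
    moreover have "\<chi> (inv s \<otimes> t \<otimes> inv (inv s)) = \<chi> t" if "t \<in> T" for t
      by (rule weight_invariant[OF \<rho> n(2) T w _ that]) (use s in simp)
    ultimately show ?thesis using s by (auto simp: weight_def W_def)
  qed
  ultimately have "invariant n \<rho> W" by (simp add: invariant_def)
  moreover have "v \<in> W" using v(1) \<chi> by (simp add: W_def)
  ultimately have W: "W = carrier_vec n" using irr v(2) unfolding irreducible_rep_def by blast
  have "\<rho> t = \<chi> t \<cdot>\<^sub>m 1\<^sub>m n" if t: "t \<in> T" for t
  proof (rule eq_matI)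
    fix i j assume "i < dim_row (\<chi> t \<cdot>\<^sub>m 1\<^sub>m n)" "j < dim_col (\<chi> t \<cdot>\<^sub>m 1\<^sub>m n)"
    then have ij: "i < n" "j < n" by auto
    have "unit_vec n j \<in> W" unfolding W by simp
    then have "\<rho> t *\<^sub>v unit_vec n j = \<chi> t \<cdot>\<^sub>v unit_vec n j" using t by (simp add: W_def)
    then have "(\<rho> t *\<^sub>v unit_vec n j) $ i = (\<chi> t \<cdot>\<^sub>v unit_vec n j) $ i" by simp
    moreover have "(\<rho> t *\<^sub>v unit_vec n j) $ i = \<rho> t $$ (i, j)"
      using tcm[OF t] ij by (simp add: scalar_prod_right_unit)
    ultimately show "\<rho> t $$ (i, j) = (\<chi> t \<cdot>\<^sub>m 1\<^sub>m n) $$ (i, j)" using ij by simp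
  qed (use tcm[OF t] in auto)
  then show thesis by (rule that)
qed

lemma det_rep:
  fixes \<rho> :: "'a \<Rightarrow> 'f::field mat"
  assumes \<rho>: "mat_rep G n \<rho>" and s: "s \<in> carrier G"
  shows "det (\<rho> s) = 1"
proof -
  note R = mat_repD[OF \<rho>]
  let ?K = "{s \<in> carrier G. det (\<rho> s) = 1}"
  have inv: "det (\<rho> s) * det (\<rho> (inv s)) = 1" if "s \<in> carrier G" for s
    using det_mult[OF R(1)[OF that] R(1)[of "inv s"]] R(4)[OF that] that by simp
  have mult: "det (\<rho> (s \<otimes> t)) = det (\<rho> s) * det (\<rho> t)" if "s \<in> carrier G" "t \<in> carrier G" for s t
    using det_mult[OF R(1)[OF that(1)] R(1)[OF that(2)]] R(3)[OF that] by simp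
  have "subgroup ?K G"
  proof (rule subgroupI)
    show "inv a \<in> ?K" if "a \<in> ?K" for a using inv[of a] that by simp
    show "a \<otimes> b \<in> ?K" if "a \<in> ?K" "b \<in> ?K" for a b using mult that by simp
    show "?K \<noteq> {}" using R(2) by force
  qed auto
  moreover have "derived_set G (carrier G) \<subseteq> ?K"
  proof
    fix x assume "x \<in> derived_set G (carrier G)"
    then obtain a b where ab: "a \<in> carrier G" "b \<in> carrier G" "x = a \<otimes> b \<otimes> inv a \<otimes> inv b" by auto
    have "det (\<rho> x) = det (\<rho> a) * det (\<rho> b) * det (\<rho> (inv a)) * det (\<rho> (inv b))"
      unfolding ab(3) by (simp only: mult m_closed inv_closed ab(1,2))
    also have "\<dots> = (det (\<rho> a) * det (\<rho> (inv a))) * (det (\<rho> b) * det (\<rho> (inv b)))"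
      by (simp only: ac_simps)
    also have "\<dots> = 1" by (simp only: inv[OF ab(1)] inv[OF ab(2)] mult_1)
    finally show "x \<in> ?K" using ab by simp
  qed
  ultimately have "derived G (carrier G) \<subseteq> ?K"
    unfolding derived_def by (intro generate_subgroup_incl)
  then show ?thesis using perfect s by auto
qed

end

section \<open>Irreducible representations have finite image on the radical\<close>

definition mtrace :: "nat \<Rightarrow> 'f::field mat \<Rightarrow> 'f" where
  "mtrace n A = (\<Sum>i<n. A $$ (i, i))"

lemma mtrace_mult:
  assumes "A \<in> carrier_mat n n" "B \<in> carrier_mat n n"
  shows "mtrace n (A * B) = (\<Sum>i<n. \<Sum>j<n. A $$ (i, j) * B $$ (j, i))"
  using mat_mult_as_sum[OF assms] by (simp add: mtrace_def)

lemma mtrace_comm: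
  assumes "A \<in> carrier_mat n n" "B \<in> carrier_mat n n"
  shows "mtrace n (A * B) = mtrace n (B * A)"
  unfolding mtrace_mult[OF assms] mtrace_mult[OF assms(2,1)]
  by (subst sum.swap) (simp add: mult.commute)

lemma (in group) finite_image_of_finite_classes:
  assumes \<rho>: "mat_rep G n \<rho>" and V: "V \<subseteq> U" "U \<subseteq> carrier G" and fin: "finite (\<rho> ` V)" "finite (f ` U)"
    and f: "\<And>u w. u \<in> U \<Longrightarrow> w \<in> U \<Longrightarrow> f u = f w \<Longrightarrow> inv u \<otimes> w \<in> V"
  shows "finite (\<rho> ` U)"
proof -
  define r where "r c = (SOME x. x \<in> U \<and> f x = c)" for c
  have r: "r (f x) \<in> U \<and> f (r (f x)) = f x" if "x \<in> U" for x
    unfolding r_def by (rule someI[of _ x]) (use that in simp)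
  have "\<rho> ` U \<subseteq> (\<lambda>(c, A). \<rho> (r c) * A) ` (f ` U \<times> \<rho> ` V)"
  proof
    fix A assume "A \<in> \<rho> ` U"
    then obtain x where x: "x \<in> U" "A = \<rho> x" by blast
    have rx: "r (f x) \<in> U" "f (r (f x)) = f x" using r[OF x(1)] by auto
    have c: "r (f x) \<in> carrier G" "x \<in> carrier G" using rx x V by auto
    have "inv (r (f x)) \<otimes> x \<in> V" using f[OF rx(1) x(1)] rx(2) by simp
    moreover have "A = \<rho> (r (f x)) * \<rho> (inv (r (f x)) \<otimes> x)"
      using mat_repD(3)[OF \<rho>, of "r (f x)" "inv (r (f x)) \<otimes> x"] c x(2) by (simp add: inv_cancel_left)
    ultimately show "A \<in> (\<lambda>(c, A). \<rho> (r c) * A) ` (f ` U \<times> \<rho> ` V)" using x(1) by force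
  qed
  then show ?thesis by (rule finite_subset) (intro finite_imageI finite_cartesian_product fin)
qed

lemma inverse_mat_commute:
  assumes A: "(A :: 'f::field mat) \<in> carrier_mat n n" and B: "B \<in> carrier_mat n n" and K: "K \<in> carrier_mat n n"
    and AB: "A * B = 1\<^sub>m n" and BA: "B * A = 1\<^sub>m n" and AK: "A * K = K * A"
  shows "B * K = K * B"
proof -
  have "B * K = (B * K) * (A * B)" using AB B K by simp
  also have "\<dots> = B * (K * A) * B" using A B K by (simp add: assoc_mult_mat[of _ n n _ n _ n])
  also have "\<dots> = (B * A) * K * B" unfolding AK[symmetric] using A B K by (simp add: assoc_mult_mat[of _ n n _ n _ n])
  also have "\<dots> = K * B" using BA K by simp
  finally show ?thesis .
qed

lemma scalar_mat_mult:
  assumes "(A :: 'f::field mat) \<in> carrier_mat n n"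
  shows "(a \<cdot>\<^sub>m 1\<^sub>m n) * A = a \<cdot>\<^sub>m A"
  using mult_smult_assoc_mat[of "1\<^sub>m n" n n A n a] assms by simp

lemma (in group) derived_memI:
  "x \<in> U \<Longrightarrow> y \<in> U \<Longrightarrow> x \<otimes> y \<otimes> inv x \<otimes> inv y \<in> derived G U"
  unfolding derived_def by (rule generate.incl) blast

context perfect_extension begin

text \<open>A scalar matrix of determinant 1 has an \<open>n\<close>-th root of unity on its diagonal.\<close>

lemma finite_scalar_image:
  fixes \<rho> :: "'a \<Rightarrow> complex mat"
  assumes \<rho>: "mat_rep G n \<rho>" and n: "0 < n" "n < q" and irr: "irreducible_rep n \<rho>"
    and T: "T \<lhd> G" and comm: "\<And>s t. s \<in> T \<Longrightarrow> t \<in> T \<Longrightarrow> \<rho> s * \<rho> t = \<rho> t * \<rho> s"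
  shows "finite (\<rho> ` T)"
proof -
  obtain \<chi> where \<chi>: "\<And>t. t \<in> T \<Longrightarrow> \<rho> t = \<chi> t \<cdot>\<^sub>m 1\<^sub>m n" using scalar_of_irreducible[OF assms] by blast
  have Tc: "T \<subseteq> carrier G" using normal_imp_subgroup[OF T] subgroup.subset by blast
  have "\<chi> t ^ n = 1" if t: "t \<in> T" for t
    using det_rep[OF \<rho>, of t] \<chi>[OF t] t Tc by (auto simp: det_smult)
  then have "\<rho> ` T \<subseteq> (\<lambda>z. z \<cdot>\<^sub>m 1\<^sub>m n) ` {z. z ^ n = 1}" using \<chi> by auto
  moreover have "finite {z :: complex. z ^ n = 1}" using n(1) by (intro finite_roots_unity) simp
  ultimately show ?thesis by (meson finite_imageI finite_subset)
qed

text \<open>Let \<open>Z\<close> consist of the elements of \<open>C\<close> that commute with \<open>C\<close> under \<open>\<rho>\<close>. It acts by scalars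
  and has finite image. If \<open>c\<close> is not in \<open>Z\<close>, some conjugate of \<open>\<rho> c\<close> is a scalar multiple of it
  with a factor other than 1, so its trace is 0. Hence for representatives \<open>c i\<close> of distinct
  cosets of \<open>Z\<close> the traces of \<open>\<rho> (inv (c j) \<otimes> c i)\<close> are 0 unless \<open>i = j\<close>: the matrices \<open>\<rho> (c i)\<close>
  are orthogonal for the trace form, and there are at most \<open>n\<^sup>2\<close> of them.\<close>

lemma finite_image_of_class_two:
  fixes \<rho> :: "'a \<Rightarrow> complex mat"
  assumes \<rho>: "mat_rep G n \<rho>" and n: "0 < n" "n < q" and irr: "irreducible_rep n \<rho>"
    and C: "C \<lhd> G"
    and comm: "\<And>x y z. x \<in> C \<Longrightarrow> y \<in> C \<Longrightarrow> z \<in> C \<Longrightarrow>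
      \<rho> ((x \<otimes> y \<otimes> inv x \<otimes> inv y) \<otimes> z) = \<rho> (z \<otimes> (x \<otimes> y \<otimes> inv x \<otimes> inv y))"
  shows "finite (\<rho> ` C)"
proof -
  note R = mat_repD[OF \<rho>]
  have Cs: "subgroup C G" using normal_imp_subgroup[OF C] .
  have Cc: "\<And>x. x \<in> C \<Longrightarrow> x \<in> carrier G" using subgroup.subset[OF Cs] by blast
  define Z where "Z = {z \<in> C. \<forall>c\<in>C. \<rho> (z \<otimes> c) = \<rho> (c \<otimes> z)}"
  have ZC: "Z \<subseteq> C" by (auto simp: Z_def)
  have Zcomm: "\<rho> z * \<rho> c = \<rho> c * \<rho> z" if "z \<in> Z" "c \<in> C" for z c
    using that R(3)[of z c] R(3)[of c z] Cc by (simp add: Z_def)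
  have ZI: "z \<in> Z" if "z \<in> C" "\<And>c. c \<in> C \<Longrightarrow> \<rho> z * \<rho> c = \<rho> c * \<rho> z" for z
    using that R(3) Cc by (simp add: Z_def)
  have carr: "\<rho> x \<in> carrier_mat n n" if "x \<in> C" for x using R(1) Cc that by blast
  have Z: "Z \<lhd> G"
  proof (rule normal_criterion)
    show "Z \<subseteq> carrier G" using ZC Cc by blast
    show "\<one> \<in> Z" using subgroup.one_closed[OF Cs] Cc by (auto simp: Z_def)
    show "x \<otimes> y \<in> Z" if xy: "x \<in> Z" "y \<in> Z" for x y
    proof (rule ZI)
      have m: "x \<in> C" "y \<in> C" using xy ZC by auto
      show "x \<otimes> y \<in> C" using m subgroup.m_closed[OF Cs] by blast
      fix c assume c: "c \<in> C"
      have "\<rho> (x \<otimes> y) * \<rho> c = \<rho> x * (\<rho> y * \<rho> c)"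
        using R(3)[OF Cc[OF m(1)] Cc[OF m(2)]] carr m c by (simp add: assoc_mult_mat[of _ n n _ n _ n])
      also have "\<dots> = (\<rho> x * \<rho> c) * \<rho> y"
        using Zcomm[OF xy(2) c] carr m c by (simp add: assoc_mult_mat[of _ n n _ n _ n])
      also have "\<dots> = \<rho> c * (\<rho> x * \<rho> y)"
        using Zcomm[OF xy(1) c] carr m c by (simp add: assoc_mult_mat[of _ n n _ n _ n])
      finally show "\<rho> (x \<otimes> y) * \<rho> c = \<rho> c * \<rho> (x \<otimes> y)" using R(3)[OF Cc[OF m(1)] Cc[OF m(2)]] by simp
    qed
    show "inv x \<in> Z" if x: "x \<in> Z" for x
    proof (rule ZI)
      have m: "x \<in> C" using x ZC by auto
      show im: "inv x \<in> C" using m subgroup.m_inv_closed[OF Cs] by blast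
      fix c assume c: "c \<in> C"
      show "\<rho> (inv x) * \<rho> c = \<rho> c * \<rho> (inv x)"
        by (rule inverse_mat_commute[OF carr[OF m] carr[OF im] carr[OF c] R(4,5)[OF Cc[OF m]] Zcomm[OF x c]])
    qed
    show "h \<otimes> x \<otimes> inv h \<in> Z" if h: "h \<in> carrier G" and x: "x \<in> Z" for h x
    proof -
      have m: "x \<in> C" using x ZC by auto
      have "\<rho> (h \<otimes> x \<otimes> inv h \<otimes> c) = \<rho> (c \<otimes> (h \<otimes> x \<otimes> inv h))" if c: "c \<in> C" for c
      proof -
        let ?c = "inv h \<otimes> c \<otimes> h"
        have cc: "?c \<in> C" by (rule normal_conj(2)[OF C h c])
        have eq: "\<rho> (x \<otimes> ?c) = \<rho> (?c \<otimes> x)" using x cc by (simp add: Z_def)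
        have "h \<otimes> x \<otimes> inv h \<otimes> c = h \<otimes> (x \<otimes> ?c) \<otimes> inv h" "c \<otimes> (h \<otimes> x \<otimes> inv h) = h \<otimes> (?c \<otimes> x) \<otimes> inv h"
          using h Cc[OF m] Cc[OF c] by (simp_all add: word_simps)
        moreover have "\<rho> (h \<otimes> y \<otimes> inv h) = \<rho> h * \<rho> y * \<rho> (inv h)" if "y \<in> carrier G" for y
          using R(3) h that by simp
        ultimately show ?thesis using eq h Cc[OF m] Cc[OF c] by simp
      qed
      then show ?thesis using normal_conj(1)[OF C h m] by (simp add: Z_def)
    qed
  qed
  obtain \<chi> where \<chi>: "\<And>t. t \<in> Z \<Longrightarrow> \<rho> t = \<chi> t \<cdot>\<^sub>m 1\<^sub>m n"
    using scalar_of_irreducible[OF \<rho> n irr Z] Zcomm ZC by blast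
  have finZ: "finite (\<rho> ` Z)" by (rule finite_scalar_image[OF \<rho> n irr Z]) (use Zcomm ZC in blast)
  have trace0: "mtrace n (\<rho> c) = 0" if c: "c \<in> C" "c \<notin> Z" for c
  proof -
    obtain y where y: "y \<in> C" "\<rho> c * \<rho> y \<noteq> \<rho> y * \<rho> c" using ZI[OF c(1)] c(2) by blast
    let ?w = "y \<otimes> c \<otimes> inv y \<otimes> inv c"
    have yc: "y \<in> carrier G" "c \<in> carrier G" using y c Cc by auto
    have wC: "?w \<in> C" using y(1) c(1) subgroup.m_closed[OF Cs] subgroup.m_inv_closed[OF Cs] by blast
    have "?w \<in> Z" using comm[OF y(1) c(1)] wC by (simp add: Z_def)
    then have w: "\<rho> ?w = \<chi> ?w \<cdot>\<^sub>m 1\<^sub>m n" by (rule \<chi>)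
    have "y \<otimes> c = ?w \<otimes> (c \<otimes> y)" using yc by (simp add: word_simps)
    then have "\<rho> y * \<rho> c = \<rho> ?w * (\<rho> c * \<rho> y)"
      using R(3)[of y c] R(3)[of ?w "c \<otimes> y"] R(3)[of c y] yc by simp
    also have "\<dots> = \<chi> ?w \<cdot>\<^sub>m (\<rho> c * \<rho> y)" unfolding w using carr[OF y(1)] carr[OF c(1)] by (intro scalar_mat_mult) simp
    finally have eq: "\<rho> y * \<rho> c = \<chi> ?w \<cdot>\<^sub>m (\<rho> c * \<rho> y)" .
    have ne: "\<chi> ?w \<noteq> 1"
    proof
      assume 1: "\<chi> ?w = 1"
      have "\<rho> y * \<rho> c = 1 \<cdot>\<^sub>m (\<rho> c * \<rho> y)" using eq unfolding 1 .
      also have "\<dots> = \<rho> c * \<rho> y" by (intro eq_matI) auto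
      finally have "\<rho> c * \<rho> y = \<rho> y * \<rho> c" by simp
      with y(2) show False by simp
    qed
    have "y \<otimes> c \<otimes> inv y = ?w \<otimes> c" using yc by (simp add: word_simps)
    then have "\<rho> y * (\<rho> c * \<rho> (inv y)) = \<rho> ?w * \<rho> c"
      using R(3)[of y "c \<otimes> inv y"] R(3)[of ?w c] R(3)[of c "inv y"] yc by (simp add: m_assoc)
    then have "mtrace n (\<chi> ?w \<cdot>\<^sub>m \<rho> c) = mtrace n (\<rho> y * (\<rho> c * \<rho> (inv y)))" using scalar_mat_mult[OF carr[OF c(1)]] by (simp add: w)
    also have "\<dots> = mtrace n ((\<rho> c * \<rho> (inv y)) * \<rho> y)"
      using R(1)[OF yc(1)] R(1)[OF yc(2)] R(1)[OF inv_closed[OF yc(1)]] by (intro mtrace_comm mult_carrier_mat)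
    also have "(\<rho> c * \<rho> (inv y)) * \<rho> y = \<rho> c * (\<rho> (inv y) * \<rho> y)"
      using yc R(1) by (intro assoc_mult_mat) auto
    also have "\<dots> = \<rho> c" using R(5)[OF yc(1)] carr[OF c(1)] by simp
    finally have "\<chi> ?w * mtrace n (\<rho> c) = mtrace n (\<rho> c)"
      using carr[OF c(1)] by (simp add: mtrace_def sum_distrib_left)
    then show ?thesis using ne by simp
  qed
  define f where "f c = c <# Z" for c
  have f: "inv u \<otimes> w \<in> Z" if uw: "u \<in> C" "w \<in> C" "f u = f w" for u w
  proof -
    have "w \<in> w <# Z" using subgroup.one_closed[OF normal_imp_subgroup[OF Z]] Cc[OF uw(2)]
      unfolding l_coset_def by force
    then obtain z where "z \<in> Z" "w = u \<otimes> z" using uw(3) by (auto simp: f_def l_coset_def)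
    then show ?thesis using Cc uw(1) ZC by (simp add: inv_cancel_left subset_iff)
  qed
  have "finite (f ` C)"
  proof (rule ccontr)
    assume "infinite (f ` C)"
    then obtain B where B: "finite B" "card B = Suc (n * n)" "B \<subseteq> f ` C"
      by (meson infinite_arbitrarily_large)
    obtain b where b: "bij_betw b {..<Suc (n * n)} B"
      using bij_betw_from_nat_into_finite[OF B(1)] ex_bij_betw_nat_finite[OF B(1)] B(2)
      by (auto simp: lessThan_atLeast0)
    have "\<exists>c. c \<in> C \<and> f c = b i" if "i < Suc (n * n)" for i
      using b B(3) that by (force simp: bij_betw_def)
    then have "\<forall>i. \<exists>c. i < Suc (n * n) \<longrightarrow> c \<in> C \<and> f c = b i" by blast
    from choice[OF this] obtain c where c: "\<And>i. i < Suc (n * n) \<Longrightarrow> c i \<in> C" "\<And>i. i < Suc (n * n) \<Longrightarrow> f (c i) = b i"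
      by blast
    have sep: "inv (c j) \<otimes> c i \<notin> Z" if "i < Suc (n * n)" "j < Suc (n * n)" "i \<noteq> j" for i j
    proof
      assume z: "inv (c j) \<otimes> c i \<in> Z" (is "?z \<in> Z")
      have cc: "c i \<in> carrier G" "c j \<in> carrier G" using c that Cc by auto
      have "c i = c j \<otimes> ?z" using cc by (simp add: inv_cancel_left)
      then have "f (c i) = f (c j)"
      proof -
        have Zs: "subgroup Z G" using normal_imp_subgroup[OF Z] .
        have zc: "?z \<in> carrier G" using cc by simp
        have "?z <# Z = Z" using coset_join3[OF zc Zs z] .
        then show ?thesis
          using lcos_m_assoc[OF subgroup.subset[OF Zs] cc(2) zc] \<open>c i = c j \<otimes> ?z\<close> by (simp add: f_def)
      qed
      then show False using c(2) that b unfolding bij_betw_def inj_on_def by force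
    qed
    \<comment> \<open>A matrix is a vector of length \<open>n * n\<close>, with entry \<open>r\<close> in row \<open>r div n\<close> and column
      \<open>r mod n\<close>.\<close>
    obtain a where a: "\<exists>i<Suc (n * n). a i \<noteq> 0"
      "\<And>r. r < n * n \<Longrightarrow> (\<Sum>i<Suc (n * n). a i * \<rho> (c i) $$ (r div n, r mod n)) = 0"
      using ex_nontrivial_relation[of "n * n" "Suc (n * n)" "\<lambda>r i. \<rho> (c i) $$ (r div n, r mod n)"] by blast
    have rel: "(\<Sum>i<Suc (n * n). a i * \<rho> (c i) $$ (r, s)) = 0" if "r < n" "s < n" for r s
    proof -
      have "r * n + s < n * n"
      proof -
        have "r * n + s < r * n + n" using that by simp
        also have "\<dots> = Suc r * n" by simp
        also have "\<dots> \<le> n * n" using that by (intro mult_le_mono1) simp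
        finally show ?thesis .
      qed
      from a(2)[OF this] show ?thesis using that by simp
    qed
    have "a j = 0" if j: "j < Suc (n * n)" for j
    proof -
      have ij: "inv (c j) \<in> C" using c(1)[OF j] subgroup.m_inv_closed[OF Cs] by blast
      have tr: "mtrace n (\<rho> (inv (c j) \<otimes> c i)) = (\<Sum>r<n. \<Sum>s<n. \<rho> (inv (c j)) $$ (r, s) * \<rho> (c i) $$ (s, r))"
        if "i < Suc (n * n)" for i
        using R(3)[OF Cc[OF ij] Cc[OF c(1)[OF that]]] mtrace_mult[OF carr[OF ij] carr[OF c(1)[OF that]]] by simp
      have "(\<Sum>i<Suc (n * n). a i * mtrace n (\<rho> (inv (c j) \<otimes> c i)))
          = (\<Sum>i<Suc (n * n). a i * (\<Sum>r<n. \<Sum>s<n. \<rho> (inv (c j)) $$ (r, s) * \<rho> (c i) $$ (s, r)))"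
        using tr by (intro sum.cong) auto
      also have "\<dots> = (\<Sum>i<Suc (n * n). \<Sum>r<n. \<Sum>s<n. \<rho> (inv (c j)) $$ (r, s) * (a i * \<rho> (c i) $$ (s, r)))"
        by (simp only: sum_distrib_left mult.left_commute)
      also have "\<dots> = (\<Sum>r<n. \<Sum>i<Suc (n * n). \<Sum>s<n. \<rho> (inv (c j)) $$ (r, s) * (a i * \<rho> (c i) $$ (s, r)))"
        by (rule sum.swap)
      also have "\<dots> = (\<Sum>r<n. \<Sum>s<n. \<Sum>i<Suc (n * n). \<rho> (inv (c j)) $$ (r, s) * (a i * \<rho> (c i) $$ (s, r)))"
        by (intro sum.cong refl sum.swap)
      also have "\<dots> = (\<Sum>r<n. \<Sum>s<n. \<rho> (inv (c j)) $$ (r, s) * (\<Sum>i<Suc (n * n). a i * \<rho> (c i) $$ (s, r)))"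
        by (simp only: sum_distrib_left)
      also have "\<dots> = 0" using rel by simp
      finally have 0: "(\<Sum>i<Suc (n * n). a i * mtrace n (\<rho> (inv (c j) \<otimes> c i))) = 0" .
      have "(\<Sum>i<Suc (n * n). a i * mtrace n (\<rho> (inv (c j) \<otimes> c i))) = (\<Sum>i<Suc (n * n). if i = j then a j * of_nat n else 0)"
      proof (intro sum.cong refl)
        fix i assume "i \<in> {..<Suc (n * n)}"
        then have i: "i < Suc (n * n)" by simp
        show "a i * mtrace n (\<rho> (inv (c j) \<otimes> c i)) = (if i = j then a j * of_nat n else 0)"
        proof (cases "i = j")
          case True
          have "mtrace n (1\<^sub>m n :: complex mat) = of_nat n" by (simp add: mtrace_def)
          then show ?thesis using True Cc[OF c(1)[OF j]] R(2) by simp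
        next
          case False
          have "inv (c j) \<otimes> c i \<in> C" using ij c(1)[OF i] subgroup.m_closed[OF Cs] by blast
          then show ?thesis using trace0 sep[OF i j False] False by simp
        qed
      qed
      also have "\<dots> = a j * of_nat n" using j by simp
      finally show "a j = 0" using 0 n(1) by simp
    qed
    with a(1) show False by blast
  qed
  then show ?thesis
    by (rule finite_image_of_finite_classes[OF \<rho> ZC subgroup.subset[OF Cs] finZ _ f])
qed

text \<open>Conjugation permutes the finite set \<open>\<rho> (derived G U)\<close>, so \<open>U\<close> has only finitely many
  classes modulo the kernel \<open>C\<close> of this action. Commutators of elements of \<open>C\<close> lie in the derived
  subgroup, so their images commute with those of \<open>C\<close>, and the class two case applies.\<close>

lemma finite_image_step:
  fixes \<rho> :: "'a \<Rightarrow> complex mat"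
  assumes \<rho>: "mat_rep G n \<rho>" and n: "0 < n" "n < q" and irr: "irreducible_rep n \<rho>"
    and U: "U \<lhd> G" and fin: "finite (\<rho> ` derived G U)"
  shows "finite (\<rho> ` U)"
proof -
  note R = mat_repD[OF \<rho>]
  let ?D = "derived G U"
  have Us: "subgroup U G" using normal_imp_subgroup[OF U] .
  have D: "?D \<lhd> G" by (rule derived_is_normal[OF U])
  have DU: "?D \<subseteq> U" by (rule derived_incl[OF order_refl Us])
  have Uc: "\<And>x. x \<in> U \<Longrightarrow> x \<in> carrier G" using subgroup.subset[OF Us] by blast
  have Dc: "\<And>x. x \<in> ?D \<Longrightarrow> x \<in> carrier G" using DU Uc by blast
  define F where "F u = (\<lambda>A\<in>\<rho> ` ?D. \<rho> u * A * \<rho> (inv u))" for u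
  have conj: "\<rho> u * \<rho> x * \<rho> (inv u) = \<rho> (u \<otimes> x \<otimes> inv u)" if "u \<in> carrier G" "x \<in> carrier G" for u x
    using R(3) that by simp
  define C where "C = {u \<in> U. \<forall>x\<in>?D. \<rho> (u \<otimes> x \<otimes> inv u) = \<rho> x}"
  have CD: "\<rho> (u \<otimes> x) = \<rho> (x \<otimes> u)" if "u \<in> C" "x \<in> ?D" for u x
  proof -
    have c: "u \<in> carrier G" "x \<in> carrier G" using that Uc Dc by (auto simp: C_def)
    have "u \<otimes> x = (u \<otimes> x \<otimes> inv u) \<otimes> u" using c by (simp add: word_simps)
    then have "\<rho> (u \<otimes> x) = \<rho> (u \<otimes> x \<otimes> inv u) * \<rho> u" using R(3)[of "u \<otimes> x \<otimes> inv u" u] c by simp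
    also have "\<dots> = \<rho> (x \<otimes> u)" using that R(3)[of x u] c by (simp add: C_def)
    finally show ?thesis .
  qed
  have CU: "C \<subseteq> U" by (auto simp: C_def)
  have Cn: "C \<lhd> G"
  proof (rule normal_criterion)
    show "C \<subseteq> carrier G" using CU Uc by blast
    show "\<one> \<in> C" using subgroup.one_closed[OF Us] Dc by (auto simp: C_def)
    show "x \<otimes> y \<in> C" if xy: "x \<in> C" "y \<in> C" for x y
    proof -
      have m: "x \<in> U" "y \<in> U" using xy CU by auto
      have "\<rho> (x \<otimes> y \<otimes> d \<otimes> inv (x \<otimes> y)) = \<rho> d" if d: "d \<in> ?D" for d
      proof -
        have "x \<otimes> y \<otimes> d \<otimes> inv (x \<otimes> y) = x \<otimes> (y \<otimes> d \<otimes> inv y) \<otimes> inv x"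
          using m Uc Dc[OF d] by (simp add: word_simps)
        then show ?thesis using xy d normal_conj(1)[OF D Uc[OF m(2)] d] by (simp add: C_def)
      qed
      then show ?thesis using subgroup.m_closed[OF Us m] by (simp add: C_def)
    qed
    show "inv x \<in> C" if x: "x \<in> C" for x
    proof -
      have m: "x \<in> U" using x CU by auto
      have "\<rho> (inv x \<otimes> d \<otimes> inv (inv x)) = \<rho> d" if d: "d \<in> ?D" for d
      proof -
        have dd: "inv x \<otimes> d \<otimes> x \<in> ?D" by (rule normal_conj(2)[OF D Uc[OF m] d])
        have "\<rho> (x \<otimes> (inv x \<otimes> d \<otimes> x) \<otimes> inv x) = \<rho> (inv x \<otimes> d \<otimes> x)" using x dd by (simp add: C_def)
        moreover have "x \<otimes> (inv x \<otimes> d \<otimes> x) \<otimes> inv x = d" using Uc[OF m] Dc[OF d] by (simp add: word_simps)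
        ultimately show ?thesis using Uc[OF m] by simp
      qed
      then show ?thesis using subgroup.m_inv_closed[OF Us m] by (simp add: C_def)
    qed
    show "h \<otimes> x \<otimes> inv h \<in> C" if h: "h \<in> carrier G" and x: "x \<in> C" for h x
    proof -
      have m: "x \<in> U" using x CU by auto
      have "\<rho> (h \<otimes> x \<otimes> inv h \<otimes> d \<otimes> inv (h \<otimes> x \<otimes> inv h)) = \<rho> d" if d: "d \<in> ?D" for d
      proof -
        let ?d = "inv h \<otimes> d \<otimes> h"
        have dd: "?d \<in> ?D" by (rule normal_conj(2)[OF D h d])
        have eq: "\<rho> (x \<otimes> ?d \<otimes> inv x) = \<rho> ?d" using x dd by (simp add: C_def)
        have "h \<otimes> x \<otimes> inv h \<otimes> d \<otimes> inv (h \<otimes> x \<otimes> inv h) = h \<otimes> (x \<otimes> ?d \<otimes> inv x) \<otimes> inv h"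
          using h Uc[OF m] Dc[OF d] by (simp add: word_simps)
        then have "\<rho> (h \<otimes> x \<otimes> inv h \<otimes> d \<otimes> inv (h \<otimes> x \<otimes> inv h)) = \<rho> h * \<rho> (x \<otimes> ?d \<otimes> inv x) * \<rho> (inv h)"
          using conj[OF h, of "x \<otimes> ?d \<otimes> inv x"] h Uc[OF m] Dc[OF d] by simp
        also have "\<dots> = \<rho> (h \<otimes> ?d \<otimes> inv h)" unfolding eq using conj[OF h, of ?d] h Dc[OF d] by simp
        also have "h \<otimes> ?d \<otimes> inv h = d" using h Dc[OF d] by (simp add: word_simps)
        finally show ?thesis .
      qed
      then show ?thesis using normal_conj(1)[OF U h m] by (simp add: C_def)
    qed
  qed
  have "finite (\<rho> ` C)"
  proof (rule finite_image_of_class_two[OF \<rho> n irr Cn])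
    fix x y z assume "x \<in> C" "y \<in> C" and z: "z \<in> C"
    then have d: "x \<otimes> y \<otimes> inv x \<otimes> inv y \<in> ?D" using CU by (intro derived_memI) auto
    show "\<rho> ((x \<otimes> y \<otimes> inv x \<otimes> inv y) \<otimes> z) = \<rho> (z \<otimes> (x \<otimes> y \<otimes> inv x \<otimes> inv y))"
      using CD[OF z d] by simp
  qed
  moreover have "finite (F ` U)"
  proof (rule finite_subset)
    show "F ` U \<subseteq> \<rho> ` ?D \<rightarrow>\<^sub>E \<rho> ` ?D"
    proof
      fix f assume "f \<in> F ` U"
      then obtain u where u: "u \<in> U" "f = F u" by blast
      have "\<rho> u * A * \<rho> (inv u) \<in> \<rho> ` ?D" if "A \<in> \<rho> ` ?D" for A
        using that conj[OF Uc[OF u(1)] Dc] normal_conj(1)[OF D Uc[OF u(1)]] by auto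
      then show "f \<in> \<rho> ` ?D \<rightarrow>\<^sub>E \<rho> ` ?D" unfolding u(2) F_def by auto
    qed
    show "finite (\<rho> ` ?D \<rightarrow>\<^sub>E \<rho> ` ?D)" using fin by (intro finite_PiE)
  qed
  moreover have "inv u \<otimes> w \<in> C" if uw: "u \<in> U" "w \<in> U" "F u = F w" for u w
  proof -
    have c: "u \<in> carrier G" "w \<in> carrier G" using uw Uc by auto
    have "\<rho> (inv u \<otimes> w \<otimes> d \<otimes> inv (inv u \<otimes> w)) = \<rho> d" if d: "d \<in> ?D" for d
    proof -
      have dc: "d \<in> carrier G" using Dc[OF d] .
      have "F u (\<rho> d) = F w (\<rho> d)" using uw(3) by simp
      then have eq: "\<rho> (w \<otimes> d \<otimes> inv w) = \<rho> (u \<otimes> d \<otimes> inv u)" using d conj c dc by (simp add: F_def)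
      have "inv u \<otimes> w \<otimes> d \<otimes> inv (inv u \<otimes> w) = inv u \<otimes> (w \<otimes> d \<otimes> inv w) \<otimes> inv (inv u)"
        using c dc by (simp add: word_simps)
      then have "\<rho> (inv u \<otimes> w \<otimes> d \<otimes> inv (inv u \<otimes> w)) = \<rho> (inv u) * \<rho> (w \<otimes> d \<otimes> inv w) * \<rho> (inv (inv u))"
        using conj[of "inv u" "w \<otimes> d \<otimes> inv w"] c dc by simp
      also have "\<dots> = \<rho> (inv u \<otimes> (u \<otimes> d \<otimes> inv u) \<otimes> inv (inv u))"
        unfolding eq using conj[of "inv u" "u \<otimes> d \<otimes> inv u"] c dc by simp
      also have "inv u \<otimes> (u \<otimes> d \<otimes> inv u) \<otimes> inv (inv u) = d" using c dc by (simp add: word_simps)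
      finally show ?thesis .
    qed
    moreover have "inv u \<otimes> w \<in> U" using uw subgroup.m_closed[OF Us] subgroup.m_inv_closed[OF Us] by blast
    ultimately show ?thesis by (simp add: C_def)
  qed
  ultimately show ?thesis
    by (intro finite_image_of_finite_classes[OF \<rho> CU subgroup.subset[OF Us]])
qed

lemma derived_series_normal: "(derived G ^^ i) N \<lhd> G"
  by (induction i) (use N derived_is_normal in auto)

text \<open>The derived series of \<open>N\<close> is climbed from its trivial end.\<close>

lemma finite_image_of_irreducible:
  fixes \<rho> :: "'a \<Rightarrow> complex mat"
  assumes \<rho>: "mat_rep G n \<rho>" and n: "0 < n" "n < q" and irr: "irreducible_rep n \<rho>"
  shows "finite (\<rho> ` N)"
proof -
  obtain m where m: "(derived G ^^ m) N = {\<one>}" using N_solvable by blast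
  have "finite (\<rho> ` (derived G ^^ (m - i)) N)" if "i \<le> m" for i
    using that
  proof (induction i)
    case (Suc i)
    have "(derived G ^^ (m - i)) N = derived G ((derived G ^^ (m - Suc i)) N)"
      using Suc.prems by (metis Suc_diff_Suc Suc_le_lessD comp_apply funpow.simps(2))
    then show ?case using finite_image_step[OF \<rho> n irr derived_series_normal, of "m - Suc i"] Suc by simp
  qed (simp add: m)
  from this[of m] show ?thesis by simp
qed

end

section \<open>Representations in small dimension are virtually unipotent\<close>

text \<open>Products of differences \<open>\<rho> d - 1\<close> for arbitrary sequences of elements express unipotency
  without a choice of a flag, and they are what iterated commutators become on a section.\<close>

definition mat_prod_minus_one :: "nat \<Rightarrow> ('a \<Rightarrow> 'f::field mat) \<Rightarrow> 'a list \<Rightarrow> 'f mat" where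
  "mat_prod_minus_one n \<rho> ds = foldr (\<lambda>d A. (\<rho> d - 1\<^sub>m n) * A) ds (1\<^sub>m n)"

lemma mat_prod_minus_one_Nil [simp]: "mat_prod_minus_one n \<rho> [] = 1\<^sub>m n"
  by (simp add: mat_prod_minus_one_def)

lemma mat_prod_minus_one_Cons [simp]:
  "mat_prod_minus_one n \<rho> (d # ds) = (\<rho> d - 1\<^sub>m n) * mat_prod_minus_one n \<rho> ds"
  by (simp add: mat_prod_minus_one_def)

lemma mat_prod_minus_one_carrier:
  assumes "\<And>d. d \<in> set ds \<Longrightarrow> \<rho> d \<in> carrier_mat n n"
  shows "mat_prod_minus_one n \<rho> ds \<in> carrier_mat n n"
  using assms by (induction ds) (auto intro!: mult_carrier_mat minus_carrier_mat)

lemma mat_prod_minus_one_append: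
  assumes "\<And>d. d \<in> set (ds @ es) \<Longrightarrow> \<rho> d \<in> carrier_mat n n"
  shows "mat_prod_minus_one n \<rho> (ds @ es) = mat_prod_minus_one n \<rho> ds * mat_prod_minus_one n \<rho> es"
  using assms
proof (induction ds)
  case Nil
  then show ?case using mat_prod_minus_one_carrier[of es \<rho> n] by simp
next
  case (Cons d ds)
  have c: "\<rho> d - 1\<^sub>m n \<in> carrier_mat n n" "mat_prod_minus_one n \<rho> ds \<in> carrier_mat n n"
    "mat_prod_minus_one n \<rho> es \<in> carrier_mat n n"
    using Cons.prems by (auto intro!: mat_prod_minus_one_carrier minus_carrier_mat)
  have "mat_prod_minus_one n \<rho> (ds @ es) = mat_prod_minus_one n \<rho> ds * mat_prod_minus_one n \<rho> es"
    using Cons by simp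
  then show ?case using assoc_mult_mat[OF c] by simp
qed

lemma mat_prod_minus_one_conj:
  assumes P: "(P :: 'f::field mat) \<in> carrier_mat n n" "P' \<in> carrier_mat n n" "P * P' = 1\<^sub>m n" "P' * P = 1\<^sub>m n"
  shows "(\<And>d. d \<in> set ds \<Longrightarrow> \<rho> d \<in> carrier_mat n n) \<Longrightarrow>
    mat_prod_minus_one n (\<lambda>s. P' * \<rho> s * P) ds = P' * mat_prod_minus_one n \<rho> ds * P"
proof (induction ds)
  case Nil
  then show ?case using P by simp
next
  case (Cons d ds)
  have c: "\<rho> d \<in> carrier_mat n n" "mat_prod_minus_one n \<rho> ds \<in> carrier_mat n n"
    using Cons.prems by (auto intro!: mat_prod_minus_one_carrier)
  have "P' * (\<rho> d - 1\<^sub>m n) * P = P' * \<rho> d * P - 1\<^sub>m n"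
    using P c by (simp add: mult_minus_distrib_mat[of _ n n _ n] minus_mult_distrib_mat[of _ n n _ _ n])
  moreover have "P' * ((\<rho> d - 1\<^sub>m n) * mat_prod_minus_one n \<rho> ds) * P =
      (P' * (\<rho> d - 1\<^sub>m n) * P) * (P' * mat_prod_minus_one n \<rho> ds * P)"
    using c by (intro conj_mult[OF P(1-3)]) (auto intro!: minus_carrier_mat)
  ultimately show ?case using Cons by simp
qed

lemma mat_prod_minus_one_blocks:
  assumes k: "k \<le> n"
  shows "(\<And>d. d \<in> set ds \<Longrightarrow> block_upper k n (\<rho> d :: 'f::field mat)) \<Longrightarrow>
    block_upper k n (mat_prod_minus_one n \<rho> ds) \<and>
    upper_block k (mat_prod_minus_one n \<rho> ds) = mat_prod_minus_one k (\<lambda>s. upper_block k (\<rho> s)) ds \<and>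
    lower_block k n (mat_prod_minus_one n \<rho> ds) = mat_prod_minus_one (n - k) (\<lambda>s. lower_block k n (\<rho> s)) ds"
proof (induction ds)
  case Nil
  have "upper_block k (1\<^sub>m n) = (1\<^sub>m k :: 'f mat)" using k by (intro eq_matI) (auto simp: upper_block_def)
  moreover have "lower_block k n (1\<^sub>m n) = (1\<^sub>m (n - k) :: 'f mat)"
    by (intro eq_matI) (auto simp: lower_block_def)
  ultimately show ?case using k by (auto simp: block_upper_def)
next
  case (Cons d ds)
  have d: "block_upper k n (\<rho> d)" using Cons.prems by simp
  then have dc: "\<rho> d \<in> carrier_mat n n" by (simp add: block_upper_def)
  have b: "block_upper k n (\<rho> d - 1\<^sub>m n)" using d k by (auto simp: block_upper_def)
  have u: "upper_block k (\<rho> d - 1\<^sub>m n) = upper_block k (\<rho> d) - 1\<^sub>m k"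
    using dc k by (intro eq_matI) (auto simp: upper_block_def)
  have l: "lower_block k n (\<rho> d - 1\<^sub>m n) = lower_block k n (\<rho> d) - 1\<^sub>m (n - k)"
    using dc by (intro eq_matI) (auto simp: lower_block_def)
  have IH: "block_upper k n (mat_prod_minus_one n \<rho> ds)" using Cons by simp
  show ?case using upper_block_mult[OF b IH k] Cons u l by simp
qed

text \<open>The matrix \<open>B\<close> maps everything into the span of the first \<open>k\<close> unit vectors, and \<open>A\<close>
  vanishes there.\<close>

lemma block_triangular_product_zero:
  assumes A: "block_upper k n (A :: 'f::field mat)" "upper_block k A = 0\<^sub>m k k"
    and B: "block_upper k n B" "lower_block k n B = 0\<^sub>m (n - k) (n - k)" and k: "k \<le> n"
  shows "A * B = 0\<^sub>m n n"
proof (rule eq_matI)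
  have Ac: "A \<in> carrier_mat n n" and Bc: "B \<in> carrier_mat n n" using A B by (auto simp: block_upper_def)
  have A0: "A $$ (i, l) = 0" if "i < n" "l < k" for i l
  proof (cases "i < k")
    case True
    then have "upper_block k A $$ (i, l) = A $$ (i, l)" using that by (simp add: upper_block_def)
    then show ?thesis using A(2) True that by simp
  next
    case False then show ?thesis using A(1) that by (simp add: block_upper_def)
  qed
  have B0: "B $$ (l, j) = 0" if "j < n" "k \<le> l" "l < n" for l j
  proof (cases "j < k")
    case False
    then have "lower_block k n B $$ (l - k, j - k) = B $$ (l, j)" using that by (simp add: lower_block_def)
    then show ?thesis using B(2) False that by (simp add: diff_less_mono)
  next
    case True then show ?thesis using B(1) that by (simp add: block_upper_def)
  qed
  fix i j assume "i < dim_row (0\<^sub>m n n :: 'f mat)" "j < dim_col (0\<^sub>m n n :: 'f mat)"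
  then have ij: "i < n" "j < n" by auto
  have "A $$ (i, l) * B $$ (l, j) = 0" if "l < n" for l using A0[OF ij(1)] B0[OF ij(2)] that by (cases "l < k") auto
  then have "(A * B) $$ (i, j) = 0" unfolding mat_mult_as_sum[OF Ac Bc ij] by (intro sum.neutral) auto
  then show "(A * B) $$ (i, j) = 0\<^sub>m n n $$ (i, j)" using ij by simp
next
  show "dim_row (A * B) = dim_row (0\<^sub>m n n :: 'f mat)" "dim_col (A * B) = dim_col (0\<^sub>m n n :: 'f mat)"
    using A(1) B(1) by (auto simp: block_upper_def)
qed

definition (in group) unipotent_on :: "nat \<Rightarrow> ('a \<Rightarrow> 'f::field mat) \<Rightarrow> 'a set \<Rightarrow> bool" where
  "unipotent_on n \<rho> D \<longleftrightarrow> (\<exists>r. \<forall>ds. length ds = r \<longrightarrow> set ds \<subseteq> D \<longrightarrow> mat_prod_minus_one n \<rho> ds = 0\<^sub>m n n)"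

context perfect_extension begin

text \<open>By induction on the dimension. An irreducible representation is trivial on a subgroup of
  finite index of \<open>N\<close>. In the reducible case a product of differences long enough for both
  diagonal blocks vanishes.\<close>

theorem virtually_unipotent:
  fixes \<rho> :: "'a \<Rightarrow> complex mat"
  assumes "mat_rep G n \<rho>" "n < q"
  shows "\<exists>D. D \<lhd> G \<and> D \<subseteq> N \<and> finite_index_subgroup D G \<and> unipotent_on n \<rho> D"
  using assms
proof (induction n arbitrary: \<rho> rule: less_induct)
  case (less n)
  note \<rho> = less.prems(1)
  note R = mat_repD[OF \<rho>]
  have Ns: "subgroup N G" using normal_imp_subgroup[OF N] .
  have Nc: "N \<subseteq> carrier G" using subgroup.subset[OF Ns] .
  consider "n = 0" | "0 < n" "irreducible_rep n \<rho>" | "0 < n" "\<not> irreducible_rep n \<rho>" by blast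
  then show ?case
  proof cases
    case 1
    have "unipotent_on n \<rho> N" unfolding unipotent_on_def 1
      by (intro exI[of _ 0]) (auto intro!: eq_matI)
    then show ?thesis using N N_finite_index by blast
  next
    case 2
    define D where "D = {s \<in> N. \<rho> s = 1\<^sub>m n}"
    have Dn: "D \<lhd> G"
    proof (rule normal_criterion)
      show "D \<subseteq> carrier G" using Nc by (auto simp: D_def)
      show "\<one> \<in> D" using subgroup.one_closed[OF Ns] R(2) by (simp add: D_def)
      show "x \<otimes> y \<in> D" if "x \<in> D" "y \<in> D" for x y
        using that R(3)[of x y] Nc subgroup.m_closed[OF Ns] by (auto simp: D_def)
      show "inv x \<in> D" if "x \<in> D" for x
      proof -
        have x: "x \<in> N" "x \<in> carrier G" "\<rho> x = 1\<^sub>m n" using that Nc by (auto simp: D_def)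
        have "\<rho> (inv x) = 1\<^sub>m n" using R(5)[OF x(2)] R(1)[of "inv x"] x by simp
        then show ?thesis using subgroup.m_inv_closed[OF Ns x(1)] by (simp add: D_def)
      qed
      show "h \<otimes> x \<otimes> inv h \<in> D" if h: "h \<in> carrier G" and x: "x \<in> D" for h x
      proof -
        have x': "x \<in> N" "x \<in> carrier G" "\<rho> x = 1\<^sub>m n" using x Nc by (auto simp: D_def)
        have "\<rho> (h \<otimes> x \<otimes> inv h) = \<rho> h * \<rho> x * \<rho> (inv h)" using R(3) h x' by simp
        also have "\<dots> = 1\<^sub>m n" using R(4)[OF h] R(1)[OF h] x' by simp
        finally show ?thesis using normal_conj(1)[OF N h x'(1)] by (simp add: D_def)
      qed
    qed
    have Ds: "subgroup D G" using normal_imp_subgroup[OF Dn] .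
    have "finite_index_subgroup D G"
    proof (rule finite_index_trans[OF N_finite_index Ds finite_image_of_irreducible[OF \<rho> 2(1) less.prems(2) 2(2)]])
      fix a b assume ab: "a \<in> N" "b \<in> N" "\<rho> a = \<rho> b"
      have c: "a \<in> carrier G" "b \<in> carrier G" using ab Nc by auto
      have "\<rho> (a \<otimes> inv b) = 1\<^sub>m n" using R(3)[of a "inv b"] R(4)[OF c(2)] c ab(3) by simp
      then show "a \<otimes> inv b \<in> D"
        using ab subgroup.m_closed[OF Ns] subgroup.m_inv_closed[OF Ns] by (simp add: D_def)
    qed
    moreover have "unipotent_on n \<rho> D"
      unfolding unipotent_on_def
    proof (intro exI[of _ 1] allI impI)
      fix ds assume ds: "length ds = 1" "set ds \<subseteq> D"
      then obtain d where "ds = [d]" "\<rho> d = 1\<^sub>m n" by (cases ds) (auto simp: D_def)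
      then show "mat_prod_minus_one n \<rho> ds = 0\<^sub>m n n" by (auto intro!: eq_matI)
    qed
    ultimately show ?thesis using Dn by (auto simp: D_def)
  next
    case 3
    then obtain W v where W: "invariant n \<rho> W" "v \<in> W" "v \<noteq> 0\<^sub>v n" "W \<noteq> carrier_vec n"
      unfolding irreducible_rep_def by blast
    have Ws: "vec_subspace n W" using W by (simp add: invariant_def)
    obtain w where w: "w \<in> carrier_vec n" "w \<notin> W" using W(4) Ws by (auto simp: vec_subspace_def)
    from ex_adapted_basis[OF Ws W(2,3) w] obtain P P' k where
      P: "P \<in> carrier_mat n n" "P' \<in> carrier_mat n n" "P * P' = 1\<^sub>m n" "P' * P = 1\<^sub>m n" and
      k: "0 < k" "k < n" and
      blk: "\<And>B i j. B \<in> carrier_mat n n \<Longrightarrow> (\<And>v. v \<in> W \<Longrightarrow> B *\<^sub>v v \<in> W) \<Longrightarrow> k \<le> i \<Longrightarrow> i < n \<Longrightarrow> j < k \<Longrightarrow>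
       (P' * B * P) $$ (i, j) = 0" by metis
    define \<rho>' where "\<rho>' s = P' * \<rho> s * P" for s
    have bu: "block_upper k n (\<rho>' s)" if s: "s \<in> carrier G" for s
    proof -
      have "\<rho>' s $$ (i, j) = 0" if "k \<le> i" "i < n" "j < k" for i j
        unfolding \<rho>'_def by (rule blk[OF R(1)[OF s] _ that]) (use W(1) s in \<open>auto simp: invariant_def\<close>)
      moreover have "\<rho>' s \<in> carrier_mat n n" using R(1)[OF s] P by (simp add: \<rho>'_def)
      ultimately show ?thesis by (simp add: block_upper_def)
    qed
    have mult: "\<rho>' (s \<otimes> t) = \<rho>' s * \<rho>' t" if "s \<in> carrier G" "t \<in> carrier G" for s t
      unfolding \<rho>'_def R(3)[OF that] by (rule conj_mult[OF P(1-3) R(1)[OF that(1)] R(1)[OF that(2)]])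
    have one: "\<rho>' \<one> = 1\<^sub>m n" using R(2) P by (simp add: \<rho>'_def)
    have kn: "k \<le> n" using k by simp
    have "mat_rep G k (\<lambda>s. upper_block k (\<rho>' s))"
      unfolding mat_rep_def
    proof (intro conjI ballI)
      show "upper_block k (\<rho>' \<one>) = 1\<^sub>m k" unfolding one using kn by (intro eq_matI) (auto simp: upper_block_def)
      show "upper_block k (\<rho>' (s \<otimes> t)) = upper_block k (\<rho>' s) * upper_block k (\<rho>' t)"
        if "s \<in> carrier G" "t \<in> carrier G" for s t
        using upper_block_mult(1)[OF bu[OF that(1)] bu[OF that(2)] kn] mult[OF that] by simp
    qed simp
    from less.IH[OF k(2) this] obtain D1 where D1: "D1 \<lhd> G" "D1 \<subseteq> N" "finite_index_subgroup D1 G"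
      "unipotent_on k (\<lambda>s. upper_block k (\<rho>' s)) D1" using less.prems(2) k by auto
    have "mat_rep G (n - k) (\<lambda>s. lower_block k n (\<rho>' s))"
      unfolding mat_rep_def
    proof (intro conjI ballI)
      show "lower_block k n (\<rho>' \<one>) = 1\<^sub>m (n - k)" unfolding one by (intro eq_matI) (auto simp: lower_block_def)
      show "lower_block k n (\<rho>' (s \<otimes> t)) = lower_block k n (\<rho>' s) * lower_block k n (\<rho>' t)"
        if "s \<in> carrier G" "t \<in> carrier G" for s t
        using upper_block_mult(2)[OF bu[OF that(1)] bu[OF that(2)] kn] mult[OF that] by simp
    qed simp
    moreover have "n - k < n" "n - k < q" using k less.prems(2) by simp_all
    ultimately obtain D2 where D2: "D2 \<lhd> G" "D2 \<subseteq> N" "finite_index_subgroup D2 G"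
      "unipotent_on (n - k) (\<lambda>s. lower_block k n (\<rho>' s)) D2" using less.IH by blast
    obtain r1 where r1: "\<And>ds. length ds = r1 \<Longrightarrow> set ds \<subseteq> D1 \<Longrightarrow>
        mat_prod_minus_one k (\<lambda>s. upper_block k (\<rho>' s)) ds = 0\<^sub>m k k" using D1(4) by (auto simp: unipotent_on_def)
    obtain r2 where r2: "\<And>ds. length ds = r2 \<Longrightarrow> set ds \<subseteq> D2 \<Longrightarrow>
        mat_prod_minus_one (n - k) (\<lambda>s. lower_block k n (\<rho>' s)) ds = 0\<^sub>m (n - k) (n - k)"
      using D2(4) by (auto simp: unipotent_on_def)
    have "unipotent_on n \<rho> (D1 \<inter> D2)"
      unfolding unipotent_on_def
    proof (intro exI[of _ "r1 + r2"] allI impI)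
      fix ds assume len: "length ds = r1 + r2" and sub: "set ds \<subseteq> D1 \<inter> D2"
      define d1 d2 where "d1 = take r1 ds" and "d2 = drop r1 ds"
      have ds: "ds = d1 @ d2" "length d1 = r1" "length d2 = r2" using len by (auto simp: d1_def d2_def)
      have sc: "set ds \<subseteq> carrier G" using sub D1(2) Nc by blast
      have b: "block_upper k n (\<rho>' d)" if "d \<in> set d1 \<union> set d2" for d using bu sc ds that by auto
      have c': "\<rho>' d \<in> carrier_mat n n" if "d \<in> set ds" for d using b[of d] that ds by (auto simp: block_upper_def)
      have m1: "block_upper k n (mat_prod_minus_one n \<rho>' d1)" "upper_block k (mat_prod_minus_one n \<rho>' d1) = 0\<^sub>m k k"
        using mat_prod_minus_one_blocks[OF kn, of d1 \<rho>'] b r1[OF ds(2)] sub ds(1) by auto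
      have m2: "block_upper k n (mat_prod_minus_one n \<rho>' d2)"
        "lower_block k n (mat_prod_minus_one n \<rho>' d2) = 0\<^sub>m (n - k) (n - k)"
        using mat_prod_minus_one_blocks[OF kn, of d2 \<rho>'] b r2[OF ds(3)] sub ds(1) by auto
      have z: "mat_prod_minus_one n \<rho>' ds = 0\<^sub>m n n"
        using mat_prod_minus_one_append[of d1 d2 \<rho>' n] c' ds(1) block_triangular_product_zero[OF m1 m2 kn] by simp
      have c: "\<rho> d \<in> carrier_mat n n" if "d \<in> set ds" for d using R(1) sc that by blast
      have pc: "mat_prod_minus_one n \<rho> ds \<in> carrier_mat n n" by (rule mat_prod_minus_one_carrier[OF c])
      have "0\<^sub>m n n = P' * mat_prod_minus_one n \<rho> ds * P"
        using mat_prod_minus_one_conj[OF P, of ds \<rho>] c z unfolding \<rho>'_def by simp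
      then have "P * 0\<^sub>m n n * P' = P * (P' * mat_prod_minus_one n \<rho> ds * P) * P'" by simp
      also have "\<dots> = (P * P') * mat_prod_minus_one n \<rho> ds * (P * P')"
        using P(1,2) pc by (simp add: assoc_mult_mat[of _ n n _ n _ n])
      also have "\<dots> = mat_prod_minus_one n \<rho> ds" using P pc by simp
      finally show "mat_prod_minus_one n \<rho> ds = 0\<^sub>m n n" using P by simp
    qed
    moreover have "D1 \<inter> D2 \<lhd> G" using normal_subgroup_intersect D1 D2 by blast
    ultimately show ?thesis using finite_index_inter D1 D2 by blast
  qed
qed

end

section \<open>Conjugation on a rational section\<close>

primrec iter_commutator :: "('a, 'b) monoid_scheme \<Rightarrow> 'a list \<Rightarrow> 'a \<Rightarrow> 'a" where
  "iter_commutator G [] y = y"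
| "iter_commutator G (d # ds) y = (let z = iter_commutator G ds y in d \<otimes>\<^bsub>G\<^esub> z \<otimes>\<^bsub>G\<^esub> inv\<^bsub>G\<^esub> d \<otimes>\<^bsub>G\<^esub> inv\<^bsub>G\<^esub> z)"

text \<open>The section \<open>L / K\<close> seen through coordinates on its rational space. The values of \<open>c\<close>
  outside \<open>L\<close> and at indices from \<open>n\<close> on are arbitrary.\<close>

locale rational_section = group G for G (structure) +
  fixes L K :: "'a set" and n :: nat and x :: "nat \<Rightarrow> 'a" and c :: "'a \<Rightarrow> nat \<Rightarrow> rat"
  assumes L: "L \<lhd> G" and K: "K \<lhd> G" and K_le_L: "K \<subseteq> L"
    and x_in: "\<And>i. i < n \<Longrightarrow> x i \<in> L"
    and c_mult: "\<And>a b i. a \<in> L \<Longrightarrow> b \<in> L \<Longrightarrow> i < n \<Longrightarrow> c (a \<otimes> b) i = c a i + c b i"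
    and c_x: "\<And>i j. i < n \<Longrightarrow> j < n \<Longrightarrow> c (x i) j = of_bool (i = j)"
    and c_zero_iff: "\<And>a. a \<in> L \<Longrightarrow> (\<forall>i<n. c a i = 0) \<longleftrightarrow> (\<exists>k::nat. 0 < k \<and> a [^] k \<in> K)"
begin

lemma L_subgroup: "subgroup L G" using L by (rule normal_imp_subgroup)

lemma L_carrier: "a \<in> L \<Longrightarrow> a \<in> carrier G" using subgroup.subset[OF L_subgroup] by blast

lemma L_closed: "\<one> \<in> L" "a \<in> L \<Longrightarrow> b \<in> L \<Longrightarrow> a \<otimes> b \<in> L" "a \<in> L \<Longrightarrow> inv a \<in> L"
  using subgroup.one_closed[OF L_subgroup] subgroup.m_closed[OF L_subgroup] subgroup.m_inv_closed[OF L_subgroup]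
  by blast+

lemma conj_in_L: "s \<in> carrier G \<Longrightarrow> a \<in> L \<Longrightarrow> s \<otimes> a \<otimes> inv s \<in> L"
  using normal_conj(1)[OF L] .

definition additive :: "('a \<Rightarrow> rat) \<Rightarrow> bool" where
  "additive f \<longleftrightarrow> (\<forall>a\<in>L. \<forall>b\<in>L. f (a \<otimes> b) = f a + f b)"

lemma additive_c: "i < n \<Longrightarrow> additive (\<lambda>a. c a i)"
  using c_mult by (simp add: additive_def)

lemma additive_simps:
  assumes f: "additive f"
  shows "f \<one> = 0" "a \<in> L \<Longrightarrow> f (inv a) = - f a" "a \<in> L \<Longrightarrow> f (a [^] (k::nat)) = of_nat k * f a"
    "a \<in> L \<Longrightarrow> f (a [^] (l::int)) = of_int l * f a"
    "s \<in> L \<Longrightarrow> a \<in> L \<Longrightarrow> f (s \<otimes> a \<otimes> inv s) = f a"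
proof -
  have m: "f (a \<otimes> b) = f a + f b" if "a \<in> L" "b \<in> L" for a b using f that by (simp add: additive_def)
  show 1: "f \<one> = 0" using m[OF L_closed(1) L_closed(1)] by simp
  have inv: "f (inv a) = - f a" if "a \<in> L" for a
    using m[OF that L_closed(3)[OF that]] 1 that L_carrier by simp
  then show "f (inv a) = - f a" if "a \<in> L" using that .
  have "a [^] k \<in> L \<and> f (a [^] k) = of_nat k * f a" if "a \<in> L" for a and k :: nat
    by (induction k) (use that m L_closed 1 in \<open>simp_all add: distrib_right\<close>)
  then have pow: "a [^] k \<in> L" "f (a [^] k) = of_nat k * f a" if "a \<in> L" for a and k :: nat using that by auto
  then show "f (a [^] (k::nat)) = of_nat k * f a" if "a \<in> L" using that by blast
  show "f (a [^] (l::int)) = of_int l * f a" if a: "a \<in> L"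
  proof (cases "0 \<le> l")
    case True
    then obtain k where l: "l = int k" using zero_le_imp_eq_int by blast
    show ?thesis using pow(2)[OF a, of k] unfolding l int_pow_int by simp
  next
    case False
    then obtain k where l: "l = - int k" by (metis int_cases2 of_nat_0_le_iff)
    have "a [^] l = inv (a [^] k)" unfolding l using a L_carrier by (simp add: int_pow_neg int_pow_int)
    then show ?thesis using inv[OF pow(1)[OF a, of k]] pow(2)[OF a, of k] by (simp add: l)
  qed
  show "f (s \<otimes> a \<otimes> inv s) = f a" if "s \<in> L" "a \<in> L"
    using m[OF L_closed(2)[OF that] L_closed(3)[OF that(1)]] m[OF that] inv[OF that(1)] by simp
qed

text \<open>A homomorphism from \<open>L\<close> to the rationals that vanishes on \<open>K\<close> is a linear form on the
  space of coordinates. Clearing the denominators of \<open>y\<close>, some power of \<open>y\<close> is a product of powers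
  of the \<open>x j\<close>, up to an element which has a power in \<open>K\<close> and hence the value 0.\<close>

lemma additive_determined:
  assumes f: "additive f" and fK: "\<And>a. a \<in> K \<Longrightarrow> f a = 0" and y: "y \<in> L"
  shows "f y = (\<Sum>j<n. c y j * f (x j))"
proof -
  have "\<forall>j. \<exists>D::nat. 0 < D \<and> (\<forall>d. D dvd d \<longrightarrow> (\<exists>k::int. of_nat d * c y j = of_int k))"
    using ex_common_denominator by blast
  from choice[OF this] obtain D :: "nat \<Rightarrow> nat" where
    D: "\<And>j. 0 < D j" "\<And>j d. D j dvd d \<Longrightarrow> \<exists>k::int. of_nat d * c y j = of_int k" by blast
  define d where "d = (\<Prod>j<n. D j)"
  have d: "0 < d" "\<And>j. j < n \<Longrightarrow> \<exists>k::int. of_nat d * c y j = of_int k"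
  proof -
    show "0 < d" unfolding d_def using D(1) by (simp add: prod_pos)
    show "\<exists>k::int. of_nat d * c y j = of_int k" if "j < n" for j
      by (rule D(2)) (use that in \<open>auto simp: d_def intro!: dvd_prodI\<close>)
  qed
  then have "\<forall>j. \<exists>k::int. j < n \<longrightarrow> of_nat d * c y j = of_int k" by blast
  from choice[OF this] obtain k :: "nat \<Rightarrow> int" where k: "\<And>j. j < n \<Longrightarrow> of_nat d * c y j = of_int (k j)" by blast
  have "\<exists>z\<in>L. \<forall>h. additive h \<longrightarrow> h z = (\<Sum>j<m. of_int (k j) * h (x j))" if "m \<le> n" for m
    using that
  proof (induction m)
    case 0
    then show ?case using L_closed(1) additive_simps(1) by (intro bexI[of _ "\<one>"]) auto
  next
    case (Suc m)
    then obtain z where z: "z \<in> L" "\<And>h. additive h \<Longrightarrow> h z = (\<Sum>j<m. of_int (k j) * h (x j))" by auto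
    have xm: "x m \<in> L" using x_in Suc.prems by simp
    have xk: "x m [^] k m \<in> L" using subgroup_int_pow_closed[OF L_subgroup xm] .
    have "h (z \<otimes> x m [^] k m) = (\<Sum>j<Suc m. of_int (k j) * h (x j))" if h: "additive h" for h
      using h z xk additive_simps(4)[OF h xm] by (simp add: additive_def)
    then show ?case using L_closed(2)[OF z(1) xk] by blast
  qed
  from this[of n] obtain z where z: "z \<in> L" "\<And>h. additive h \<Longrightarrow> h z = (\<Sum>j<n. of_int (k j) * h (x j))" by auto
  have yd: "y [^] d \<in> L" using subgroup_int_pow_closed[OF L_subgroup y, of "int d"] by (simp add: int_pow_int)
  let ?w = "y [^] d \<otimes> inv z"
  have w: "?w \<in> L" using yd L_closed z by blast
  have hw: "h ?w = of_nat d * h y - (\<Sum>j<n. of_int (k j) * h (x j))" if h: "additive h" for h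
    using h yd L_closed(3)[OF z(1)] additive_simps(2)[OF h z(1)] additive_simps(3)[OF h y] z(2)[OF h]
    by (simp add: additive_def)
  have "c ?w i = 0" if i: "i < n" for i
  proof -
    have "(\<Sum>j<n. of_int (k j) * c (x j) i) = (\<Sum>j<n. if j = i then of_int (k i) else 0)"
      by (intro sum.cong) (auto simp: c_x i)
    also have "\<dots> = of_int (k i)" using i by simp
    finally show ?thesis using hw[OF additive_c[OF i]] k[OF i] by simp
  qed
  then obtain e :: nat where e: "0 < e" "?w [^] e \<in> K" using c_zero_iff[OF w] by blast
  have "of_nat e * f ?w = 0" using fK[OF e(2)] additive_simps(3)[OF f w] by simp
  then have "of_nat d * f y = (\<Sum>j<n. of_int (k j) * f (x j))" using e(1) hw[OF f] by simp
  also have "\<dots> = (\<Sum>j<n. of_nat d * c y j * f (x j))" using k by (intro sum.cong) auto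
  also have "\<dots> = of_nat d * (\<Sum>j<n. c y j * f (x j))" by (simp add: sum_distrib_left mult.assoc)
  finally show ?thesis using d(1) by simp
qed

text \<open>The coordinates with value 0 from index \<open>n\<close> on, so that they form a vector in a fixed
  space of functions.\<close>

definition coord :: "'a \<Rightarrow> nat \<Rightarrow> rat" where
  "coord y i = (if i < n then c y i else 0)"

definition act :: "'a \<Rightarrow> nat \<Rightarrow> nat \<Rightarrow> rat" where
  "act s i j = c (s \<otimes> x j \<otimes> inv s) i"

lemma c_conj:
  assumes s: "s \<in> carrier G" and y: "y \<in> L" and i: "i < n"
  shows "c (s \<otimes> y \<otimes> inv s) i = (\<Sum>j<n. act s i j * c y j)"
proof -
  have "c (s \<otimes> y \<otimes> inv s) i = (\<Sum>j<n. c y j * c (s \<otimes> x j \<otimes> inv s) i)"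
  proof (rule additive_determined[OF _ _ y])
    show "additive (\<lambda>y. c (s \<otimes> y \<otimes> inv s) i)"
      unfolding additive_def
    proof (intro ballI)
      fix a b assume ab: "a \<in> L" "b \<in> L"
      have "s \<otimes> (a \<otimes> b) \<otimes> inv s = (s \<otimes> a \<otimes> inv s) \<otimes> (s \<otimes> b \<otimes> inv s)"
        using s L_carrier ab by (simp add: word_simps)
      then show "c (s \<otimes> (a \<otimes> b) \<otimes> inv s) i = c (s \<otimes> a \<otimes> inv s) i + c (s \<otimes> b \<otimes> inv s) i"
        using c_mult conj_in_L s ab i by simp
    qed
    fix a assume a: "a \<in> K"
    have sa: "s \<otimes> a \<otimes> inv s \<in> K" using normal_conj(1)[OF K s a] .
    have "(s \<otimes> a \<otimes> inv s) [^] (1::nat) \<in> K" using sa subgroup.mem_carrier[OF normal_imp_subgroup[OF K]] by simp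
    then have "\<exists>k::nat. 0 < k \<and> (s \<otimes> a \<otimes> inv s) [^] k \<in> K" by (intro exI[of _ 1]) simp
    moreover have "s \<otimes> a \<otimes> inv s \<in> L" using sa K_le_L by blast
    ultimately show "c (s \<otimes> a \<otimes> inv s) i = 0" using c_zero_iff i by blast
  qed
  then show ?thesis by (simp add: act_def mult.commute)
qed

lemma act_mult:
  assumes "s \<in> carrier G" "t \<in> carrier G" "i < n" "j < n"
  shows "act (s \<otimes> t) i j = (\<Sum>l<n. act s i l * act t l j)"
proof -
  have xj: "x j \<in> carrier G" using x_in L_carrier assms by blast
  have "s \<otimes> t \<otimes> x j \<otimes> inv (s \<otimes> t) = s \<otimes> (t \<otimes> x j \<otimes> inv t) \<otimes> inv s"
    using assms xj by (simp add: word_simps)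
  then show ?thesis using c_conj[OF assms(1) conj_in_L[OF assms(2) x_in[OF assms(4)]] assms(3)] by (simp add: act_def)
qed

lemma act_one: "i < n \<Longrightarrow> j < n \<Longrightarrow> act \<one> i j = of_bool (i = j)"
  using x_in L_carrier c_x by (auto simp: act_def)

definition complex_rep :: "'a \<Rightarrow> complex mat" where
  "complex_rep s = mat n n (\<lambda>(i, j). of_rat (act s i j))"

lemma complex_rep: "mat_rep G n complex_rep"
  unfolding mat_rep_def
proof (intro conjI ballI)
  show "complex_rep \<one> = 1\<^sub>m n" by (intro eq_matI) (auto simp: complex_rep_def act_one)
  fix s t assume st: "s \<in> carrier G" "t \<in> carrier G"
  show "complex_rep (s \<otimes> t) = complex_rep s * complex_rep t"
  proof (rule eq_matI)
    fix i j assume "i < dim_row (complex_rep s * complex_rep t)" "j < dim_col (complex_rep s * complex_rep t)"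
    then have ij: "i < n" "j < n" by (auto simp: complex_rep_def)
    have "(complex_rep s * complex_rep t) $$ (i, j) = (\<Sum>l<n. complex_rep s $$ (i, l) * complex_rep t $$ (l, j))"
      by (rule mat_mult_as_sum[of _ n n _ n]) (auto simp: complex_rep_def ij)
    also have "\<dots> = of_rat (\<Sum>l<n. act s i l * act t l j)"
      using ij by (simp add: complex_rep_def of_rat_sum of_rat_mult)
    finally show "complex_rep (s \<otimes> t) $$ (i, j) = (complex_rep s * complex_rep t) $$ (i, j)"
      using act_mult[OF st ij] ij by (simp add: complex_rep_def)
  qed (auto simp: complex_rep_def)
qed (simp add: complex_rep_def)

lemma iter_commutator_in_L:
  "set ds \<subseteq> carrier G \<Longrightarrow> y \<in> L \<Longrightarrow> iter_commutator G ds y \<in> L"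
  by (induction ds) (auto simp: Let_def conj_in_L L_closed)

text \<open>On coordinates, \<open>y \<mapsto> d \<otimes> y \<otimes> inv d \<otimes> inv y\<close> is the difference \<open>\<rho> d - 1\<close>.\<close>

lemma unipotent_commutators:
  assumes u: "unipotent_on n complex_rep D" and D: "D \<subseteq> carrier G"
  obtains r where "\<And>ds y. length ds = r \<Longrightarrow> set ds \<subseteq> D \<Longrightarrow> y \<in> L \<Longrightarrow> \<exists>k::nat. 0 < k \<and> iter_commutator G ds y [^] k \<in> K"
proof -
  obtain r where r: "\<And>ds. length ds = r \<Longrightarrow> set ds \<subseteq> D \<Longrightarrow> mat_prod_minus_one n complex_rep ds = 0\<^sub>m n n"
    using u by (auto simp: unipotent_on_def)
  define v where "v y = vec n (\<lambda>i. of_rat (c y i) :: complex)" for y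
  have vc: "v y \<in> carrier_vec n" for y by (simp add: v_def)
  note R = mat_repD[OF complex_rep]
  have conj: "complex_rep s *\<^sub>v v y = v (s \<otimes> y \<otimes> inv s)" if s: "s \<in> carrier G" and y: "y \<in> L" for s y
  proof (rule eq_vecI)
    fix i assume "i < dim_vec (v (s \<otimes> y \<otimes> inv s))"
    then have i: "i < n" by (simp add: v_def)
    have "(complex_rep s *\<^sub>v v y) $ i = (\<Sum>j<n. complex_rep s $$ (i, j) * v y $ j)"
      by (rule mat_vec_as_sum[OF R(1)[OF s] vc i])
    also have "\<dots> = of_rat (\<Sum>j<n. act s i j * c y j)" using i by (simp add: complex_rep_def v_def of_rat_sum of_rat_mult)
    finally show "(complex_rep s *\<^sub>v v y) $ i = v (s \<otimes> y \<otimes> inv s) $ i" using c_conj[OF s y i] i by (simp add: v_def)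
  qed (use R(1)[OF s] in \<open>simp add: v_def\<close>)
  have it: "mat_prod_minus_one n complex_rep ds *\<^sub>v v y = v (iter_commutator G ds y)"
    if "set ds \<subseteq> D" "y \<in> L" for ds y
    using that
  proof (induction ds)
    case Nil
    then show ?case using vc by simp
  next
    case (Cons d ds)
    let ?z = "iter_commutator G ds y"
    have d: "d \<in> carrier G" and ds: "set ds \<subseteq> carrier G" using Cons.prems D by auto
    have z: "?z \<in> L" by (rule iter_commutator_in_L[OF ds Cons.prems(2)])
    have dc: "complex_rep d - 1\<^sub>m n \<in> carrier_mat n n" using R(1)[OF d] by (auto intro: minus_carrier_mat)
    have pc: "mat_prod_minus_one n complex_rep ds \<in> carrier_mat n n"
      using R(1) ds by (intro mat_prod_minus_one_carrier) blast
    have "mat_prod_minus_one n complex_rep (d # ds) *\<^sub>v v y = (complex_rep d - 1\<^sub>m n) *\<^sub>v v ?z"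
      using assoc_mult_mat_vec[OF dc pc vc] Cons by simp
    also have "\<dots> = complex_rep d *\<^sub>v v ?z - v ?z"
      using minus_mult_distrib_mat_vec[OF R(1)[OF d] one_carrier_mat vc] vc by simp
    also have "\<dots> = v (d \<otimes> ?z \<otimes> inv d) - v ?z" using conj[OF d z] by simp
    also have "\<dots> = v (iter_commutator G (d # ds) y)"
    proof (rule eq_vecI)
      fix i assume "i < dim_vec (v (iter_commutator G (d # ds) y))"
      then have i: "i < n" by (simp add: v_def)
      have "c ((d \<otimes> ?z \<otimes> inv d) \<otimes> inv ?z) i = c (d \<otimes> ?z \<otimes> inv d) i - c ?z i"
        using c_mult[OF conj_in_L[OF d z] L_closed(3)[OF z] i] additive_simps(2)[OF additive_c[OF i] z] by simp
      then show "(v (d \<otimes> ?z \<otimes> inv d) - v ?z) $ i = v (iter_commutator G (d # ds) y) $ i"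
        using i by (simp add: v_def Let_def of_rat_diff)
    qed (simp add: v_def)
    finally show ?case .
  qed
  show thesis
  proof (rule that[of r])
    fix ds y assume ds: "length ds = r" "set ds \<subseteq> D" and y: "y \<in> L"
    have "v (iter_commutator G ds y) = 0\<^sub>m n n *\<^sub>v v y" using it[OF ds(2) y] r[OF ds] by simp
    also have "\<dots> = 0\<^sub>v n" using vc by (intro eq_vecI) auto
    finally have v0: "v (iter_commutator G ds y) = 0\<^sub>v n" .
    have "c (iter_commutator G ds y) i = 0" if "i < n" for i
    proof -
      have "v (iter_commutator G ds y) $ i = 0" using v0 that by simp
      then show ?thesis using that by (simp add: v_def)
    qed
    moreover have "iter_commutator G ds y \<in> L" using iter_commutator_in_L ds(2) D y by blast
    ultimately show "\<exists>k::nat. 0 < k \<and> iter_commutator G ds y [^] k \<in> K" using c_zero_iff by blast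
  qed
qed

end

section \<open>Polynomials in a linear map\<close>

context
  fixes T :: "(nat \<Rightarrow> rat) \<Rightarrow> nat \<Rightarrow> rat"
  assumes T_add: "T (\<lambda>i. v i + w i) = (\<lambda>i. T v i + T w i)" and T_scale: "T (\<lambda>i. a * v i) = (\<lambda>i. a * T v i)"
begin

text \<open>The polynomial \<open>u\<close> evaluated at the linear map \<open>T\<close> and applied to \<open>v\<close>. Vectors are
  functions on the natural numbers, so that no type depends on the dimension.\<close>

definition poly_act :: "rat poly \<Rightarrow> (nat \<Rightarrow> rat) \<Rightarrow> nat \<Rightarrow> rat" where
  "poly_act u v = (\<lambda>i. \<Sum>k\<le>degree u. coeff u k * (T ^^ k) v i)"

lemma T_zero: "T (\<lambda>_. 0) = (\<lambda>_. 0)"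
  using T_scale[of 0 "\<lambda>_. 0"] by simp

lemma T_sum: "T (\<lambda>i. \<Sum>k\<in>A. a k * w k i) = (\<lambda>i. \<Sum>k\<in>A. a k * T (w k) i)"
  by (induction A rule: infinite_finite_induct) (simp_all add: T_zero T_add T_scale)

lemma poly_act_bound:
  assumes "degree u \<le> m"
  shows "poly_act u v i = (\<Sum>k\<le>m. coeff u k * (T ^^ k) v i)"
  unfolding poly_act_def using assms
  by (intro sum.mono_neutral_left) (auto simp: coeff_eq_0)

lemma poly_act_0 [simp]: "poly_act 0 v = (\<lambda>_. 0)"
  by (simp add: poly_act_def)

lemma poly_act_add: "poly_act (u + w) v i = poly_act u v i + poly_act w v i"
proof -
  let ?m = "max (degree u) (degree w)"
  have "poly_act (u + w) v i = (\<Sum>k\<le>?m. coeff (u + w) k * (T ^^ k) v i)"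
    by (rule poly_act_bound) (rule degree_add_le_max)
  also have "\<dots> = poly_act u v i + poly_act w v i"
    by (simp add: poly_act_bound[of u ?m] poly_act_bound[of w ?m] distrib_right sum.distrib)
  finally show ?thesis .
qed

lemma poly_act_smult: "poly_act (Polynomial.smult a u) v i = a * poly_act u v i"
  by (subst poly_act_bound[of _ "degree u"]) (auto simp: poly_act_def sum_distrib_left mult.assoc degree_smult_le)

lemma poly_act_pCons: "poly_act (pCons a u) v i = a * v i + T (poly_act u v) i"
proof -
  have "poly_act (pCons a u) v i = (\<Sum>k\<le>Suc (degree u). coeff (pCons a u) k * (T ^^ k) v i)"
    by (rule poly_act_bound) (rule degree_pCons_le)
  also have "\<dots> = a * v i + (\<Sum>k\<le>degree u. coeff u k * (T ^^ Suc k) v i)"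
    by (simp only: sum.atMost_Suc_shift) simp
  also have "(\<Sum>k\<le>degree u. coeff u k * (T ^^ Suc k) v i) = T (poly_act u v) i"
    unfolding poly_act_def T_sum by simp
  finally show ?thesis .
qed

lemma poly_act_mult: "poly_act (u * w) v = poly_act u (poly_act w v)"
proof (induction u)
  case (pCons a u)
  have "poly_act (pCons a u * w) v i = poly_act (pCons a u) (poly_act w v) i" for i
    using pCons(2) by (simp add: mult_pCons_left poly_act_add poly_act_smult poly_act_pCons)
  then show ?case by blast
qed (simp add: poly_act_def)

lemma poly_act_zero_vec: "poly_act u (\<lambda>_. 0) = (\<lambda>_. 0)"
proof -
  have "(T ^^ k) (\<lambda>_. 0) = (\<lambda>_. 0)" for k by (induction k) (simp_all add: T_zero)
  then show ?thesis by (simp add: poly_act_def)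
qed

lemma poly_act_one: "poly_act 1 v = v"
  by (simp add: poly_act_def)

text \<open>The vectors \<open>v, T v, \<dots>, T\<^sup>n v\<close> are linearly dependent, so \<open>v\<close> is also killed by a nonzero
  polynomial of degree at most \<open>n\<close>. It is coprime to the irreducible \<open>\<Phi>\<close>, so \<open>v\<close> is killed by 1.\<close>

lemma irreducible_annihilator:
  assumes supp: "\<And>v i. n \<le> i \<Longrightarrow> T v i = 0" and v: "\<And>i. n \<le> i \<Longrightarrow> v i = 0"
    and \<Phi>: "Factorial_Ring.irreducible \<Phi>" "n < degree \<Phi>" "poly_act \<Phi> v = (\<lambda>_. 0)"
  shows "v = (\<lambda>_. 0)"
proof -
  obtain a where a: "\<exists>k<Suc n. a k \<noteq> 0" "\<And>i. i < n \<Longrightarrow> (\<Sum>k<Suc n. a k * (T ^^ k) v i) = 0"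
    using ex_nontrivial_relation[of n "Suc n" "\<lambda>i k. (T ^^ k) v i"] by auto
  define u where "u = (\<Sum>k<Suc n. Polynomial.monom (a k) k)"
  have cu: "coeff u k = (if k < Suc n then a k else 0)" for k
  proof -
    have "coeff u k = (\<Sum>j<Suc n. if j = k then a j else 0)" unfolding u_def coeff_sum coeff_monom ..
    also have "\<dots> = (if k \<in> {..<Suc n} then a k else 0)" by (rule sum.delta) (rule finite_lessThan)
    finally show ?thesis by simp
  qed
  have u0: "u \<noteq> 0" using a(1) cu by (metis coeff_0)
  have du: "degree u \<le> n" by (rule degree_le) (simp add: cu)
  have "poly_act u v i = 0" for i
  proof (cases "i < n")
    case True
    then show ?thesis using a(2) poly_act_bound[OF du] cu by (simp add: lessThan_Suc_atMost)
  next
    case False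
    then have "(T ^^ k) v i = 0" for k using supp v by (cases k) auto
    then show ?thesis by (simp add: poly_act_def)
  qed
  then have uv: "poly_act u v = (\<lambda>_. 0)" by blast
  have "\<not> \<Phi> dvd u" using dvd_imp_degree_le[of \<Phi> u] u0 du \<Phi>(2) by linarith
  then have "algebraic_semidom_class.coprime \<Phi> u"
    using prime_elem_imp_coprime[OF irreducible_imp_prime_elem[OF \<Phi>(1)]] by blast
  then have "fst (bezout_coefficients \<Phi> u) * \<Phi> + snd (bezout_coefficients \<Phi> u) * u = 1"
    unfolding bezout_coefficients_fst_snd using coprime_iff_gcd_eq_1 by blast
  then obtain s t where "s * \<Phi> + t * u = 1" by blast
  then have "v = poly_act (s * \<Phi> + t * u) v" by (simp add: poly_act_one)
  also have "\<dots> = (\<lambda>_. 0)"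
    by (rule ext) (simp add: poly_act_add poly_act_mult uv \<Phi>(3) poly_act_zero_vec)
  finally show ?thesis .
qed

end

section \<open>The transfer and the rank of a section\<close>

lemma (in group) additive_on_perfect_zero:
  fixes F :: "'a \<Rightarrow> rat"
  assumes perfect: "derived G (carrier G) = carrier G"
    and F: "\<And>s t. s \<in> carrier G \<Longrightarrow> t \<in> carrier G \<Longrightarrow> F (s \<otimes> t) = F s + F t" and s: "s \<in> carrier G"
  shows "F s = 0"
proof -
  have F1: "F \<one> = 0" using F[of \<one> \<one>] by simp
  have Finv: "F (inv a) = - F a" if "a \<in> carrier G" for a using F[of a "inv a"] F1 that by simp
  let ?K = "{s \<in> carrier G. F s = 0}"
  have "subgroup ?K G" by (rule subgroupI) (use F F1 Finv in auto)
  moreover have "derived_set G (carrier G) \<subseteq> ?K" using F Finv by auto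
  ultimately have "derived G (carrier G) \<subseteq> ?K" unfolding derived_def by (intro generate_subgroup_incl)
  then show ?thesis using perfect s by auto
qed

context group begin

text \<open>Choosing the identity in \<open>H\<close> itself makes the elements \<open>t H \<otimes> s \<otimes> inv (t (H #> s))\<close>
  reproduce \<open>s\<close> for \<open>s \<in> H\<close>.\<close>

definition transversal :: "'a set \<Rightarrow> ('a set \<Rightarrow> 'a) \<Rightarrow> bool" where
  "transversal H t \<longleftrightarrow> (\<forall>C\<in>rcosets H. t C \<in> carrier G \<and> H #> t C = C) \<and> t H = \<one>"

lemma ex_transversal:
  assumes H: "subgroup H G"
  obtains t where "transversal H t"
proof -
  define t where "t C = (if C = H then \<one> else SOME x. x \<in> carrier G \<and> H #> x = C)" for C
  have "t C \<in> carrier G \<and> H #> t C = C" if C: "C \<in> rcosets H" for C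
  proof (cases "C = H")
    case True
    then show ?thesis using coset_mult_one subgroup.subset[OF H] by (simp add: t_def)
  next
    case False
    obtain x where "x \<in> carrier G \<and> H #> x = C" using C by (auto simp: RCOSETS_def)
    then have "(SOME x. x \<in> carrier G \<and> H #> x = C) \<in> carrier G \<and> H #> (SOME x. x \<in> carrier G \<and> H #> x = C) = C"
      by (rule someI)
    then show ?thesis using False by (simp add: t_def)
  qed
  then show thesis by (intro that[of t]) (auto simp: transversal_def t_def)
qed

text \<open>The last identity is the cocycle property behind both the transfer and the Schreier
  generators.\<close>

lemma transversal_cocycle:
  assumes H: "subgroup H G" and trans: "transversal H t" and C: "C \<in> rcosets H" and s: "s \<in> carrier G"
  shows "C #> s \<in> rcosets H" "t C \<otimes> s \<otimes> inv (t (C #> s)) \<in> H"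
    "s' \<in> carrier G \<Longrightarrow> C #> (s \<otimes> s') = C #> s #> s'"
    "s' \<in> carrier G \<Longrightarrow> t C \<otimes> (s \<otimes> s') \<otimes> inv (t (C #> s #> s'))
       = (t C \<otimes> s \<otimes> inv (t (C #> s))) \<otimes> (t (C #> s) \<otimes> s' \<otimes> inv (t (C #> s #> s')))"
proof -
  have t: "t C \<in> carrier G" "H #> t C = C" if "C \<in> rcosets H" for C using trans that by (simp_all add: transversal_def)
  have Hc: "H \<subseteq> carrier G" using subgroup.subset[OF H] .
  have shift: "C #> s \<in> rcosets H" "C #> s = H #> (t C \<otimes> s)" if "C \<in> rcosets H" "s \<in> carrier G" for C s
  proof -
    show 1: "C #> s = H #> (t C \<otimes> s)"
      using t(2)[OF that(1)] coset_mult_assoc[OF Hc t(1)[OF that(1)] that(2)] by simp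
    show "C #> s \<in> rcosets H" unfolding 1 using rcosetsI[OF Hc] t(1)[OF that(1)] that(2) by simp
  qed
  show 1: "C #> s \<in> rcosets H" by (rule shift(1)[OF C s])
  have "H #> (t C \<otimes> s) = H #> t (C #> s)" using shift(2)[OF C s] t(2)[OF 1] by simp
  then show "t C \<otimes> s \<otimes> inv (t (C #> s)) \<in> H" using rcoset_eqD[OF H] t(1)[OF C] t(1)[OF 1] s by blast
  assume s': "s' \<in> carrier G"
  have "C \<subseteq> carrier G" using C rcosets_part_G[OF H] by blast
  then show "C #> (s \<otimes> s') = C #> s #> s'" using coset_mult_assoc[of C s s'] s s' by simp
  show "t C \<otimes> (s \<otimes> s') \<otimes> inv (t (C #> s #> s'))
       = (t C \<otimes> s \<otimes> inv (t (C #> s))) \<otimes> (t (C #> s) \<otimes> s' \<otimes> inv (t (C #> s #> s')))"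
    using s s' t(1)[OF C] t(1)[OF 1] t(1)[OF shift(1)[OF 1 s']] by (simp add: word_simps)
qed

end

text \<open>The transfer \<open>F\<close> of \<open>f\<close> is a homomorphism on the whole perfect group and thus 0. On \<open>L\<close> it
  is the index of \<open>L\<close> times \<open>f\<close>, because \<open>f\<close> is invariant under conjugation.\<close>

lemma (in group) transfer_vanishes:
  fixes f :: "'a \<Rightarrow> rat"
  assumes perfect: "derived G (carrier G) = carrier G" and L: "L \<lhd> G" "finite_index_subgroup L G"
    and f: "\<And>a b. a \<in> L \<Longrightarrow> b \<in> L \<Longrightarrow> f (a \<otimes> b) = f a + f b"
    and inv: "\<And>s a. s \<in> carrier G \<Longrightarrow> a \<in> L \<Longrightarrow> f (s \<otimes> a \<otimes> inv s) = f a" and l: "l \<in> L"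
  shows "f l = 0"
proof -
  have Ls: "subgroup L G" using L by (simp add: finite_index_subgroup_def)
  have Lc: "L \<subseteq> carrier G" using subgroup.subset[OF Ls] .
  obtain t where trans: "transversal L t" using ex_transversal[OF Ls] .
  have t: "C \<in> rcosets L \<Longrightarrow> t C \<in> carrier G" "C \<in> rcosets L \<Longrightarrow> L #> t C = C" for C
    using trans by (simp_all add: transversal_def)
  note tc = transversal_cocycle[OF Ls trans]
  have fin: "finite (rcosets L)" using L(2) by (simp add: finite_index_subgroup_def)
  have bij: "bij_betw (\<lambda>C. C #> s) (rcosets L) (rcosets L)" if s: "s \<in> carrier G" for s
  proof -
    have "inj_on (\<lambda>C. C #> s) (rcosets L)"
    proof (rule inj_on_inverseI[where g = "\<lambda>C. C #> inv s"])
      fix C assume C: "C \<in> rcosets L"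
      have "C \<subseteq> carrier G" using C rcosets_part_G[OF Ls] by blast
      then show "C #> s #> inv s = C" using coset_mult_assoc[of C s "inv s"] s by simp
    qed
    moreover have "(\<lambda>C. C #> s) ` (rcosets L) \<subseteq> rcosets L" using tc(1) s by blast
    ultimately show ?thesis using fin by (simp add: bij_betw_def endo_inj_surj)
  qed
  define F where "F s = (\<Sum>C\<in>rcosets L. f (t C \<otimes> s \<otimes> inv (t (C #> s))))" for s
  have "F (s \<otimes> s') = F s + F s'" if s: "s \<in> carrier G" "s' \<in> carrier G" for s s'
  proof -
    have "f (t C \<otimes> (s \<otimes> s') \<otimes> inv (t (C #> (s \<otimes> s'))))
        = f (t C \<otimes> s \<otimes> inv (t (C #> s))) + f (t (C #> s) \<otimes> s' \<otimes> inv (t (C #> s #> s')))"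
      if C: "C \<in> rcosets L" for C
      unfolding tc(3)[OF C s] tc(4)[OF C s]
      by (rule f[OF tc(2)[OF C s(1)] tc(2)[OF tc(1)[OF C s(1)] s(2)]])
    then have "F (s \<otimes> s') = (\<Sum>C\<in>rcosets L. f (t C \<otimes> s \<otimes> inv (t (C #> s))))
        + (\<Sum>C\<in>rcosets L. f (t (C #> s) \<otimes> s' \<otimes> inv (t (C #> s #> s'))))"
      by (simp add: F_def sum.distrib)
    also have "(\<Sum>C\<in>rcosets L. f (t (C #> s) \<otimes> s' \<otimes> inv (t (C #> s #> s')))) = F s'"
      unfolding F_def by (rule sum.reindex_bij_betw[OF bij[OF s(1)]])
    finally show ?thesis by (simp add: F_def)
  qed
  then have F0: "F l = 0" by (rule additive_on_perfect_zero[OF perfect]) (use l Lc in auto)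
  have lc: "l \<in> carrier G" using l Lc by blast
  have "f (t C \<otimes> l \<otimes> inv (t (C #> l))) = f l" if C: "C \<in> rcosets L" for C
  proof -
    have tC: "t C \<in> carrier G" using t(1)[OF C] .
    have m: "t C \<otimes> l \<otimes> inv (t C) \<in> L" by (rule normal_conj(1)[OF L(1) tC l])
    have "C #> l = L #> (t C \<otimes> l)" using coset_mult_assoc[OF Lc tC lc] t(2)[OF C] by simp
    also have "\<dots> = C" using rcoset_eq_iff[OF Ls _ tC, of "t C \<otimes> l"] m tC lc t(2)[OF C] by simp
    finally have "C #> l = C" .
    then show ?thesis using inv[OF tC l] by simp
  qed
  then have "F l = of_nat (card (rcosets L)) * f l" by (simp add: F_def)
  moreover have "card (rcosets L) \<noteq> 0"
    using fin subgroup.subgroup_in_rcosets[OF Ls is_group] by auto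
  ultimately show ?thesis using F0 by simp
qed

locale perfect_section = perfect_extension G N g q + rational_section G L K n x c
  for G (structure) and N g q L K n x c
begin

text \<open>The elements acting trivially on the section form a normal subgroup \<open>M\<close>, which is proper
  by the transfer. So the order \<open>j\<close> of \<open>g\<close> modulo \<open>M\<close> is divisible by \<open>q\<close>, and some power \<open>s\<close> of
  \<open>g\<close> has order \<open>q\<close> modulo \<open>M\<close>. Some coordinate vector is moved by \<open>s [^] r\<close>, and its displacement
  \<open>v\<close> is annihilated by \<open>1 + x^r + \<dots> + x^(r (p - 1))\<close>, because the sum telescopes to the
  displacement under \<open>s [^] q\<close>. A nonzero \<open>v\<close> of this kind needs a space of at least the degree of
  this irreducible polynomial.\<close>

lemma rank_of_section:
  fixes p r :: nat
  assumes L_fin: "finite_index_subgroup L G" and n: "0 < n" and q: "q = p * r" "0 < r" "1 < p"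
    and \<Phi>: "Factorial_Ring.irreducible (\<Sum>i<p. Polynomial.monom (1::rat) (r * i))"
  shows "r * (p - 1) \<le> n"
proof (rule ccontr)
  assume small: "\<not> r * (p - 1) \<le> n"
  define M where "M = {s \<in> carrier G. \<forall>y\<in>L. \<forall>i<n. c (s \<otimes> y \<otimes> inv s) i = c y i}"
  have MD: "c (s \<otimes> y \<otimes> inv s) i = c y i" if "s \<in> M" "y \<in> L" "i < n" for s y i using that by (simp add: M_def)
  have Mc: "s \<in> carrier G" if "s \<in> M" for s using that by (simp add: M_def)
  have MI: "s \<in> M" if "s \<in> carrier G" "\<And>y i. y \<in> L \<Longrightarrow> i < n \<Longrightarrow> c (s \<otimes> y \<otimes> inv s) i = c y i" for s
    using that unfolding M_def by blast
  have M: "M \<lhd> G"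
  proof (rule normal_criterion)
    show "\<one> \<in> M" using L_carrier by (simp add: M_def)
    show "a \<otimes> b \<in> M" if ab: "a \<in> M" "b \<in> M" for a b
    proof -
      have "c (a \<otimes> b \<otimes> y \<otimes> inv (a \<otimes> b)) i = c y i" if y: "y \<in> L" "i < n" for y i
      proof -
        have "a \<otimes> b \<otimes> y \<otimes> inv (a \<otimes> b) = a \<otimes> (b \<otimes> y \<otimes> inv b) \<otimes> inv a"
          using ab Mc L_carrier y by (simp add: word_simps)
        then show ?thesis using MD[OF ab(1) conj_in_L[OF Mc[OF ab(2)] y(1)] y(2)] MD[OF ab(2) y] by simp
      qed
      then show ?thesis using Mc[OF ab(1)] Mc[OF ab(2)] by (intro MI) simp_all
    qed
    show "inv a \<in> M" if a: "a \<in> M" for a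
    proof -
      have "c (inv a \<otimes> y \<otimes> inv (inv a)) i = c y i" if y: "y \<in> L" "i < n" for y i
      proof -
        have m: "inv a \<otimes> y \<otimes> inv (inv a) \<in> L" by (rule conj_in_L[OF _ y(1)]) (use Mc a in simp)
        have "a \<otimes> (inv a \<otimes> y \<otimes> inv (inv a)) \<otimes> inv a = y"
          using Mc[OF a] L_carrier[OF y(1)] by (simp add: word_simps)
        then show ?thesis using MD[OF a m y(2)] by simp
      qed
      then show ?thesis using Mc[OF a] by (intro MI) simp_all
    qed
    show "h \<otimes> a \<otimes> inv h \<in> M" if h: "h \<in> carrier G" and a: "a \<in> M" for h a
    proof -
      have "c (h \<otimes> a \<otimes> inv h \<otimes> y \<otimes> inv (h \<otimes> a \<otimes> inv h)) i = c y i" if y: "y \<in> L" "i < n" for y i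
      proof -
        let ?y = "inv h \<otimes> y \<otimes> inv (inv h)"
        have m: "?y \<in> L" by (rule conj_in_L[OF _ y(1)]) (use h in simp)
        have e: "h \<otimes> a \<otimes> inv h \<otimes> y \<otimes> inv (h \<otimes> a \<otimes> inv h) = h \<otimes> (a \<otimes> ?y \<otimes> inv a) \<otimes> inv h"
          using h Mc[OF a] L_carrier[OF y(1)] by (simp add: word_simps)
        have "c (h \<otimes> (a \<otimes> ?y \<otimes> inv a) \<otimes> inv h) i = (\<Sum>j<n. act h i j * c (a \<otimes> ?y \<otimes> inv a) j)"
          by (rule c_conj[OF h conj_in_L[OF Mc[OF a] m] y(2)])
        also have "\<dots> = (\<Sum>j<n. act h i j * c ?y j)" using MD[OF a m] by simp
        also have "\<dots> = c (h \<otimes> ?y \<otimes> inv h) i" by (rule c_conj[OF h m y(2), symmetric])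
        also have "h \<otimes> ?y \<otimes> inv h = y" using h L_carrier[OF y(1)] by (simp add: word_simps)
        finally show ?thesis using e by simp
      qed
      then show ?thesis using Mc[OF a] h by (intro MI) simp_all
    qed
  qed (auto simp: M_def)
  have Mne: "M \<noteq> carrier G"
  proof
    assume all: "M = carrier G"
    have "c (x 0) 0 = 0"
    proof (rule transfer_vanishes[OF perfect L L_fin, where f = "\<lambda>a. c a 0"])
      show "c (a \<otimes> b) 0 = c a 0 + c b 0" if "a \<in> L" "b \<in> L" for a b using c_mult[OF that n] .
      show "c (s \<otimes> a \<otimes> inv s) 0 = c a 0" if "s \<in> carrier G" "a \<in> L" for s a
        using MD[of s a 0] that n all by simp
      show "x 0 \<in> L" by (rule x_in[OF n])
    qed
    then show False using c_x[of 0 0] n by simp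
  qed
  have LM: "L \<subseteq> M"
    using additive_simps(5)[OF additive_c] L_carrier by (auto simp: M_def)
  obtain o0 :: nat where o0: "0 < o0" "g [^] o0 \<in> L" using ex_pow_in_finite_index[OF L_fin g] .
  define j where "j = (LEAST j::nat. 0 < j \<and> g [^] j \<in> M)"
  have j: "0 < j" "g [^] j \<in> M" and jmin: "\<And>i::nat. 0 < i \<Longrightarrow> g [^] i \<in> M \<Longrightarrow> j \<le> i"
    using LeastI[of "\<lambda>j::nat. 0 < j \<and> g [^] j \<in> M" o0] Least_le[of "\<lambda>j::nat. 0 < j \<and> g [^] j \<in> M"] o0 LM
    unfolding j_def by blast+
  have "q dvd j" using full[OF M j(2)] Mne by blast
  then obtain e where e: "j = q * e" by (rule dvdE)
  define s where "s = g [^] e"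
  have sc: "s \<in> carrier G" using g by (simp add: s_def)
  have spow: "s [^] k = g [^] (e * k)" for k :: nat using g by (simp add: s_def nat_pow_pow)
  have sq: "s [^] q \<in> M" using j(2) e spow by (simp add: mult.commute)
  have "s [^] r \<notin> M"
  proof
    assume "s [^] r \<in> M"
    then have "j \<le> e * r" using jmin[of "e * r"] spow j(1) e q by auto
    then have "p * (r * e) \<le> 1 * (r * e)" using e q by (simp add: mult.commute mult.left_commute)
    moreover have "0 < r * e" using j(1) e q by simp
    ultimately show False using q(3) by simp
  qed
  then obtain y i0 where y: "y \<in> L" "i0 < n" "c (s [^] r \<otimes> y \<otimes> inv (s [^] r)) i0 \<noteq> c y i0"
    using sc by (auto simp: M_def)
  define T where "T v i = (if i < n then \<Sum>k<n. act s i k * v k else 0)" for v :: "nat \<Rightarrow> rat" and i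
  have T_add: "T (\<lambda>i. v i + w i) = (\<lambda>i. T v i + T w i)" for v w
    by (rule ext) (simp add: T_def distrib_left sum.distrib)
  have T_scale: "T (\<lambda>i. a * v i) = (\<lambda>i. a * T v i)" for a v
    by (rule ext) (simp add: T_def sum_distrib_left mult.left_commute)
  have Tc: "T (coord z) = coord (s \<otimes> z \<otimes> inv s)" if "z \<in> L" for z
    by (rule ext) (use c_conj[OF sc that] in \<open>simp add: T_def coord_def\<close>)
  have Tk: "(T ^^ k) (coord z) = coord (s [^] k \<otimes> z \<otimes> inv (s [^] k))" if z: "z \<in> L" for z k
  proof (induction k)
    case 0
    then show ?case using L_carrier[OF z] by simp
  next
    case (Suc k)
    have e: "s [^] Suc k = s \<otimes> s [^] k" by (rule nat_pow_Suc2[OF sc])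
    have "s \<otimes> (s [^] k \<otimes> z \<otimes> inv (s [^] k)) \<otimes> inv s = s [^] Suc k \<otimes> z \<otimes> inv (s [^] Suc k)"
      unfolding e using sc L_carrier[OF z] by (simp add: word_simps)
    then show ?case using Suc Tc[OF conj_in_L[OF _ z], of "s [^] k"] sc by simp
  qed
  \<comment> \<open>The orbit of \<open>y\<close> under \<open>s [^] r\<close>, which closes up after \<open>p\<close> steps on coordinates.\<close>
  define z where "z k = s [^] (r * k) \<otimes> y \<otimes> inv (s [^] (r * k))" for k :: nat
  have zL: "z k \<in> L" for k unfolding z_def by (rule conj_in_L[OF _ y(1)]) (use sc in simp)
  have Tz: "(T ^^ (r * k)) (coord (z m)) = coord (z (k + m))" for k m
  proof -
    have "s [^] (r * k) \<otimes> z m \<otimes> inv (s [^] (r * k)) = z (k + m)"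
      using sc L_carrier[OF y(1)] by (simp add: z_def word_simps distrib_left nat_pow_mult[symmetric])
    then show ?thesis using Tk[OF zL] by simp
  qed
  define v where "v i = coord (z 1) i + (-1) * coord (z 0) i" for i
  have Tadd_k: "(T ^^ k) (\<lambda>i. a i + (-1) * b i) = (\<lambda>i. (T ^^ k) a i + (-1) * (T ^^ k) b i)" for k a b
  proof (induction k)
    case (Suc k)
    then show ?case using T_add[of "(T ^^ k) a" "\<lambda>i. (-1) * (T ^^ k) b i"] T_scale[of "-1" "(T ^^ k) b"] by simp
  qed simp
  have vk: "(T ^^ (r * k)) v i = coord (z (Suc k)) i - coord (z k) i" for k i
  proof -
    have "(T ^^ (r * k)) v = (\<lambda>i. (T ^^ (r * k)) (coord (z 1)) i + (-1) * (T ^^ (r * k)) (coord (z 0)) i)"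
      unfolding v_def by (rule Tadd_k)
    then show ?thesis using Tz[of k 1] Tz[of k 0] by simp
  qed
  let ?\<Phi> = "\<Sum>i<p. Polynomial.monom (1::rat) (r * i)"
  have c\<Phi>: "coeff ?\<Phi> k = (\<Sum>i<p. if r * i = k then 1 else 0)" for k
    by (simp add: coeff_sum)
  have deg: "degree ?\<Phi> = r * (p - 1)"
  proof (rule antisym)
    show "degree ?\<Phi> \<le> r * (p - 1)"
    proof (rule degree_le, intro allI impI)
      fix k assume k: "r * (p - 1) < k"
      have "r * i \<noteq> k" if "i < p" for i
      proof -
        have "r * i \<le> r * (p - 1)" using that by (intro mult_le_mono2) simp
        with k show ?thesis by linarith
      qed
      then show "coeff ?\<Phi> k = 0" unfolding c\<Phi> by (intro sum.neutral) auto
    qed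
    have "coeff ?\<Phi> (r * (p - 1)) = (\<Sum>i<p. if i = p - 1 then 1 else 0)"
      unfolding c\<Phi> using q by (intro sum.cong) auto
    also have "\<dots> = 1" using q(3) by simp
    finally show "r * (p - 1) \<le> degree ?\<Phi>" by (intro le_degree) simp
  qed
  have "poly_act T ?\<Phi> v i = 0" for i
  proof -
    have "poly_act T (\<Sum>k<m. Polynomial.monom 1 (r * k)) v i = coord (z m) i - coord (z 0) i" for m
    proof (induction m)
      case 0
      then show ?case by (simp add: poly_act_0[OF T_add T_scale])
    next
      case (Suc m)
      have "poly_act T (Polynomial.monom 1 (r * m)) v i = (T ^^ (r * m)) v i"
        by (simp add: poly_act_def[OF T_add T_scale] degree_monom_eq if_distrib[where f = "\<lambda>a. a * _"] cong: if_cong)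
      then show ?case using Suc vk[of m i] by (simp add: poly_act_add[OF T_add T_scale])
    qed
    moreover have "coord (z p) i = coord (z 0) i"
    proof -
      have "z p = s [^] q \<otimes> y \<otimes> inv (s [^] q)" by (simp add: z_def q mult.commute)
      then have "c (z p) i = c y i" if "i < n" using MD[OF sq y(1) that] by simp
      moreover have "z 0 = y" using L_carrier[OF y(1)] by (simp add: z_def)
      ultimately show ?thesis by (simp add: coord_def)
    qed
    ultimately show ?thesis by simp
  qed
  then have kill: "poly_act T ?\<Phi> v = (\<lambda>_. 0)" by (intro ext)
  have "v = (\<lambda>_. 0)"
  proof (rule irreducible_annihilator[OF T_add T_scale _ _ \<Phi> _ kill, where n = n])
    show "n < degree ?\<Phi>" using small deg by linarith
    show "T w i = 0" if "n \<le> i" for w i using that by (simp add: T_def)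
    show "v i = 0" if "n \<le> i" for i using that by (simp add: v_def coord_def)
  qed
  then have "v i0 = 0" by simp
  moreover have "z 0 = y" using L_carrier[OF y(1)] by (simp add: z_def)
  ultimately show False using y by (simp add: v_def coord_def z_def)
qed

end

section \<open>Nilpotency and roots\<close>

text \<open>The upper central series of \<open>A\<close> modulo \<open>V\<close>, without forming the quotient.\<close>

primrec rel_center :: "('a, 'b) monoid_scheme \<Rightarrow> 'a set \<Rightarrow> 'a set \<Rightarrow> nat \<Rightarrow> 'a set" where
  "rel_center G A V 0 = V \<inter> A"
| "rel_center G A V (Suc m) = {z \<in> A. \<forall>x\<in>A. x \<otimes>\<^bsub>G\<^esub> z \<otimes>\<^bsub>G\<^esub> inv\<^bsub>G\<^esub> x \<otimes>\<^bsub>G\<^esub> inv\<^bsub>G\<^esub> z \<in> rel_center G A V m}"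

context group begin

lemma pow_mult_commuting_mod:
  assumes W: "normal_within G W A" and ab: "a \<in> A" "b \<in> A" and comm: "b \<otimes> a \<otimes> inv b \<otimes> inv a \<in> W"
  shows "(a \<otimes> b) [^] (k::nat) \<otimes> inv (b [^] k) \<otimes> inv (a [^] k) \<in> W"
proof -
  have Ws: "subgroup W G" and A: "subgroup A G" using W by (simp_all add: normal_within_def)
  have c: "a \<in> carrier G" "b \<in> carrier G" using ab subgroup.mem_carrier[OF A] by blast+
  let ?Q = "G\<lparr>carrier := A\<rparr> Mod W"
  interpret \<pi>: group_hom "G\<lparr>carrier := A\<rparr>" ?Q "(#>) W" by (rule normal_within_quotient_hom[OF W])
  have pow: "a [^] k \<in> A" "b [^] k \<in> A" "a \<otimes> b \<in> A"
    using subgroup_int_pow_closed[OF A ab(1), of "int k"] subgroup_int_pow_closed[OF A ab(2), of "int k"]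
      subgroup.m_closed[OF A ab] by (simp_all add: int_pow_int)
  have "(b \<otimes> a) \<otimes> inv (a \<otimes> b) \<in> W" using comm c by (simp add: word_simps)
  then have "W #> (b \<otimes> a) = W #> (a \<otimes> b)" using rcoset_eq_iff[OF Ws] c by simp
  then have cm: "(W #> a) \<otimes>\<^bsub>?Q\<^esub> (W #> b) = (W #> b) \<otimes>\<^bsub>?Q\<^esub> (W #> a)"
    using \<pi>.hom_mult[of a b] \<pi>.hom_mult[of b a] ab by simp
  have "W #> ((a \<otimes> b) [^] k) = ((W #> a) \<otimes>\<^bsub>?Q\<^esub> (W #> b)) [^]\<^bsub>?Q\<^esub> k"
    using \<pi>.hom_nat_pow[of "a \<otimes> b" k] \<pi>.hom_mult[of a b] ab pow by (simp add: carrier_upd_nat_pow)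
  also have "\<dots> = (W #> a) [^]\<^bsub>?Q\<^esub> k \<otimes>\<^bsub>?Q\<^esub> (W #> b) [^]\<^bsub>?Q\<^esub> k"
    by (rule \<pi>.H.pow_mult_distrib[OF cm]) (use ab \<pi>.hom_closed in simp_all)
  also have "\<dots> = W #> (a [^] k \<otimes> b [^] k)"
    using \<pi>.hom_nat_pow[of a k] \<pi>.hom_nat_pow[of b k] \<pi>.hom_mult[of "a [^] k" "b [^] k"] ab pow
    by (simp add: carrier_upd_nat_pow)
  finally have "(a \<otimes> b) [^] k \<otimes> inv (a [^] k \<otimes> b [^] k) \<in> W" using rcoset_eq_iff[OF Ws] c by simp
  then show ?thesis using c by (simp add: word_simps)
qed

lemma rel_center_normal:
  assumes A: "subgroup A G" and V: "subgroup V G" "\<And>x v. x \<in> A \<Longrightarrow> v \<in> V \<inter> A \<Longrightarrow> x \<otimes> v \<otimes> inv x \<in> V"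
  shows "normal_within G (rel_center G A V m) A"
proof (induction m)
  case 0
  have "x \<otimes> v \<otimes> inv x \<in> A" if "x \<in> A" "v \<in> A" for x v
    using that subgroup.m_closed[OF A] subgroup.m_inv_closed[OF A] by blast
  then show ?case using A V subgroups_Inter_pair by (auto simp: normal_within_def)
next
  case (Suc m)
  let ?U = "rel_center G A V m"
  have U: "subgroup ?U G" "?U \<subseteq> A" and Un: "\<And>x u. x \<in> A \<Longrightarrow> u \<in> ?U \<Longrightarrow> x \<otimes> u \<otimes> inv x \<in> ?U"
    using Suc by (auto simp: normal_within_def)
  have Ac: "\<And>x. x \<in> A \<Longrightarrow> x \<in> carrier G" using subgroup.mem_carrier[OF A] .
  have Am: "\<And>x y. x \<in> A \<Longrightarrow> y \<in> A \<Longrightarrow> x \<otimes> y \<in> A" "\<And>x. x \<in> A \<Longrightarrow> inv x \<in> A" "\<one> \<in> A"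
    using subgroup.m_closed[OF A] subgroup.m_inv_closed[OF A] subgroup.one_closed[OF A] by blast+
  note Um = subgroup.m_closed[OF U(1)] subgroup.m_inv_closed[OF U(1)] subgroup.one_closed[OF U(1)]
  have D: "z \<in> A" "\<And>x. x \<in> A \<Longrightarrow> x \<otimes> z \<otimes> inv x \<otimes> inv z \<in> ?U" if "z \<in> rel_center G A V (Suc m)" for z
    using that by auto
  have sub: "subgroup (rel_center G A V (Suc m)) G"
  proof (rule subgroupI)
    show "rel_center G A V (Suc m) \<subseteq> carrier G" using Ac by auto
    have "\<one> \<in> rel_center G A V (Suc m)" using Am Um Ac by simp
    then show "rel_center G A V (Suc m) \<noteq> {}" by blast
    show "inv z \<in> rel_center G A V (Suc m)" if z: "z \<in> rel_center G A V (Suc m)" for z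
    proof -
      have "x \<otimes> inv z \<otimes> inv x \<otimes> inv (inv z) \<in> ?U" if x: "x \<in> A" for x
      proof -
        have "inv z \<otimes> inv (x \<otimes> z \<otimes> inv x \<otimes> inv z) \<otimes> inv (inv z) \<in> ?U"
          by (rule Un[OF Am(2)[OF D(1)[OF z]] Um(2)[OF D(2)[OF z x]]])
        moreover have "inv z \<otimes> inv (x \<otimes> z \<otimes> inv x \<otimes> inv z) \<otimes> inv (inv z) = x \<otimes> inv z \<otimes> inv x \<otimes> inv (inv z)"
          using Ac[OF x] Ac[OF D(1)[OF z]] by (simp add: word_simps)
        ultimately show ?thesis by simp
      qed
      then show ?thesis using Am(2)[OF D(1)[OF z]] by simp
    qed
    show "y \<otimes> z \<in> rel_center G A V (Suc m)" if y: "y \<in> rel_center G A V (Suc m)" and z: "z \<in> rel_center G A V (Suc m)" for y z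
    proof -
      have "x \<otimes> (y \<otimes> z) \<otimes> inv x \<otimes> inv (y \<otimes> z) \<in> ?U" if x: "x \<in> A" for x
      proof -
        have "(x \<otimes> y \<otimes> inv x \<otimes> inv y) \<otimes> (y \<otimes> (x \<otimes> z \<otimes> inv x \<otimes> inv z) \<otimes> inv y) \<in> ?U"
          by (rule Um(1)[OF D(2)[OF y x] Un[OF D(1)[OF y] D(2)[OF z x]]])
        moreover have "(x \<otimes> y \<otimes> inv x \<otimes> inv y) \<otimes> (y \<otimes> (x \<otimes> z \<otimes> inv x \<otimes> inv z) \<otimes> inv y)
            = x \<otimes> (y \<otimes> z) \<otimes> inv x \<otimes> inv (y \<otimes> z)"
          using Ac[OF x] Ac[OF D(1)[OF z]] Ac[OF D(1)[OF y]] by (simp add: word_simps)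
        ultimately show ?thesis by simp
      qed
      then show ?thesis using Am(1)[OF D(1)[OF y] D(1)[OF z]] by simp
    qed
  qed
  have "h \<otimes> z \<otimes> inv h \<in> rel_center G A V (Suc m)" if h: "h \<in> A" and z: "z \<in> rel_center G A V (Suc m)" for h z
  proof -
    have "x \<otimes> (h \<otimes> z \<otimes> inv h) \<otimes> inv x \<otimes> inv (h \<otimes> z \<otimes> inv h) \<in> ?U" if x: "x \<in> A" for x
    proof -
      let ?x = "inv h \<otimes> x \<otimes> h"
      have xx: "?x \<in> A" using h x Am by simp
      have "h \<otimes> (?x \<otimes> z \<otimes> inv ?x \<otimes> inv z) \<otimes> inv h \<in> ?U" by (rule Un[OF h D(2)[OF z xx]])
      moreover have "h \<otimes> (?x \<otimes> z \<otimes> inv ?x \<otimes> inv z) \<otimes> inv h = x \<otimes> (h \<otimes> z \<otimes> inv h) \<otimes> inv x \<otimes> inv (h \<otimes> z \<otimes> inv h)"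
        using Ac[OF x] Ac[OF D(1)[OF z]] Ac[OF h] by (simp add: word_simps)
      ultimately show ?thesis by simp
    qed
    moreover have "h \<otimes> z \<otimes> inv h \<in> A" using h D(1)[OF z] Am by simp
    ultimately show ?thesis by simp
  qed
  then show ?case using sub A by (auto simp: normal_within_def)
qed

lemma rel_center_le: "rel_center G A V m \<subseteq> A"
  by (cases m) auto

context
  fixes A V
  assumes A: "subgroup A G" and V: "subgroup V G" "\<And>x v. x \<in> A \<Longrightarrow> v \<in> V \<inter> A \<Longrightarrow> x \<otimes> v \<otimes> inv x \<in> V"
    and tf: "\<And>y k::nat. y \<in> A \<Longrightarrow> 0 < k \<Longrightarrow> y [^] k \<in> V \<Longrightarrow> y \<in> V"
begin

text \<open>If \<open>A\<close> is torsion free modulo \<open>V\<close>, then so are the factors of its upper central series.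
  For \<open>m > 0\<close>, commutation with \<open>x\<close> is a homomorphism modulo lower terms, so it maps \<open>z\<close> to an
  element with a \<open>k\<close>-th power in the lower term, and the induction hypothesis applies to this
  element.\<close>

lemma rel_center_factor_torsion_free:
  "z \<in> rel_center G A V (Suc m) \<Longrightarrow> 0 < (k::nat) \<Longrightarrow> z [^] k \<in> rel_center G A V m \<Longrightarrow> z \<in> rel_center G A V m"
proof (induction m arbitrary: z)
  case 0
  then show ?case using tf by auto
next
  case (Suc m)
  let ?U = "rel_center G A V"
  have nw: "normal_within G (?U i) A" for i by (rule rel_center_normal[OF A V])
  have s: "subgroup (?U i) G" for i using nw by (simp add: normal_within_def)
  have zA: "z \<in> A" using Suc.prems(1) by simp
  have Ac: "\<And>x. x \<in> A \<Longrightarrow> x \<in> carrier G" using subgroup.mem_carrier[OF A] .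
  have "x \<otimes> z \<otimes> inv x \<otimes> inv z \<in> ?U m" if x: "x \<in> A" for x
  proof -
    let ?w = "x \<otimes> z \<otimes> inv x \<otimes> inv z"
    have c: "x \<in> carrier G" "z \<in> carrier G" using x zA Ac by auto
    have w: "?w \<in> ?U (Suc m)" using Suc.prems(1) x by simp
    have wA: "?w \<in> A" using w rel_center_le by blast
    have "z \<otimes> ?w \<otimes> inv z \<otimes> inv ?w \<in> ?U m" using w zA by simp
    from pow_mult_commuting_mod[OF nw wA zA this, of k]
    have 1: "(?w \<otimes> z) [^] k \<otimes> inv (z [^] k) \<otimes> inv (?w [^] k) \<in> ?U m" .
    have "(x \<otimes> z \<otimes> inv x) [^] k = x \<otimes> z [^] k \<otimes> inv x" by (rule conj_nat_pow[OF c])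
    moreover have "?w \<otimes> z = x \<otimes> z \<otimes> inv x" using c by (simp add: word_simps)
    moreover have "x \<otimes> z [^] k \<otimes> inv x \<otimes> inv (z [^] k) \<in> ?U m" using Suc.prems(3) x by simp
    ultimately have 2: "(?w \<otimes> z) [^] k \<otimes> inv (z [^] k) \<in> ?U m" by simp
    let ?t = "(?w \<otimes> z) [^] k \<otimes> inv (z [^] k)"
    have wc: "?w \<in> carrier G" using c by simp
    have tc: "?t \<in> carrier G" using c by simp
    have "inv (?t \<otimes> inv (?w [^] k)) \<otimes> ?t \<in> ?U m"
      by (rule subgroup.m_closed[OF s subgroup.m_inv_closed[OF s 1] 2])
    moreover have "inv (?t \<otimes> inv (?w [^] k)) \<otimes> ?t = ?w [^] k"
    proof -
      have "?w [^] k \<in> carrier G" using wc by simp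
      with tc show ?thesis by (simp only: inv_mult_group inv_closed inv_inv m_assoc l_inv r_one)
    qed
    ultimately have "?w [^] k \<in> ?U m" by simp
    then show ?thesis by (rule Suc.IH[OF w Suc.prems(2)])
  qed
  with zA show ?case by simp
qed

text \<open>Let \<open>z = a \<otimes> inv b\<close>. If \<open>z\<close> lies in a term of the upper central series, then it is central
  modulo the next lower one, so that \<open>z [^] k\<close> is the quotient of the \<open>k\<close>-th powers modulo that
  term and thus lies in it. Since the factors are torsion free, \<open>z\<close> lies in it as well.\<close>

lemma unique_roots_mod:
  assumes nil: "A \<subseteq> rel_center G A V m" and ab: "a \<in> A" "b \<in> A"
    and k: "0 < (k::nat)" "a [^] k \<otimes> inv (b [^] k) \<in> V"
  shows "a \<otimes> inv b \<in> V"
proof -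
  let ?U = "rel_center G A V"
  have nw: "normal_within G (?U i) A" for i by (rule rel_center_normal[OF A V])
  have s: "subgroup (?U i) G" for i using nw by (simp add: normal_within_def)
  have c: "a \<in> carrier G" "b \<in> carrier G" using ab subgroup.mem_carrier[OF A] by blast+
  let ?z = "a \<otimes> inv b"
  have zc: "?z \<in> carrier G" using c by simp
  have zA: "?z \<in> A" using ab subgroup.m_closed[OF A] subgroup.m_inv_closed[OF A] by blast
  have pA: "a [^] k \<otimes> inv (b [^] k) \<in> A"
    using subgroup_int_pow_closed[OF A ab(1), of "int k"] subgroup_int_pow_closed[OF A ab(2), of "int k"]
      subgroup.m_closed[OF A] subgroup.m_inv_closed[OF A] by (simp add: int_pow_int)
  have up: "?U 0 \<subseteq> ?U i" for i
  proof (induction i)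
    case (Suc i)
    show ?case
    proof
      fix v assume v: "v \<in> ?U 0"
      have vA: "v \<in> A" using v by simp
      have "x \<otimes> v \<otimes> inv x \<otimes> inv v \<in> ?U i" if x: "x \<in> A" for x
      proof -
        have "x \<otimes> v \<otimes> inv x \<in> ?U 0" using nw[of 0] v x unfolding normal_within_def by blast
        then have "x \<otimes> v \<otimes> inv x \<otimes> inv v \<in> ?U 0"
          using subgroup.m_closed[OF s] subgroup.m_inv_closed[OF s] v by blast
        then show ?thesis using Suc by blast
      qed
      then show "v \<in> ?U (Suc i)" using vA by simp
    qed
  qed simp
  have "?z \<in> ?U (m - i)" if "i \<le> m" for i
    using that
  proof (induction i)
    case 0
    then show ?case using nil zA by auto
  next
    case (Suc i)
    let ?j = "m - Suc i"
    have z: "?z \<in> ?U (Suc ?j)" using Suc by (simp add: Suc_diff_Suc)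
    have "b \<otimes> ?z \<otimes> inv b \<otimes> inv ?z \<in> ?U ?j" using z ab(2) by simp
    from pow_mult_commuting_mod[OF nw zA ab(2) this, of k]
    have "(?z \<otimes> b) [^] k \<otimes> inv (b [^] k) \<otimes> inv (?z [^] k) \<in> ?U ?j" .
    moreover have "?z \<otimes> b = a" using c by (simp add: word_simps)
    ultimately have 1: "a [^] k \<otimes> inv (b [^] k) \<otimes> inv (?z [^] k) \<in> ?U ?j" by simp
    have 2: "a [^] k \<otimes> inv (b [^] k) \<in> ?U ?j" using up[of ?j] k(2) pA by auto
    let ?t = "a [^] k \<otimes> inv (b [^] k)"
    have "inv (?t \<otimes> inv (?z [^] k)) \<otimes> ?t \<in> ?U ?j"
      by (rule subgroup.m_closed[OF s subgroup.m_inv_closed[OF s 1] 2])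
    moreover have "inv (?t \<otimes> inv (?z [^] k)) \<otimes> ?t = ?z [^] k"
    proof -
      have "?z [^] k \<in> carrier G" "?t \<in> carrier G" using zc c by simp_all
      then show ?thesis by (simp only: inv_mult_group inv_closed inv_inv m_assoc l_inv r_one)
    qed
    ultimately show ?case using rel_center_factor_torsion_free[OF z k(1)] by simp
  qed
  from this[of m] show ?thesis by simp
qed

end

text \<open>Roots of central elements are central. By induction on \<open>j\<close>, the subgroup \<open>A\<close> is torsion
  free modulo the \<open>j\<close>-th centre of \<open>D\<close>, and it is nilpotent. If \<open>y [^] k\<close> is in the next centre
  and \<open>d \<in> D\<close>, then \<open>y\<close> and its conjugate by \<open>d\<close> have the same \<open>k\<close>-th power modulo the \<open>j\<close>-th
  centre, so they agree modulo it by uniqueness of roots.\<close>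

lemma isolator_in_center:
  assumes torsion: "torsion_free G" and D: "subgroup D G"
    and A: "normal_within G A D" and comm: "\<And>x y. x \<in> A \<Longrightarrow> y \<in> A \<Longrightarrow> x \<otimes> y \<otimes> inv x \<otimes> inv y \<in> rel_center G D {\<one>} c"
  shows "y \<in> A \<Longrightarrow> 0 < (k::nat) \<Longrightarrow> y [^] k \<in> rel_center G D {\<one>} j \<Longrightarrow> y \<in> rel_center G D {\<one>} j"
proof (induction j arbitrary: y k)
  case 0
  have As: "subgroup A G" using A by (simp add: normal_within_def)
  have "y \<in> carrier G" "y \<in> D" using 0 subgroup.mem_carrier[OF As] A by (auto simp: normal_within_def)
  then show ?case using 0 torsion by (auto simp: torsion_free_def)
next
  case (Suc j)
  let ?Z = "rel_center G D {\<one>}"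
  have As: "subgroup A G" and AD: "A \<subseteq> D" and An: "\<And>d a. d \<in> D \<Longrightarrow> a \<in> A \<Longrightarrow> d \<otimes> a \<otimes> inv d \<in> A"
    using A by (auto simp: normal_within_def)
  have Zn: "normal_within G (?Z i) D" for i
    by (rule rel_center_normal[OF D triv_subgroup]) (use subgroup.mem_carrier[OF D] in auto)
  have Zs: "subgroup (?Z i) G" and Zc: "\<And>x v. x \<in> D \<Longrightarrow> v \<in> ?Z i \<Longrightarrow> x \<otimes> v \<otimes> inv x \<in> ?Z i" for i
    using Zn by (auto simp: normal_within_def)
  have ZA: "x \<otimes> v \<otimes> inv x \<in> ?Z j" if "x \<in> A" "v \<in> ?Z j \<inter> A" for x v using Zc that AD by blast
  have "A \<inter> ?Z i \<subseteq> rel_center G A (?Z j) i" for i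
  proof (induction i)
    case 0
    have "\<one> \<in> ?Z j" using subgroup.one_closed[OF Zs] .
    then show ?case by auto
  next
    case (Suc i)
    have "z \<in> rel_center G A (?Z j) (Suc i)" if z: "z \<in> A" "z \<in> ?Z (Suc i)" for z
    proof -
      have "x \<otimes> z \<otimes> inv x \<otimes> inv z \<in> rel_center G A (?Z j) i" if x: "x \<in> A" for x
      proof -
        have "x \<otimes> z \<otimes> inv x \<otimes> inv z \<in> ?Z i" using z(2) x AD by auto
        moreover have "x \<otimes> z \<otimes> inv x \<otimes> inv z \<in> A"
          using x z(1) subgroup.m_closed[OF As] subgroup.m_inv_closed[OF As] by blast
        ultimately show ?thesis using Suc by blast
      qed
      then show ?thesis using z(1) by simp
    qed
    then show ?case by blast
  qed
  then have nil: "A \<subseteq> rel_center G A (?Z j) (Suc c)"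
    using comm subgroup.m_closed[OF As] subgroup.m_inv_closed[OF As] by (auto simp: subset_iff)
  have yD: "y \<in> D" using Suc.prems(1) AD by blast
  have yc: "y \<in> carrier G" using subgroup.mem_carrier[OF D yD] .
  have "d \<otimes> y \<otimes> inv d \<otimes> inv y \<in> ?Z j" if d: "d \<in> D" for d
  proof (rule unique_roots_mod[OF As Zs ZA _ nil An[OF d Suc.prems(1)] Suc.prems(1,2)])
    show "y \<in> ?Z j" if "y \<in> A" "0 < k" "y [^] k \<in> ?Z j" for y and k :: nat using Suc.IH that .
    have dc: "d \<in> carrier G" using subgroup.mem_carrier[OF D d] .
    have "(d \<otimes> y \<otimes> inv d) [^] k = d \<otimes> y [^] k \<otimes> inv d" by (rule conj_nat_pow[OF dc yc])
    then show "(d \<otimes> y \<otimes> inv d) [^] k \<otimes> inv (y [^] k) \<in> ?Z j" using Suc.prems(3) d by simp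
  qed
  then show ?case using yD by simp
qed

lemma iter_commutator_in_center:
  assumes D: "subgroup D G"
  shows "y \<in> D \<Longrightarrow> (\<And>ds. length ds = r \<Longrightarrow> set ds \<subseteq> D \<Longrightarrow> iter_commutator G ds y \<in> rel_center G D {\<one>} c) \<Longrightarrow>
    y \<in> rel_center G D {\<one>} (c + r)"
proof (induction r arbitrary: c)
  case 0
  from 0(2)[of "[]"] show ?case by simp
next
  case (Suc r)
  have "iter_commutator G ds y \<in> rel_center G D {\<one>} (Suc c)" if ds: "length ds = r" "set ds \<subseteq> D" for ds
  proof -
    have "iter_commutator G ds y \<in> D"
      using ds(2) by (induction ds) (auto simp: Let_def Suc.prems(1) intro!: subgroup.m_closed[OF D] subgroup.m_inv_closed[OF D])
    moreover have "d \<otimes> iter_commutator G ds y \<otimes> inv d \<otimes> inv (iter_commutator G ds y) \<in> rel_center G D {\<one>} c"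
      if "d \<in> D" for d
      using Suc.prems(2)[of "d # ds"] ds that by (simp add: Let_def)
    ultimately show ?thesis by simp
  qed
  from Suc.IH[OF Suc.prems(1) this] show ?case by simp
qed

text \<open>The terms of the lower central series lie in those of the upper one, counted from the
  other end.\<close>

lemma nilpotent_of_rel_center:
  assumes D: "subgroup D G" and c: "D \<subseteq> rel_center G D {\<one>} c"
  shows "nilpotent (G\<lparr>carrier := D\<rparr>)"
proof -
  let ?D = "G\<lparr>carrier := D\<rparr>"
  interpret D: group ?D using D by (rule subgroup_imp_group)
  let ?Z = "rel_center G D {\<one>}"
  have Zs: "subgroup (?Z i) G" for i
    using rel_center_normal[OF D triv_subgroup, of i] subgroup.mem_carrier[OF D] by (auto simp: normal_within_def)
  have Z: "subgroup (?Z i) ?D" for i using subgroup_incl[OF Zs D rel_center_le] .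
  have Dc: "\<And>x. x \<in> D \<Longrightarrow> x \<in> carrier G" using subgroup.mem_carrier[OF D] .
  have low: "lower_central ?D i \<subseteq> ?Z (c - i)" if "i \<le> c" for i
    using that
  proof (induction i)
    case 0
    then show ?case using c by simp
  next
    case (Suc i)
    have e: "c - i = Suc (c - Suc i)" using Suc.prems by simp
    have "{x \<otimes>\<^bsub>?D\<^esub> y \<otimes>\<^bsub>?D\<^esub> inv\<^bsub>?D\<^esub> x \<otimes>\<^bsub>?D\<^esub> inv\<^bsub>?D\<^esub> y | x y. x \<in> lower_central ?D i \<and> y \<in> carrier ?D} \<subseteq> ?Z (c - Suc i)"
    proof
      fix w assume "w \<in> {x \<otimes>\<^bsub>?D\<^esub> y \<otimes>\<^bsub>?D\<^esub> inv\<^bsub>?D\<^esub> x \<otimes>\<^bsub>?D\<^esub> inv\<^bsub>?D\<^esub> y | x y. x \<in> lower_central ?D i \<and> y \<in> carrier ?D}"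
      then obtain x y where xy: "x \<in> lower_central ?D i" "y \<in> D" "w = x \<otimes>\<^bsub>?D\<^esub> y \<otimes>\<^bsub>?D\<^esub> inv\<^bsub>?D\<^esub> x \<otimes>\<^bsub>?D\<^esub> inv\<^bsub>?D\<^esub> y"
        by auto
      have x: "x \<in> ?Z (Suc (c - Suc i))" using Suc xy(1) e by auto
      then have xD: "x \<in> D" by simp
      have "y \<otimes> x \<otimes> inv y \<otimes> inv x \<in> ?Z (c - Suc i)" using x xy(2) by simp
      then have "inv (y \<otimes> x \<otimes> inv y \<otimes> inv x) \<in> ?Z (c - Suc i)" by (rule subgroup.m_inv_closed[OF Zs])
      moreover have "inv (y \<otimes> x \<otimes> inv y \<otimes> inv x) = x \<otimes> y \<otimes> inv x \<otimes> inv y"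
        using Dc[OF xD] Dc[OF xy(2)] by (simp add: word_simps)
      moreover have "w = x \<otimes> y \<otimes> inv x \<otimes> inv y" using xy(2,3) xD D by (simp add: m_inv_consistent)
      ultimately show "w \<in> ?Z (c - Suc i)" by simp
    qed
    then show ?case unfolding lower_central.simps by (rule D.generate_subgroup_incl[OF _ Z])
  qed
  have "lower_central ?D c \<subseteq> {\<one>}" using low[of c] by auto
  moreover have "\<one> \<in> lower_central ?D i" for i
  proof (cases i)
    case 0
    then show ?thesis using subgroup.one_closed[OF D] by simp
  next
    case (Suc k)
    then show ?thesis using generate.one[of ?D] by simp
  qed
  ultimately show ?thesis unfolding nilpotent_def by (intro exI[of _ c]) auto
qed

end

section \<open>Finite generation of subgroups of finite index\<close>

context group begin

text \<open>The Schreier generators \<open>t C \<otimes> y \<otimes> inv (t (C #> y))\<close>. The elements \<open>s\<close> for which all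
  cocycle values lie in the group generated by them form a subgroup, and it contains the
  generating set \<open>Y\<close>.\<close>

lemma finite_index_finitely_generated:
  assumes Y: "finite Y" "Y \<subseteq> carrier G" "generate G Y = carrier G" and H: "finite_index_subgroup H G"
  obtains Z where "finite Z" "Z \<subseteq> H" "generate G Z = H"
proof -
  have Hs: "subgroup H G" and fin: "finite (rcosets H)" using H by (auto simp: finite_index_subgroup_def)
  obtain t where trans: "transversal H t" using ex_transversal[OF Hs] by blast
  have t: "C \<in> rcosets H \<Longrightarrow> t C \<in> carrier G" "C \<in> rcosets H \<Longrightarrow> H #> t C = C" "t H = \<one>" for C
    using trans by (simp_all add: transversal_def)
  note tc = transversal_cocycle[OF Hs trans]
  define Z where "Z = (\<lambda>(C, y). t C \<otimes> y \<otimes> inv (t (C #> y))) ` ((rcosets H) \<times> Y)"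
  have ZH: "Z \<subseteq> H" using tc(2) Y(2) by (auto simp: Z_def)
  have gs: "subgroup (generate G Z) G"
    using generate_is_subgroup ZH subgroup.subset[OF Hs] by (meson subset_trans)
  define P where "P = {s \<in> carrier G. \<forall>C\<in>rcosets H. t C \<otimes> s \<otimes> inv (t (C #> s)) \<in> generate G Z}"
  have CH: "C \<subseteq> carrier G" if "C \<in> rcosets H" for C using that rcosets_part_G[OF Hs] by blast
  have "subgroup P G"
  proof (rule subgroupI)
    have "\<one> \<in> P" using t(1) coset_mult_one[OF CH] subgroup.one_closed[OF gs] by (auto simp: P_def)
    then show "P \<noteq> {}" by blast
    show "inv a \<in> P" if a: "a \<in> P" for a
    proof -
      have ac: "a \<in> carrier G" using a by (simp add: P_def)
      have "t C \<otimes> inv a \<otimes> inv (t (C #> inv a)) \<in> generate G Z" if C: "C \<in> rcosets H" for C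
      proof -
        let ?C = "C #> inv a"
        have C': "?C \<in> rcosets H" using tc(1)[OF C inv_closed[OF ac]] .
        have "?C #> a = C" using coset_mult_assoc[OF CH[OF C], of "inv a" a] ac coset_mult_one[OF CH[OF C]] by simp
        then have "t ?C \<otimes> a \<otimes> inv (t C) \<in> generate G Z" using a C' by (auto simp: P_def)
        then have "inv (t ?C \<otimes> a \<otimes> inv (t C)) \<in> generate G Z" by (rule subgroup.m_inv_closed[OF gs])
        then show ?thesis using t(1)[OF C] t(1)[OF C'] ac by (simp add: word_simps)
      qed
      then show ?thesis using ac by (simp add: P_def)
    qed
    show "a \<otimes> b \<in> P" if a: "a \<in> P" and b: "b \<in> P" for a b
    proof -
      have ab: "a \<in> carrier G" "b \<in> carrier G" using a b by (auto simp: P_def)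
      have "t C \<otimes> (a \<otimes> b) \<otimes> inv (t (C #> (a \<otimes> b))) \<in> generate G Z" if C: "C \<in> rcosets H" for C
        unfolding tc(3)[OF C ab] tc(4)[OF C ab]
        by (rule subgroup.m_closed[OF gs]) (use a b C tc(1)[OF C ab(1)] in \<open>auto simp: P_def\<close>)
      then show ?thesis using ab by (simp add: P_def)
    qed
  qed (auto simp: P_def)
  moreover have "Y \<subseteq> P"
  proof
    fix y assume y: "y \<in> Y"
    have "t C \<otimes> y \<otimes> inv (t (C #> y)) \<in> generate G Z" if "C \<in> rcosets H" for C
      by (rule generate.incl) (use that y in \<open>force simp: Z_def\<close>)
    then show "y \<in> P" using y Y(2) by (auto simp: P_def)
  qed
  ultimately have PG: "carrier G \<subseteq> P" using generate_subgroup_incl[of Y P] Y(3) by simp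
  have "H \<subseteq> generate G Z"
  proof
    fix h assume h: "h \<in> H"
    have hc: "h \<in> carrier G" using h subgroup.mem_carrier[OF Hs] by blast
    have "H \<in> rcosets H" using subgroup.subgroup_in_rcosets[OF Hs is_group] .
    then have "t H \<otimes> h \<otimes> inv (t (H #> h)) \<in> generate G Z" using PG hc by (auto simp: P_def)
    moreover have "H #> h = H" using coset_join2[OF hc Hs h] .
    ultimately show "h \<in> generate G Z" using t(3) hc by simp
  qed
  moreover have "generate G Z \<subseteq> H" using generate_subgroup_incl[OF ZH Hs] .
  moreover have "finite Z" unfolding Z_def using fin Y(1) by (intro finite_imageI finite_cartesian_product)
  ultimately show thesis using that[of Z] ZH by blast
qed

end

text \<open>Adjoining one more generator of finite order to a finite commutative group keeps it
  finite.\<close>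

lemma (in comm_group) finite_generate_torsion:
  assumes "finite Z" "Z \<subseteq> carrier G" "\<And>z. z \<in> Z \<Longrightarrow> \<exists>k::nat. 0 < k \<and> z [^] k = \<one>"
  shows "finite (generate G Z)"
  using assms
proof (induction Z rule: finite_induct)
  case empty
  then show ?case by (simp add: generate_empty)
next
  case (insert z Z)
  then obtain k :: nat where k: "0 < k" "z [^] k = \<one>" by auto
  have zc: "z \<in> carrier G" and Zc: "Z \<subseteq> carrier G" using insert.prems by auto
  let ?B = "(\<lambda>(b, i). b \<otimes> z [^] (i::nat)) ` (generate G Z \<times> UNIV)"
  have gs: "subgroup (generate G Z) G" by (rule generate_is_subgroup[OF Zc])
  have gc: "\<And>b. b \<in> generate G Z \<Longrightarrow> b \<in> carrier G" using subgroup.mem_carrier[OF gs] .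
  have "subgroup ?B G"
  proof (rule subgroupI)
    show "?B \<subseteq> carrier G" using gc zc by auto
    show "?B \<noteq> {}" using subgroup.one_closed[OF gs] by auto
    show "inv a \<in> ?B" if aB: "a \<in> ?B" for a
    proof -
      obtain b i where b: "b \<in> generate G Z" "a = b \<otimes> z [^] (i::nat)" using aB by auto
      have "z [^] i \<otimes> z [^] (k * i - i) = \<one>"
        using k zc by (simp add: nat_pow_mult nat_pow_pow[symmetric])
      then have "inv (z [^] i) = z [^] (k * i - i)" using zc by (metis inv_equality m_comm nat_pow_closed)
      then have "inv a = inv b \<otimes> z [^] (k * i - i)" using b gc zc by (simp add: inv_mult)
      then show ?thesis using subgroup.m_inv_closed[OF gs b(1)] by force
    qed
    show "a \<otimes> a' \<in> ?B" if aB: "a \<in> ?B" "a' \<in> ?B" for a a'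
    proof -
      obtain b i b' i' where b: "b \<in> generate G Z" "a = b \<otimes> z [^] (i::nat)" "b' \<in> generate G Z" "a' = b' \<otimes> z [^] (i'::nat)"
        using aB by auto
      have "a \<otimes> a' = (b \<otimes> b') \<otimes> z [^] (i + i')"
        using b gc zc by (simp add: nat_pow_mult[symmetric] m_ac)
      then show ?thesis using subgroup.m_closed[OF gs b(1,3)] by force
    qed
  qed
  moreover have "insert z Z \<subseteq> ?B"
  proof -
    have "z = \<one> \<otimes> z [^] (1::nat)" using zc by simp
    then have "z \<in> ?B" using subgroup.one_closed[OF gs] by force
    moreover have "y \<in> ?B" if "y \<in> Z" for y
    proof -
      have "y = y \<otimes> z [^] (0::nat)" using that Zc by auto
      then show ?thesis using generate.incl[OF that, of G] by force
    qed
    ultimately show ?thesis by blast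
  qed
  ultimately have "generate G (insert z Z) \<subseteq> ?B" using generate_subgroup_incl by blast
  moreover have "?B \<subseteq> (\<lambda>(b, i). b \<otimes> z [^] (i::nat)) ` (generate G Z \<times> {..<k})"
  proof
    fix a assume "a \<in> ?B"
    then obtain b i where b: "b \<in> generate G Z" "a = b \<otimes> z [^] (i::nat)" by auto
    have "z [^] i = z [^] (k * (i div k) + i mod k)" by simp
    also have "\<dots> = (z [^] k) [^] (i div k) \<otimes> z [^] (i mod k)" using zc by (simp only: nat_pow_mult nat_pow_pow nat_pow_closed)
    also have "\<dots> = z [^] (i mod k)" using k(2) zc by simp
    finally show "a \<in> (\<lambda>(b, i). b \<otimes> z [^] (i::nat)) ` (generate G Z \<times> {..<k})" using b k(1) by force
  qed
  moreover have "finite ((\<lambda>(b, i). b \<otimes> z [^] (i::nat)) ` (generate G Z \<times> {..<k}))"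
    using insert by (intro finite_imageI finite_cartesian_product) auto
  ultimately show ?case by (meson finite_subset)
qed

text \<open>The abelianization of \<open>H\<close> is finitely generated and torsion, hence finite.
  Contrapositively, a derived subgroup of infinite index leaves a nonzero rational section.\<close>

lemma (in group) finite_index_derived:
  assumes fg: "finitely_generated G" and H: "finite_index_subgroup H G"
    and tors: "\<And>x. x \<in> H \<Longrightarrow> \<exists>k::nat. 0 < k \<and> x [^] k \<in> derived G H"
  shows "finite_index_subgroup (derived G H) G"
proof -
  have Hs: "subgroup H G" using H by (simp add: finite_index_subgroup_def)
  let ?D = "derived G H"
  have Ds: "subgroup ?D G" by (rule derived_is_subgroup[OF subgroup.subset[OF Hs]])
  obtain Z where Z: "finite Z" "Z \<subseteq> H" "generate G Z = H"
    using fg finite_index_finitely_generated[OF _ _ _ H] by (auto simp: finitely_generated_def)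
  let ?Q = "G\<lparr>carrier := H\<rparr> Mod ?D"
  have nw: "normal_within G ?D H" using normal_within_iff[OF Hs] derived_subgroup_is_normal[OF Hs] by blast
  interpret \<pi>: group_hom "G\<lparr>carrier := H\<rparr>" ?Q "(#>) ?D" by (rule normal_within_quotient_hom[OF nw])
  have Q: "comm_group ?Q" by (rule derived_quot_of_subgroup_is_comm_group[OF Hs])
  have im: "(#>) ?D ` H = generate ?Q ((#>) ?D ` Z)"
    using \<pi>.generate_img[of Z] Z(2,3) generate_consistent[OF Z(2) Hs] by simp
  have "finite (generate ?Q ((#>) ?D ` Z))"
  proof (rule comm_group.finite_generate_torsion[OF Q])
    show "finite ((#>) ?D ` Z)" using Z(1) by simp
    show "(#>) ?D ` Z \<subseteq> carrier ?Q" using \<pi>.hom_closed Z(2) by auto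
    fix w assume "w \<in> (#>) ?D ` Z"
    then obtain z where z: "z \<in> H" "w = ?D #> z" using Z(2) by blast
    obtain k :: nat where k: "0 < k" "z [^] k \<in> ?D" using tors[OF z(1)] by blast
    have "z [^] k \<in> carrier G" using k(2) subgroup.mem_carrier[OF Ds] by blast
    then have "?D #> (z [^] k) = ?D" using coset_join2[OF _ Ds k(2)] by blast
    then have "w [^]\<^bsub>?Q\<^esub> k = \<one>\<^bsub>?Q\<^esub>" using \<pi>.hom_nat_pow[of z k] z by (simp add: carrier_upd_nat_pow)
    with k(1) show "\<exists>k::nat. 0 < k \<and> w [^]\<^bsub>?Q\<^esub> k = \<one>\<^bsub>?Q\<^esub>" by blast
  qed
  then have fin: "finite ((#>) ?D ` H)" unfolding im .
  show ?thesis
    by (rule finite_index_trans[OF H Ds fin]) (use rcoset_eqD[OF Ds] subgroup.mem_carrier[OF Hs] in blast)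
qed

section \<open>Small Hirsch length forces virtual nilpotency\<close>

context perfect_extension begin

text \<open>Either the term \<open>E i\<close> of the derived series has finite index, and then it acts trivially
  on its abelianization, or the section has rank less than \<open>q\<close>, because a rank of at least
  \<open>r (p - 1)\<close> is already used up above it, and then a subgroup of finite index acts unipotently.
  The intersection \<open>D\<close> of these subgroups over the finitely many steps is nilpotent; this is shown
  from the bottom of the derived series upwards.\<close>

theorem virtually_nilpotent_of_small_hirsch:
  fixes p r :: nat
  assumes torsion: "torsion_free G" and fg: "finitely_generated G"
    and q: "q = p * r" "0 < r" "1 < p"
    and \<Phi>: "Factorial_Ring.irreducible (\<Sum>i<p. Polynomial.monom (1::rat) (r * i))"
    and small: "\<And>v. hirsch_ge G (carrier G) v \<Longrightarrow> v < q + r * (p - 1)"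
  shows "\<exists>D. finite_index_subgroup D G \<and> nilpotent (G\<lparr>carrier := D\<rparr>)"
proof -
  define E where "E i = (derived G ^^ i) N" for i
  have E_Suc: "E (Suc i) = derived G (E i)" for i by (simp add: E_def)
  have En: "E i \<lhd> G" for i unfolding E_def by (rule derived_series_normal)
  have Es: "subgroup (E i) G" for i using normal_imp_subgroup[OF En] .
  have Ec: "E i \<subseteq> carrier G" for i using subgroup.subset[OF Es] .
  have EE: "E (Suc i) \<subseteq> E i" for i unfolding E_Suc by (rule derived_incl[OF order_refl Es])
  have mono: "E j \<subseteq> E i" if "i \<le> j" for i j using lift_Suc_antimono_le[of E, OF EE that] .
  have E0: "E 0 = N" by (simp add: E_def)
  obtain m where m: "E m = {\<one>}" using N_solvable by (auto simp: E_def)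
  have Ews: "normal_within G (E (Suc i)) (E i)" for i
    unfolding E_Suc normal_within_iff[OF Es] by (rule derived_subgroup_is_normal[OF Es])
  have Ecomm: "comm_group (G\<lparr>carrier := E i\<rparr> Mod E (Suc i))" for i
    unfolding E_Suc by (rule derived_quot_of_subgroup_is_comm_group[OF Es])
  have bound: "v \<le> q + r * (p - 1)" if "hirsch_ge G (E i) v" for v i
    using small[OF hirsch_ge.mono[OF that Ec subgroup_self]] by simp
  have sect: "\<exists>n x c. perfect_section G N g q (E i) (E (Suc i)) n x c \<and> hirsch_ge G (E i) (w + n)"
    if "hirsch_ge G (E (Suc i)) w" for i w
  proof -
    show ?thesis
    proof (rule ex_rational_coordinates_mod[OF Ews Ecomm \<open>hirsch_ge G (E (Suc i)) w\<close> bound])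
      fix n x and c :: "'a \<Rightarrow> nat \<Rightarrow> rat"
      assume nxc: "\<And>i'. i' < n \<Longrightarrow> x i' \<in> E i"
        "\<And>a b i'. a \<in> E i \<Longrightarrow> b \<in> E i \<Longrightarrow> i' < n \<Longrightarrow> c (a \<otimes> b) i' = c a i' + c b i'"
        "\<And>i j. i < n \<Longrightarrow> j < n \<Longrightarrow> c (x i) j = of_bool (i = j)"
        "\<And>a. a \<in> E i \<Longrightarrow> (\<forall>i'<n. c a i' = 0) \<longleftrightarrow> (\<exists>k::nat. 0 < k \<and> a [^] k \<in> E (Suc i))"
        "hirsch_ge G (E i) (w + n)"
      have "rational_section G (E i) (E (Suc i)) n x c"
        by (intro rational_section.intro is_group rational_section_axioms.intro En EE) (fact nxc)+
      then have "perfect_section G N g q (E i) (E (Suc i)) n x c"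
        by (simp add: perfect_section_def perfect_extension_axioms)
      with nxc(5) show ?thesis by blast
    qed
  qed
  have rank_small: "n < q"
    if inf: "\<not> finite_index_subgroup (E i) G" and h: "hirsch_ge G (E i) n" for i n
  proof -
    have fin0: "finite_index_subgroup (E 0) G" using N_finite_index E0 by simp
    \<comment> \<open>The last term of finite index is followed by a section of rank at least \<open>r * (p - 1)\<close>,
      which leaves less than \<open>q\<close> for all later terms.\<close>
    define j1 where "j1 = (LEAST j. \<not> finite_index_subgroup (E j) G)"
    have j1: "\<not> finite_index_subgroup (E j1) G" unfolding j1_def by (rule LeastI[where P = "\<lambda>j. \<not> finite_index_subgroup (E j) G", OF inf])
    have "j1 \<le> i" unfolding j1_def by (rule Least_le[where P = "\<lambda>j. \<not> finite_index_subgroup (E j) G", OF inf])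
    have "j1 \<noteq> 0" using j1 fin0 by metis
    then obtain j where j: "j1 = Suc j" by (cases j1) auto
    have finj: "finite_index_subgroup (E j) G"
      using not_less_Least[of j "\<lambda>j. \<not> finite_index_subgroup (E j) G"] j j1_def by auto
    have "hirsch_ge G (E (Suc j)) n"
      using hirsch_ge.mono[OF h mono Es] \<open>j1 \<le> i\<close> j by simp
    from sect[OF this] obtain n' x c where
      S: "perfect_section G N g q (E j) (E (Suc j)) n' x c" and h': "hirsch_ge G (E j) (n + n')" by blast
    interpret S: perfect_section G N g q "E j" "E (Suc j)" n' x c by (rule S)
    have "0 < n'"
    proof (rule ccontr)
      assume "\<not> 0 < n'"
      then have "\<exists>k::nat. 0 < k \<and> a [^] k \<in> derived G (E j)" if "a \<in> E j" for a
        using S.c_zero_iff[OF that] E_Suc by simp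
      from finite_index_derived[OF fg finj this] have "finite_index_subgroup (E j1) G" using E_Suc j by simp
      with j1 show False ..
    qed
    then have "r * (p - 1) \<le> n'" by (rule S.rank_of_section[OF finj _ q \<Phi>])
    moreover have "n + n' < q + r * (p - 1)" by (rule small[OF hirsch_ge.mono[OF h' Ec subgroup_self]])
    ultimately show "n < q" by simp
  qed
  \<comment> \<open>Commutators with elements of \<open>D\<close> descend, up to a power, one step in the derived series
    after a bounded number \<open>s\<close> of iterations.\<close>
  have unip: "\<exists>D s. D \<lhd> G \<and> D \<subseteq> N \<and> finite_index_subgroup D G \<and>
    (\<forall>ds y. length ds = s \<longrightarrow> set ds \<subseteq> D \<longrightarrow> y \<in> E i \<longrightarrow> (\<exists>k::nat. 0 < k \<and> iter_commutator G ds y [^] k \<in> E (Suc i)))" for i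
  proof (cases "finite_index_subgroup (E i) G")
    case True
    have "\<exists>k::nat. 0 < k \<and> iter_commutator G ds y [^] k \<in> E (Suc i)"
      if ds: "length ds = 1" "set ds \<subseteq> E i" and y: "y \<in> E i" for ds y
    proof -
      obtain d where d: "ds = [d]" "d \<in> E i" using ds by (cases ds) auto
      then have "iter_commutator G ds y \<in> E (Suc i)" unfolding E_Suc using derived_memI[OF d(2) y] by simp
      then have "iter_commutator G ds y [^] (1::nat) \<in> E (Suc i)"
        by (subst nat_pow_eone) (auto intro: subgroup.mem_carrier[OF Es])
      then show ?thesis by (intro exI[of _ 1]) simp
    qed
    then show ?thesis using True En mono[of 0 i] E0 by (intro exI[of _ "E i"] exI[of _ 1]) auto
  next
    case False
    have "hirsch_ge G (E (Suc i)) 0" by (rule hirsch_ge.zero[OF Es])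
    from sect[OF this] obtain n x c where
      S: "perfect_section G N g q (E i) (E (Suc i)) n x c" and h: "hirsch_ge G (E i) n" by auto
    interpret S: perfect_section G N g q "E i" "E (Suc i)" n x c by (rule S)
    obtain D where D: "D \<lhd> G" "D \<subseteq> N" "finite_index_subgroup D G" "unipotent_on n S.complex_rep D"
      using virtually_unipotent[OF S.complex_rep rank_small[OF False h]] by blast
    have Dc: "D \<subseteq> carrier G" using D(2) Ec[of 0] E0 by blast
    obtain s where "\<And>ds y. length ds = s \<Longrightarrow> set ds \<subseteq> D \<Longrightarrow> y \<in> E i \<Longrightarrow>
        \<exists>k::nat. 0 < k \<and> iter_commutator G ds y [^] k \<in> E (Suc i)"
      using S.unipotent_commutators[OF D(4) Dc] by blast
    then show ?thesis using D(1-3) by blast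
  qed
  have "\<exists>D. D \<lhd> G \<and> D \<subseteq> N \<and> finite_index_subgroup D G \<and> (\<forall>i<l. \<exists>s. \<forall>ds y. length ds = s \<longrightarrow> set ds \<subseteq> D \<longrightarrow> y \<in> E i \<longrightarrow>
    (\<exists>k::nat. 0 < k \<and> iter_commutator G ds y [^] k \<in> E (Suc i)))" for l
  proof (induction l)
    case 0
    then show ?case using N N_finite_index by blast
  next
    case (Suc l)
    then obtain D where D: "D \<lhd> G" "D \<subseteq> N" "finite_index_subgroup D G" "\<forall>i<l. \<exists>s. \<forall>ds y. length ds = s \<longrightarrow> set ds \<subseteq> D \<longrightarrow> y \<in> E i \<longrightarrow>
    (\<exists>k::nat. 0 < k \<and> iter_commutator G ds y [^] k \<in> E (Suc i))" by blast
    obtain D' s where D': "D' \<lhd> G" "D' \<subseteq> N" "finite_index_subgroup D' G"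
    "\<forall>ds y. length ds = s \<longrightarrow> set ds \<subseteq> D' \<longrightarrow> y \<in> E l \<longrightarrow> (\<exists>k::nat. 0 < k \<and> iter_commutator G ds y [^] k \<in> E (Suc l))"
      using unip[of l] by blast
    have "\<exists>s. \<forall>ds y. length ds = s \<longrightarrow> set ds \<subseteq> D \<inter> D' \<longrightarrow> y \<in> E i \<longrightarrow>
      (\<exists>k::nat. 0 < k \<and> iter_commutator G ds y [^] k \<in> E (Suc i))" if "i < Suc l" for i
    proof (cases "i = l")
      case True
      then show ?thesis using D'(4) by (intro exI[of _ s]) blast
    next
      case False
      then have "i < l" using that by simp
      then obtain s' where "\<forall>ds y. length ds = s' \<longrightarrow> set ds \<subseteq> D \<longrightarrow> y \<in> E i \<longrightarrow>
        (\<exists>k::nat. 0 < k \<and> iter_commutator G ds y [^] k \<in> E (Suc i))" using D(4) by blast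
      then show ?thesis by (intro exI[of _ s']) blast
    qed
    moreover have "D \<inter> D' \<lhd> G" using normal_subgroup_intersect D(1) D'(1) by blast
    moreover have "finite_index_subgroup (D \<inter> D') G" using finite_index_inter D(3) D'(3) by blast
    ultimately show ?case using D(2) by blast
  qed
  then obtain D where D: "D \<lhd> G" "D \<subseteq> N" "finite_index_subgroup D G" and
    Du: "\<And>i. i < m \<Longrightarrow> \<exists>s. \<forall>ds y. length ds = s \<longrightarrow> set ds \<subseteq> D \<longrightarrow> y \<in> E i \<longrightarrow>
      (\<exists>k::nat. 0 < k \<and> iter_commutator G ds y [^] k \<in> E (Suc i))" by (metis (no_types, lifting))
  have Ds: "subgroup D G" using normal_imp_subgroup[OF D(1)] .
  have Dc: "D \<subseteq> carrier G" using subgroup.subset[OF Ds] .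
  have "\<exists>c. E (m - l) \<inter> D \<subseteq> rel_center G D {\<one>} c" if "l \<le> m" for l
    using that
  proof (induction l)
    case 0
    have "E m \<inter> D \<subseteq> rel_center G D {\<one>} 0" using m by auto
    then show ?case by (metis diff_zero)
  next
    case (Suc l)
    define i where "i = m - Suc l"
    have i: "i < m" "Suc i = m - l" using Suc.prems by (auto simp: i_def)
    obtain c where c: "E (Suc i) \<inter> D \<subseteq> rel_center G D {\<one>} c" using Suc i by auto
    obtain s where s: "\<And>ds y. length ds = s \<Longrightarrow> set ds \<subseteq> D \<Longrightarrow> y \<in> E i \<Longrightarrow>
      \<exists>k::nat. 0 < k \<and> iter_commutator G ds y [^] k \<in> E (Suc i)" using Du[OF i(1)] by blast
    \<comment> \<open>The isolator of the next term in \<open>D\<close>. Iterated commutators land in it, and it lies in the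
      same centre as the next term, because roots of central elements are central.\<close>
    define A where "A = {y \<in> E i \<inter> D. \<exists>k::nat. 0 < k \<and> y [^] k \<in> E (Suc i)}"
    have AI: "y \<in> A" if "y \<in> E i" "y \<in> D" "0 < k" "y [^] (k::nat) \<in> E (Suc i)" for y k
      using that by (auto simp: A_def)
    have EDm: "x \<otimes> y \<in> E i \<inter> D" "inv x \<in> E i \<inter> D" if "x \<in> E i \<inter> D" "y \<in> E i \<inter> D" for x y
      using that subgroup.m_closed[OF Es] subgroup.m_inv_closed[OF Es] subgroup.m_closed[OF Ds] subgroup.m_inv_closed[OF Ds]
      by blast+
    have powE: "x [^] (k::nat) \<in> E i" if "x \<in> E i" for x k i
      using subgroup_int_pow_closed[OF Es that, of "int k"] by (simp add: int_pow_int)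
    have As: "subgroup A G"
    proof (rule subgroupI)
      show "A \<subseteq> carrier G" using Dc by (auto simp: A_def)
      have "\<one> [^] (1::nat) \<in> E (Suc i)" using subgroup.one_closed[OF Es] by simp
      then have "\<one> \<in> A" using AI[of \<one> 1] subgroup.one_closed[OF Es] subgroup.one_closed[OF Ds] by simp
      then show "A \<noteq> {}" by blast
      show "inv a \<in> A" if a: "a \<in> A" for a
      proof -
        obtain k :: nat where k: "a \<in> E i \<inter> D" "0 < k" "a [^] k \<in> E (Suc i)" using a by (auto simp: A_def)
        have "inv a [^] k \<in> E (Suc i)" using subgroup.m_inv_closed[OF Es k(3)] k(1) Dc by (simp add: nat_pow_inv subset_iff)
        then show ?thesis using AI[of "inv a" k] EDm(2)[OF k(1,1)] k(2) by blast
      qed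
      show "a \<otimes> b \<in> A" if a: "a \<in> A" and b: "b \<in> A" for a b
      proof -
        obtain k :: nat where k: "a \<in> E i \<inter> D" "0 < k" "a [^] k \<in> E (Suc i)" using a by (auto simp: A_def)
        obtain k' :: nat where k': "b \<in> E i \<inter> D" "0 < k'" "b [^] k' \<in> E (Suc i)" using b by (auto simp: A_def)
        have cc: "a \<in> carrier G" "b \<in> carrier G" using k(1) k'(1) Dc by auto
        let ?K = "k * k'"
        have pa: "a [^] ?K \<in> E (Suc i)" using powE[OF k(3), of k'] cc by (simp add: nat_pow_pow)
        have pb: "b [^] ?K \<in> E (Suc i)" using powE[OF k'(3), of k] cc by (simp add: nat_pow_pow mult.commute)
        have "b \<otimes> a \<otimes> inv b \<otimes> inv a \<in> E (Suc i)"
          unfolding E_Suc using k(1) k'(1) by (intro derived_memI) auto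
        from pow_mult_commuting_mod[OF Ews _ _ this, of ?K]
        have "(a \<otimes> b) [^] ?K \<otimes> inv (b [^] ?K) \<otimes> inv (a [^] ?K) \<in> E (Suc i)" using k(1) k'(1) by blast
        then have "(a \<otimes> b) [^] ?K \<otimes> inv (b [^] ?K) \<otimes> inv (a [^] ?K) \<otimes> a [^] ?K \<otimes> b [^] ?K \<in> E (Suc i)"
          using pa pb subgroup.m_closed[OF Es] by blast
        then have "(a \<otimes> b) [^] ?K \<in> E (Suc i)" using cc by (simp add: m_assoc inv_cancel_left)
        then show ?thesis using AI[of "a \<otimes> b" ?K] EDm(1)[OF k(1) k'(1)] k(2) k'(2) by simp
      qed
    qed
    have An: "normal_within G A D"
      unfolding normal_within_def
    proof (intro conjI ballI)
      fix d a assume d: "d \<in> D" and a: "a \<in> A"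
      obtain k :: nat where k: "a \<in> E i \<inter> D" "0 < k" "a [^] k \<in> E (Suc i)" using a by (auto simp: A_def)
      have cc: "a \<in> carrier G" "d \<in> carrier G" using k(1) d Dc by auto
      have "(d \<otimes> a \<otimes> inv d) [^] k = d \<otimes> a [^] k \<otimes> inv d" by (rule conj_nat_pow[OF cc(2,1)])
      then have "(d \<otimes> a \<otimes> inv d) [^] k \<in> E (Suc i)" using normal_conj(1)[OF En cc(2) k(3)] by simp
      moreover have "d \<otimes> a \<otimes> inv d \<in> E i" "d \<otimes> a \<otimes> inv d \<in> D"
        using normal_conj(1)[OF En cc(2)] normal_conj(1)[OF D(1) cc(2)] k(1) by auto
      ultimately show "d \<otimes> a \<otimes> inv d \<in> A" using AI k(2) by blast
    qed (use As Ds in \<open>auto simp: A_def\<close>)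
    have "A \<subseteq> rel_center G D {\<one>} c"
    proof
      fix y assume y: "y \<in> A"
      then obtain k :: nat where k: "y \<in> E i \<inter> D" "0 < k" "y [^] k \<in> E (Suc i)" by (auto simp: A_def)
      have "y [^] k \<in> D" using subgroup_int_pow_closed[OF Ds, of y "int k"] k(1) by (simp add: int_pow_int)
      then have yk: "y [^] k \<in> rel_center G D {\<one>} c" using c k(3) by blast
      have comm: "a \<otimes> b \<otimes> inv a \<otimes> inv b \<in> rel_center G D {\<one>} c" if "a \<in> A" "b \<in> A" for a b
      proof -
        have ab: "a \<in> E i \<inter> D" "b \<in> E i \<inter> D" using that by (auto simp: A_def)
        have "a \<otimes> b \<otimes> inv a \<otimes> inv b \<in> E (Suc i)" unfolding E_Suc using ab by (intro derived_memI) auto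
        moreover have "a \<otimes> b \<otimes> inv a \<otimes> inv b \<in> D"
          using ab subgroup.m_closed[OF Ds] subgroup.m_inv_closed[OF Ds] by blast
        ultimately show ?thesis using c by blast
      qed
      show "y \<in> rel_center G D {\<one>} c" by (rule isolator_in_center[OF torsion Ds An comm y k(2) yk])
    qed
    moreover have "iter_commutator G ds y \<in> E i" "iter_commutator G ds y \<in> D"
      if "set ds \<subseteq> D" "y \<in> E i \<inter> D" for ds y
    proof -
      have "iter_commutator G ds y \<in> E i \<inter> D"
        using that(1)
      proof (induction ds)
        case (Cons d ds)
        let ?z = "iter_commutator G ds y"
        have z: "?z \<in> E i \<inter> D" and d: "d \<in> D" "d \<in> carrier G" using Cons Dc by auto
        have "d \<otimes> ?z \<otimes> inv d \<in> E i \<inter> D"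
          using z normal_conj(1)[OF En d(2)] normal_conj(1)[OF D(1) d(2)] by blast
        then show ?case using EDm z by (simp add: Let_def)
      qed (use that(2) in simp)
      then show "iter_commutator G ds y \<in> E i" "iter_commutator G ds y \<in> D" by auto
    qed
    ultimately have it: "iter_commutator G ds y \<in> rel_center G D {\<one>} c"
      if "length ds = s" "set ds \<subseteq> D" "y \<in> E i \<inter> D" for ds y
      using that s[of ds y] AI by blast
    have "E i \<inter> D \<subseteq> rel_center G D {\<one>} (c + s)"
    proof
      fix y assume y: "y \<in> E i \<inter> D"
      show "y \<in> rel_center G D {\<one>} (c + s)"
        by (rule iter_commutator_in_center[OF Ds]) (use y it in auto)
    qed
    then show ?case unfolding i_def by blast
  qed
  from this[of m] obtain c where "E 0 \<inter> D \<subseteq> rel_center G D {\<one>} c" by auto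
  then have "D \<subseteq> rel_center G D {\<one>} c" using D(2) E0 by auto
  then show ?thesis using nilpotent_of_rel_center[OF Ds] D(3) by blast
qed

end

section \<open>Irreducibility of three cyclotomic polynomials\<close>

text \<open>The prime \<open>p\<close> divides exactly one of the constant terms of \<open>g\<close> and \<open>h\<close>, say that of \<open>g\<close>.
  At the first coefficient of \<open>g\<close> not divisible by \<open>p\<close>, the coefficient of \<open>f\<close> is not divisible by
  \<open>p\<close> either, so its index, and the degree of \<open>g\<close>, is the degree of \<open>f\<close>.\<close>

lemma eisenstein:
  fixes f :: "int poly" and p :: int
  assumes p: "Factorial_Ring.prime p" and lead: "\<not> p dvd lead_coeff f"
    and low: "\<And>i. i < degree f \<Longrightarrow> p dvd coeff f i" and c0: "\<not> p ^ 2 dvd coeff f 0"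
    and fgh: "f = g * h"
  shows "degree g = degree f \<or> degree h = degree f"
proof (rule ccontr)
  assume neg: "\<not> ?thesis"
  have f0: "f \<noteq> 0" using lead by auto
  then have gh0: "g \<noteq> 0" "h \<noteq> 0" using fgh by auto
  then have dsum: "degree f = degree g + degree h" using fgh by (simp add: degree_mult_eq)
  then have dpos: "0 < degree g" "0 < degree h" using neg by auto
  have main: False if g: "f = g * h" "g \<noteq> 0" "h \<noteq> 0" "degree f = degree g + degree h" "0 < degree h" "p dvd coeff g 0" "\<not> p dvd coeff h 0" for g h
  proof -
    have "lead_coeff f = lead_coeff g * lead_coeff h" using g(1) by (simp add: lead_coeff_mult)
    then have "\<not> p dvd coeff g (degree g)" using lead by auto
    then have ex: "\<exists>i. \<not> p dvd coeff g i" by blast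
    define i where "i = (LEAST i. \<not> p dvd coeff g i)"
    have i: "\<not> p dvd coeff g i" unfolding i_def by (rule LeastI_ex[OF ex])
    have small: "p dvd coeff g j" if "j < i" for j using not_less_Least that unfolding i_def by blast
    have "i \<le> degree g" using i by (metis coeff_eq_0 dvd_0_right not_le_imp_less)
    then have "i < degree f" using g(4,5) by simp
    then have "p dvd coeff f i" by (rule low)
    moreover have "coeff f i = (\<Sum>j<i. coeff g j * coeff h (i - j)) + coeff g i * coeff h 0"
      unfolding g(1) coeff_mult by (simp add: lessThan_Suc_atMost[symmetric])
    moreover have "p dvd (\<Sum>j<i. coeff g j * coeff h (i - j))" using small by (intro dvd_sum) auto
    ultimately have "p dvd coeff g i * coeff h 0" by (simp add: dvd_add_right_iff)
    then show False using p i g(7) prime_dvd_multD by blast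
  qed
  have prod: "coeff f 0 = coeff g 0 * coeff h 0" using fgh by (simp add: coeff_mult)
  have "p dvd coeff g 0 * coeff h 0" using low[of 0] dsum dpos prod by simp
  then consider "p dvd coeff g 0" "\<not> p dvd coeff h 0" | "p dvd coeff h 0" "\<not> p dvd coeff g 0" | "p dvd coeff g 0" "p dvd coeff h 0"
    using p prime_dvd_multD by blast
  then show False
  proof cases
    case 1
    then show False using main[OF fgh gh0 dsum dpos(2)] by blast
  next
    case 2
    then show False using main[of h g] fgh gh0 dsum dpos by (simp add: mult.commute add.commute)
  next
    case 3
    then have "p ^ 2 dvd coeff f 0" unfolding prod power2_eq_square by (rule mult_dvd_mono)
    with c0 show False ..
  qed
qed

lemma irreducible_of_shifted_eisenstein:
  fixes f :: "int poly" and p :: int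
  assumes p: "Factorial_Ring.prime p" and deg: "0 < degree f"
    and lead: "\<not> p dvd lead_coeff (pcompose f [:1, 1:])"
    and low: "\<And>i. i < degree f \<Longrightarrow> p dvd coeff (pcompose f [:1, 1:]) i"
    and c0: "\<not> p ^ 2 dvd coeff (pcompose f [:1, 1:]) 0"
  shows "Factorial_Ring.irreducible (map_poly rat_of_int f)"
proof -
  have "irreducible\<^sub>d f"
  proof (rule irreducible\<^sub>dI[OF deg])
    fix g h assume gh: "0 < degree g" "degree g < degree f" "0 < degree h" "degree h < degree f" "f = g * h"
    have d: "degree (pcompose u [:1, 1:]) = degree u" for u :: "int poly" by (simp add: degree_pcompose)
    have "pcompose f [:1, 1:] = pcompose g [:1, 1:] * pcompose h [:1, 1:]" using gh(5) by (simp add: pcompose_mult)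
    from eisenstein[OF p lead _ c0 this] low have "degree g = degree f \<or> degree h = degree f" by (simp add: d)
    with gh show False by simp
  qed
  then have "irreducible\<^sub>d (map_poly rat_of_int f)" by (rule irreducible\<^sub>d_int_rat)
  then show ?thesis by simp
qed

text \<open>The cyclotomic polynomials of 5, 7 and 9, written as \<open>1 + x^r + \<dots> + x^(r (p - 1))\<close>. The
  substitution of \<open>x + 1\<close> for \<open>x\<close> makes them Eisenstein polynomials for 5, 7 and 3.\<close>

lemma cyclotomic_5_7_9_irreducible:
  "Factorial_Ring.irreducible (\<Sum>i<5. Polynomial.monom (1::rat) (1 * i))"
  "Factorial_Ring.irreducible (\<Sum>i<7. Polynomial.monom (1::rat) (1 * i))"
  "Factorial_Ring.irreducible (\<Sum>i<3. Polynomial.monom (1::rat) (3 * i))"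
proof -
  have 5: "Factorial_Ring.irreducible (map_poly rat_of_int [:1, 1, 1, 1, 1:])"
  proof (rule irreducible_of_shifted_eisenstein[where p = 5])
    have e: "pcompose [:1, 1, 1, 1, 1:] [:1, 1:] = ([:5, 10, 10, 5, 1:] :: int poly)" by (simp add: pcompose_pCons numeral_poly one_pCons del: pCons_one)
    show "(5::int) dvd coeff (pcompose [:1, 1, 1, 1, 1:] [:1, 1:]) i" if "i < degree [:1, 1, 1, 1, 1 :: int:]" for i
      using that unfolding e by (auto simp: less_Suc_eq coeff_pCons split: nat.splits)
  qed (simp_all add: pcompose_pCons numeral_poly one_pCons del: pCons_one)
  have 7: "Factorial_Ring.irreducible (map_poly rat_of_int [:1, 1, 1, 1, 1, 1, 1:])"
  proof (rule irreducible_of_shifted_eisenstein[where p = 7])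
    have e: "pcompose [:1, 1, 1, 1, 1, 1, 1:] [:1, 1:] = ([:7, 21, 35, 35, 21, 7, 1:] :: int poly)" by (simp add: pcompose_pCons numeral_poly one_pCons del: pCons_one)
    show "(7::int) dvd coeff (pcompose [:1, 1, 1, 1, 1, 1, 1:] [:1, 1:]) i" if "i < degree [:1, 1, 1, 1, 1, 1, 1 :: int:]" for i
      using that unfolding e by (auto simp: less_Suc_eq coeff_pCons split: nat.splits)
  qed (simp_all add: pcompose_pCons numeral_poly one_pCons del: pCons_one)
  have 9: "Factorial_Ring.irreducible (map_poly rat_of_int [:1, 0, 0, 1, 0, 0, 1:])"
  proof (rule irreducible_of_shifted_eisenstein[where p = 3])
    have e: "pcompose [:1, 0, 0, 1, 0, 0, 1:] [:1, 1:] = ([:3, 9, 18, 21, 15, 6, 1:] :: int poly)" by (simp add: pcompose_pCons numeral_poly one_pCons del: pCons_one)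
    show "(3::int) dvd coeff (pcompose [:1, 0, 0, 1, 0, 0, 1:] [:1, 1:]) i" if "i < degree [:1, 0, 0, 1, 0, 0, 1 :: int:]" for i
      using that unfolding e by (auto simp: less_Suc_eq coeff_pCons split: nat.splits)
  qed (simp_all add: pcompose_pCons numeral_poly one_pCons del: pCons_one)
  have "(\<Sum>i<5. Polynomial.monom (1::rat) (1 * i)) = map_poly rat_of_int [:1, 1, 1, 1, 1:]"
    by (simp add: numeral_eq_Suc Polynomial.monom_Suc Polynomial.monom_0 one_pCons del: pCons_one)
  with 5 show "Factorial_Ring.irreducible (\<Sum>i<5. Polynomial.monom (1::rat) (1 * i))" by simp
  have "(\<Sum>i<7. Polynomial.monom (1::rat) (1 * i)) = map_poly rat_of_int [:1, 1, 1, 1, 1, 1, 1:]"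
    by (simp add: numeral_eq_Suc Polynomial.monom_Suc Polynomial.monom_0 one_pCons del: pCons_one)
  with 7 show "Factorial_Ring.irreducible (\<Sum>i<7. Polynomial.monom (1::rat) (1 * i))" by simp
  have "(\<Sum>i<3. Polynomial.monom (1::rat) (3 * i)) = map_poly rat_of_int [:1, 0, 0, 1, 0, 0, 1:]"
    by (simp add: numeral_eq_Suc Polynomial.monom_Suc Polynomial.monom_0 one_pCons del: pCons_one)
  with 9 show "Factorial_Ring.irreducible (\<Sum>i<3. Polynomial.monom (1::rat) (3 * i))" by simp
qed

section \<open>The solvable radical and the Hirsch length\<close>

context group begin

lemma solvable_subgroup_iff:
  assumes "subgroup N G"
  shows "solvable (G\<lparr>carrier := N\<rparr>) \<longleftrightarrow> (\<exists>m. (derived G ^^ m) N = {\<one>})"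
proof -
  interpret N: group "G\<lparr>carrier := N\<rparr>" using assms by (rule subgroup_imp_group)
  have "(derived (G\<lparr>carrier := N\<rparr>) ^^ m) N = (derived G ^^ m) N \<and> (derived G ^^ m) N \<subseteq> N" for m
  proof (induction m)
    case (Suc m)
    have sub: "(derived G ^^ m) N \<subseteq> N" using Suc by blast
    then have "derived G ((derived G ^^ m) N) \<subseteq> N" by (rule derived_incl[OF _ assms])
    then show ?case using Suc derived_consistent[OF sub assms] by simp
  qed simp
  then show ?thesis using N.solvable_iff_trivial_derived_seq by simp
qed

text \<open>\<open>P\<close> and \<open>R\<close> have the same image modulo \<open>M\<close>, so the derived series of \<open>P\<close> is trivial modulo
  \<open>M\<close> as soon as that of \<open>R\<close> ends.\<close>

lemma derived_series_in_kernel: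
  assumes M: "M \<lhd> G" and P: "P \<subseteq> carrier G" and R: "R \<subseteq> carrier G"
    and cover: "\<And>x. x \<in> P \<Longrightarrow> \<exists>r\<in>R. x \<otimes> inv r \<in> M" "\<And>r. r \<in> R \<Longrightarrow> \<exists>x\<in>P. x \<otimes> inv r \<in> M"
    and m: "(derived G ^^ m) R = {\<one>}"
  shows "(derived G ^^ m) P \<subseteq> M"
proof
  have Ms: "subgroup M G" using normal_imp_subgroup[OF M] .
  interpret \<pi>: group_hom G "G Mod M" "(#>) M"
    using normal.r_coset_hom_Mod[OF M] normal.factorgroup_is_group[OF M]
    by (simp add: group_hom_def group_hom_axioms_def is_group)
  have "(#>) M ` P = (#>) M ` R"
  proof (intro equalityI subsetI)
    fix C assume "C \<in> (#>) M ` P"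
    then obtain x where x: "x \<in> P" "C = M #> x" by blast
    then obtain r where r: "r \<in> R" "x \<otimes> inv r \<in> M" using cover(1) by blast
    have "M #> x = M #> r" using rcoset_eq_iff[OF Ms] x r P R by blast
    then show "C \<in> (#>) M ` R" using x r by blast
  next
    fix C assume "C \<in> (#>) M ` R"
    then obtain r where r: "r \<in> R" "C = M #> r" by blast
    then obtain x where x: "x \<in> P" "x \<otimes> inv r \<in> M" using cover(2) by blast
    have "M #> x = M #> r" using rcoset_eq_iff[OF Ms] x r P R by blast
    then show "C \<in> (#>) M ` P" using x r by blast
  qed
  then have "(#>) M ` ((derived G ^^ m) P) = (#>) M ` ((derived G ^^ m) R)"
    using \<pi>.exp_of_derived_img[OF P, of m] \<pi>.exp_of_derived_img[OF R, of m] by simp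
  then have im: "(#>) M ` ((derived G ^^ m) P) = {M}" using m coset_mult_one[OF subgroup.subset[OF Ms]] by simp
  fix x assume x: "x \<in> (derived G ^^ m) P"
  have xc: "x \<in> carrier G" using x exp_of_derived_in_carrier[OF P] by blast
  have "M #> x = M" using im x by blast
  then show "x \<in> M" using rcos_self[OF xc Ms] by simp
qed

lemma derived_series_antimono: "A \<subseteq> B \<Longrightarrow> (derived G ^^ m) B = {\<one>} \<Longrightarrow> subgroup A G \<Longrightarrow> (derived G ^^ m) A = {\<one>}"
  using mono_exp_of_derived[of A B m] subgroup.one_closed[OF exp_of_derived_is_subgroup[of A m]] by auto

lemma normal_product:
  assumes N: "N \<lhd> G" and K: "K \<lhd> G"
  shows "{n \<otimes> k | n k. n \<in> N \<and> k \<in> K} \<lhd> G" (is "?P \<lhd> G")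
proof (rule normal_criterion)
  have Ns: "subgroup N G" and Ks: "subgroup K G" using N K by (auto intro: normal_imp_subgroup)
  have c: "\<And>n. n \<in> N \<Longrightarrow> n \<in> carrier G" "\<And>k. k \<in> K \<Longrightarrow> k \<in> carrier G"
    using subgroup.mem_carrier[OF Ns] subgroup.mem_carrier[OF Ks] by blast+
  show "?P \<subseteq> carrier G" using c by auto
  show "\<one> \<in> ?P" using subgroup.one_closed[OF Ns] subgroup.one_closed[OF Ks] by force
  show "x \<otimes> y \<in> ?P" if xy: "x \<in> ?P" "y \<in> ?P" for x y
  proof -
    obtain n k n' k' where e: "x = n \<otimes> k" "y = n' \<otimes> k'" "n \<in> N" "k \<in> K" "n' \<in> N" "k' \<in> K" using xy by blast
    have "x \<otimes> y = (n \<otimes> (k \<otimes> n' \<otimes> inv k)) \<otimes> (k \<otimes> k')" using e c by (simp add: word_simps)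
    moreover have "n \<otimes> (k \<otimes> n' \<otimes> inv k) \<in> N" "k \<otimes> k' \<in> K"
      using e normal_conj(1)[OF N c(2)] subgroup.m_closed[OF Ns] subgroup.m_closed[OF Ks] by blast+
    ultimately show ?thesis by blast
  qed
  show "inv x \<in> ?P" if x: "x \<in> ?P" for x
  proof -
    obtain n k where e: "x = n \<otimes> k" "n \<in> N" "k \<in> K" using x by blast
    have "inv x = (inv k \<otimes> inv n \<otimes> k) \<otimes> inv k" using e c by (simp add: word_simps)
    moreover have "inv k \<otimes> inv n \<otimes> k \<in> N" "inv k \<in> K"
      using e normal_conj(2)[OF N c(2)] subgroup.m_inv_closed[OF Ns] subgroup.m_inv_closed[OF Ks] by blast+
    ultimately show ?thesis by blast
  qed
  show "h \<otimes> x \<otimes> inv h \<in> ?P" if h: "h \<in> carrier G" and x: "x \<in> ?P" for h x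
  proof -
    obtain n k where e: "x = n \<otimes> k" "n \<in> N" "k \<in> K" using x by blast
    have "h \<otimes> x \<otimes> inv h = (h \<otimes> n \<otimes> inv h) \<otimes> (h \<otimes> k \<otimes> inv h)" using e c h by (simp add: word_simps)
    then show ?thesis using normal_conj(1)[OF N h e(2)] normal_conj(1)[OF K h e(3)] by blast
  qed
qed

text \<open>The normal core of \<open>H\<close>, that is the kernel of the action on its right cosets.\<close>

lemma ex_solvable_normal_finite_index:
  assumes H: "finite_index_subgroup H G" and m: "(derived G ^^ m) H = {\<one>}"
  obtains N where "N \<lhd> G" "finite_index_subgroup N G" "(derived G ^^ m) N = {\<one>}"
proof -
  have Hs: "subgroup H G" and fin: "finite (rcosets H)" using H by (auto simp: finite_index_subgroup_def)
  have Cc: "C \<subseteq> carrier G" if "C \<in> rcosets H" for C using that rcosets_part_G[OF Hs] by blast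
  have Cs: "C #> x \<in> rcosets H" if "C \<in> rcosets H" "x \<in> carrier G" for C x
  proof -
    obtain t where "transversal H t" using ex_transversal[OF Hs] by blast
    then show ?thesis using transversal_cocycle(1)[OF Hs _ that] by blast
  qed
  define N where "N = {x \<in> carrier G. \<forall>C\<in>rcosets H. C #> x = C}"
  have N: "N \<lhd> G"
  proof (rule normal_criterion)
    show "\<one> \<in> N" using coset_mult_one[OF Cc] by (simp add: N_def)
    show "x \<otimes> y \<in> N" if "x \<in> N" "y \<in> N" for x y
      using that coset_mult_assoc[OF Cc, symmetric] by (simp add: N_def)
    show "inv x \<in> N" if x: "x \<in> N" for x
    proof -
      have "C #> inv x = C" if C: "C \<in> rcosets H" for C
      proof -
        have "C #> inv x = (C #> x) #> inv x" using x C by (simp add: N_def)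
        also have "\<dots> = C" using coset_mult_assoc[OF Cc[OF C], of x "inv x"] coset_mult_one[OF Cc[OF C]] x by (simp add: N_def)
        finally show ?thesis .
      qed
      then show ?thesis using x by (simp add: N_def)
    qed
    show "h \<otimes> x \<otimes> inv h \<in> N" if h: "h \<in> carrier G" and x: "x \<in> N" for h x
    proof -
      have xc: "x \<in> carrier G" using x by (simp add: N_def)
      have "C #> (h \<otimes> x \<otimes> inv h) = C" if C: "C \<in> rcosets H" for C
      proof -
        have "C #> (h \<otimes> x \<otimes> inv h) = ((C #> h) #> x) #> inv h"
          using coset_mult_assoc[OF Cc[OF C]] coset_mult_assoc[OF Cc[OF Cs[OF C h]]] h xc by (simp add: m_assoc)
        also have "(C #> h) #> x = C #> h" using x Cs[OF C h] by (simp add: N_def)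
        also have "(C #> h) #> inv h = C" using coset_mult_assoc[OF Cc[OF C], of h "inv h"] coset_mult_one[OF Cc[OF C]] h by simp
        finally show ?thesis .
      qed
      then show ?thesis using h xc by (simp add: N_def)
    qed
  qed (auto simp: N_def)
  have "finite_index_subgroup N G"
  proof (rule finite_index_criterion[OF normal_imp_subgroup[OF N], where f = "\<lambda>x. \<lambda>C\<in>rcosets H. C #> x"])
    have "(\<lambda>x. \<lambda>C\<in>rcosets H. C #> x) ` carrier G \<subseteq> rcosets H \<rightarrow>\<^sub>E rcosets H" using Cs by auto
    moreover have "finite (rcosets H \<rightarrow>\<^sub>E rcosets H)" using fin by (intro finite_PiE)
    ultimately show "finite ((\<lambda>x. \<lambda>C\<in>rcosets H. C #> x) ` carrier G)" by (rule finite_subset)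
    fix x y assume x: "x \<in> carrier G" and y: "y \<in> carrier G"
      and xy: "(\<lambda>C\<in>rcosets H. C #> x) = (\<lambda>C\<in>rcosets H. C #> y)"
    have "C #> (x \<otimes> inv y) = C" if C: "C \<in> rcosets H" for C
    proof -
      have "C #> x = C #> y" using fun_cong[OF xy, of C] C by simp
      then have "C #> (x \<otimes> inv y) = C #> (y \<otimes> inv y)"
        using coset_mult_assoc[OF Cc[OF C], of x "inv y"] coset_mult_assoc[OF Cc[OF C], of y "inv y"] x y by simp
      then show ?thesis using coset_mult_one[OF Cc[OF C]] y by simp
    qed
    then show "x \<otimes> inv y \<in> N" using x y by (simp add: N_def)
  qed
  moreover have "N \<subseteq> H"
  proof
    fix x assume x: "x \<in> N"
    have xc: "x \<in> carrier G" using x by (simp add: N_def)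
    have "H #> x = H" using x subgroup.subgroup_in_rcosets[OF Hs is_group] by (simp add: N_def)
    then show "x \<in> H" using rcos_self[OF xc Hs] by simp
  qed
  ultimately show thesis using that[OF N] derived_series_antimono[OF _ m normal_imp_subgroup[OF N]] by blast
qed

text \<open>A solvable normal subgroup \<open>N\<close> of least finite index contains every solvable normal
  subgroup \<open>K\<close>, since the product \<open>N K\<close> is again solvable and its index cannot be smaller. So the
  largest solvable normal subgroup exists.\<close>

lemma solvable_radical:
  assumes "virtually solvable G"
  shows "solvable_radical G \<lhd> G" "\<exists>m. (derived G ^^ m) (solvable_radical G) = {\<one>}"
    "finite_index_subgroup (solvable_radical G) G"
proof -
  define sn where "sn N \<longleftrightarrow> N \<lhd> G \<and> (\<exists>m. (derived G ^^ m) N = {\<one>})" for N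
  have sn_iff: "N \<lhd> G \<and> solvable (G\<lparr>carrier := N\<rparr>) \<longleftrightarrow> sn N" for N
    using solvable_subgroup_iff normal_imp_subgroup by (auto simp: sn_def)
  obtain H where H: "finite_index_subgroup H G" "solvable (G\<lparr>carrier := H\<rparr>)" using assms by (auto simp: virtually_def)
  then obtain m where "(derived G ^^ m) H = {\<one>}" using solvable_subgroup_iff by (auto simp: finite_index_subgroup_def)
  with H(1) obtain N0 where N0: "sn N0" "finite_index_subgroup N0 G"
    using ex_solvable_normal_finite_index sn_def by metis
  define d where "d N = card (rcosets N)" for N
  obtain N where N: "sn N" "finite_index_subgroup N G" and min: "\<And>K. sn K \<Longrightarrow> finite_index_subgroup K G \<Longrightarrow> d N \<le> d K"
    using arg_min_nat_lemma[of "\<lambda>N. sn N \<and> finite_index_subgroup N G" N0 d] N0 by blast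
  have Nn: "N \<lhd> G" using N by (simp add: sn_def)
  have Ns: "subgroup N G" using normal_imp_subgroup[OF Nn] .
  have top: "K \<subseteq> N" if K: "sn K" for K
  proof -
    have Kn: "K \<lhd> G" using K by (simp add: sn_def)
    have Ks: "subgroup K G" using normal_imp_subgroup[OF Kn] .
    have c: "\<And>n. n \<in> N \<Longrightarrow> n \<in> carrier G" "\<And>k. k \<in> K \<Longrightarrow> k \<in> carrier G"
      using subgroup.mem_carrier[OF Ns] subgroup.mem_carrier[OF Ks] by blast+
    define P where "P = {n \<otimes> k | n k. n \<in> N \<and> k \<in> K}"
    have P: "P \<lhd> G" unfolding P_def by (rule normal_product[OF Nn Kn])
    have Ps: "subgroup P G" using normal_imp_subgroup[OF P] .
    have NP: "N \<subseteq> P"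
    proof
      fix n assume "n \<in> N"
      then show "n \<in> P" unfolding P_def using subgroup.one_closed[OF Ks] c by (intro CollectI exI[of _ n] exI[of _ \<one>]) simp
    qed
    have KP: "K \<subseteq> P"
    proof
      fix k assume "k \<in> K"
      then show "k \<in> P" unfolding P_def using subgroup.one_closed[OF Ns] c by (intro CollectI exI[of _ \<one>] exI[of _ k]) simp
    qed
    obtain a b where ab: "(derived G ^^ a) N = {\<one>}" "(derived G ^^ b) K = {\<one>}" using N K by (auto simp: sn_def)
    have "(derived G ^^ b) P \<subseteq> N"
    proof (rule derived_series_in_kernel[OF Nn subgroup.subset[OF Ps] subgroup.subset[OF Ks] _ _ ab(2)])
      show "\<exists>r\<in>K. x \<otimes> inv r \<in> N" if "x \<in> P" for x
      proof -
        obtain n k where "x = n \<otimes> k" "n \<in> N" "k \<in> K" using \<open>x \<in> P\<close> by (auto simp: P_def)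
        then show ?thesis using c by (intro bexI[of _ k]) (simp_all add: m_assoc)
      qed
      show "\<exists>x\<in>P. x \<otimes> inv r \<in> N" if "r \<in> K" for r
        using that KP subgroup.one_closed[OF Ns] c by (intro bexI[of _ r]) auto
    qed
    then have "(derived G ^^ a) ((derived G ^^ b) P) = {\<one>}"
      using derived_series_antimono[OF _ ab(1) exp_of_derived_is_subgroup[OF Ps]] by blast
    then have "(derived G ^^ (a + b)) P = {\<one>}" by (simp add: funpow_add)
    then have snP: "sn P" using P by (auto simp: sn_def)
    have eq: "P <#> (N #> x) = P #> x" if x: "x \<in> carrier G" for x
    proof -
      have "P <#> N = P"
      proof (intro equalityI subsetI)
        fix z assume "z \<in> P <#> N"
        then show "z \<in> P" using NP subgroup.m_closed[OF Ps] by (auto simp: set_mult_def)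
      next
        fix z assume z: "z \<in> P"
        then have "z = z \<otimes> \<one>" using subgroup.mem_carrier[OF Ps] by simp
        then show "z \<in> P <#> N" using z subgroup.one_closed[OF Ns] by (auto simp: set_mult_def)
      qed
      then show ?thesis using setmult_rcos_assoc[OF subgroup.subset[OF Ps] subgroup.subset[OF Ns] x] by simp
    qed
    have cov: "(\<lambda>C. P <#> C) ` (rcosets N) = rcosets P"
    proof (intro equalityI subsetI)
      fix D assume "D \<in> (\<lambda>C. P <#> C) ` (rcosets N)"
      then obtain x where "x \<in> carrier G" "D = P <#> (N #> x)" by (auto simp: RCOSETS_def)
      then show "D \<in> rcosets P" using eq by (auto simp: RCOSETS_def)
    next
      fix D assume "D \<in> rcosets P"
      then obtain x where x: "x \<in> carrier G" "D = P #> x" by (auto simp: RCOSETS_def)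
      then have "D = P <#> (N #> x)" "N #> x \<in> rcosets N" using eq by (auto simp: RCOSETS_def)
      then show "D \<in> (\<lambda>C. P <#> C) ` (rcosets N)" by blast
    qed
    have finN: "finite (rcosets N)" using N(2) by (simp add: finite_index_subgroup_def)
    have finP: "finite_index_subgroup P G" using Ps finN cov by (metis finite_imageI finite_index_subgroup_def)
    have "card ((\<lambda>C. P <#> C) ` (rcosets N)) = card (rcosets N)"
      using min[OF snP finP] card_image_le[OF finN, of "\<lambda>C. P <#> C"] unfolding cov d_def by simp
    then have inj: "inj_on (\<lambda>C. P <#> C) (rcosets N)" by (rule eq_card_imp_inj_on[OF finN])
    show "K \<subseteq> N"
    proof
      fix k assume k: "k \<in> K"
      have kc: "k \<in> carrier G" using c k by blast
      have kP: "k \<in> P" using k KP by blast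
      have "P <#> (N #> k) = P <#> (N #> \<one>)"
        using eq[OF kc] eq[OF one_closed] coset_join2[OF kc Ps kP] coset_mult_one[OF subgroup.subset[OF Ps]] by simp
      then have "P <#> (N #> k) = P <#> N" using coset_mult_one[OF subgroup.subset[OF Ns]] by simp
      then have "N #> k = N"
        using inj_onD[OF inj] rcosetsI[OF subgroup.subset[OF Ns] kc] subgroup.subgroup_in_rcosets[OF Ns is_group] by blast
      then show "k \<in> N" using rcos_self[OF kc Ns] by simp
    qed
  qed
  have "solvable_radical G = N"
    unfolding solvable_radical_def sn_iff by (rule Greatest_equality[where P = sn, OF N(1)]) (rule top)
  then show "solvable_radical G \<lhd> G" "\<exists>m. (derived G ^^ m) (solvable_radical G) = {\<one>}"
    "finite_index_subgroup (solvable_radical G) G" using N by (auto simp: sn_def)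
qed

text \<open>The Hirsch length comes from some series, whichever it is, and each series satisfies the
  bound.\<close>

lemma hirsch_ge_le_hirsch_length:
  assumes vs: "virtually solvable G" and v: "hirsch_ge G (carrier G) v"
  shows "enat v \<le> hirsch_length G"
proof -
  define Q where "Q h \<longleftrightarrow> (\<exists>H n M. finite_index_subgroup H G \<and> abelian_series (G\<lparr>carrier := H\<rparr>) n M \<and>
     h = (\<Sum>i<n. rat_dim (rat_tensor (G\<lparr>carrier := M i\<rparr> Mod M (Suc i)))))" for h
  obtain H where H: "finite_index_subgroup H G" "solvable (G\<lparr>carrier := H\<rparr>)" using vs by (auto simp: virtually_def)
  have Hs: "subgroup H G" using H by (simp add: finite_index_subgroup_def)
  obtain m where m: "(derived G ^^ m) H = {\<one>}" using H solvable_subgroup_iff[OF Hs] by blast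
  have "abelian_series (G\<lparr>carrier := H\<rparr>) m (\<lambda>i. (derived G ^^ i) H)"
    unfolding abelian_series_def
    using m derived_subgroup_is_normal[OF exp_of_derived_is_subgroup[OF Hs]]
      derived_quot_of_subgroup_is_comm_group[OF exp_of_derived_is_subgroup[OF Hs]] by simp
  then have "Q (\<Sum>i<m. rat_dim (rat_tensor (G\<lparr>carrier := (derived G ^^ i) H\<rparr> Mod (derived G ^^ Suc i) H)))"
    unfolding Q_def by (intro exI[of _ H] exI[of _ m] exI[of _ "\<lambda>i. (derived G ^^ i) H"] conjI H(1) refl)
  then have "\<exists>h. Q h" ..
  then have "Q (hirsch_length G)" unfolding hirsch_length_def Q_def by (rule someI_ex)
  then obtain H n M where H: "finite_index_subgroup H G" and M: "abelian_series (G\<lparr>carrier := H\<rparr>) n M"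
    and h: "hirsch_length G = (\<Sum>i<n. rat_dim (rat_tensor (G\<lparr>carrier := M i\<rparr> Mod M (Suc i))))"
    unfolding Q_def by blast
  from hirsch_ge_series[OF v H M] obtain \<nu> where \<nu>0: "v \<le> (\<Sum>j<n. \<nu> j) \<and>
      (\<forall>j<n. \<exists>x. int_indep (G\<lparr>carrier := M j\<rparr> Mod M (Suc j)) (\<nu> j) x \<and>
        x ` {..<\<nu> j} \<subseteq> (#>) (M (Suc j)) ` (carrier G \<inter> M j))" by (rule exE)
  have \<nu>: "v \<le> (\<Sum>j<n. \<nu> j)" "\<And>j. j < n \<Longrightarrow> \<exists>x. int_indep (G\<lparr>carrier := M j\<rparr> Mod M (Suc j)) (\<nu> j) x"
    using \<nu>0 by blast+
  have "enat (\<nu> j) \<le> rat_dim (rat_tensor (G\<lparr>carrier := M j\<rparr> Mod M (Suc j)))" if j: "j < n" for j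
  proof -
    have "comm_group (G\<lparr>carrier := M j\<rparr> Mod M (Suc j))" using M j by (simp add: abelian_series_def)
    then show ?thesis using comm_group.int_indep_le_rat_dim \<nu>(2)[OF j] by blast
  qed
  then have "(\<Sum>j<n. enat (\<nu> j)) \<le> hirsch_length G" unfolding h by (intro sum_mono) auto
  moreover have "(\<Sum>j<n. enat (\<nu> j)) = enat (\<Sum>j<n. \<nu> j)" by (induction n) (simp_all add: zero_enat_def)
  ultimately show ?thesis using \<nu>(1) by (metis enat_ord_simps(1) order_trans)
qed

text \<open>The lift \<open>g\<close> of \<open>h0\<close> satisfies the condition \<open>full\<close>: the image of \<open>M\<close> in \<open>H\<close> contains
  \<open>h0 [^] j\<close>, hence \<open>h0 [^] gcd j q\<close> and \<open>h0 [^] r\<close>, so it is all of \<open>H\<close>. The derived series of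
  the whole group then descends into \<open>M\<close> along with that of the radical, but it is constant
  because the group is perfect.\<close>

theorem hirsch_length_bound:
  fixes H :: "('c, 'd) monoid_scheme" and p r q :: nat
  assumes fg: "finitely_generated G" and perfect: "perfect G" and torsion: "torsion_free G"
    and vs: "virtually solvable G" and nvn: "\<not> virtually nilpotent G"
    and H: "group H" and iso: "G Mod solvable_radical G \<cong> H"
    and h0: "h0 \<in> carrier H" "h0 [^]\<^bsub>H\<^esub> q = \<one>\<^bsub>H\<^esub>"
    and closure: "\<And>M. M \<lhd> H \<Longrightarrow> h0 [^]\<^bsub>H\<^esub> r \<in> M \<Longrightarrow> M = carrier H"
    and q: "q = p * r" "0 < r" "1 < p" and divs: "\<And>d. d dvd q \<Longrightarrow> d \<noteq> q \<Longrightarrow> d dvd r"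
    and k: "\<exists>k::nat. (\<forall>m. 0 < m \<and> m < q \<longrightarrow> m dvd k) \<and> \<not> q dvd k"
    and \<Phi>: "Factorial_Ring.irreducible (\<Sum>i<p. Polynomial.monom (1::rat) (r * i))"
  shows "enat (q + r * (p - 1)) \<le> hirsch_length G"
proof -
  let ?R = "solvable_radical G"
  note R = solvable_radical[OF vs]
  have Rs: "subgroup ?R G" using normal_imp_subgroup[OF R(1)] .
  interpret H: group H by (rule H)
  have derived: "derived G (carrier G) = carrier G" using perfect by (simp add: perfect_def)
  obtain f where f: "f \<in> iso (G Mod ?R) H" using iso by (auto simp: is_iso_def)
  interpret \<pi>: group_hom G "G Mod ?R" "(#>) ?R"
    using normal.r_coset_hom_Mod[OF R(1)] normal.factorgroup_is_group[OF R(1)]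
    by (simp add: group_hom_def group_hom_axioms_def is_group)
  define \<psi> where "\<psi> x = f (?R #> x)" for x
  have \<psi>hom: "\<psi> \<in> hom G H"
  proof (rule homI)
    have fh: "f \<in> hom (G Mod ?R) H" using f by (simp add: iso_def)
    show "\<psi> x \<in> carrier H" if "x \<in> carrier G" for x
      unfolding \<psi>_def by (rule hom_in_carrier[OF fh \<pi>.hom_closed[OF that]])
    show "\<psi> (x \<otimes> y) = \<psi> x \<otimes>\<^bsub>H\<^esub> \<psi> y" if "x \<in> carrier G" "y \<in> carrier G" for x y
      unfolding \<psi>_def \<pi>.hom_mult[OF that] by (rule hom_mult[OF fh \<pi>.hom_closed[OF that(1)] \<pi>.hom_closed[OF that(2)]])
  qed
  interpret \<psi>: group_hom G H \<psi> using \<psi>hom by unfold_locales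
  have \<psi>surj: "\<psi> ` carrier G = carrier H"
  proof -
    have "f ` carrier (G Mod ?R) = carrier H" using f by (simp add: iso_def bij_betw_def)
    then show ?thesis unfolding carrier_FactGroup \<psi>_def by (simp add: image_image)
  qed
  have \<psi>inj: "x \<otimes> inv y \<in> ?R" if "x \<in> carrier G" "y \<in> carrier G" "\<psi> x = \<psi> y" for x y
  proof -
    have "inj_on f (carrier (G Mod ?R))" using f by (simp add: iso_def bij_betw_def)
    then have "?R #> x = ?R #> y" using that \<pi>.hom_closed unfolding \<psi>_def inj_on_def by blast
    then show ?thesis using rcoset_eq_iff[OF Rs that(1,2)] by blast
  qed
  obtain g where g: "g \<in> carrier G" "\<psi> g = h0" using h0(1) \<psi>surj by (metis imageE)
  have full: "M = carrier G" if M: "M \<lhd> G" and gj: "g [^] (j::nat) \<in> M" and j: "\<not> q dvd j" for M j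
  proof -
    have Ms: "subgroup M G" using normal_imp_subgroup[OF M] .
    have PM: "\<psi> ` M \<lhd> H" by (rule normal.surj_hom_normal_subgroup[OF M \<psi>.group_hom_axioms \<psi>surj])
    have PMs: "subgroup (\<psi> ` M) H" using normal_imp_subgroup[OF PM] .
    have hj: "h0 [^]\<^bsub>H\<^esub> j \<in> \<psi> ` M" using gj \<psi>.hom_nat_pow[OF g(1), of j] g(2) by (metis imageI)
    define d where "d = gcd j q"
    have "d \<noteq> q" using j by (metis d_def gcd_dvd1)
    then have "d dvd r" using divs by (simp add: d_def)
    have j0: "j \<noteq> 0" using j by (metis dvd_0_right)
    obtain u v where uv: "j * u = q * v + d" using bezout_nat[OF j0, of q] by (auto simp: d_def)
    have "h0 [^]\<^bsub>H\<^esub> (j * u) = h0 [^]\<^bsub>H\<^esub> d"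
      unfolding uv using h0 by (simp add: H.nat_pow_mult[symmetric] H.nat_pow_pow[symmetric])
    moreover have "h0 [^]\<^bsub>H\<^esub> (j * u) = (h0 [^]\<^bsub>H\<^esub> j) [^]\<^bsub>H\<^esub> int u"
      using h0 by (simp add: H.nat_pow_pow int_pow_int)
    ultimately have hd: "h0 [^]\<^bsub>H\<^esub> d \<in> \<psi> ` M" using H.subgroup_int_pow_closed[OF PMs hj, of "int u"] by simp
    obtain e where e: "r = d * e" using \<open>d dvd r\<close> by (rule dvdE)
    have "h0 [^]\<^bsub>H\<^esub> r = (h0 [^]\<^bsub>H\<^esub> d) [^]\<^bsub>H\<^esub> int e"
      unfolding e using h0 by (simp add: H.nat_pow_pow int_pow_int)
    then have "h0 [^]\<^bsub>H\<^esub> r \<in> \<psi> ` M" using H.subgroup_int_pow_closed[OF PMs hd, of "int e"] by simp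
    then have all: "\<psi> ` M = carrier H" by (rule closure[OF PM])
    obtain a where a: "(derived G ^^ a) ?R = {\<one>}" using R(2) by blast
    have "(derived G ^^ a) (carrier G) \<subseteq> M"
    proof (rule derived_series_in_kernel[OF M order_refl subgroup.subset[OF Rs] _ _ a])
      show "\<exists>y\<in>?R. x \<otimes> inv y \<in> M" if x: "x \<in> carrier G" for x
      proof -
        have "\<psi> x \<in> \<psi> ` M" using all \<psi>.hom_closed[OF x] by simp
        then obtain m where m: "m \<in> M" "\<psi> x = \<psi> m" by blast
        have mc: "m \<in> carrier G" using subgroup.mem_carrier[OF Ms m(1)] .
        let ?y = "x \<otimes> inv m"
        have "?y \<in> ?R" by (rule \<psi>inj[OF x mc m(2)])
        moreover have "x \<otimes> inv ?y = x \<otimes> m \<otimes> inv x" using x mc by (simp add: word_simps)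
        ultimately show ?thesis using normal_conj(1)[OF M x m(1)] by (intro bexI[of _ ?y]) auto
      qed
      show "\<exists>x\<in>carrier G. x \<otimes> inv y \<in> M" if "y \<in> ?R" for y
        using that subgroup.mem_carrier[OF Rs that] subgroup.one_closed[OF Ms] by (intro bexI[of _ y]) auto
    qed
    moreover have "(derived G ^^ a) (carrier G) = carrier G" for a using derived by (induction a) auto
    ultimately show ?thesis using subgroup.subset[OF Ms] by auto
  qed
  have PE: "perfect_extension G ?R g q"
    by (intro perfect_extension.intro perfect_extension_axioms.intro is_group derived R g(1) k full)
  show ?thesis
  proof (rule ccontr)
    assume "\<not> ?thesis"
    then have small: "v < q + r * (p - 1)" if "hirsch_ge G (carrier G) v" for v
      using hirsch_ge_le_hirsch_length[OF vs that] by (metis enat_ord_simps(2) leI le_less_trans not_less order_trans)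
    from perfect_extension.virtually_nilpotent_of_small_hirsch[OF PE torsion fg q \<Phi> small]
    show False using nvn by (auto simp: virtually_def)
  qed
qed

end

section \<open>The alternating group of degree five\<close>

lemma three_cycle_alternating:
  "cycle [a, b, c] \<Longrightarrow> {a, b, c} \<subseteq> {1..n} \<Longrightarrow> cycle_of_list [a, b, c] \<in> carrier (alt_group n)"
  by (rule subsetD[OF three_cycles_incl]) (intro CollectI exI[of _ "[a, b, c]"], simp)

text \<open>The commutator of the 5-cycle with a 3-cycle is a 3-cycle. All 3-cycles are conjugate in
  the alternating group, as an odd conjugating permutation can be corrected by the transposition
  of the two fixed points, and they generate it.\<close>

lemma alternating_5_normal_closure:
  assumes M: "M \<lhd> alt_group 5" and c: "cycle_of_list [1, 2, 3, 4, 5] \<in> M"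
  shows "M = carrier (alt_group 5)"
proof -
  interpret A: group "alt_group 5" by (rule alt_group_is_group)
  have Ms: "subgroup M (alt_group 5)" using normal_imp_subgroup[OF M] .
  have M_sub: "M \<subseteq> carrier (alt_group 5)" by (rule subgroup.subset[OF Ms])
  define c t where "c = cycle_of_list [1, 2, 3, 4, 5 :: nat]" and "t = cycle_of_list [1, 2, 3 :: nat]"
  have cA: "c \<in> carrier (alt_group 5)" using c M_sub by (auto simp: c_def)
  have tA: "t \<in> carrier (alt_group 5)" unfolding t_def by (rule three_cycle_alternating) auto
  have cM: "c \<in> M" using c by (simp add: c_def)
  let ?m = "(\<otimes>\<^bsub>alt_group 5\<^esub>)" and ?i = "\<lambda>x. inv\<^bsub>alt_group 5\<^esub> x"
  define u where "u = ?m c (?m (?m t (?i c)) (?i t))"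
  have uM: "u \<in> M"
    unfolding u_def using cM tA subgroup.m_closed[OF Ms] subgroup.m_inv_closed[OF Ms] A.normal_invE(2)[OF M] by blast
  have "?m u t = ?m (?m c t) (?i c)" unfolding u_def using cA tA by (simp add: A.m_assoc)
  also have "\<dots> = c \<circ> t \<circ> inv' c" by (simp add: alt_group_mult alt_group_inv_equality[OF cA])
  also have "\<dots> = cycle_of_list (map c [1, 2, 3])"
    unfolding t_def by (rule conjugation_of_cycle) (use cA permutes_bij in \<open>auto simp: alt_group_carrier\<close>)
  also have "map c [1, 2, 3] = [2, 3, 4]" by (simp add: c_def transpose_def)
  also have "cycle_of_list [2, 3, 4] = ?m (cycle_of_list [1, 4, 2]) t"
    by (simp add: alt_group_mult t_def fun_eq_iff transpose_def)
  finally have "?m u t = ?m (cycle_of_list [1, 4, 2]) t" .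
  moreover have dA: "cycle_of_list [1, 4, 2] \<in> carrier (alt_group 5)" by (rule three_cycle_alternating) auto
  moreover have "u \<in> carrier (alt_group 5)" using uM M_sub by blast
  ultimately have u: "u = cycle_of_list [1, 4, 2]" using A.r_cancel tA by metis
  have "three_cycles 5 \<subseteq> M"
  proof
    fix x assume "x \<in> three_cycles 5"
    then obtain cs where cs: "x = cycle_of_list cs" "cycle cs" "length cs = 3" "set cs \<subseteq> {1..5}" by blast
    then obtain a b d where abd: "cs = [a, b, d]" using stupid_lemma by blast
    have in5: "{a, b, d} \<subseteq> {1..5}" and dist: "a \<noteq> b" "a \<noteq> d" "b \<noteq> d" using cs abd by auto
    \<comment> \<open>A permutation of \<open>{1..5}\<close> that maps 1, 4, 2 to \<open>a\<close>, \<open>b\<close>, \<open>d\<close>, put together from three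
      transpositions.\<close>
    define \<rho> where "\<rho> = transpose (transpose 1 a 4) b \<circ> transpose 1 a"
    define \<sigma> where "\<sigma> = transpose (\<rho> 2) d \<circ> \<rho>"
    have sw: "transpose x y permutes {1..5}" if "x \<in> {1..5}" "y \<in> {1..5}" for x y :: nat
      using that by (rule permutes_swap_id)
    have t4: "transpose 1 a 4 \<in> {1..5}" using in5 by (auto simp: transpose_def)
    have \<rho>: "\<rho> permutes {1..5}" unfolding \<rho>_def using in5 t4 by (intro permutes_compose sw) auto
    have r2: "\<rho> 2 \<in> {1..5}" using permutes_in_image[OF \<rho>, of 2] by simp
    have \<sigma>: "\<sigma> permutes {1..5}" unfolding \<sigma>_def using in5 r2 by (intro permutes_compose sw \<rho>) auto
    have \<sigma>_map: "map \<sigma> [1, 4, 2] = cs"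
      using dist unfolding abd \<sigma>_def \<rho>_def by (auto simp: transpose_def)
    have swap: "(\<sigma> \<circ> transpose 3 5) permutes {1..5}" using \<sigma> by (intro permutes_compose sw) auto
    define \<tau> where "\<tau> = (if evenperm \<sigma> then \<sigma> else \<sigma> \<circ> transpose 3 5)"
    have "permutation \<sigma>" using \<sigma> by (metis finite_atLeastAtMost permutation_permutes)
    then have \<tau>A: "\<tau> \<in> carrier (alt_group 5)"
      using \<sigma> swap by (auto simp: \<tau>_def alt_group_carrier evenperm_comp permutation_swap_id evenperm_swap)
    have \<tau>_map: "map \<tau> [1, 4, 2] = cs" using \<sigma>_map by (auto simp: \<tau>_def transpose_def)
    have "?m (?m \<tau> u) (?i \<tau>) = \<tau> \<circ> cycle_of_list [1, 4, 2] \<circ> inv' \<tau>"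
      by (simp add: alt_group_mult alt_group_inv_equality[OF \<tau>A] u)
    also have "\<dots> = cycle_of_list (map \<tau> [1, 4, 2])"
      by (rule conjugation_of_cycle) (use \<tau>A permutes_bij in \<open>auto simp: alt_group_carrier\<close>)
    also have "\<dots> = x" unfolding \<tau>_map cs(1) ..
    finally show "x \<in> M" using A.normal_invE(2)[OF M \<tau>A uM] by simp
  qed
  then have "carrier (alt_group 5) \<subseteq> M"
    unfolding alt_group_carrier_as_three_cycles using A.generate_subgroup_incl[OF _ Ms] by blast
  then show ?thesis using M_sub by blast
qed

lemma alternating_5_cycle:
  "cycle_of_list [1, 2, 3, 4, 5] \<in> carrier (alt_group 5)"
  "cycle_of_list [1, 2, 3, 4, 5] [^]\<^bsub>alt_group 5\<^esub> (5::nat) = \<one>\<^bsub>alt_group 5\<^esub>"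
proof -
  let ?c = "cycle_of_list [1, 2, 3, 4, 5 :: nat]"
  have c: "?c = cycle_of_list [1, 2, 3] \<circ> cycle_of_list [3, 4, 5]" by (simp add: o_assoc)
  have "{cycle_of_list [1, 2, 3], cycle_of_list [3, 4, 5]} \<subseteq> carrier (alt_group 5)"
    using three_cycle_alternating[of 1 2 3 5] three_cycle_alternating[of 3 4 5 5] by simp
  then show cA: "?c \<in> carrier (alt_group 5)"
    unfolding c using monoid.m_closed[OF group.is_monoid[OF alt_group_is_group[of 5]]] by (simp add: alt_group_mult)
  have "?c ^^ length [1, 2, 3, 4, 5 :: nat] = id" by (rule cycle_is_id_root) simp
  moreover have "length [1, 2, 3, 4, 5 :: nat] = 5" by simp
  ultimately have "?c ^^ 5 = id" by (simp only:)
  moreover have "?c [^]\<^bsub>alt_group 5\<^esub> n = ?c ^^ n" for n :: nat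
  proof (induction n)
    case (Suc n) then show ?case by (simp only: monoid.nat_pow_Suc[OF group.is_monoid[OF alt_group_is_group]] alt_group_mult funpow_Suc_right)
  qed (simp add: alt_group_one nat_pow_def)
  ultimately show "?c [^]\<^bsub>alt_group 5\<^esub> (5::nat) = \<one>\<^bsub>alt_group 5\<^esub>" by (simp only: alt_group_one)
qed

section \<open>Special linear groups of degree two\<close>

definition mat2 :: "'f \<Rightarrow> 'f \<Rightarrow> 'f \<Rightarrow> 'f \<Rightarrow> 'f::field mat" where
  "mat2 a b c d = mat 2 2 (\<lambda>(i, j). if i = 0 then if j = 0 then a else b else if j = 0 then c else d)"

lemma mat2_carrier [simp]: "mat2 a b c d \<in> carrier_mat 2 2"
  by (simp add: mat2_def)

lemma mat2_index [simp]:
  "mat2 a b c d $$ (0, 0) = a" "mat2 a b c d $$ (0, Suc 0) = b"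
  "mat2 a b c d $$ (Suc 0, 0) = c" "mat2 a b c d $$ (Suc 0, Suc 0) = d"
  by (simp_all add: mat2_def)

lemma mat2_eqI:
  assumes "A \<in> carrier_mat 2 2" shows "A = mat2 (A $$ (0, 0)) (A $$ (0, Suc 0)) (A $$ (Suc 0, 0)) (A $$ (Suc 0, Suc 0))"
proof (rule eq_matI)
  fix i j assume "i < dim_row (mat2 (A $$ (0, 0)) (A $$ (0, Suc 0)) (A $$ (Suc 0, 0)) (A $$ (Suc 0, Suc 0)))"
    "j < dim_col (mat2 (A $$ (0, 0)) (A $$ (0, Suc 0)) (A $$ (Suc 0, 0)) (A $$ (Suc 0, Suc 0)))"
  then have "i = 0 \<or> i = Suc 0" "j = 0 \<or> j = Suc 0" by (auto simp: mat2_def)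
  then show "A $$ (i, j) = mat2 (A $$ (0, 0)) (A $$ (0, Suc 0)) (A $$ (Suc 0, 0)) (A $$ (Suc 0, Suc 0)) $$ (i, j)"
    by (auto simp: mat2_def)
qed (use assms in \<open>auto simp: mat2_def\<close>)

lemma mat2_mult: "mat2 a b c d * mat2 a' b' c' d' = mat2 (a * a' + b * c') (a * b' + b * d') (c * a' + d * c') (c * b' + d * d')"
  (is "?A * ?B = _")
proof -
  have "?A * ?B \<in> carrier_mat 2 2" by (rule mult_carrier_mat[OF mat2_carrier mat2_carrier])
  moreover have "(?A * ?B) $$ (i, j) = ?A $$ (i, 0) * ?B $$ (0, j) + ?A $$ (i, Suc 0) * ?B $$ (Suc 0, j)"
    if "i < 2" "j < 2" for i j
    using that carrier_matD[OF mat2_carrier[of a b c d]] carrier_matD[OF mat2_carrier[of a' b' c' d']]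
    by (simp add: scalar_prod_def numeral_2_eq_2)
  ultimately show ?thesis by (subst mat2_eqI[of "?A * ?B"]) simp_all
qed

lemma mat2_one: "1\<^sub>m 2 = mat2 1 0 0 1"
  by (subst mat2_eqI[of "1\<^sub>m 2"]) simp_all

lemma det_mat2: "det (mat2 a b c d) = a * d - b * c"
proof -
  have "det (mat2 a b c d) = (\<Sum>j<2. mat2 a b c d $$ (0, j) * cofactor (mat2 a b c d) 0 j)"
    by (rule laplace_expansion_row) simp_all
  moreover have "det (mat_delete (mat2 a b c d) 0 j) = mat_delete (mat2 a b c d) 0 j $$ (0, 0)" for j
    by (rule det_single) (simp add: mat_delete_def mat2_def)
  ultimately show ?thesis
    by (simp add: numeral_2_eq_2 cofactor_def) (simp add: mat_delete_def mat2_def numeral_2_eq_2)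
qed

abbreviation SL2 :: "'f::field itself \<Rightarrow> 'f mat monoid" where
  "SL2 F \<equiv> special_linear_group 2 F"

lemma SL2_mult: "x \<otimes>\<^bsub>SL2 F\<^esub> y = x * y" and SL2_one: "\<one>\<^bsub>SL2 F\<^esub> = mat2 1 0 0 1"
  by (simp_all add: special_linear_group_def mat2_one)

lemma mat2_in_SL2: "mat2 a b c d \<in> carrier (SL2 TYPE('f::field)) \<longleftrightarrow> a * d - b * c = (1::'f)"
  by (simp add: special_linear_group_def det_mat2)

lemma SL2_cases:
  fixes A :: "'f::field mat"
  assumes "A \<in> carrier (SL2 TYPE('f))"
  obtains a b c d where "A = mat2 a b c d" "a * d - b * c = 1"
proof -
  have "A = mat2 (A $$ (0, 0)) (A $$ (0, Suc 0)) (A $$ (Suc 0, 0)) (A $$ (Suc 0, Suc 0))"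
    using assms by (intro mat2_eqI) (simp add: special_linear_group_def)
  with that assms show thesis using mat2_in_SL2 by metis
qed

lemma SL2_group: "group (SL2 TYPE('f::field))"
proof (rule groupI)
  fix x y z :: "'f mat"
  assume x: "x \<in> carrier (SL2 TYPE('f))"
  show "\<one>\<^bsub>SL2 TYPE('f)\<^esub> \<otimes>\<^bsub>SL2 TYPE('f)\<^esub> x = x" using x by (auto simp: special_linear_group_def)
  obtain a b c d where x2: "x = mat2 a b c d" "a * d - b * c = 1" using x by (rule SL2_cases)
  have "mat2 d (- b) (- c) a \<in> carrier (SL2 TYPE('f))" using x2(2) by (simp add: mat2_in_SL2 algebra_simps)
  moreover have "mat2 d (- b) (- c) a * x = mat2 1 0 0 1"
    unfolding x2(1) mat2_mult using x2(2) by (simp add: algebra_simps)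
  ultimately show "\<exists>y\<in>carrier (SL2 TYPE('f)). y \<otimes>\<^bsub>SL2 TYPE('f)\<^esub> x = \<one>\<^bsub>SL2 TYPE('f)\<^esub>"
    unfolding SL2_mult SL2_one by blast
  assume y: "y \<in> carrier (SL2 TYPE('f))"
  show "x \<otimes>\<^bsub>SL2 TYPE('f)\<^esub> y \<in> carrier (SL2 TYPE('f))"
    using x y det_mult[of x 2 y] by (auto simp: special_linear_group_def)
  assume z: "z \<in> carrier (SL2 TYPE('f))"
  show "x \<otimes>\<^bsub>SL2 TYPE('f)\<^esub> y \<otimes>\<^bsub>SL2 TYPE('f)\<^esub> z = x \<otimes>\<^bsub>SL2 TYPE('f)\<^esub> (y \<otimes>\<^bsub>SL2 TYPE('f)\<^esub> z)"
    using x y z by (auto simp: special_linear_group_def)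
qed (simp_all add: special_linear_group_def)

lemma SL2_inv:
  fixes a b c d :: "'f::field"
  assumes "a * d - b * c = 1"
  shows "inv\<^bsub>SL2 TYPE('f)\<^esub> mat2 a b c d = mat2 d (- b) (- c) a"
proof (rule group.inv_equality[OF SL2_group])
  show "mat2 d (- b) (- c) a \<otimes>\<^bsub>SL2 TYPE('f)\<^esub> mat2 a b c d = \<one>\<^bsub>SL2 TYPE('f)\<^esub>"
    unfolding SL2_mult SL2_one mat2_mult using assms by (simp add: algebra_simps)
qed (use assms in \<open>simp_all add: mat2_in_SL2 algebra_simps\<close>)

text \<open>A matrix with lower left entry \<open>c \<noteq> 0\<close> is a product of three elementary matrices; if
  \<open>c = 0\<close>, adding the first row to the second one makes it nonzero.\<close>

lemma SL2_generated:
  fixes M :: "'f::field mat set"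
  assumes M: "subgroup M (SL2 TYPE('f))"
    and upper: "\<And>s. mat2 1 s 0 1 \<in> M" and lower: "\<And>s. mat2 1 0 s 1 \<in> M"
  shows "M = carrier (SL2 TYPE('f))"
proof
  have mult: "x * y \<in> M" if "x \<in> M" "y \<in> M" for x y
    using subgroup.m_closed[OF M that] by (simp add: SL2_mult)
  have nz: "mat2 a b c d \<in> M" if det: "a * d - b * c = 1" and c: "c \<noteq> 0" for a b c d
  proof -
    have "mat2 a b c d = mat2 1 ((a - 1) / c) 0 1 * mat2 1 0 c 1 * mat2 1 ((d - 1) / c) 0 1"
    proof -
      have "a * d / c - 1 / c = b" using det c by (simp add: field_simps)
      then show ?thesis using c by (simp add: mat2_mult add_divide_distrib diff_divide_distrib algebra_simps)
    qed
    then show ?thesis by (simp only: mult upper lower)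
  qed
  show "carrier (SL2 TYPE('f)) \<subseteq> M"
  proof
    fix x :: "'f mat" assume "x \<in> carrier (SL2 TYPE('f))"
    then obtain a b c d where x: "x = mat2 a b c d" "a * d - b * c = 1" by (rule SL2_cases)
    show "x \<in> M"
    proof (cases "c = 0")
      case True
      then have "a \<noteq> 0" using x by auto
      have "mat2 a b a (d + b) \<in> M" by (rule nz) (use x True \<open>a \<noteq> 0\<close> in \<open>simp_all add: algebra_simps\<close>)
      then have "mat2 1 0 (- 1) 1 * mat2 a b a (d + b) \<in> M" by (intro mult lower)
      then show ?thesis unfolding x(1) using True by (simp add: mat2_mult)
    qed (use nz x in auto)
  qed
qed (rule subgroup.subset[OF M])

text \<open>An element outside the upper triangular group is conjugate by an upper unipotent matrix to
  one with top left entry 0. Its commutator with \<open>diag(a, 1/a)\<close> is lower triangular with diagonal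
  \<open>a\<^sup>-\<^sup>2, a\<^sup>2\<close>, and the commutator of this with lower unipotent matrices gives all of them,
  because \<open>a\<^sup>4 \<noteq> 1\<close>. Conjugation turns them into the upper ones.\<close>

lemma SL2_normal_closure:
  fixes \<alpha> \<beta> \<gamma> \<delta> :: "'f::field"
  assumes M: "M \<lhd> SL2 TYPE('f)" and x: "mat2 \<alpha> \<beta> \<gamma> \<delta> \<in> M" and \<gamma>: "\<gamma> \<noteq> 0"
    and a: "a \<noteq> (0::'f)" "a ^ 4 \<noteq> 1"
  shows "M = carrier (SL2 TYPE('f))"
proof -
  interpret SL: group "SL2 TYPE('f)" by (rule SL2_group)
  have Ms: "subgroup M (SL2 TYPE('f))" using normal_imp_subgroup[OF M] .
  have mult: "u * v \<in> M" if "u \<in> M" "v \<in> M" for u v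
    using subgroup.m_closed[OF Ms that] by (simp add: SL2_mult)
  have inverse: "mat2 d (- b) (- c) a \<in> M" if "mat2 a b c d \<in> M" for a b c d
    using subgroup.m_inv_closed[OF Ms that] subgroup.mem_carrier[OF Ms that] by (simp add: mat2_in_SL2 SL2_inv)
  have conj: "mat2 a b c d * h * mat2 d (- b) (- c) a \<in> M" if "h \<in> M" "a * d - b * c = 1" for a b c d h
    using SL.normal_invE(2)[OF M, of "mat2 a b c d" h] that by (simp add: mat2_in_SL2 SL2_inv SL2_mult)
  have det: "\<alpha> * \<delta> - \<beta> * \<gamma> = 1" using subgroup.mem_carrier[OF Ms x] by (simp add: mat2_in_SL2)
  define s where "s = - \<alpha> / \<gamma>"
  have "mat2 1 s 0 1 * mat2 \<alpha> \<beta> \<gamma> \<delta> * mat2 1 (- s) (- 0) 1 \<in> M" using x by (intro conj) simp_all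
  moreover have "mat2 1 s 0 1 * mat2 \<alpha> \<beta> \<gamma> \<delta> * mat2 1 (- s) (- 0) 1 = mat2 0 (- 1 / \<gamma>) \<gamma> (\<alpha> + \<delta>)"
  proof -
    have "\<beta> - \<alpha> * \<delta> / \<gamma> = - (1 / \<gamma>)" using det \<gamma> by (simp add: field_simps)
    with \<gamma> show ?thesis by (simp add: mat2_mult s_def)
  qed
  ultimately have B: "mat2 0 (- 1 / \<gamma>) \<gamma> (\<alpha> + \<delta>) \<in> M" by simp
  have "mat2 a 0 0 (1 / a) * mat2 (\<alpha> + \<delta>) (- (- 1 / \<gamma>)) (- \<gamma>) 0 * mat2 (1 / a) (- 0) (- 0) a \<in> M"
    by (rule conj[OF inverse[OF B]]) (use a in simp)
  from mult[OF B this] obtain \<kappa> where C: "mat2 (1 / a\<^sup>2) 0 \<kappa> (a\<^sup>2) \<in> M"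
    using a \<gamma> by (simp add: mat2_mult power2_eq_square)
  have lower: "mat2 1 0 s 1 \<in> M" for s
  proof -
    define b where "b = s / (a ^ 4 - 1)"
    have "mat2 1 0 b 1 * mat2 (a\<^sup>2) (- 0) (- \<kappa>) (1 / a\<^sup>2) * mat2 1 (- 0) (- b) 1 \<in> M"
      by (rule conj[OF inverse[OF C]]) simp
    from mult[OF C this] have "mat2 1 0 ((a ^ 4 - 1) * b) 1 \<in> M"
    proof (rule back_subst[of "\<lambda>x. x \<in> M"])
      have "a\<^sup>2 * a\<^sup>2 = a ^ 4" by (simp flip: power_add)
      then show "mat2 (1 / a\<^sup>2) 0 \<kappa> (a\<^sup>2) *
        (mat2 1 0 b 1 * mat2 (a\<^sup>2) (- 0) (- \<kappa>) (1 / a\<^sup>2) * mat2 1 (- 0) (- b) 1) = mat2 1 0 ((a ^ 4 - 1) * b) 1"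
        using a by (simp add: mat2_mult algebra_simps)
    qed
    then show ?thesis using a by (simp add: b_def)
  qed
  moreover have "mat2 1 s 0 1 \<in> M" for s
    using conj[OF lower[of "- s"], of 0 0 1 "-1"] by (simp add: mat2_mult)
  ultimately show ?thesis using SL2_generated[OF Ms] by blast
qed

lemma (in group) group_center_normal: "group_center G \<lhd> G"
proof -
  have comm: "z \<otimes> x = x \<otimes> z" if "z \<in> group_center G" "x \<in> carrier G" for z x
    using that by (simp add: group_center_def)
  have c: "z \<in> carrier G" if "z \<in> group_center G" for z using that by (simp add: group_center_def)
  have "subgroup (group_center G) G"
  proof (rule subgroupI)
    show "group_center G \<subseteq> carrier G" using c by blast
    show "group_center G \<noteq> {}" using one_closed by (force simp: group_center_def)
    fix y z assume y: "y \<in> group_center G" and z: "z \<in> group_center G"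
    show "inv y \<in> group_center G"
    proof -
      have "inv y \<otimes> x = x \<otimes> inv y" if x: "x \<in> carrier G" for x
      proof -
        have "inv (y \<otimes> inv x) = inv (inv x \<otimes> y)" using comm[OF y, of "inv x"] x by simp
        then show ?thesis using x c[OF y] by (simp add: inv_mult_group)
      qed
      then show ?thesis using c[OF y] by (simp add: group_center_def)
    qed
    have "y \<otimes> z \<otimes> x = x \<otimes> (y \<otimes> z)" if x: "x \<in> carrier G" for x
    proof -
      have "y \<otimes> z \<otimes> x = y \<otimes> x \<otimes> z" using comm[OF z x] c[OF y] c[OF z] x by (simp add: m_assoc)
      also have "\<dots> = x \<otimes> (y \<otimes> z)" using comm[OF y x] c[OF y] c[OF z] x by (simp add: m_assoc)
      finally show ?thesis .
    qed
    then show "y \<otimes> z \<in> group_center G" using c[OF y] c[OF z] by (simp add: group_center_def)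
  qed
  moreover have "x \<otimes> z \<otimes> inv x \<in> group_center G" if x: "x \<in> carrier G" and z: "z \<in> group_center G" for x z
  proof -
    have "x \<otimes> z \<otimes> inv x = z \<otimes> x \<otimes> inv x" using comm[OF z x] by simp
    then show ?thesis using x z c[OF z] by (simp add: m_assoc)
  qed
  ultimately show ?thesis by (simp add: normal_inv_iff)
qed

lemma (in group_hom) normal_preimage:
  assumes N: "N \<lhd> H" shows "{x \<in> carrier G. h x \<in> N} \<lhd> G"
proof -
  have Ns: "subgroup N H" using normal_imp_subgroup[OF N] .
  have "subgroup {x \<in> carrier G. h x \<in> N} G"
    using subgroup.one_closed[OF Ns] subgroup.m_closed[OF Ns] subgroup.m_inv_closed[OF Ns]
    by (intro subgroup.intro) auto
  moreover have "h x \<otimes>\<^bsub>H\<^esub> h y \<otimes>\<^bsub>H\<^esub> inv\<^bsub>H\<^esub> h x \<in> N" if "x \<in> carrier G" "h y \<in> N" for x y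
    using H.normal_invE(2)[OF N] that by simp
  ultimately show ?thesis by (simp add: G.normal_inv_iff)
qed

lemma SL2_unipotent_pow:
  "mat2 1 0 1 1 [^]\<^bsub>SL2 TYPE('f::field)\<^esub> (n::nat) = mat2 1 0 (of_nat n :: 'f) 1"
proof (induction n)
  case (Suc n)
  then show ?case
    by (simp only: monoid.nat_pow_Suc[OF group.is_monoid[OF SL2_group]] SL2_mult mat2_mult) (simp add: add_ac)
qed (simp add: SL2_one nat_pow_def)

lemma PSL2_group: "group (projective_special_linear_group 2 TYPE('f::field))"
  unfolding projective_special_linear_group_def
  by (rule normal.factorgroup_is_group[OF group.group_center_normal[OF SL2_group]])

text \<open>The class of an elementary matrix; its seventh power is 1 because 7 is 0 in the field. In
  the normal closure argument \<open>a = 3\<close> serves, as \<open>3\<^sup>4 - 1 = 80\<close> is not divisible by 7.\<close>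

lemma PSL_2_7_element:
  assumes card7: "CARD('f::field) = 7"
  obtains h0 where "h0 \<in> carrier (projective_special_linear_group 2 TYPE('f::field))"
    "h0 [^]\<^bsub>projective_special_linear_group 2 TYPE('f)\<^esub> (7::nat) = \<one>\<^bsub>projective_special_linear_group 2 TYPE('f)\<^esub>"
    "\<And>M. M \<lhd> projective_special_linear_group 2 TYPE('f) \<Longrightarrow> h0 \<in> M \<Longrightarrow>
      M = carrier (projective_special_linear_group 2 TYPE('f))"
proof -
  let ?P = "projective_special_linear_group 2 TYPE('f)"
  let ?S = "SL2 TYPE('f)"
  define Z where "Z = group_center ?S"
  define h0 where h0: "h0 = Z #>\<^bsub>?S\<^esub> mat2 1 0 1 1"
  interpret SL: group ?S by (rule SL2_group)
  have Z: "Z \<lhd> ?S" unfolding Z_def by (rule SL.group_center_normal)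
  have P: "?P = ?S Mod Z" by (simp add: projective_special_linear_group_def Z_def)
  interpret \<pi>: group_hom ?S "?S Mod Z" "(#>\<^bsub>?S\<^esub>) Z"
    using normal.r_coset_hom_Mod[OF Z] normal.factorgroup_is_group[OF Z]
    by (simp add: group_hom_def group_hom_axioms_def SL.is_group)
  have e: "mat2 1 0 1 1 \<in> carrier ?S" by (simp add: mat2_in_SL2)
  have hc: "h0 \<in> carrier ?P" unfolding P h0 using e by simp
  have "CHAR('f) dvd 7" using CHAR_dvd_CARD[where ?'a = 'f] card7 by simp
  moreover have "Factorial_Ring.prime (7::nat)" by simp
  ultimately have "CHAR('f) = 1 \<or> CHAR('f) = 7" unfolding prime_nat_iff by blast
  then have char: "CHAR('f) = 7" using CHAR_not_1[where ?'a = 'f] by simp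
  have seven: "(7 :: 'f) = 0" using of_nat_eq_0_iff_char_dvd[of 7, where ?'a = 'f] by (simp add: char)
  have "h0 [^]\<^bsub>?P\<^esub> (7::nat) = Z #>\<^bsub>?S\<^esub> (mat2 1 0 1 1 [^]\<^bsub>?S\<^esub> (7::nat))"
    unfolding P h0 using \<pi>.hom_nat_pow[OF e] by simp
  also have "mat2 1 0 1 1 [^]\<^bsub>?S\<^esub> (7::nat) = \<one>\<^bsub>?S\<^esub>"
    unfolding SL2_unipotent_pow SL2_one by (simp add: seven)
  finally have h7: "h0 [^]\<^bsub>?P\<^esub> (7::nat) = \<one>\<^bsub>?P\<^esub>" unfolding P by simp
  have closure: "M = carrier ?P" if M: "M \<lhd> ?P" and hM: "h0 \<in> M" for M
  proof -
    have "{x \<in> carrier ?S. Z #>\<^bsub>?S\<^esub> x \<in> M} = carrier ?S"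
    proof (rule SL2_normal_closure)
      show "{x \<in> carrier ?S. Z #>\<^bsub>?S\<^esub> x \<in> M} \<lhd> ?S"
        using \<pi>.normal_preimage M unfolding P by blast
      show "mat2 1 0 1 1 \<in> {x \<in> carrier ?S. Z #>\<^bsub>?S\<^esub> x \<in> M}"
        using e hM unfolding h0 by simp
      have nz: "(of_nat n :: 'f) \<noteq> 0" if "\<not> 7 dvd n" for n
        using that by (simp add: of_nat_eq_0_iff_char_dvd char)
      show "(3 :: 'f) \<noteq> 0" using nz[of 3] by simp
      have "(3 :: 'f) ^ 4 - 1 = of_nat 80" by simp
      moreover have "(of_nat 80 :: 'f) \<noteq> 0" by (rule nz) simp
      ultimately show "(3 :: 'f) ^ 4 \<noteq> 1" by (metis diff_self)
    qed simp
    then have "carrier ?P \<subseteq> M" unfolding P carrier_FactGroup by blast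
    then show "M = carrier ?P" using subgroup.subset[OF normal_imp_subgroup[OF M]] by blast
  qed
  show thesis by (rule that[OF hc h7 closure])
qed

text \<open>A root of one of the two irreducible cubic polynomials over the prime field. An element
  \<open>a\<close> other than 0 and 1 satisfies \<open>a\<^sup>7 = 1\<close>, and \<open>a\<^sup>7 - 1\<close> splits in characteristic 2 into
  \<open>a - 1\<close> and the two cubic polynomials, which are exchanged by \<open>a \<mapsto> 1/a\<close>.\<close>

lemma field_8_element:
  assumes card8: "CARD('f::field) = 8"
  obtains t :: "'f::field" where "t ^ 3 + t + 1 = 0" and "(2 :: 'f) = 0"
proof -
  have "CHAR('f) dvd 2 ^ 3" using CHAR_dvd_CARD[where ?'a = 'f] card8 by simp
  moreover have "Factorial_Ring.prime CHAR('f)"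
    using CHAR_dvd_CARD[where ?'a = 'f] card8 by (intro prime_CHAR_semidom) (auto intro!: Nat.gr0I)
  ultimately have "CHAR('f) = 2" by (metis prime_dvd_power primes_dvd_imp_eq two_is_prime_nat)
  then have two: "(2 :: 'f) = 0" using of_nat_eq_0_iff_char_dvd[of 2, where ?'a = 'f] by simp
  have fin: "finite (UNIV :: 'f set)" using card8 by (intro card_ge_0_finite) simp
  have "\<not> (UNIV :: 'f set) \<subseteq> {0, 1}"
  proof
    assume "(UNIV :: 'f set) \<subseteq> {0, 1}"
    then have "card (UNIV :: 'f set) \<le> card {0, 1 :: 'f}" by (intro card_mono) auto
    then show False using card8 by simp
  qed
  then obtain a :: 'f where a: "a \<noteq> 0" "a \<noteq> 1" by auto
  \<comment> \<open>Multiplication by \<open>a\<close> permutes the nonzero elements, which gives \<open>a\<^sup>7 = 1\<close>.\<close>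
  have "(\<Prod>y\<in>UNIV - {0}. a * y) = (\<Prod>y\<in>UNIV - {0 :: 'f}. y)"
    by (rule prod.reindex_bij_witness[of _ "\<lambda>y. y / a" "\<lambda>y. a * y"]) (use a in auto)
  then have "a ^ card (UNIV - {0 :: 'f}) * (\<Prod>y\<in>UNIV - {0 :: 'f}. y) = (\<Prod>y\<in>UNIV - {0 :: 'f}. y)"
    by (simp add: prod.distrib)
  moreover have "(\<Prod>y\<in>UNIV - {0 :: 'f}. y) \<noteq> 0" using fin by simp
  moreover have "card (UNIV - {0 :: 'f}) = 7" using fin card8 by (simp add: card_Diff_singleton)
  ultimately have a7: "a ^ 7 = 1" by simp
  have "(a - 1) * ((a ^ 3 + a + 1) * (a ^ 3 + a\<^sup>2 + 1)) = a ^ 7 - 1 + 2 * (a ^ 3 * (a - 1))"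
    by (simp add: algebra_simps eval_nat_numeral)
  then have "a ^ 3 + a + 1 = 0 \<or> a ^ 3 + a\<^sup>2 + 1 = 0" using a a7 two by simp
  then consider "a ^ 3 + a\<^sup>2 + 1 = 0" | "a ^ 3 + a + 1 = 0" by (elim disjE)
  then show thesis
  proof cases
    assume "a ^ 3 + a\<^sup>2 + 1 = 0"
    then have "(a ^ 3 + a\<^sup>2 + 1) / a ^ 3 = 0" by simp
    then have "(1 / a) ^ 3 + 1 / a + 1 = 0" using a by (simp add: field_simps eval_nat_numeral)
    with two show thesis by (rule that[rotated])
  next
    assume "a ^ 3 + a + 1 = 0"
    then show thesis using two by (rule that)
  qed
qed

text \<open>The ninth power of the matrix with rows \<open>(0, 1)\<close> and \<open>(1, t)\<close> is 1: its cube has trace 1,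
  so it is a root of \<open>x\<^sup>2 + x + 1\<close>, and the cube of this cube is 1. The cube is not upper
  triangular, so its normal closure is the whole group.\<close>

lemma SL_2_8_element:
  assumes card8: "CARD('f::field) = 8"
  obtains h0 where "h0 \<in> carrier (SL2 TYPE('f))" "h0 [^]\<^bsub>SL2 TYPE('f)\<^esub> (9::nat) = \<one>\<^bsub>SL2 TYPE('f)\<^esub>"
    "\<And>M. M \<lhd> SL2 TYPE('f) \<Longrightarrow> h0 [^]\<^bsub>SL2 TYPE('f)\<^esub> (3::nat) \<in> M \<Longrightarrow> M = carrier (SL2 TYPE('f))"
proof -
  obtain t :: 'f where t: "t ^ 3 + t + 1 = 0" and two: "(2 :: 'f) = 0" using field_8_element[OF card8] .
  have neg: "- x = x" for x :: 'f
  proof -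
    have "x + x = 2 * x" by simp
    then show ?thesis using two by (metis add_eq_0_iff mult_zero_left)
  qed
  have dbl1: "x + x = 0" for x :: 'f using neg[of x] by (metis add.right_inverse)
  have dbl2: "x + (x + y) = y" for x y :: 'f unfolding add.assoc[symmetric] dbl1 by (rule add_0)
  note dbl = dbl1 dbl2
  have "t ^ 3 = - (t + 1)" using t by (simp only: eq_neg_iff_add_eq_0 add.assoc)
  then have t3: "t * t * t = t + 1" unfolding neg power3_eq_cube .
  have t31: "t * (t * t) = t + 1" using t3 unfolding mult.assoc .
  have t32: "t * (t * (t * x)) = t * x + x" for x
    using t3 by (metis (no_types) distrib_right mult.assoc mult_1)
  note t3' = t31 t32
  interpret SL: group "SL2 TYPE('f)" by (rule SL2_group)
  define h0 where "h0 = mat2 0 1 1 t"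
  define y where "y = mat2 t (t * t + 1) (t * t + 1) (t + 1)"
  have h0: "h0 \<in> carrier (SL2 TYPE('f))" by (simp add: h0_def mat2_in_SL2 neg)
  have pow3: "x [^]\<^bsub>SL2 TYPE('f)\<^esub> (3::nat) = x * x * x" if "x \<in> carrier (SL2 TYPE('f))" for x
    using that by (simp add: numeral_3_eq_3) (simp only: SL2_mult)
  have cube: "h0 [^]\<^bsub>SL2 TYPE('f)\<^esub> (3::nat) = y"
    unfolding pow3[OF h0] by (simp add: h0_def y_def mat2_mult algebra_simps t3' dbl)
  then have yc: "y \<in> carrier (SL2 TYPE('f))" using h0 by (metis SL.nat_pow_closed)
  have "y [^]\<^bsub>SL2 TYPE('f)\<^esub> (3::nat) = mat2 1 0 0 1"
    unfolding pow3[OF yc] by (simp add: y_def mat2_mult algebra_simps t3' dbl)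
  then have "h0 [^]\<^bsub>SL2 TYPE('f)\<^esub> (3 * 3::nat) = \<one>\<^bsub>SL2 TYPE('f)\<^esub>"
    unfolding SL.nat_pow_pow[OF h0, symmetric] cube SL2_one .
  then have h9: "h0 [^]\<^bsub>SL2 TYPE('f)\<^esub> (9::nat) = \<one>\<^bsub>SL2 TYPE('f)\<^esub>" by simp
  have t0: "t \<noteq> 0" using t by auto
  have t1: "t \<noteq> 1" using t dbl(1)[of 1] by auto
  have sq: "t * t + 1 \<noteq> 0"
  proof
    assume "t * t + 1 = 0"
    moreover have "(t + 1) * (t + 1) = t * t + 1" by (simp add: algebra_simps dbl)
    ultimately have "t + 1 = 0" by simp
    then show False using t1 neg[of 1] by (simp add: eq_neg_iff_add_eq_0[symmetric])
  qed
  have t4: "t ^ 4 \<noteq> 1"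
  proof
    assume "t ^ 4 = 1"
    then have 1: "t * t + t = 1" by (simp add: eval_nat_numeral t3' algebra_simps)
    then have "t * (t * t + t) = t" by simp
    then have "t + (t * t + 1) = t" by (simp add: distrib_left t31 add_ac)
    with sq show False unfolding add_cancel_left_right by blast
  qed
  show thesis
  proof (rule that[OF h0 h9])
    fix M assume "M \<lhd> SL2 TYPE('f)" "h0 [^]\<^bsub>SL2 TYPE('f)\<^esub> (3::nat) \<in> M"
    then show "M = carrier (SL2 TYPE('f))" unfolding cube y_def by (rule SL2_normal_closure[OF _ _ sq t0 t4])
  qed
qed

section \<open>The bounds for the three quotients\<close>

theorem theorem20:
  fixes S :: "('a, 'b) monoid_scheme"
  assumes "group S"
    and "finitely_generated S"
    and "perfect S"
    and "torsion_free S"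
    and "virtually solvable S"
    and "\<not> solvable S"
    and "\<not> virtually nilpotent S"
  shows "(S Mod solvable_radical S \<cong> alt_group 5 \<longrightarrow> 9 \<le> hirsch_length S) \<and>
    (CARD('k) = 7 \<and>
       S Mod solvable_radical S \<cong> projective_special_linear_group 2 TYPE('k::field) \<longrightarrow>
       13 \<le> hirsch_length S) \<and>
    (CARD('l) = 8 \<and>
       S Mod solvable_radical S \<cong> special_linear_group 2 TYPE('l::field) \<longrightarrow>
       14 \<le> hirsch_length S)"
proof (intro conjI impI)
  note bound = group.hirsch_length_bound[OF assms(1-5,7)]
  have prime_divisors: "d dvd q \<Longrightarrow> d \<noteq> q \<Longrightarrow> d dvd 1" if "Factorial_Ring.prime q" for d q :: nat
    using that unfolding prime_nat_iff by auto
  \<comment> \<open>The numbers 12, 60 and 840 are the least common multiples of the numbers below 5, 7 and 9.\<close>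
  have lcm5: "(\<forall>m::nat. 0 < m \<and> m < 5 \<longrightarrow> m dvd 12) \<and> \<not> 5 dvd (12::nat)"
  proof (intro conjI allI impI)
    fix m :: nat assume "0 < m \<and> m < 5"
    then have "m = 1 \<or> m = 2 \<or> m = 3 \<or> m = 4" by arith
    then show "m dvd 12" by auto
  qed simp
  have lcm7: "(\<forall>m::nat. 0 < m \<and> m < 7 \<longrightarrow> m dvd 60) \<and> \<not> 7 dvd (60::nat)"
  proof (intro conjI allI impI)
    fix m :: nat assume "0 < m \<and> m < 7"
    then have "m = 1 \<or> m = 2 \<or> m = 3 \<or> m = 4 \<or> m = 5 \<or> m = 6" by arith
    then show "m dvd 60" by auto
  qed simp
  have lcm9: "(\<forall>m::nat. 0 < m \<and> m < 9 \<longrightarrow> m dvd 840) \<and> \<not> 9 dvd (840::nat)"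
  proof (intro conjI allI impI)
    fix m :: nat assume "0 < m \<and> m < 9"
    then have "m = 1 \<or> m = 2 \<or> m = 3 \<or> m = 4 \<or> m = 5 \<or> m = 6 \<or> m = 7 \<or> m = 8" by arith
    then show "m dvd 840" by auto
  qed simp
  {
    assume iso: "S Mod solvable_radical S \<cong> alt_group 5"
    have "enat (5 + 1 * (5 - 1)) \<le> hirsch_length S"
    proof (rule bound[where q = 5, OF alt_group_is_group iso alternating_5_cycle])
      interpret A: group "alt_group 5" by (rule alt_group_is_group)
      show "M = carrier (alt_group 5)"
        if "M \<lhd> alt_group 5" "cycle_of_list [1, 2, 3, 4, 5] [^]\<^bsub>alt_group 5\<^esub> (1::nat) \<in> M" for M
        using alternating_5_normal_closure[OF that(1)] that(2) alternating_5_cycle(1) by (simp only: A.nat_pow_eone)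
      show "Factorial_Ring.irreducible (\<Sum>i<5. Polynomial.monom (1::rat) (1 * i))" by (rule cyclotomic_5_7_9_irreducible(1))
    qed (use lcm5 prime_divisors[of 5] in auto)
    then show "9 \<le> hirsch_length S" by (simp add: numeral_eq_enat)
  next
    assume "CARD('k) = 7 \<and> S Mod solvable_radical S \<cong> projective_special_linear_group 2 TYPE('k)"
    then have card: "CARD('k) = 7" and iso: "S Mod solvable_radical S \<cong> projective_special_linear_group 2 TYPE('k)"
      by blast+
    obtain h0 where h0: "h0 \<in> carrier (projective_special_linear_group 2 TYPE('k))"
      "h0 [^]\<^bsub>projective_special_linear_group 2 TYPE('k)\<^esub> (7::nat) = \<one>\<^bsub>projective_special_linear_group 2 TYPE('k)\<^esub>"
      "\<And>M. M \<lhd> projective_special_linear_group 2 TYPE('k) \<Longrightarrow> h0 \<in> M \<Longrightarrow>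
        M = carrier (projective_special_linear_group 2 TYPE('k))"
      using PSL_2_7_element[OF card] by blast
    have "enat (7 + 1 * (7 - 1)) \<le> hirsch_length S"
    proof (rule bound[where q = 7, OF PSL2_group iso h0(1,2)])
      interpret P: group "projective_special_linear_group 2 TYPE('k)" by (rule PSL2_group)
      show "M = carrier (projective_special_linear_group 2 TYPE('k))"
        if "M \<lhd> projective_special_linear_group 2 TYPE('k)"
          "h0 [^]\<^bsub>projective_special_linear_group 2 TYPE('k)\<^esub> (1::nat) \<in> M" for M
        using h0(3)[OF that(1)] that(2) h0(1) by (simp only: P.nat_pow_eone)
      show "Factorial_Ring.irreducible (\<Sum>i<7. Polynomial.monom (1::rat) (1 * i))" by (rule cyclotomic_5_7_9_irreducible(2))
    qed (use lcm7 prime_divisors[of 7] in auto)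
    then show "13 \<le> hirsch_length S" by (simp add: numeral_eq_enat)
  next
    assume "CARD('l) = 8 \<and> S Mod solvable_radical S \<cong> SL2 TYPE('l)"
    then have card: "CARD('l) = 8" and iso: "S Mod solvable_radical S \<cong> SL2 TYPE('l)" by blast+
    obtain h0 where h0: "h0 \<in> carrier (SL2 TYPE('l))" "h0 [^]\<^bsub>SL2 TYPE('l)\<^esub> (9::nat) = \<one>\<^bsub>SL2 TYPE('l)\<^esub>"
      "\<And>M. M \<lhd> SL2 TYPE('l) \<Longrightarrow> h0 [^]\<^bsub>SL2 TYPE('l)\<^esub> (3::nat) \<in> M \<Longrightarrow> M = carrier (SL2 TYPE('l))"
      using SL_2_8_element[OF card] by blast
    have "enat (9 + 3 * (3 - 1)) \<le> hirsch_length S"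
    proof (rule bound[where q = 9, OF SL2_group iso h0])
      show "Factorial_Ring.irreducible (\<Sum>i<3. Polynomial.monom (1::rat) (3 * i))" by (rule cyclotomic_5_7_9_irreducible(3))
      have nine: "(9::nat) = 3 ^ 2" by simp
      show "d dvd 3" if "d dvd 9" "d \<noteq> 9" for d :: nat
      proof -
        have three: "Factorial_Ring.prime (3::nat)" by simp
        have "d dvd 3 ^ 2" using that(1) nine by (simp only:)
        then obtain i where "i \<le> 2" "d = 3 ^ i" unfolding divides_primepow_nat[OF three] by blast
        moreover have "i \<noteq> 2" using that(2) \<open>d = 3 ^ i\<close> by auto
        ultimately have "d = 3 ^ i" "i \<le> 1" by auto
        then show ?thesis using le_imp_power_dvd[of i 1 "3::nat"] by simp
      qed
    qed (use lcm9 in auto)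
    then have "enat 15 \<le> hirsch_length S" by simp
    moreover have "14 \<le> enat 15" by (simp add: numeral_eq_enat)
    ultimately show "14 \<le> hirsch_length S" by (rule order_trans[rotated])
  }
qed

end
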